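(* Let $R$ be a local Gorenstein ring, and let $M$ and $N$ be finitely generated maximal Cohen-Macaulay $R$-modules. Then the following are equivalent: (1) $\operatorname{Tor}^R_i(M,N)=0$ for all $i\gg 0$; (2) $\operatorname{Ext}^i_R(M,N^* )=0$ for all $i\gg 0$; (3) $\operatorname{Ext}^i_R(N,M^* )=0$ for all $i\gg 0$.
   Context: Local rings are commutative Noetherian local rings. For an $R$-module $X$, $X^*:=\operatorname{Hom}_R(X,R)$. *)

theory Defs
  imports "HOL-Algebra.Module" "HOL-Algebra.Ring_Divisibility" "HOL-Library.Extended_Nat"
begin

section \<open>Modules over a commutative ring\<close>

text \<open>
  Modules are the \<open>('a, 'm) module\<close> records of \<open>HOL-Algebra\<close>. Such a record also has the
  fields \<open>mult\<close> and \<open>one\<close>; they play no role in the locale \<^locale>\<open>module\<close>, and the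
  constructions below leave them \<^const>\<open>undefined\<close>.
\<close>

definition ring_module :: "('a, 'r) ring_scheme \<Rightarrow> ('a, 'a) module" where
  "ring_module R =
     \<lparr>carrier = carrier R, monoid.mult = (\<otimes>\<^bsub>R\<^esub>), one = \<one>\<^bsub>R\<^esub>,
      ring.zero = \<zero>\<^bsub>R\<^esub>, ring.add = (\<oplus>\<^bsub>R\<^esub>), smult = (\<otimes>\<^bsub>R\<^esub>)\<rparr>"

definition zero_module :: "('a, 'm, 'x) module_scheme \<Rightarrow> bool" where
  "zero_module M \<longleftrightarrow> carrier M = {\<zero>\<^bsub>M\<^esub>}"

definition span_module ::
    "('a, 'r) ring_scheme \<Rightarrow> ('a, 'm, 'x) module_scheme \<Rightarrow> 'm set \<Rightarrow> 'm set" where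
  "span_module R M S = \<Inter>{H. submodule H R M \<and> S \<subseteq> H}"

definition fin_gen_module :: "('a, 'r) ring_scheme \<Rightarrow> ('a, 'm, 'x) module_scheme \<Rightarrow> bool" where
  "fin_gen_module R M \<longleftrightarrow>
     module R M \<and> (\<exists>S. finite S \<and> S \<subseteq> carrier M \<and> span_module R M S = carrier M)"

definition module_hom ::
    "('a, 'r) ring_scheme \<Rightarrow> ('a, 'm, 'x) module_scheme \<Rightarrow> ('a, 'n, 'y) module_scheme \<Rightarrow> ('m \<Rightarrow> 'n) set"
  where
  "module_hom R M N = {f \<in> carrier M \<rightarrow> carrier N.
     (\<forall>x\<in>carrier M. \<forall>y\<in>carrier M. f (x \<oplus>\<^bsub>M\<^esub> y) = f x \<oplus>\<^bsub>N\<^esub> f y) \<and>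
     (\<forall>r\<in>carrier R. \<forall>x\<in>carrier M. f (r \<odot>\<^bsub>M\<^esub> x) = r \<odot>\<^bsub>N\<^esub> f x)}"

text \<open>
  The module \<open>Hom\<^sub>R(M,N)\<close>. Its elements are extensional, so that two homomorphisms agreeing on the
  carrier of \<open>M\<close> are equal.
\<close>

definition hom_module ::
    "('a, 'r) ring_scheme \<Rightarrow> ('a, 'm, 'x) module_scheme \<Rightarrow> ('a, 'n, 'y) module_scheme
      \<Rightarrow> ('a, 'm \<Rightarrow> 'n) module" where
  "hom_module R M N =
     \<lparr>carrier = module_hom R M N \<inter> extensional (carrier M),
      monoid.mult = undefined, one = undefined,
      ring.zero = (\<lambda>x\<in>carrier M. \<zero>\<^bsub>N\<^esub>),
      ring.add = (\<lambda>f g. \<lambda>x\<in>carrier M. f x \<oplus>\<^bsub>N\<^esub> g x),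
      smult = (\<lambda>r f. \<lambda>x\<in>carrier M. r \<odot>\<^bsub>N\<^esub> f x)\<rparr>"

definition dual_module ::
    "('a, 'r) ring_scheme \<Rightarrow> ('a, 'm, 'x) module_scheme \<Rightarrow> ('a, 'm \<Rightarrow> 'a) module" where
  "dual_module R M = hom_module R M (ring_module R)"

text \<open>\<open>M/K\<close> for a submodule \<open>K\<close>; in \<open>smult\<close> all members of the union are the same coset.\<close>

definition quotient_module :: "('a, 'm, 'x) module_scheme \<Rightarrow> 'm set \<Rightarrow> ('a, 'm set) module" where
  "quotient_module M K =
     \<lparr>carrier = a_rcosets\<^bsub>M\<^esub> K,
      monoid.mult = undefined, one = undefined,
      ring.zero = K,
      ring.add = set_add M,
      smult = (\<lambda>r C. \<Union>x\<in>C. K +>\<^bsub>M\<^esub> (r \<odot>\<^bsub>M\<^esub> x))\<rparr>"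

text \<open>The free module with basis \<open>B\<close>: finitely supported functions on \<open>B\<close>, extended by \<open>0\<close>.\<close>

definition free_module :: "('a, 'r) ring_scheme \<Rightarrow> 'b set \<Rightarrow> ('a, 'b \<Rightarrow> 'a) module" where
  "free_module R B =
     \<lparr>carrier = {u. (\<forall>b. u b \<in> carrier R) \<and> finite {b. u b \<noteq> \<zero>\<^bsub>R\<^esub>} \<and> {b. u b \<noteq> \<zero>\<^bsub>R\<^esub>} \<subseteq> B},
      monoid.mult = undefined, one = undefined,
      ring.zero = (\<lambda>b. \<zero>\<^bsub>R\<^esub>),
      ring.add = (\<lambda>u v b. u b \<oplus>\<^bsub>R\<^esub> v b),
      smult = (\<lambda>r u b. r \<otimes>\<^bsub>R\<^esub> u b)\<rparr>"

definition basis_vec :: "('a, 'r) ring_scheme \<Rightarrow> 'b \<Rightarrow> 'b \<Rightarrow> 'a" where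
  "basis_vec R b = (\<lambda>c. if c = b then \<one>\<^bsub>R\<^esub> else \<zero>\<^bsub>R\<^esub>)"

section \<open>Tensor products\<close>

definition tensor_relations ::
    "('a, 'r) ring_scheme \<Rightarrow> ('a, 'm, 'x) module_scheme \<Rightarrow> ('a, 'n, 'y) module_scheme
      \<Rightarrow> ('m \<times> 'n \<Rightarrow> 'a) set" where
  "tensor_relations R M N =
    (let F = free_module R (carrier M \<times> carrier N); e = (\<lambda>x y. basis_vec R (x, y)) in
     span_module R F
      ({e (x \<oplus>\<^bsub>M\<^esub> x') y \<ominus>\<^bsub>F\<^esub> (e x y \<oplus>\<^bsub>F\<^esub> e x' y) | x x' y.
          x \<in> carrier M \<and> x' \<in> carrier M \<and> y \<in> carrier N} \<union>
       {e x (y \<oplus>\<^bsub>N\<^esub> y') \<ominus>\<^bsub>F\<^esub> (e x y \<oplus>\<^bsub>F\<^esub> e x y') | x y y'.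
          x \<in> carrier M \<and> y \<in> carrier N \<and> y' \<in> carrier N} \<union>
       {e (r \<odot>\<^bsub>M\<^esub> x) y \<ominus>\<^bsub>F\<^esub> r \<odot>\<^bsub>F\<^esub> e x y | r x y.
          r \<in> carrier R \<and> x \<in> carrier M \<and> y \<in> carrier N} \<union>
       {e x (r \<odot>\<^bsub>N\<^esub> y) \<ominus>\<^bsub>F\<^esub> r \<odot>\<^bsub>F\<^esub> e x y | r x y.
          r \<in> carrier R \<and> x \<in> carrier M \<and> y \<in> carrier N}))"

definition tensor_module ::
    "('a, 'r) ring_scheme \<Rightarrow> ('a, 'm, 'x) module_scheme \<Rightarrow> ('a, 'n, 'y) module_scheme
      \<Rightarrow> ('a, ('m \<times> 'n \<Rightarrow> 'a) set) module" where
  "tensor_module R M N =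
     quotient_module (free_module R (carrier M \<times> carrier N)) (tensor_relations R M N)"

definition pure_tensor ::
    "('a, 'r) ring_scheme \<Rightarrow> ('a, 'm, 'x) module_scheme \<Rightarrow> ('a, 'n, 'y) module_scheme
      \<Rightarrow> 'm \<Rightarrow> 'n \<Rightarrow> ('m \<times> 'n \<Rightarrow> 'a) set" where
  "pure_tensor R M N x y =
     tensor_relations R M N +>\<^bsub>free_module R (carrier M \<times> carrier N)\<^esub> basis_vec R (x, y)"

text \<open>For \<open>f : M \<rightarrow> M'\<close>, the map \<open>f \<otimes> N : M \<otimes> N \<rightarrow> M' \<otimes> N\<close>.\<close>

definition tensor_map ::
    "('a, 'r) ring_scheme \<Rightarrow> ('a, 'm, 'x) module_scheme \<Rightarrow> ('a, 'k, 'z) module_scheme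
      \<Rightarrow> ('a, 'n, 'y) module_scheme \<Rightarrow> ('m \<Rightarrow> 'k) \<Rightarrow> ('m \<times> 'n \<Rightarrow> 'a) set \<Rightarrow> ('k \<times> 'n \<Rightarrow> 'a) set" where
  "tensor_map R M M' N f = (THE h.
     h \<in> module_hom R (tensor_module R M N) (tensor_module R M' N) \<and>
     h \<in> extensional (carrier (tensor_module R M N)) \<and>
     (\<forall>x\<in>carrier M. \<forall>y\<in>carrier N. h (pure_tensor R M N x y) = pure_tensor R M' N (f x) y))"

section \<open>Tor and Ext\<close>

text \<open>
  A resolution \<open>\<dots> \<rightarrow> R\<^bsup>n 1\<^esup> \<rightarrow> R\<^bsup>n 0\<^esup> \<rightarrow> M \<rightarrow> 0\<close> by free modules of finite rank with differentials
  \<open>d i : R\<^bsup>n (i + 1)\<^esup> \<rightarrow> R\<^bsup>n i\<^esup>\<close> and augmentation \<open>\<epsilon>\<close>. Every finitely generated module over a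
  Noetherian ring has one.
\<close>

abbreviation fin_free :: "('a, 'r) ring_scheme \<Rightarrow> nat \<Rightarrow> ('a, nat \<Rightarrow> 'a) module" where
  "fin_free R k \<equiv> free_module R {..<k}"

definition free_resolution ::
    "('a, 'r) ring_scheme \<Rightarrow> ('a, 'm, 'x) module_scheme \<Rightarrow> (nat \<Rightarrow> nat)
      \<Rightarrow> (nat \<Rightarrow> (nat \<Rightarrow> 'a) \<Rightarrow> (nat \<Rightarrow> 'a)) \<Rightarrow> ((nat \<Rightarrow> 'a) \<Rightarrow> 'm) \<Rightarrow> bool" where
  "free_resolution R M n d \<epsilon> \<longleftrightarrow>
     \<epsilon> \<in> module_hom R (fin_free R (n 0)) M \<and>
     (\<forall>i. d i \<in> module_hom R (fin_free R (n (Suc i))) (fin_free R (n i))) \<and>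
     \<epsilon> ` carrier (fin_free R (n 0)) = carrier M \<and>
     d 0 ` carrier (fin_free R (n 1)) = a_kernel (fin_free R (n 0)) M \<epsilon> \<and>
     (\<forall>i. d (Suc i) ` carrier (fin_free R (n (Suc (Suc i)))) =
            a_kernel (fin_free R (n (Suc i))) (fin_free R (n i)) (d i))"

text \<open>
  Tor and Ext of a finitely generated module are computed from one chosen resolution; any other
  choice gives isomorphic modules.
\<close>

definition some_resolution ::
    "('a, 'r) ring_scheme \<Rightarrow> ('a, 'm, 'x) module_scheme
      \<Rightarrow> (nat \<Rightarrow> nat) \<times> (nat \<Rightarrow> (nat \<Rightarrow> 'a) \<Rightarrow> (nat \<Rightarrow> 'a))" where
  "some_resolution R M = (SOME (n, d). \<exists>\<epsilon>. free_resolution R M n d \<epsilon>)"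

text \<open>\<open>Tor\<^sub>i(M,N)\<close> is the homology of \<open>F \<otimes> N\<close> at \<open>i\<close>, and \<open>Ext\<^sup>i(M,N)\<close> the cohomology of
  \<open>Hom(F,N)\<close> at \<open>i\<close>, where \<open>F\<close> is the resolution of \<open>M\<close>.\<close>

definition Tor_module ::
    "('a, 'r) ring_scheme \<Rightarrow> nat \<Rightarrow> ('a, 'm, 'x) module_scheme \<Rightarrow> ('a, 'n, 'y) module_scheme
      \<Rightarrow> ('a, ((nat \<Rightarrow> 'a) \<times> 'n \<Rightarrow> 'a) set set) module" where
  "Tor_module R i M N =
    (let (n, d) = some_resolution R M;
         F = (\<lambda>j. fin_free R (n j));
         T = (\<lambda>j. tensor_module R (F j) N);
         D = (\<lambda>j. tensor_map R (F (Suc j)) (F j) N (d j));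
         Z = (case i of 0 \<Rightarrow> carrier (T 0) | Suc j \<Rightarrow> a_kernel (T (Suc j)) (T j) (D j))
     in quotient_module (T i\<lparr>carrier := Z\<rparr>) (D i ` carrier (T (Suc i))))"

definition Ext_module ::
    "('a, 'r) ring_scheme \<Rightarrow> nat \<Rightarrow> ('a, 'm, 'x) module_scheme \<Rightarrow> ('a, 'n, 'y) module_scheme
      \<Rightarrow> ('a, ((nat \<Rightarrow> 'a) \<Rightarrow> 'n) set) module" where
  "Ext_module R i M N =
    (let (n, d) = some_resolution R M;
         F = (\<lambda>j. fin_free R (n j));
         C = (\<lambda>j. hom_module R (F j) N);
         D = (\<lambda>j \<phi>. compose (carrier (F (Suc j))) \<phi> (d j));
         B = (case i of 0 \<Rightarrow> {\<zero>\<^bsub>C 0\<^esub>} | Suc j \<Rightarrow> D j ` carrier (C j))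
     in quotient_module (C i\<lparr>carrier := a_kernel (C i) (C (Suc i)) (D i)\<rparr>) B)"

section \<open>Local rings, depth and maximal Cohen--Macaulay modules\<close>

definition local_ring :: "('a, 'r) ring_scheme \<Rightarrow> bool" where
  "local_ring R \<longleftrightarrow> cring R \<and> noetherian_ring R \<and> (\<exists>!m. maximalideal m R)"

definition max_ideal :: "('a, 'r) ring_scheme \<Rightarrow> 'a set" where
  "max_ideal R = (THE m. maximalideal m R)"

definition krull_dim :: "('a, 'r) ring_scheme \<Rightarrow> enat" where
  "krull_dim R = Sup {enat n | n. \<exists>p. (\<forall>i\<le>n. primeideal (p i) R) \<and> (\<forall>i<n. p i \<subset> p (Suc i))}"

text \<open>The submodule \<open>(xs)M\<close>.\<close>

definition list_smult ::
    "('a, 'r) ring_scheme \<Rightarrow> ('a, 'm, 'x) module_scheme \<Rightarrow> 'a list \<Rightarrow> 'm set" where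
  "list_smult R M xs = span_module R M {x \<odot>\<^bsub>M\<^esub> y | x y. x \<in> set xs \<and> y \<in> carrier M}"

text \<open>
  The second condition says that \<open>xs ! i\<close> is a nonzerodivisor on \<open>M/(xs ! 0, \<dots>, xs ! (i - 1))M\<close>.
\<close>

definition regular_sequence ::
    "('a, 'r) ring_scheme \<Rightarrow> ('a, 'm, 'x) module_scheme \<Rightarrow> 'a list \<Rightarrow> bool" where
  "regular_sequence R M xs \<longleftrightarrow>
     set xs \<subseteq> carrier R \<and>
     (\<forall>i<length xs. \<forall>y\<in>carrier M.
        (xs ! i) \<odot>\<^bsub>M\<^esub> y \<in> list_smult R M (take i xs) \<longrightarrow> y \<in> list_smult R M (take i xs)) \<and>
     list_smult R M xs \<noteq> carrier M"

text \<open>Meaningful for nonzero modules only.\<close>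

definition depth :: "('a, 'r) ring_scheme \<Rightarrow> ('a, 'm, 'x) module_scheme \<Rightarrow> enat" where
  "depth R M = Sup {enat (length xs) | xs. set xs \<subseteq> max_ideal R \<and> regular_sequence R M xs}"

text \<open>The zero module, whose depth is \<open>\<infinity>\<close> by convention, is counted as maximal Cohen--Macaulay.\<close>

definition maximal_cohen_macaulay ::
    "('a, 'r) ring_scheme \<Rightarrow> ('a, 'm, 'x) module_scheme \<Rightarrow> bool" where
  "maximal_cohen_macaulay R M \<longleftrightarrow>
     fin_gen_module R M \<and> (zero_module M \<or> depth R M = krull_dim R)"

section \<open>Injective dimension and Gorenstein rings\<close>

text \<open>
  HOL cannot quantify over all types, so the extension property is required for modules \<open>A\<close>, \<open>B\<close>
  with elements of type \<open>nat \<Rightarrow> 'a\<close>. This type accommodates every finite free \<open>R\<close>-module and its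
  submodules, in particular the ideals of \<open>R\<close>, so by Baer's criterion there is no loss of generality.
\<close>

definition injective_module :: "('a, 'r) ring_scheme \<Rightarrow> ('a, 'i, 'x) module_scheme \<Rightarrow> bool" where
  "injective_module R I \<longleftrightarrow>
     module R I \<and>
     (\<forall>(A :: ('a, nat \<Rightarrow> 'a) module) (B :: ('a, nat \<Rightarrow> 'a) module).
        \<forall>f \<in> module_hom R A B. \<forall>g \<in> module_hom R A I.
          module R A \<and> module R B \<and> inj_on f (carrier A) \<longrightarrow>
          (\<exists>h \<in> module_hom R B I. \<forall>a\<in>carrier A. h (f a) = g a))"

text \<open>
  A resolution \<open>0 \<rightarrow> M \<rightarrow> I 0 \<rightarrow> I 1 \<rightarrow> \<dots>\<close> by injective modules, with \<open>\<eta> : M \<rightarrow> I 0\<close> and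
  \<open>d i : I i \<rightarrow> I (i + 1)\<close>.
\<close>

definition injective_resolution ::
    "('a, 'r) ring_scheme \<Rightarrow> ('a, 'm, 'x) module_scheme \<Rightarrow> (nat \<Rightarrow> ('a, 'i) module)
      \<Rightarrow> (nat \<Rightarrow> 'i \<Rightarrow> 'i) \<Rightarrow> ('m \<Rightarrow> 'i) \<Rightarrow> bool" where
  "injective_resolution R M I d \<eta> \<longleftrightarrow>
     (\<forall>i. injective_module R (I i)) \<and>
     \<eta> \<in> module_hom R M (I 0) \<and>
     (\<forall>i. d i \<in> module_hom R (I i) (I (Suc i))) \<and>
     inj_on \<eta> (carrier M) \<and>
     \<eta> ` carrier M = a_kernel (I 0) (I 1) (d 0) \<and>
     (\<forall>i. d i ` carrier (I i) = a_kernel (I (Suc i)) (I (Suc (Suc i))) (d (Suc i)))"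

text \<open>
  The type \<open>'i\<close> holds the elements of the injective modules. A theorem assuming
  \<open>gorenstein_ring TYPE('i) R\<close> for a type variable \<open>'i\<close> thus applies to every ring that has
  a finite injective resolution over whatever type.
\<close>

definition finite_injective_dimension ::
    "'i itself \<Rightarrow> ('a, 'r) ring_scheme \<Rightarrow> ('a, 'm, 'x) module_scheme \<Rightarrow> bool" where
  "finite_injective_dimension _ R M \<longleftrightarrow>
     (\<exists>(I :: nat \<Rightarrow> ('a, 'i) module) d \<eta> k.
        injective_resolution R M I d \<eta> \<and> (\<forall>i>k. zero_module (I i)))"

definition gorenstein_ring :: "'i itself \<Rightarrow> ('a, 'r) ring_scheme \<Rightarrow> bool" where
  "gorenstein_ring T R \<longleftrightarrow> local_ring R \<and> finite_injective_dimension T R (ring_module R)"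

end

theory Submission
  imports Defs "HOL-Library.Countable"
begin

text \<open>
  A maximal Cohen--Macaulay module \<open>N\<close> satisfies \<open>Ext\<^sup>i(N,R) = 0\<close> for \<open>i > 0\<close>: the largest degree in
  which \<open>Ext(-,R)\<close> does not vanish identically is attained at the residue field and is at most
  \<open>dim R = depth N\<close>, and by Nakayama's lemma the vanishing range grows by one degree with each step
  up along a regular sequence on \<open>N\<close>.

  Let \<open>F\<close> and \<open>G\<close> be free resolutions of \<open>M\<close> and \<open>N\<close>. The terms of \<open>F \<otimes> N\<close> and of its dual
  \<open>Hom(F,N\<^sup>*)\<close> have no higher \<open>Ext\<close> into \<open>R\<close>; as \<open>R\<close> has finite injective dimension, such a complex is
  exact in high degrees if and only if its dual is. Both \<open>Ext\<^sup>i(M,N\<^sup>*)\<close> and \<open>Ext\<^sup>i(N,M\<^sup>*)\<close> are the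
  cohomology of the double complex \<open>Hom(F \<otimes> G,R)\<close>, whose rows and columns are exact away from the
  edges.
\<close>

text \<open>Injectivity is tested only against modules with elements of one type, and only
  \<open>R\<close> comes with a resolution. Hence \<open>Ext\<close> is always taken into
  \<open>R\<close>, from the injective side, and only on subquotients \<open>A/B\<close> of free
  modules with countable bases. A homomorphism out of \<open>A/B\<close> is represented by one on
  the whole ambient module that kills \<open>B\<close>, so restrictions and connecting homomorphisms
  act directly on such functions and the exact sequences need no quotient modules. The given
  resolution has some length \<open>k\<close>; that \<open>Ext\<close> already vanishes above
  \<open>dim R\<close> has to be proved, by turning a nonvanishing \<open>Ext\<close> in the top
  degree into a long chain of prime ideals. The passage to dual complexes is dimension shifting:
  each step along an exact complex of \<open>Ext\<close>-acyclic modules lowers by one the degree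
  above which \<open>Ext\<close> of the cokernel vanishes, so \<open>k\<close> steps suffice. The
  way back needs that \<open>N\<close> is reflexive. \<open>Tor\<close> and \<open>Ext\<close> are
  compared through matrices, which act on powers of any module and are transposed by
  dualizing.\<close>

lemma module_homI:
  assumes "\<And>x. x \<in> carrier M \<Longrightarrow> f x \<in> carrier N"
    and "\<And>x y. x \<in> carrier M \<Longrightarrow> y \<in> carrier M \<Longrightarrow> f (x \<oplus>\<^bsub>M\<^esub> y) = f x \<oplus>\<^bsub>N\<^esub> f y"
    and "\<And>r x. r \<in> carrier R \<Longrightarrow> x \<in> carrier M \<Longrightarrow> f (r \<odot>\<^bsub>M\<^esub> x) = r \<odot>\<^bsub>N\<^esub> f x"
  shows "f \<in> module_hom R M N"
  using assms unfolding module_hom_def by auto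

lemma module_hom_closed: "f \<in> module_hom R M N \<Longrightarrow> x \<in> carrier M \<Longrightarrow> f x \<in> carrier N"
  and module_hom_add: "f \<in> module_hom R M N \<Longrightarrow> x \<in> carrier M \<Longrightarrow> y \<in> carrier M \<Longrightarrow>
    f (x \<oplus>\<^bsub>M\<^esub> y) = f x \<oplus>\<^bsub>N\<^esub> f y"
  and module_hom_smult: "f \<in> module_hom R M N \<Longrightarrow> r \<in> carrier R \<Longrightarrow> x \<in> carrier M \<Longrightarrow>
    f (r \<odot>\<^bsub>M\<^esub> x) = r \<odot>\<^bsub>N\<^esub> f x"
  unfolding module_hom_def by auto

context abelian_group
begin

lemma diff_zero_right: "x \<in> carrier G \<Longrightarrow> x \<ominus> \<zero> = x"
  by (simp add: minus_eq)

lemma diff_self: "x \<in> carrier G \<Longrightarrow> x \<ominus> x = \<zero>"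
  by (simp add: minus_eq r_neg)

lemma add_diff_cancel:
  assumes "x \<in> carrier G" "y \<in> carrier G"
  shows "y \<oplus> (x \<ominus> y) = x"
  using assms by (simp add: minus_eq a_lcomm[of y x] r_neg)

lemma diff_eqI:
  assumes "x = y \<oplus> z" "y \<in> carrier G" "z \<in> carrier G"
  shows "x \<ominus> y = z"
  using assms by (simp add: minus_eq a_comm[of y z] a_assoc r_neg)

lemma diff_eq_zero_iff:
  assumes "x \<in> carrier G" "y \<in> carrier G"
  shows "x \<ominus> y = \<zero> \<longleftrightarrow> x = y"
  using add_diff_cancel[OF assms] diff_self assms by (metis r_zero)

lemma add_diff_add:
  assumes "a \<in> carrier G" "b \<in> carrier G" "c \<in> carrier G" "d \<in> carrier G"
  shows "(a \<oplus> b) \<ominus> (c \<oplus> d) = (a \<ominus> c) \<oplus> (b \<ominus> d)"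
  using assms by (simp add: minus_eq minus_add a_ac)

end

lemma (in module) neg_eq_smult: "x \<in> carrier M \<Longrightarrow> \<ominus>\<^bsub>M\<^esub> x = (\<ominus> \<one>) \<odot>\<^bsub>M\<^esub> x"
  by (simp add: smult_l_minus)

lemma (in module) smult_r_diff:
  "a \<in> carrier R \<Longrightarrow> x \<in> carrier M \<Longrightarrow> y \<in> carrier M \<Longrightarrow>
    a \<odot>\<^bsub>M\<^esub> (x \<ominus>\<^bsub>M\<^esub> y) = a \<odot>\<^bsub>M\<^esub> x \<ominus>\<^bsub>M\<^esub> a \<odot>\<^bsub>M\<^esub> y"
  by (simp add: a_minus_def smult_r_distr smult_r_minus)

lemma module_hom_zero:
  assumes "module R M" "module R N" "f \<in> module_hom R M N"
  shows "f \<zero>\<^bsub>M\<^esub> = \<zero>\<^bsub>N\<^esub>"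
proof -
  interpret M: module R M by fact
  interpret N: module R N by fact
  have "f (\<zero>\<^bsub>R\<^esub> \<odot>\<^bsub>M\<^esub> \<zero>\<^bsub>M\<^esub>) = \<zero>\<^bsub>R\<^esub> \<odot>\<^bsub>N\<^esub> f \<zero>\<^bsub>M\<^esub>"
    by (rule module_hom_smult[OF assms(3)]) auto
  then show ?thesis
    using module_hom_closed[OF assms(3) M.zero_closed] by simp
qed

lemma module_hom_neg:
  assumes "module R M" "module R N" "f \<in> module_hom R M N" "x \<in> carrier M"
  shows "f (\<ominus>\<^bsub>M\<^esub> x) = \<ominus>\<^bsub>N\<^esub> f x"
proof -
  interpret M: module R M by fact
  interpret N: module R N by fact
  show ?thesis
    using module_hom_smult[OF assms(3), of "\<ominus>\<^bsub>R\<^esub> \<one>\<^bsub>R\<^esub>" x] module_hom_closed[OF assms(3,4)] assms(4)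
    by (simp add: M.neg_eq_smult N.neg_eq_smult)
qed

lemma module_hom_diff:
  assumes "module R M" "module R N" "f \<in> module_hom R M N" "x \<in> carrier M" "y \<in> carrier M"
  shows "f (x \<ominus>\<^bsub>M\<^esub> y) = f x \<ominus>\<^bsub>N\<^esub> f y"
proof -
  interpret M: module R M by fact
  show ?thesis
    using assms by (simp add: a_minus_def module_hom_add[OF assms(3)] module_hom_neg[OF assms(1-3)])
qed

lemma module_hom_finsum:
  assumes "module R M" "module R N" "f \<in> module_hom R M N" "c \<in> A \<rightarrow> carrier M"
  shows "f (\<Oplus>\<^bsub>M\<^esub>i\<in>A. c i) = (\<Oplus>\<^bsub>N\<^esub>i\<in>A. f (c i))"
proof -
  interpret M: module R M by fact
  interpret N: module R N by fact
  show ?thesis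
    using assms(4)
  proof (induct A rule: infinite_finite_induct)
    case (insert x A)
    then have c: "c \<in> A \<rightarrow> carrier M" "c x \<in> carrier M"
      and fc: "(\<lambda>i. f (c i)) \<in> A \<rightarrow> carrier N" "f (c x) \<in> carrier N"
      by (auto intro: module_hom_closed[OF assms(3)])
    show ?case
      using insert c fc by (simp add: module_hom_add[OF assms(3)])
  qed (simp_all add: module_hom_zero[OF assms(1-3)])
qed

lemma module_hom_comp:
  "f \<in> module_hom R M N \<Longrightarrow> g \<in> module_hom R N P \<Longrightarrow> (\<lambda>x. g (f x)) \<in> module_hom R M P"
  by (rule module_homI) (simp_all add: module_hom_closed module_hom_add module_hom_smult)

lemma module_hom_id: "(\<lambda>x. x) \<in> module_hom R M M"
  unfolding module_hom_def by auto

context module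
begin

lemma module_hom_zero_map: "(\<lambda>x. \<zero>\<^bsub>M\<^esub>) \<in> module_hom R L M"
  by (rule module_homI) auto

lemma module_hom_plus:
  assumes f: "f \<in> module_hom R L M" and g: "g \<in> module_hom R L M"
  shows "(\<lambda>x. f x \<oplus>\<^bsub>M\<^esub> g x) \<in> module_hom R L M"
proof (rule module_homI)
  fix x y assume xy: "x \<in> carrier L" "y \<in> carrier L"
  note c = module_hom_closed[OF f xy(1)] module_hom_closed[OF g xy(1)]
    module_hom_closed[OF f xy(2)] module_hom_closed[OF g xy(2)]
  show "f (x \<oplus>\<^bsub>L\<^esub> y) \<oplus>\<^bsub>M\<^esub> g (x \<oplus>\<^bsub>L\<^esub> y) = f x \<oplus>\<^bsub>M\<^esub> g x \<oplus>\<^bsub>M\<^esub> (f y \<oplus>\<^bsub>M\<^esub> g y)"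
    using c by (simp add: module_hom_add[OF f xy] module_hom_add[OF g xy] M.a_ac)
qed (auto simp: module_hom_smult[OF f] module_hom_smult[OF g] smult_r_distr
    module_hom_closed[OF f] module_hom_closed[OF g])

lemma module_hom_smult_map:
  assumes f: "f \<in> module_hom R L M" and r: "r \<in> carrier R"
  shows "(\<lambda>x. r \<odot>\<^bsub>M\<^esub> f x) \<in> module_hom R L M"
proof (rule module_homI)
  fix s x assume sx: "s \<in> carrier R" "x \<in> carrier L"
  show "r \<odot>\<^bsub>M\<^esub> f (s \<odot>\<^bsub>L\<^esub> x) = s \<odot>\<^bsub>M\<^esub> (r \<odot>\<^bsub>M\<^esub> f x)"
    using sx r module_hom_closed[OF f sx(2)] R.m_comm[of r s]
    by (simp add: module_hom_smult[OF f] smult_assoc1[symmetric])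
qed (auto simp: r module_hom_add[OF f] smult_r_distr module_hom_closed[OF f])

lemma module_hom_minus:
  assumes f: "f \<in> module_hom R L M" and g: "g \<in> module_hom R L M"
  shows "(\<lambda>x. f x \<ominus>\<^bsub>M\<^esub> g x) \<in> module_hom R L M"
  using module_hom_closed[OF f] module_hom_closed[OF g]
  by (intro module_homI)
     (auto simp: module_hom_add[OF f] module_hom_add[OF g] module_hom_smult[OF f]
       module_hom_smult[OF g] smult_r_diff M.add_diff_add)

lemma module_hom_sum_map:
  assumes f: "\<And>j. j \<in> J \<Longrightarrow> f j \<in> module_hom R L M"
  shows "(\<lambda>x. \<Oplus>\<^bsub>M\<^esub>j\<in>J. f j x) \<in> module_hom R L M"
proof (cases "finite J")
  case True
  note c = module_hom_closed[OF f]
  show ?thesis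
  proof (rule module_homI)
    fix x y assume xy: "x \<in> carrier L" "y \<in> carrier L"
    have "(\<Oplus>\<^bsub>M\<^esub>j\<in>J. f j (x \<oplus>\<^bsub>L\<^esub> y)) = (\<Oplus>\<^bsub>M\<^esub>j\<in>J. f j x \<oplus>\<^bsub>M\<^esub> f j y)"
      using xy by (intro M.finsum_cong') (auto simp: c module_hom_add[OF f])
    also have "\<dots> = (\<Oplus>\<^bsub>M\<^esub>j\<in>J. f j x) \<oplus>\<^bsub>M\<^esub> (\<Oplus>\<^bsub>M\<^esub>j\<in>J. f j y)"
      using xy by (intro M.finsum_addf) (auto simp: c)
    finally show "(\<Oplus>\<^bsub>M\<^esub>j\<in>J. f j (x \<oplus>\<^bsub>L\<^esub> y)) = (\<Oplus>\<^bsub>M\<^esub>j\<in>J. f j x) \<oplus>\<^bsub>M\<^esub> (\<Oplus>\<^bsub>M\<^esub>j\<in>J. f j y)" .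
  next
    fix r x assume rx: "r \<in> carrier R" "x \<in> carrier L"
    have "(\<Oplus>\<^bsub>M\<^esub>j\<in>J. f j (r \<odot>\<^bsub>L\<^esub> x)) = (\<Oplus>\<^bsub>M\<^esub>j\<in>J. r \<odot>\<^bsub>M\<^esub> f j x)"
      using rx by (intro M.finsum_cong') (auto simp: c module_hom_smult[OF f])
    also have "\<dots> = r \<odot>\<^bsub>M\<^esub> (\<Oplus>\<^bsub>M\<^esub>j\<in>J. f j x)"
      using rx True by (intro finsum_smult_ldistr[symmetric]) (auto simp: c)
    finally show "(\<Oplus>\<^bsub>M\<^esub>j\<in>J. f j (r \<odot>\<^bsub>L\<^esub> x)) = r \<odot>\<^bsub>M\<^esub> (\<Oplus>\<^bsub>M\<^esub>j\<in>J. f j x)" .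
  qed (auto intro!: M.finsum_closed c)
qed (simp add: module_hom_zero_map)

section \<open>Submodules\<close>

lemma submodI:
  assumes "H \<subseteq> carrier M" "\<zero>\<^bsub>M\<^esub> \<in> H"
    and "\<And>a b. a \<in> H \<Longrightarrow> b \<in> H \<Longrightarrow> a \<oplus>\<^bsub>M\<^esub> b \<in> H"
    and "\<And>r a. r \<in> carrier R \<Longrightarrow> a \<in> H \<Longrightarrow> r \<odot>\<^bsub>M\<^esub> a \<in> H"
  shows "submodule H R M"
proof (rule submoduleI)
  fix a assume a: "a \<in> H"
  then have "\<ominus>\<^bsub>M\<^esub> a = (\<ominus> \<one>) \<odot>\<^bsub>M\<^esub> a"
    using assms(1) neg_eq_smult by auto
  then show "\<ominus>\<^bsub>M\<^esub> a \<in> H"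
    using assms(4)[OF _ a, of "\<ominus> \<one>"] by simp
qed (use assms in auto)

lemma submodD:
  assumes "submodule H R M"
  shows "H \<subseteq> carrier M" "\<zero>\<^bsub>M\<^esub> \<in> H"
    and "\<And>a b. a \<in> H \<Longrightarrow> b \<in> H \<Longrightarrow> a \<oplus>\<^bsub>M\<^esub> b \<in> H"
    and "\<And>a b. a \<in> H \<Longrightarrow> b \<in> H \<Longrightarrow> a \<ominus>\<^bsub>M\<^esub> b \<in> H"
    and "\<And>r a. r \<in> carrier R \<Longrightarrow> a \<in> H \<Longrightarrow> r \<odot>\<^bsub>M\<^esub> a \<in> H"
proof -
  note H = submoduleE[OF assms]
  show "H \<subseteq> carrier M" by (rule H(1))
  obtain a where a: "a \<in> H" using H(2) by auto
  then show "\<zero>\<^bsub>M\<^esub> \<in> H"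
    using H(1) H(4)[OF R.zero_closed a] by (simp add: subset_iff)
  show "a \<oplus>\<^bsub>M\<^esub> b \<in> H" if "a \<in> H" "b \<in> H" for a b using H(5) that .
  show "a \<ominus>\<^bsub>M\<^esub> b \<in> H" if "a \<in> H" "b \<in> H" for a b
    unfolding a_minus_def using H(3,5) that by simp
  show "r \<odot>\<^bsub>M\<^esub> a \<in> H" if "r \<in> carrier R" "a \<in> H" for r a using H(4) that .
qed

lemma submod_finsum:
  assumes H: "submodule H R M" and c: "\<And>j. j \<in> J \<Longrightarrow> c j \<in> H"
  shows "(\<Oplus>\<^bsub>M\<^esub>j\<in>J. c j) \<in> H"
  using c
proof (induct J rule: infinite_finite_induct)
  case (insert j J)
  then have "c \<in> J \<rightarrow> carrier M" "c j \<in> carrier M"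
    using submodD(1)[OF H] by auto
  with insert show ?case
    by (simp add: submodD(3)[OF H])
qed (use submodD(2)[OF H] in auto)

lemma submod_zero: "submodule {\<zero>\<^bsub>M\<^esub>} R M"
  by (rule submodI) auto

lemma submod_Inter:
  assumes "\<And>H. H \<in> C \<Longrightarrow> submodule H R M" "C \<noteq> {}"
  shows "submodule (\<Inter>C) R M"
proof (rule submodI)
  show "\<Inter>C \<subseteq> carrier M"
    using assms submodD(1) by blast
qed (use submodD[OF assms(1)] in auto)

lemma submod_span:
  assumes "S \<subseteq> carrier M"
  shows "submodule (span_module R M S) R M" "S \<subseteq> span_module R M S"
    and "\<And>H. submodule H R M \<Longrightarrow> S \<subseteq> H \<Longrightarrow> span_module R M S \<subseteq> H"
proof -
  show "submodule (span_module R M S) R M"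
    unfolding span_module_def using assms carrier_is_submodule by (intro submod_Inter) auto
qed (auto simp: span_module_def)

lemma submod_sum:
  assumes A: "submodule A R M" and B: "submodule B R M"
  shows "submodule {a \<oplus>\<^bsub>M\<^esub> b | a b. a \<in> A \<and> b \<in> B} R M" (is "submodule ?S R M")
proof (rule submodI)
  note A' = submodD[OF A] and B' = submodD[OF B]
  show "?S \<subseteq> carrier M"
    using A'(1) B'(1) by auto
  show "\<zero>\<^bsub>M\<^esub> \<in> ?S"
    using A'(2) B'(2) by (auto intro!: exI[of _ "\<zero>\<^bsub>M\<^esub>"])
  fix x assume "x \<in> ?S"
  then obtain a b where ab: "a \<in> A" "b \<in> B" "x = a \<oplus>\<^bsub>M\<^esub> b" by auto
  have abc: "a \<in> carrier M" "b \<in> carrier M" using ab A'(1) B'(1) by auto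
  show "x \<oplus>\<^bsub>M\<^esub> y \<in> ?S" if y: "y \<in> ?S" for y
  proof -
    obtain a' b' where ab': "a' \<in> A" "b' \<in> B" "y = a' \<oplus>\<^bsub>M\<^esub> b'" using y by auto
    have abc': "a' \<in> carrier M" "b' \<in> carrier M" using ab' A'(1) B'(1) by auto
    have "x \<oplus>\<^bsub>M\<^esub> y = (a \<oplus>\<^bsub>M\<^esub> a') \<oplus>\<^bsub>M\<^esub> (b \<oplus>\<^bsub>M\<^esub> b')"
      using ab ab' abc abc' by (simp add: M.a_ac)
    then show ?thesis
      using A'(3) B'(3) ab ab' by blast
  qed
  show "r \<odot>\<^bsub>M\<^esub> x \<in> ?S" if r: "r \<in> carrier R" for r
  proof -
    have "r \<odot>\<^bsub>M\<^esub> x = r \<odot>\<^bsub>M\<^esub> a \<oplus>\<^bsub>M\<^esub> r \<odot>\<^bsub>M\<^esub> b"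
      using ab abc r by (simp add: smult_r_distr)
    then show ?thesis
      using A'(5) B'(5) ab r by blast
  qed
qed

lemma submod_module: "submodule H R M \<Longrightarrow> module R (M\<lparr>carrier := H\<rparr>)"
  by (intro submodule.submodule_is_module module_axioms)

end

lemma submod_image:
  assumes "module R M" "module R N" "f \<in> module_hom R M N" "submodule H R M"
  shows "submodule (f ` H) R N"
proof -
  interpret M: module R M by fact
  interpret N: module R N by fact
  note H = M.submodD[OF assms(4)]
  show ?thesis
  proof (rule N.submodI)
    show "f ` H \<subseteq> carrier N" using H(1) module_hom_closed[OF assms(3)] by auto
    show "\<zero>\<^bsub>N\<^esub> \<in> f ` H" using H(2) module_hom_zero[OF assms(1-3)] by force
    fix a assume "a \<in> f ` H"
    then obtain x where x: "x \<in> H" "a = f x" by auto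
    have xc: "x \<in> carrier M" using x H(1) by auto
    show "a \<oplus>\<^bsub>N\<^esub> b \<in> f ` H" if b: "b \<in> f ` H" for b
    proof -
      obtain y where y: "y \<in> H" "b = f y" using b by auto
      have yc: "y \<in> carrier M" using y H(1) by auto
      have "a \<oplus>\<^bsub>N\<^esub> b = f (x \<oplus>\<^bsub>M\<^esub> y)" using x y module_hom_add[OF assms(3) xc yc] by simp
      then show ?thesis using H(3)[OF x(1) y(1)] by blast
    qed
    show "r \<odot>\<^bsub>N\<^esub> a \<in> f ` H" if r: "r \<in> carrier R" for r
    proof -
      have "r \<odot>\<^bsub>N\<^esub> a = f (r \<odot>\<^bsub>M\<^esub> x)" using x module_hom_smult[OF assms(3) r xc] by simp
      then show ?thesis using H(5)[OF r x(1)] by blast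
    qed
  qed
qed

lemma submod_preimage:
  assumes "module R M" "module R N" "f \<in> module_hom R M N" "submodule H R M" "submodule K R N"
  shows "submodule {x \<in> H. f x \<in> K} R M"
proof -
  interpret M: module R M by fact
  interpret N: module R N by fact
  note H = M.submodD[OF assms(4)] and K = N.submodD[OF assms(5)]
  have c: "x \<in> carrier M" if "x \<in> H" for x using H(1) that by auto
  show ?thesis
    by (intro M.submodI)
      (auto simp: c H(2,3,5) K(2,3,5) module_hom_zero[OF assms(1-3)] module_hom_add[OF assms(3)]
        module_hom_smult[OF assms(3)])
qed

section \<open>Free modules\<close>

lemma free_module_simps [simp]:
  "\<zero>\<^bsub>free_module R B\<^esub> = (\<lambda>b. \<zero>\<^bsub>R\<^esub>)"
  "u \<oplus>\<^bsub>free_module R B\<^esub> v = (\<lambda>b. u b \<oplus>\<^bsub>R\<^esub> v b)"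
  "r \<odot>\<^bsub>free_module R B\<^esub> u = (\<lambda>b. r \<otimes>\<^bsub>R\<^esub> u b)"
  by (simp_all add: free_module_def)

lemma free_module_carrier:
  "u \<in> carrier (free_module R B) \<longleftrightarrow>
    (\<forall>b. u b \<in> carrier R) \<and> finite {b. u b \<noteq> \<zero>\<^bsub>R\<^esub>} \<and> {b. u b \<noteq> \<zero>\<^bsub>R\<^esub>} \<subseteq> B"
  by (simp add: free_module_def)

lemma free_module_carrier_finite:
  assumes "finite B"
  shows "u \<in> carrier (free_module R B) \<longleftrightarrow> (\<forall>b. u b \<in> carrier R) \<and> (\<forall>b. b \<notin> B \<longrightarrow> u b = \<zero>\<^bsub>R\<^esub>)"
proof -
  have "{b. u b \<noteq> \<zero>\<^bsub>R\<^esub>} \<subseteq> B \<longleftrightarrow> (\<forall>b. b \<notin> B \<longrightarrow> u b = \<zero>\<^bsub>R\<^esub>)" by auto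
  then show ?thesis
    using assms by (auto simp: free_module_carrier intro: finite_subset)
qed

lemma free_module_closed: "u \<in> carrier (free_module R B) \<Longrightarrow> u b \<in> carrier R"
  by (simp add: free_module_carrier)

lemma free_module_eq_zero: "u \<in> carrier (free_module R B) \<Longrightarrow> b \<notin> B \<Longrightarrow> u b = \<zero>\<^bsub>R\<^esub>"
  by (auto simp: free_module_carrier)

context cring
begin

text \<open>One ambient module for each index type: the \<open>Fr J\<close> are submodules of it
  with the same zero and the same operations, so free modules of different ranks, and submodules of
  them, can be compared without inclusion maps.\<close>

abbreviation E :: "('a, 'j \<Rightarrow> 'a) module" where "E \<equiv> free_module R UNIV"

abbreviation Fr :: "'j set \<Rightarrow> ('j \<Rightarrow> 'a) set" where "Fr J \<equiv> carrier (free_module R J)"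

lemma free_module_is_module: "module R (free_module R B)"
proof (rule moduleI[OF is_cring])
  show "abelian_group (free_module R B)"
  proof (rule abelian_groupI)
    fix u v assume u: "u \<in> Fr B" and v: "v \<in> Fr B"
    have *: "{b. u b \<oplus> v b \<noteq> \<zero>} \<subseteq> {b. u b \<noteq> \<zero>} \<union> {b. v b \<noteq> \<zero>}" by auto
    have "finite {b. u b \<oplus> v b \<noteq> \<zero>}"
      by (rule finite_subset[OF *]) (use u v in \<open>auto simp: free_module_carrier\<close>)
    with * u v show "u \<oplus>\<^bsub>free_module R B\<^esub> v \<in> Fr B"
      unfolding free_module_carrier free_module_simps by blast
    show "u \<oplus>\<^bsub>free_module R B\<^esub> v = v \<oplus>\<^bsub>free_module R B\<^esub> u"
      using u v by (simp add: fun_eq_iff free_module_closed a_comm)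
    show "\<zero>\<^bsub>free_module R B\<^esub> \<oplus>\<^bsub>free_module R B\<^esub> u = u"
      using u by (simp add: fun_eq_iff free_module_closed)
    have **: "{b. \<ominus> u b \<noteq> \<zero>} \<subseteq> {b. u b \<noteq> \<zero>}" by auto
    have "finite {b. \<ominus> u b \<noteq> \<zero>}"
      by (rule finite_subset[OF **]) (use u in \<open>auto simp: free_module_carrier\<close>)
    with ** u have "(\<lambda>b. \<ominus> u b) \<in> Fr B"
      unfolding free_module_carrier by blast
    then show "\<exists>y\<in>Fr B. y \<oplus>\<^bsub>free_module R B\<^esub> u = \<zero>\<^bsub>free_module R B\<^esub>"
      using u by (intro bexI[of _ "\<lambda>b. \<ominus> u b"]) (simp_all add: fun_eq_iff free_module_closed l_neg)
  qed (auto simp: fun_eq_iff free_module_closed a_assoc free_module_carrier[where u = "\<lambda>b. \<zero>"])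
next
  fix r u assume r: "r \<in> carrier R" and u: "u \<in> Fr B"
  have *: "{b. r \<otimes> u b \<noteq> \<zero>} \<subseteq> {b. u b \<noteq> \<zero>}" using r by auto
  have "finite {b. r \<otimes> u b \<noteq> \<zero>}"
    by (rule finite_subset[OF *]) (use u in \<open>auto simp: free_module_carrier\<close>)
  with * u r show "r \<odot>\<^bsub>free_module R B\<^esub> u \<in> Fr B"
    unfolding free_module_carrier free_module_simps by blast
qed (simp_all add: fun_eq_iff free_module_closed l_distr r_distr m_assoc)

lemma free_module_neg: "u \<in> Fr B \<Longrightarrow> \<ominus>\<^bsub>free_module R B\<^esub> u = (\<lambda>b. \<ominus> u b)"
  using module.neg_eq_smult[OF free_module_is_module, of u B]
  by (simp add: fun_eq_iff free_module_closed l_minus)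

lemma free_module_diff:
  "u \<in> Fr B \<Longrightarrow> v \<in> Fr B \<Longrightarrow>
    u \<ominus>\<^bsub>free_module R B\<^esub> v = (\<lambda>b. u b \<ominus> v b)"
  by (simp add: a_minus_def free_module_neg)

lemma free_module_finsum:
  assumes "c \<in> A \<rightarrow> Fr B"
  shows "(\<Oplus>\<^bsub>free_module R B\<^esub>i\<in>A. c i) = (\<lambda>b. \<Oplus>i\<in>A. c i b)"
proof -
  interpret F: module R "free_module R B" by (rule free_module_is_module)
  show ?thesis
    using assms
  proof (induct A rule: infinite_finite_induct)
    case (insert x A)
    then have "\<And>b. (\<lambda>i. c i b) \<in> A \<rightarrow> carrier R" "\<And>b. c x b \<in> carrier R"
      by (auto intro: free_module_closed)
    with insert show ?case by simp
  qed simp_all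
qed

lemma basis_vec_carrier: "b \<in> B \<Longrightarrow> basis_vec R b \<in> Fr B"
  by (auto simp: free_module_carrier basis_vec_def)

lemma free_module_mono: "B \<subseteq> C \<Longrightarrow> Fr B \<subseteq> Fr C"
  by (rule subsetI, unfold free_module_carrier) blast

lemma submod_free:
  assumes BC: "B \<subseteq> C"
  shows "submodule (Fr B) R (free_module R C)"
proof -
  interpret C: module R "free_module R C" by (rule free_module_is_module)
  interpret B: module R "free_module R B" by (rule free_module_is_module)
  show ?thesis
  proof (rule C.submodI)
    show "\<zero>\<^bsub>free_module R C\<^esub> \<in> Fr B"
      using B.zero_closed by simp
    show "a \<oplus>\<^bsub>free_module R C\<^esub> b \<in> Fr B"
      if "a \<in> Fr B" "b \<in> Fr B" for a b
      using B.a_closed[OF that] by simp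
    show "r \<odot>\<^bsub>free_module R C\<^esub> a \<in> Fr B"
      if "r \<in> carrier R" "a \<in> Fr B" for r a
      using B.smult_closed[OF that] by simp
  qed (rule free_module_mono[OF BC])
qed

lemma basis_smult_closed:
  assumes "j \<in> B" "r \<in> carrier R"
  shows "r \<odot>\<^bsub>free_module R B\<^esub> basis_vec R j \<in> Fr B"
proof -
  interpret B: module R "free_module R B" by (rule free_module_is_module)
  show ?thesis by (rule B.smult_closed[OF assms(2) basis_vec_carrier[OF assms(1)]])
qed

lemma free_module_expand:
  assumes J: "finite J" "J \<subseteq> B" and u: "u \<in> Fr J"
  shows "u = (\<Oplus>\<^bsub>free_module R B\<^esub>j\<in>J. u j \<odot>\<^bsub>free_module R B\<^esub> basis_vec R j)"
proof -
  have uc: "\<And>b. u b \<in> carrier R" using u by (simp add: free_module_closed)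
  have c: "(\<lambda>j. u j \<odot>\<^bsub>free_module R B\<^esub> basis_vec R j) \<in> J \<rightarrow> Fr B"
    using J uc by (auto intro!: basis_smult_closed simp del: free_module_simps)
  have s: "(\<Oplus>j\<in>J. u j \<otimes> basis_vec R j b) = u b" for b
  proof -
    have "(\<Oplus>j\<in>J. u j \<otimes> basis_vec R j b) = (\<Oplus>j\<in>J. if b = j then u j else \<zero>)"
      using uc by (intro finsum_cong') (auto simp: basis_vec_def)
    also have "\<dots> = u b"
    proof (cases "b \<in> J")
      case True
      then show ?thesis using J uc by (subst finsum_singleton) auto
    next
      case False
      have "(\<Oplus>j\<in>J. if b = j then u j else \<zero>) = (\<Oplus>j\<in>J. \<zero>)"
        using False by (intro finsum_cong') auto
      then show ?thesis using free_module_eq_zero[OF u False] by simp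
    qed
    finally show ?thesis .
  qed
  show ?thesis
    by (subst free_module_finsum[OF c]) (simp add: s)
qed

lemma module_hom_expand:
  assumes P: "module R P" and f: "f \<in> module_hom R (free_module R B) P"
    and J: "finite J" "J \<subseteq> B" and u: "u \<in> Fr J"
  shows "f u = (\<Oplus>\<^bsub>P\<^esub>j\<in>J. u j \<odot>\<^bsub>P\<^esub> f (basis_vec R j))"
proof -
  interpret P: module R P by fact
  have uc: "\<And>b. u b \<in> carrier R" using u by (simp add: free_module_closed)
  have bc: "basis_vec R j \<in> Fr B" if "j \<in> J" for j
    using that J by (auto intro: basis_vec_carrier)
  have c: "(\<lambda>j. u j \<odot>\<^bsub>free_module R B\<^esub> basis_vec R j) \<in> J \<rightarrow> Fr B"
    using J uc by (auto intro!: basis_smult_closed simp del: free_module_simps)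
  have "f u = f (\<Oplus>\<^bsub>free_module R B\<^esub>j\<in>J. u j \<odot>\<^bsub>free_module R B\<^esub> basis_vec R j)"
    by (subst free_module_expand[OF J u]) (rule refl)
  also have "\<dots> = (\<Oplus>\<^bsub>P\<^esub>j\<in>J. f (u j \<odot>\<^bsub>free_module R B\<^esub> basis_vec R j))"
    by (rule module_hom_finsum[OF free_module_is_module P f c])
  also have "\<dots> = (\<Oplus>\<^bsub>P\<^esub>j\<in>J. u j \<odot>\<^bsub>P\<^esub> f (basis_vec R j))"
  proof (rule P.finsum_cong')
    show "(\<lambda>j. u j \<odot>\<^bsub>P\<^esub> f (basis_vec R j)) \<in> J \<rightarrow> carrier P"
      using uc module_hom_closed[OF f bc] by auto
    show "f (u j \<odot>\<^bsub>free_module R B\<^esub> basis_vec R j) = u j \<odot>\<^bsub>P\<^esub> f (basis_vec R j)" if "j \<in> J" for j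
      by (rule module_hom_smult[OF f uc bc[OF that]])
  qed simp
  finally show ?thesis .
qed

lemma module_hom_eqI:
  assumes P: "module R P" and f: "f \<in> module_hom R (free_module R B) P"
    and g: "g \<in> module_hom R (free_module R B) P"
    and J: "finite J" "J \<subseteq> B" and u: "u \<in> Fr J"
    and e: "\<And>j. j \<in> J \<Longrightarrow> f (basis_vec R j) = g (basis_vec R j)"
  shows "f u = g u"
proof -
  interpret P: module R P by fact
  have uc: "\<And>b. u b \<in> carrier R" using u by (simp add: free_module_closed)
  have bc: "basis_vec R j \<in> Fr B" if "j \<in> J" for j
    using that J by (auto intro: basis_vec_carrier)
  show ?thesis
    unfolding module_hom_expand[OF P f J u] module_hom_expand[OF P g J u]
    using uc e module_hom_closed[OF g bc] by (intro P.finsum_cong') auto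
qed

lemma module_hom_free:
  assumes P: "module R P" and c: "\<And>j. j \<in> J \<Longrightarrow> c j \<in> carrier P"
  shows "(\<lambda>u. \<Oplus>\<^bsub>P\<^esub>j\<in>J. u j \<odot>\<^bsub>P\<^esub> c j) \<in> module_hom R (free_module R B) P"
proof -
  interpret P: module R P by fact
  show ?thesis
    by (intro P.module_hom_sum_map module_homI)
      (simp_all add: c free_module_closed P.smult_l_distr P.smult_assoc1)
qed

lemma module_hom_free_basis:
  assumes P: "module R P" and c: "\<And>j. j \<in> J \<Longrightarrow> c j \<in> carrier P" and J: "finite J" "i \<in> J"
  shows "(\<Oplus>\<^bsub>P\<^esub>j\<in>J. basis_vec R i j \<odot>\<^bsub>P\<^esub> c j) = c i"
proof -
  interpret P: module R P by fact
  have "(\<Oplus>\<^bsub>P\<^esub>j\<in>J. basis_vec R i j \<odot>\<^bsub>P\<^esub> c j) = (\<Oplus>\<^bsub>P\<^esub>j\<in>J. if i = j then c j else \<zero>\<^bsub>P\<^esub>)"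
    using c by (intro P.finsum_cong') (auto simp: basis_vec_def)
  also have "\<dots> = c i"
    using J c by (subst P.finsum_singleton) auto
  finally show ?thesis .
qed

text \<open>The coordinates outside of \<open>J\<close> are set to zero before \<open>f\<close> is
  applied. In this way an augmentation that is given on a free module of finite rank becomes a map
  on the whole ambient module.\<close>

lemma module_hom_extend:
  assumes f: "f \<in> module_hom R (free_module R J) P"
  obtains f' where "f' \<in> module_hom R (free_module R B) P"
    and "\<And>u. u \<in> Fr J \<Longrightarrow> f' u = f u"
proof -
  define t where "t = (\<lambda>(u :: 'c \<Rightarrow> 'a) j. if j \<in> J then u j else \<zero>)"
  have "t \<in> module_hom R (free_module R B) (free_module R J)"
  proof (rule module_homI)
    fix u assume u: "u \<in> Fr B"
    have *: "{b. t u b \<noteq> \<zero>} \<subseteq> {b. u b \<noteq> \<zero>} \<inter> J" by (auto simp: t_def)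
    have "finite {b. t u b \<noteq> \<zero>}"
      by (rule finite_subset[OF *]) (use u in \<open>auto simp: free_module_carrier\<close>)
    moreover have "t u b \<in> carrier R" for b using free_module_closed[OF u] by (simp add: t_def)
    ultimately show "t u \<in> Fr J"
      using * unfolding free_module_carrier by blast
  qed (auto simp: t_def fun_eq_iff)
  from module_hom_comp[OF this f] have "(\<lambda>u. f (t u)) \<in> module_hom R (free_module R B) P" .
  moreover have "t u = u" if "u \<in> Fr J" for u
    using free_module_eq_zero[OF that] by (auto simp: t_def fun_eq_iff)
  ultimately show ?thesis using that by metis
qed

section \<open>The ring as a module over itself\<close>

lemma ring_module_simps [simp]:
  "carrier (ring_module R) = carrier R" "\<zero>\<^bsub>ring_module R\<^esub> = \<zero>"
  "x \<oplus>\<^bsub>ring_module R\<^esub> y = x \<oplus> y" "x \<odot>\<^bsub>ring_module R\<^esub> y = x \<otimes> y"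
  by (simp_all add: ring_module_def)

lemma ring_module_is_module: "module R (ring_module R)"
proof (rule moduleI[OF is_cring])
  show "abelian_group (ring_module R)"
  proof (rule abelian_groupI)
    fix x assume "x \<in> carrier (ring_module R)"
    then show "\<exists>y\<in>carrier (ring_module R). y \<oplus>\<^bsub>ring_module R\<^esub> x = \<zero>\<^bsub>ring_module R\<^esub>"
      by (intro bexI[of _ "\<ominus> x"]) (simp_all add: l_neg)
  qed (simp_all add: a_ac)
qed (simp_all add: l_distr r_distr m_assoc)

lemma ring_module_diff: "x \<in> carrier R \<Longrightarrow> y \<in> carrier R \<Longrightarrow> x \<ominus>\<^bsub>ring_module R\<^esub> y = x \<ominus> y"
  using module.neg_eq_smult[OF ring_module_is_module, of y] by (simp add: a_minus_def l_minus)

lemma ring_module_finsum: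
  assumes "c \<in> A \<rightarrow> carrier R"
  shows "(\<Oplus>\<^bsub>ring_module R\<^esub>i\<in>A. c i) = (\<Oplus>i\<in>A. c i)"
proof -
  interpret F: module R "ring_module R" by (rule ring_module_is_module)
  show ?thesis
    using assms by (induct A rule: infinite_finite_induct) simp_all
qed

end

section \<open>Ext of subquotients of a free module\<close>

lemma (in abelian_group) diff_eq_diffI:
  assumes "a \<oplus> b = c \<oplus> d" "a \<in> carrier G" "b \<in> carrier G" "c \<in> carrier G" "d \<in> carrier G"
  shows "a \<ominus> c = d \<ominus> b"
proof (rule diff_eqI)
  have "(c \<oplus> d) \<ominus> b = a"
    using assms by (intro diff_eqI) (simp_all add: a_comm)
  then show "a = c \<oplus> (d \<ominus> b)"
    using assms by (simp add: minus_eq a_assoc)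
qed (use assms in auto)

text \<open>Neither locality nor the Noetherian property is included, since the theory of dual
  complexes uses nothing but the resolution. Both are added in \<open>local_gorenstein\<close>,
  where dimension and depth come in.\<close>

locale finite_inj_res = cring R for R :: "('a, 'r) ring_scheme" (structure) +
  fixes I :: "nat \<Rightarrow> ('a, 'i) module" and \<delta> :: "nat \<Rightarrow> 'i \<Rightarrow> 'i" and \<eta> :: "'a \<Rightarrow> 'i" and k :: nat
  assumes res: "injective_resolution R (ring_module R) I \<delta> \<eta>"
    and I_zero: "\<And>i. i > k \<Longrightarrow> zero_module (I i)"
begin

lemma E_module: "module R E"
  by (rule free_module_is_module)

lemma I_module: "module R (I i)"
  using res unfolding injective_resolution_def injective_module_def by blast

lemma \<delta>_hom: "\<delta> i \<in> module_hom R (I i) (I (Suc i))"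
  using res unfolding injective_resolution_def by blast

lemma \<eta>_hom: "\<eta> \<in> module_hom R (ring_module R) (I 0)"
  using res unfolding injective_resolution_def by blast

lemma \<eta>_inj: "inj_on \<eta> (carrier R)"
  using res unfolding injective_resolution_def by simp

lemma \<delta>_zero: "\<delta> i \<zero>\<^bsub>I i\<^esub> = \<zero>\<^bsub>I (Suc i)\<^esub>"
  by (rule module_hom_zero[OF I_module I_module \<delta>_hom])

lemma ker_\<delta>0: "x \<in> carrier (I 0) \<Longrightarrow> \<delta> 0 x = \<zero>\<^bsub>I (Suc 0)\<^esub> \<Longrightarrow> \<exists>r\<in>carrier R. x = \<eta> r"
  and \<delta>0_\<eta>: "r \<in> carrier R \<Longrightarrow> \<delta> 0 (\<eta> r) = \<zero>\<^bsub>I (Suc 0)\<^esub>"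
proof -
  have *: "\<eta> ` carrier R = {x \<in> carrier (I 0). \<delta> 0 x = \<zero>\<^bsub>I (Suc 0)\<^esub>}"
    using res unfolding injective_resolution_def by (simp add: a_kernel_def')
  show "x \<in> carrier (I 0) \<Longrightarrow> \<delta> 0 x = \<zero>\<^bsub>I (Suc 0)\<^esub> \<Longrightarrow> \<exists>r\<in>carrier R. x = \<eta> r"
    using * by blast
  show "r \<in> carrier R \<Longrightarrow> \<delta> 0 (\<eta> r) = \<zero>\<^bsub>I (Suc 0)\<^esub>"
    using * by blast
qed

lemma ker_\<delta>: "x \<in> carrier (I (Suc i)) \<Longrightarrow> \<delta> (Suc i) x = \<zero>\<^bsub>I (Suc (Suc i))\<^esub> \<Longrightarrow>
    \<exists>y\<in>carrier (I i). x = \<delta> i y"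
  and \<delta>\<delta>: "y \<in> carrier (I i) \<Longrightarrow> \<delta> (Suc i) (\<delta> i y) = \<zero>\<^bsub>I (Suc (Suc i))\<^esub>"
proof -
  have *: "\<delta> i ` carrier (I i) = {x \<in> carrier (I (Suc i)). \<delta> (Suc i) x = \<zero>\<^bsub>I (Suc (Suc i))\<^esub>}"
    using res unfolding injective_resolution_def by (simp add: a_kernel_def')
  show "x \<in> carrier (I (Suc i)) \<Longrightarrow> \<delta> (Suc i) x = \<zero>\<^bsub>I (Suc (Suc i))\<^esub> \<Longrightarrow>
    \<exists>y\<in>carrier (I i). x = \<delta> i y"
    using * by blast
  show "y \<in> carrier (I i) \<Longrightarrow> \<delta> (Suc i) (\<delta> i y) = \<zero>\<^bsub>I (Suc (Suc i))\<^esub>"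
    using * by blast
qed

text \<open>The definition of \<open>injective_module\<close> speaks about index type
  \<open>nat\<close> only. A countable index type is encoded in \<open>nat\<close>, the extension is
  made there along the inclusion of the image of \<open>A\<close>, and the result is pulled
  back.\<close>

lemma injective_extend:
  fixes A :: "('b::countable \<Rightarrow> 'a) set"
  assumes A: "submodule A R E"
    and gc: "\<And>a. a \<in> A \<Longrightarrow> g a \<in> carrier (I i)"
    and ga: "\<And>a b. a \<in> A \<Longrightarrow> b \<in> A \<Longrightarrow> g (a \<oplus>\<^bsub>E\<^esub> b) = g a \<oplus>\<^bsub>I i\<^esub> g b"
    and gs: "\<And>r a. r \<in> carrier R \<Longrightarrow> a \<in> A \<Longrightarrow> g (r \<odot>\<^bsub>E\<^esub> a) = r \<odot>\<^bsub>I i\<^esub> g a"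
  obtains h where "h \<in> module_hom R E (I i)" "\<And>a. a \<in> A \<Longrightarrow> h a = g a"
proof -
  interpret E: module R "E :: ('a, 'b \<Rightarrow> 'a) module" by (rule E_module)
  interpret En: module R "E :: ('a, nat \<Rightarrow> 'a) module" by (rule E_module)
  note A' = E.submodD[OF A]
  \<comment> \<open>Outside of the range of \<open>to_nat\<close> the values
    \<open>from_nat n\<close> may repeat, so zero is put there; this keeps supports finite.\<close>
  define \<tau> :: "('b \<Rightarrow> 'a) \<Rightarrow> nat \<Rightarrow> 'a"
    where "\<tau> = (\<lambda>u n. if n \<in> range (to_nat :: 'b \<Rightarrow> nat) then u (from_nat n) else \<zero>)"
  have \<tau>: "\<tau> \<in> module_hom R E E"
  proof (rule module_homI)
    fix u :: "'b \<Rightarrow> 'a" assume u: "u \<in> carrier E"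
    have *: "{n. \<tau> u n \<noteq> \<zero>} \<subseteq> to_nat ` {b. u b \<noteq> \<zero>}" by (auto simp: \<tau>_def)
    have "finite {n. \<tau> u n \<noteq> \<zero>}"
      by (rule finite_subset[OF *]) (use u in \<open>auto simp: free_module_carrier\<close>)
    then show "\<tau> u \<in> carrier E"
      unfolding free_module_carrier using free_module_closed[OF u] by (simp add: \<tau>_def)
  qed (auto simp: \<tau>_def fun_eq_iff)
  have inj: "u = v" if "\<tau> u = \<tau> v" for u v
  proof
    fix b show "u b = v b"
      using fun_cong[OF that, of "to_nat b"] by (simp add: \<tau>_def)
  qed
  define \<sigma> where "\<sigma> = inv_into A \<tau>"
  have \<sigma>: "\<sigma> (\<tau> a) = a" if "a \<in> A" for a
    unfolding \<sigma>_def using that inj by (intro inv_into_f_f) (auto simp: inj_on_def)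
  have sub: "submodule (\<tau> ` A) R E"
    by (rule submod_image[OF E_module E_module \<tau> A])
  let ?A = "E\<lparr>carrier := \<tau> ` A\<rparr> :: ('a, nat \<Rightarrow> 'a) module"
  have mA: "module R ?A" by (rule En.submod_module[OF sub])
  have c: "a \<in> carrier E" if "a \<in> A" for a using A'(1) that by auto
  have g': "(\<lambda>x. g (\<sigma> x)) \<in> module_hom R ?A (I i)"
  proof (rule module_homI)
    fix x assume "x \<in> carrier ?A"
    then obtain a where a: "a \<in> A" "x = \<tau> a" by auto
    then show "g (\<sigma> x) \<in> carrier (I i)" using gc by (simp add: \<sigma>)
    show "g (\<sigma> (x \<oplus>\<^bsub>?A\<^esub> y)) = g (\<sigma> x) \<oplus>\<^bsub>I i\<^esub> g (\<sigma> y)" if y: "y \<in> carrier ?A" for y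
    proof -
      obtain b where b: "b \<in> A" "y = \<tau> b" using y by auto
      have "x \<oplus>\<^bsub>?A\<^esub> y = \<tau> (a \<oplus>\<^bsub>E\<^esub> b)"
        using a b module_hom_add[OF \<tau> c[OF a(1)] c[OF b(1)]] by simp
      then have "\<sigma> (x \<oplus>\<^bsub>?A\<^esub> y) = a \<oplus>\<^bsub>E\<^esub> b" using \<sigma>[OF A'(3)[OF a(1) b(1)]] by simp
      then show ?thesis using ga[OF a(1) b(1)] \<sigma> a b by simp
    qed
    show "g (\<sigma> (r \<odot>\<^bsub>?A\<^esub> x)) = r \<odot>\<^bsub>I i\<^esub> g (\<sigma> x)" if r: "r \<in> carrier R" for r
    proof -
      have "r \<odot>\<^bsub>?A\<^esub> x = \<tau> (r \<odot>\<^bsub>E\<^esub> a)"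
        using a module_hom_smult[OF \<tau> r c[OF a(1)]] by simp
      then have "\<sigma> (r \<odot>\<^bsub>?A\<^esub> x) = r \<odot>\<^bsub>E\<^esub> a" using \<sigma>[OF A'(5)[OF r a(1)]] by simp
      then show ?thesis using gs[OF r a(1)] \<sigma> a by simp
    qed
  qed
  have id: "(\<lambda>x. x) \<in> module_hom R ?A (E :: ('a, nat \<Rightarrow> 'a) module)"
    using submodule.smult_closed[OF sub] En.submodD(1)[OF sub] by (intro module_homI) auto
  have "injective_module R (I i)"
    using res unfolding injective_resolution_def by blast
  then obtain h where h: "h \<in> module_hom R (E :: ('a, nat \<Rightarrow> 'a) module) (I i)"
      "\<And>x. x \<in> \<tau> ` A \<Longrightarrow> h x = g (\<sigma> x)"
    using id g' mA E_module unfolding injective_module_def by fastforce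
  show ?thesis
  proof (rule that)
    show "(\<lambda>u. h (\<tau> u)) \<in> module_hom R E (I i)" by (rule module_hom_comp[OF \<tau> h(1)])
    show "h (\<tau> a) = g a" if "a \<in> A" for a using h(2) \<sigma> that by simp
  qed
qed

text \<open>
  Every finitely generated module is a subquotient \<open>A/B\<close> of \<open>E\<close>, and as the \<open>I i\<close> are injective,
  every homomorphism from \<open>A/B\<close> to \<open>I i\<close> is induced by one that is defined on all of \<open>E\<close> and
  vanishes on \<open>B\<close>. Thus \<open>ext_zero A B j\<close> says that \<open>Ext\<close> of \<open>A/B\<close> and \<open>R\<close> vanishes in degree
  \<open>j + 1\<close>.
\<close>

definition cocycle :: "('b::countable \<Rightarrow> 'a) set \<Rightarrow> ('b \<Rightarrow> 'a) set \<Rightarrow> nat \<Rightarrow> (('b \<Rightarrow> 'a) \<Rightarrow> 'i) \<Rightarrow> bool" where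
  "cocycle A B i f \<longleftrightarrow> f \<in> module_hom R E (I i) \<and> (\<forall>b\<in>B. f b = \<zero>\<^bsub>I i\<^esub>) \<and>
     (\<forall>a\<in>A. \<delta> i (f a) = \<zero>\<^bsub>I (Suc i)\<^esub>)"

text \<open>Functions are defined on all of \<open>E\<close>, but as cochains of \<open>A/B\<close>
  only their values on \<open>A\<close> count. Degree 0, where nothing maps in, is the start of the
  induction for finite generation.\<close>

definition coboundary :: "('b::countable \<Rightarrow> 'a) set \<Rightarrow> ('b \<Rightarrow> 'a) set \<Rightarrow> nat \<Rightarrow> (('b \<Rightarrow> 'a) \<Rightarrow> 'i) \<Rightarrow> bool" where
  "coboundary A B i f \<longleftrightarrow> (case i of 0 \<Rightarrow> \<forall>a\<in>A. f a = \<zero>\<^bsub>I 0\<^esub>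
     | Suc j \<Rightarrow> \<exists>g\<in>module_hom R E (I j). (\<forall>b\<in>B. g b = \<zero>\<^bsub>I j\<^esub>) \<and> (\<forall>a\<in>A. f a = \<delta> j (g a)))"

definition ext_zero :: "('b::countable \<Rightarrow> 'a) set \<Rightarrow> ('b \<Rightarrow> 'a) set \<Rightarrow> nat \<Rightarrow> bool" where
  "ext_zero A B j \<longleftrightarrow> (\<forall>f. cocycle A B (Suc j) f \<longrightarrow> coboundary A B (Suc j) f)"

section \<open>Vanishing of Ext along short exact sequences\<close>

lemma cocycleI:
  assumes "f \<in> module_hom R E (I i)" "\<And>b. b \<in> B \<Longrightarrow> f b = \<zero>\<^bsub>I i\<^esub>"
    and "\<And>a. a \<in> A \<Longrightarrow> \<delta> i (f a) = \<zero>\<^bsub>I (Suc i)\<^esub>"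
  shows "cocycle A B i f"
  using assms unfolding cocycle_def by auto

lemma cocycleD:
  assumes "cocycle A B i f"
  shows "f \<in> module_hom R E (I i)" "\<And>b. b \<in> B \<Longrightarrow> f b = \<zero>\<^bsub>I i\<^esub>"
    and "\<And>a. a \<in> A \<Longrightarrow> \<delta> i (f a) = \<zero>\<^bsub>I (Suc i)\<^esub>"
  using assms unfolding cocycle_def by auto

lemma ext_zeroI:
  assumes "\<And>f. cocycle A B (Suc j) f \<Longrightarrow>
    \<exists>g. g \<in> module_hom R E (I j) \<and> (\<forall>b\<in>B. g b = \<zero>\<^bsub>I j\<^esub>) \<and> (\<forall>a\<in>A. f a = \<delta> j (g a))"
  shows "ext_zero A B j"
  unfolding ext_zero_def coboundary_def using assms by (simp add: Bex_def)

lemma ext_zeroE: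
  assumes "ext_zero A B j" "cocycle A B (Suc j) f"
  obtains g where "g \<in> module_hom R E (I j)" "\<And>b. b \<in> B \<Longrightarrow> g b = \<zero>\<^bsub>I j\<^esub>"
    "\<And>a. a \<in> A \<Longrightarrow> f a = \<delta> j (g a)"
  using assms unfolding ext_zero_def coboundary_def by auto

text \<open>Cocycles of degree \<open>j + 1 > k\<close> take values in a zero module. This is the
  only place where the finiteness of the injective resolution enters.\<close>

lemma ext_zero_large:
  fixes A :: "('b::countable \<Rightarrow> 'a) set"
  assumes "j \<ge> k" "A \<subseteq> carrier E"
  shows "ext_zero A B j"
proof (rule ext_zeroI)
  fix f assume f: "cocycle A B (Suc j) f"
  interpret I: module R "I j" by (rule I_module)
  have "carrier (I (Suc j)) = {\<zero>\<^bsub>I (Suc j)\<^esub>}"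
    using I_zero[of "Suc j"] assms(1) by (simp add: zero_module_def)
  then have "f a = \<zero>\<^bsub>I (Suc j)\<^esub>" if "a \<in> A" for a
    using module_hom_closed[OF cocycleD(1)[OF f], of a] that assms(2) by auto
  then show "\<exists>g. g \<in> module_hom R E (I j) \<and> (\<forall>b\<in>B. g b = \<zero>\<^bsub>I j\<^esub>) \<and> (\<forall>a\<in>A. f a = \<delta> j (g a))"
    using I.module_hom_zero_map by (intro exI[of _ "\<lambda>_. \<zero>\<^bsub>I j\<^esub>"]) (auto simp: \<delta>_zero)
qed

lemma ext_zero_self:
  fixes A :: "('b::countable \<Rightarrow> 'a) set"
  shows "ext_zero A A j"
proof (rule ext_zeroI)
  fix f assume f: "cocycle A A (Suc j) f"
  interpret I: module R "I j" by (rule I_module)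
  show "\<exists>g. g \<in> module_hom R E (I j) \<and> (\<forall>b\<in>A. g b = \<zero>\<^bsub>I j\<^esub>) \<and> (\<forall>a\<in>A. f a = \<delta> j (g a))"
    using I.module_hom_zero_map cocycleD(2)[OF f]
    by (intro exI[of _ "\<lambda>_. \<zero>\<^bsub>I j\<^esub>"]) (auto simp: \<delta>_zero)
qed

text \<open>Exactness of \<open>Ext(C/A) -> Ext(C/B) -> Ext(A/B)\<close> in degree
  \<open>j + 1\<close>. The cochain \<open>g\<close> that bounds \<open>f\<close> on
  \<open>A\<close> is defined on all of \<open>E\<close>, so \<open>f - \<delta> g\<close> makes
  sense on \<open>C\<close> and vanishes on \<open>A\<close>.\<close>

lemma ext_zero_middle:
  fixes A B C :: "('b::countable \<Rightarrow> 'a) set"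
  assumes sub: "B \<subseteq> A" "A \<subseteq> C" "C \<subseteq> carrier E"
    and AB: "ext_zero A B j" and CA: "ext_zero C A j"
  shows "ext_zero C B j"
proof (rule ext_zeroI)
  interpret I: module R "I j" by (rule I_module)
  interpret I': module R "I (Suc j)" by (rule I_module)
  interpret I'': module R "I (Suc (Suc j))" by (rule I_module)
  fix f assume f: "cocycle C B (Suc j) f"
  note f' = cocycleD[OF f]
  have "cocycle A B (Suc j) f" using f' sub by (intro cocycleI) auto
  then obtain g where g: "g \<in> module_hom R E (I j)" "\<And>b. b \<in> B \<Longrightarrow> g b = \<zero>\<^bsub>I j\<^esub>"
    "\<And>a. a \<in> A \<Longrightarrow> f a = \<delta> j (g a)"
    by (rule ext_zeroE[OF AB]) auto
  have \<delta>g: "(\<lambda>x. \<delta> j (g x)) \<in> module_hom R E (I (Suc j))" by (rule module_hom_comp[OF g(1) \<delta>_hom])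
  have c: "c \<in> carrier E" if "c \<in> C" for c using sub that by auto
  note cl = module_hom_closed[OF f'(1)] module_hom_closed[OF \<delta>g] module_hom_closed[OF g(1)]
  have "cocycle C A (Suc j) (\<lambda>x. f x \<ominus>\<^bsub>I (Suc j)\<^esub> \<delta> j (g x))"
  proof (rule cocycleI)
    show "(\<lambda>x. f x \<ominus>\<^bsub>I (Suc j)\<^esub> \<delta> j (g x)) \<in> module_hom R E (I (Suc j))"
      by (rule I'.module_hom_minus[OF f'(1) \<delta>g])
    show "f a \<ominus>\<^bsub>I (Suc j)\<^esub> \<delta> j (g a) = \<zero>\<^bsub>I (Suc j)\<^esub>" if "a \<in> A" for a
      using g(3)[OF that] cl(2)[of a] c sub that by (simp add: I'.M.diff_self subset_iff)
    show "\<delta> (Suc j) (f a \<ominus>\<^bsub>I (Suc j)\<^esub> \<delta> j (g a)) = \<zero>\<^bsub>I (Suc (Suc j))\<^esub>" if "a \<in> C" for a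
      using module_hom_diff[OF I_module I_module \<delta>_hom cl(1)[OF c[OF that]] cl(2)[OF c[OF that]]]
        f'(3)[OF that] \<delta>\<delta>[OF cl(3)[OF c[OF that]]] by (simp add: I''.M.diff_self)
  qed
  then obtain g' where g': "g' \<in> module_hom R E (I j)" "\<And>b. b \<in> A \<Longrightarrow> g' b = \<zero>\<^bsub>I j\<^esub>"
    "\<And>a. a \<in> C \<Longrightarrow> f a \<ominus>\<^bsub>I (Suc j)\<^esub> \<delta> j (g a) = \<delta> j (g' a)"
    by (rule ext_zeroE[OF CA]) auto
  show "\<exists>g. g \<in> module_hom R E (I j) \<and> (\<forall>b\<in>B. g b = \<zero>\<^bsub>I j\<^esub>) \<and> (\<forall>a\<in>C. f a = \<delta> j (g a))"
  proof (intro exI conjI ballI)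
    show "(\<lambda>x. g x \<oplus>\<^bsub>I j\<^esub> g' x) \<in> module_hom R E (I j)"
      by (rule I.module_hom_plus[OF g(1) g'(1)])
    show "g b \<oplus>\<^bsub>I j\<^esub> g' b = \<zero>\<^bsub>I j\<^esub>" if "b \<in> B" for b
      using g(2)[OF that] g'(2)[of b] that sub by auto
    show "f a = \<delta> j (g a \<oplus>\<^bsub>I j\<^esub> g' a)" if "a \<in> C" for a
      using module_hom_add[OF \<delta>_hom cl(3)[OF c[OF that]] module_hom_closed[OF g'(1) c[OF that]]]
        g'(3)[OF that] I'.M.add_diff_cancel[OF cl(1,2)[OF c[OF that]]] by simp
  qed
qed

text \<open>Exactness of \<open>Ext(C/B) -> Ext(A/B) -> Ext(C/A)\<close>, where the last degree is
  \<open>j + 2\<close>. The connecting homomorphism sends \<open>f\<close> to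
  \<open>\<delta> f\<close>, as \<open>f\<close> is already extended from \<open>A\<close> to
  \<open>C\<close>; once \<open>\<delta> f = \<delta> g\<close> on \<open>C\<close> with
  \<open>g\<close> killing \<open>A\<close>, the difference \<open>f - g\<close> is a cocycle on
  \<open>C/B\<close>.\<close>

lemma ext_zero_sub:
  fixes A B C :: "('b::countable \<Rightarrow> 'a) set"
  assumes sub: "B \<subseteq> A" "A \<subseteq> C" "C \<subseteq> carrier E"
    and CB: "ext_zero C B j" and CA: "ext_zero C A (Suc j)"
  shows "ext_zero A B j"
proof (rule ext_zeroI)
  interpret I': module R "I (Suc j)" by (rule I_module)
  interpret I'': module R "I (Suc (Suc j))" by (rule I_module)
  fix f assume f: "cocycle A B (Suc j) f"
  note f' = cocycleD[OF f]
  have c: "c \<in> carrier E" if "c \<in> C" for c using sub that by auto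
  have "cocycle C A (Suc (Suc j)) (\<lambda>x. \<delta> (Suc j) (f x))"
    using module_hom_comp[OF f'(1) \<delta>_hom] f'(3) \<delta>\<delta>[OF module_hom_closed[OF f'(1) c]]
    by (intro cocycleI) auto
  then obtain g where g: "g \<in> module_hom R E (I (Suc j))" "\<And>b. b \<in> A \<Longrightarrow> g b = \<zero>\<^bsub>I (Suc j)\<^esub>"
    "\<And>a. a \<in> C \<Longrightarrow> \<delta> (Suc j) (f a) = \<delta> (Suc j) (g a)"
    by (rule ext_zeroE[OF CA]) auto
  note cl = module_hom_closed[OF f'(1)] module_hom_closed[OF g(1)]
  have "cocycle C B (Suc j) (\<lambda>x. f x \<ominus>\<^bsub>I (Suc j)\<^esub> g x)"
  proof (rule cocycleI)
    show "(\<lambda>x. f x \<ominus>\<^bsub>I (Suc j)\<^esub> g x) \<in> module_hom R E (I (Suc j))"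
      by (rule I'.module_hom_minus[OF f'(1) g(1)])
    show "f b \<ominus>\<^bsub>I (Suc j)\<^esub> g b = \<zero>\<^bsub>I (Suc j)\<^esub>" if "b \<in> B" for b
      using f'(2)[OF that] g(2)[of b] that sub by (auto simp: I'.M.diff_self)
    show "\<delta> (Suc j) (f a \<ominus>\<^bsub>I (Suc j)\<^esub> g a) = \<zero>\<^bsub>I (Suc (Suc j))\<^esub>" if "a \<in> C" for a
      using module_hom_diff[OF I_module I_module \<delta>_hom cl(1)[OF c[OF that]] cl(2)[OF c[OF that]]]
        g(3)[OF that] module_hom_closed[OF \<delta>_hom cl(2)[OF c[OF that]]] by (simp add: I''.M.diff_self)
  qed
  then obtain h where h: "h \<in> module_hom R E (I j)" "\<And>b. b \<in> B \<Longrightarrow> h b = \<zero>\<^bsub>I j\<^esub>"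
    "\<And>a. a \<in> C \<Longrightarrow> f a \<ominus>\<^bsub>I (Suc j)\<^esub> g a = \<delta> j (h a)"
    by (rule ext_zeroE[OF CB]) auto
  have "f a = \<delta> j (h a)" if "a \<in> A" for a
    using h(3)[of a] g(2)[OF that] that sub cl(1)[of a] c[of a] by (auto simp: I'.M.diff_zero_right)
  with h(1,2) show "\<exists>g. g \<in> module_hom R E (I j) \<and> (\<forall>b\<in>B. g b = \<zero>\<^bsub>I j\<^esub>) \<and> (\<forall>a\<in>A. f a = \<delta> j (g a))"
    by blast
qed

text \<open>Exactness of \<open>Ext(A/B) -> Ext(C/A) -> Ext(C/B)\<close>, where the first degree is
  \<open>j + 1\<close> and the others are \<open>j + 2\<close>. If \<open>f = \<delta> g\<close> on
  \<open>C\<close>, then \<open>g\<close> is a cocycle on \<open>A/B\<close>, and subtracting what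
  bounds it makes \<open>g\<close> kill \<open>A\<close>.\<close>

lemma ext_zero_quot:
  fixes A B C :: "('b::countable \<Rightarrow> 'a) set"
  assumes sub: "B \<subseteq> A" "A \<subseteq> C" "C \<subseteq> carrier E"
    and AB: "ext_zero A B j" and CB: "ext_zero C B (Suc j)"
  shows "ext_zero C A (Suc j)"
proof (rule ext_zeroI)
  interpret I': module R "I (Suc j)" by (rule I_module)
  interpret I'': module R "I (Suc (Suc j))" by (rule I_module)
  fix f assume f: "cocycle C A (Suc (Suc j)) f"
  note f' = cocycleD[OF f]
  have c: "c \<in> carrier E" if "c \<in> C" for c using sub that by auto
  have "cocycle C B (Suc (Suc j)) f" using f' sub by (intro cocycleI) auto
  then obtain g where g: "g \<in> module_hom R E (I (Suc j))" "\<And>b. b \<in> B \<Longrightarrow> g b = \<zero>\<^bsub>I (Suc j)\<^esub>"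
    "\<And>a. a \<in> C \<Longrightarrow> f a = \<delta> (Suc j) (g a)"
    by (rule ext_zeroE[OF CB]) auto
  have "cocycle A B (Suc j) g"
    using g f'(2) sub by (intro cocycleI) (auto simp: subset_iff)
  then obtain h where h: "h \<in> module_hom R E (I j)" "\<And>b. b \<in> B \<Longrightarrow> h b = \<zero>\<^bsub>I j\<^esub>"
    "\<And>a. a \<in> A \<Longrightarrow> g a = \<delta> j (h a)"
    by (rule ext_zeroE[OF AB]) auto
  have \<delta>h: "(\<lambda>x. \<delta> j (h x)) \<in> module_hom R E (I (Suc j))" by (rule module_hom_comp[OF h(1) \<delta>_hom])
  note cl = module_hom_closed[OF g(1)] module_hom_closed[OF \<delta>h] module_hom_closed[OF h(1)]
  show "\<exists>g. g \<in> module_hom R E (I (Suc j)) \<and> (\<forall>b\<in>A. g b = \<zero>\<^bsub>I (Suc j)\<^esub>) \<and> (\<forall>a\<in>C. f a = \<delta> (Suc j) (g a))"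
  proof (intro exI conjI ballI)
    show "(\<lambda>x. g x \<ominus>\<^bsub>I (Suc j)\<^esub> \<delta> j (h x)) \<in> module_hom R E (I (Suc j))"
      by (rule I'.module_hom_minus[OF g(1) \<delta>h])
    show "g a \<ominus>\<^bsub>I (Suc j)\<^esub> \<delta> j (h a) = \<zero>\<^bsub>I (Suc j)\<^esub>" if "a \<in> A" for a
      using h(3)[OF that] cl(2)[of a] c[of a] that sub by (auto simp: I'.M.diff_self)
    show "f a = \<delta> (Suc j) (g a \<ominus>\<^bsub>I (Suc j)\<^esub> \<delta> j (h a))" if "a \<in> C" for a
      using module_hom_diff[OF I_module I_module \<delta>_hom cl(1)[OF c[OF that]] cl(2)[OF c[OF that]]]
        g(3)[OF that] \<delta>\<delta>[OF cl(3)[OF c[OF that]]] module_hom_closed[OF \<delta>_hom cl(1)[OF c[OF that]]]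
      by (simp add: I''.M.diff_zero_right)
  qed
qed

section \<open>Isomorphic subquotients have the same Ext\<close>

text \<open>The isomorphism \<open>A/B -> A'/B'\<close> is required to come from a map
  \<open>\<phi>\<close> of the ambient modules; an inverse of that kind need not exist. The last two
  clauses are injectivity and surjectivity on the quotients.\<close>

definition subquot_iso ::
    "(('b::countable \<Rightarrow> 'a) \<Rightarrow> ('c::countable \<Rightarrow> 'a)) \<Rightarrow> ('b \<Rightarrow> 'a) set \<Rightarrow> ('b \<Rightarrow> 'a) set \<Rightarrow>
      ('c \<Rightarrow> 'a) set \<Rightarrow> ('c \<Rightarrow> 'a) set \<Rightarrow> bool" where
  "subquot_iso \<phi> A B A' B' \<longleftrightarrow> \<phi> \<in> module_hom R E E \<and>
     submodule A R E \<and> submodule A' R E \<and> submodule B' R E \<and> B \<subseteq> A \<and> B' \<subseteq> A' \<and> \<phi> ` A \<subseteq> A' \<and>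
     (\<forall>a\<in>A. \<phi> a \<in> B' \<longleftrightarrow> a \<in> B) \<and> (\<forall>x\<in>A'. \<exists>a\<in>A. \<exists>b\<in>B'. x = \<phi> a \<oplus>\<^bsub>E\<^esub> b)"

lemma subquot_isoI:
  assumes "\<phi> \<in> module_hom R E E" "submodule A R E" "submodule A' R E" "submodule B' R E"
    "B \<subseteq> A" "B' \<subseteq> A'" "\<And>a. a \<in> A \<Longrightarrow> \<phi> a \<in> A'" "\<And>a. a \<in> A \<Longrightarrow> \<phi> a \<in> B' \<longleftrightarrow> a \<in> B"
    "\<And>x. x \<in> A' \<Longrightarrow> \<exists>a\<in>A. \<exists>b\<in>B'. x = \<phi> a \<oplus>\<^bsub>E\<^esub> b"
  shows "subquot_iso \<phi> A B A' B'"
  using assms unfolding subquot_iso_def by auto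

lemma subquot_isoD:
  assumes "subquot_iso \<phi> A B A' B'"
  shows "\<phi> \<in> module_hom R E E" "submodule A R E" "submodule A' R E" "submodule B' R E"
    "B \<subseteq> A" "B' \<subseteq> A'" "\<And>a. a \<in> A \<Longrightarrow> \<phi> a \<in> A'" "\<And>a. a \<in> A \<Longrightarrow> \<phi> a \<in> B' \<longleftrightarrow> a \<in> B"
    "\<And>x. x \<in> A' \<Longrightarrow> \<exists>a\<in>A. \<exists>b\<in>B'. x = \<phi> a \<oplus>\<^bsub>E\<^esub> b"
  using assms unfolding subquot_iso_def by auto

text \<open>As \<open>\<phi>\<close> has no inverse on the ambient modules, \<open>g\<close> is
  carried over to \<open>A'\<close> by choosing preimages, and the outcome is then extended from
  \<open>A'\<close> to all of \<open>E\<close> by injectivity of \<open>I i\<close>.\<close>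

lemma subquot_iso_lift:
  fixes A B :: "('b::countable \<Rightarrow> 'a) set" and A' B' :: "('c::countable \<Rightarrow> 'a) set"
  assumes iso: "subquot_iso \<phi> A B A' B'"
    and g: "g \<in> module_hom R E (I i)" "\<And>b. b \<in> B \<Longrightarrow> g b = \<zero>\<^bsub>I i\<^esub>"
  obtains g' where "g' \<in> module_hom R E (I i)" "\<And>b. b \<in> B' \<Longrightarrow> g' b = \<zero>\<^bsub>I i\<^esub>"
    "\<And>a. a \<in> A \<Longrightarrow> g' (\<phi> a) = g a"
proof -
  interpret E: module R "E :: ('a, 'b \<Rightarrow> 'a) module" by (rule E_module)
  interpret E': module R "E :: ('a, 'c \<Rightarrow> 'a) module" by (rule E_module)
  interpret I: module R "I i" by (rule I_module)
  note iso' = subquot_isoD[OF iso]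
  note A = E.submodD[OF iso'(2)] and A' = E'.submodD[OF iso'(3)] and B' = E'.submodD[OF iso'(4)]
  define G where "G = (\<lambda>x. g (SOME a. a \<in> A \<and> (\<exists>b\<in>B'. x = \<phi> a \<oplus>\<^bsub>E\<^esub> b)))"
  have c: "a \<in> carrier E" if "a \<in> A" for a using A(1) that by auto
  have c': "b \<in> carrier E" if "b \<in> B'" for b using B'(1) that by auto
  have \<phi>c: "\<phi> a \<in> carrier E" if "a \<in> A" for a by (rule module_hom_closed[OF iso'(1) c[OF that]])
  \<comment> \<open>Well-definedness: for two decompositions of one element,
    \<open>\<phi> (a - s)\<close> lies in \<open>B'\<close>, so \<open>a - s\<close> lies in
    \<open>B\<close>, where \<open>g\<close> vanishes.\<close>
  have G: "G (\<phi> a \<oplus>\<^bsub>E\<^esub> b) = g a" if ab: "a \<in> A" "b \<in> B'" for a b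
  proof -
    define s where "s = (SOME s. s \<in> A \<and> (\<exists>b'\<in>B'. \<phi> a \<oplus>\<^bsub>E\<^esub> b = \<phi> s \<oplus>\<^bsub>E\<^esub> b'))"
    have "s \<in> A \<and> (\<exists>b'\<in>B'. \<phi> a \<oplus>\<^bsub>E\<^esub> b = \<phi> s \<oplus>\<^bsub>E\<^esub> b')"
      unfolding s_def by (rule someI[of _ a]) (use ab in blast)
    then obtain b' where s: "s \<in> A" "b' \<in> B'" "\<phi> a \<oplus>\<^bsub>E\<^esub> b = \<phi> s \<oplus>\<^bsub>E\<^esub> b'" by blast
    have "\<phi> (a \<ominus>\<^bsub>E\<^esub> s) = \<phi> a \<ominus>\<^bsub>E\<^esub> \<phi> s"
      by (rule module_hom_diff[OF E_module E_module iso'(1) c[OF ab(1)] c[OF s(1)]])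
    also have "\<dots> = b' \<ominus>\<^bsub>E\<^esub> b"
      by (rule E'.M.diff_eq_diffI[OF s(3) \<phi>c[OF ab(1)] c'[OF ab(2)] \<phi>c[OF s(1)] c'[OF s(2)]])
    also have "\<dots> \<in> B'" by (rule B'(4)[OF s(2) ab(2)])
    finally have "a \<ominus>\<^bsub>E\<^esub> s \<in> B" using iso'(8)[OF A(4)[OF ab(1) s(1)]] by simp
    then have "g a \<ominus>\<^bsub>I i\<^esub> g s = \<zero>\<^bsub>I i\<^esub>"
      using g(2) module_hom_diff[OF E_module I_module g(1) c[OF ab(1)] c[OF s(1)]] by simp
    then have "g a = g s"
      using I.M.diff_eq_zero_iff[OF module_hom_closed[OF g(1) c[OF ab(1)]] module_hom_closed[OF g(1) c[OF s(1)]]]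
      by simp
    then show ?thesis unfolding G_def s_def[symmetric] by simp
  qed
  have G': "G x \<in> carrier (I i)" "y \<in> A' \<Longrightarrow> G (x \<oplus>\<^bsub>E\<^esub> y) = G x \<oplus>\<^bsub>I i\<^esub> G y"
    "r \<in> carrier R \<Longrightarrow> G (r \<odot>\<^bsub>E\<^esub> x) = r \<odot>\<^bsub>I i\<^esub> G x" if x: "x \<in> A'" for x y r
  proof -
    obtain a b where ab: "a \<in> A" "b \<in> B'" "x = \<phi> a \<oplus>\<^bsub>E\<^esub> b" using iso'(9) x by blast
    show "G x \<in> carrier (I i)"
      unfolding ab(3) G[OF ab(1,2)] by (rule module_hom_closed[OF g(1) c[OF ab(1)]])
    show "G (x \<oplus>\<^bsub>E\<^esub> y) = G x \<oplus>\<^bsub>I i\<^esub> G y" if "y \<in> A'"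
    proof -
      obtain a' b' where ab': "a' \<in> A" "b' \<in> B'" "y = \<phi> a' \<oplus>\<^bsub>E\<^esub> b'" using iso'(9) \<open>y \<in> A'\<close> by blast
      have "x \<oplus>\<^bsub>E\<^esub> y = (\<phi> a \<oplus>\<^bsub>E\<^esub> \<phi> a') \<oplus>\<^bsub>E\<^esub> (b \<oplus>\<^bsub>E\<^esub> b')"
        unfolding ab(3) ab'(3) using \<phi>c[OF ab(1)] \<phi>c[OF ab'(1)] c'[OF ab(2)] c'[OF ab'(2)]
        by (simp only: E'.M.a_ac E'.M.a_closed)
      also have "\<phi> a \<oplus>\<^bsub>E\<^esub> \<phi> a' = \<phi> (a \<oplus>\<^bsub>E\<^esub> a')"
        by (rule module_hom_add[OF iso'(1) c[OF ab(1)] c[OF ab'(1)], symmetric])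
      finally have "G (x \<oplus>\<^bsub>E\<^esub> y) = g (a \<oplus>\<^bsub>E\<^esub> a')"
        using G[OF A(3)[OF ab(1) ab'(1)] B'(3)[OF ab(2) ab'(2)]] by simp
      then show ?thesis
        using module_hom_add[OF g(1) c[OF ab(1)] c[OF ab'(1)]] G[OF ab(1,2)] G[OF ab'(1,2)]
        unfolding ab(3) ab'(3) by simp
    qed
    show "G (r \<odot>\<^bsub>E\<^esub> x) = r \<odot>\<^bsub>I i\<^esub> G x" if r: "r \<in> carrier R"
    proof -
      have "r \<odot>\<^bsub>E\<^esub> x = \<phi> (r \<odot>\<^bsub>E\<^esub> a) \<oplus>\<^bsub>E\<^esub> r \<odot>\<^bsub>E\<^esub> b"
        unfolding ab(3) using E'.smult_r_distr[OF r \<phi>c[OF ab(1)] c'[OF ab(2)]]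
          module_hom_smult[OF iso'(1) r c[OF ab(1)]] by simp
      then have "G (r \<odot>\<^bsub>E\<^esub> x) = g (r \<odot>\<^bsub>E\<^esub> a)"
        using G[OF A(5)[OF r ab(1)] B'(5)[OF r ab(2)]] by simp
      then show ?thesis
        using module_hom_smult[OF g(1) r c[OF ab(1)]] G[OF ab(1,2)] unfolding ab(3) by simp
    qed
  qed
  obtain h where h: "h \<in> module_hom R E (I i)" "\<And>x. x \<in> A' \<Longrightarrow> h x = G x"
    using injective_extend[OF iso'(3), of G i, OF G'] by blast
  show ?thesis
  proof (rule that[OF h(1)])
    show "h b = \<zero>\<^bsub>I i\<^esub>" if b: "b \<in> B'" for b
    proof -
      have "\<phi> \<zero>\<^bsub>E\<^esub> \<oplus>\<^bsub>E\<^esub> b = b"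
        using module_hom_zero[OF E_module E_module iso'(1)] E'.M.l_zero[OF c'[OF b]] by simp
      then have "h b = g \<zero>\<^bsub>E\<^esub>" using G[OF A(2) b] h(2)[of b] iso'(6) b by auto
      then show ?thesis using module_hom_zero[OF E_module I_module g(1)] by simp
    qed
    show "h (\<phi> a) = g a" if a: "a \<in> A" for a
      using G[OF a B'(2)] h(2)[OF iso'(7)[OF a]] E'.M.r_zero[OF \<phi>c[OF a]] by simp
  qed
qed

text \<open>In one direction the cocycle is pulled back along \<open>\<phi>\<close> and the cochain
  that bounds it is lifted; in the other the cocycle is lifted and the bounding cochain is pulled
  back.\<close>

lemma ext_zero_iso:
  fixes A B :: "('b::countable \<Rightarrow> 'a) set" and A' B' :: "('c::countable \<Rightarrow> 'a) set"
  assumes iso: "subquot_iso \<phi> A B A' B'"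
  shows "ext_zero A B j \<longleftrightarrow> ext_zero A' B' j"
proof -
  interpret E: module R "E :: ('a, 'b \<Rightarrow> 'a) module" by (rule E_module)
  interpret E': module R "E :: ('a, 'c \<Rightarrow> 'a) module" by (rule E_module)
  note iso' = subquot_isoD[OF iso]
  note A = E.submodD[OF iso'(2)] and A' = E'.submodD[OF iso'(3)] and B' = E'.submodD[OF iso'(4)]
  have c: "a \<in> carrier E" if "a \<in> A" for a using A(1) that by auto
  have c': "b \<in> carrier E" if "b \<in> B'" for b using B'(1) that by auto
  have \<phi>c: "\<phi> a \<in> carrier E" if "a \<in> A" for a by (rule module_hom_closed[OF iso'(1) c[OF that]])
  \<comment> \<open>A homomorphism that kills \<open>B'\<close> is determined on \<open>A'\<close>
    by its values on the image of \<open>A\<close>.\<close>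
  have red: "\<exists>a\<in>A. f x = f (\<phi> a)" if f: "f \<in> module_hom R E (I i)" "\<And>b. b \<in> B' \<Longrightarrow> f b = \<zero>\<^bsub>I i\<^esub>"
      and x: "x \<in> A'" for i f x
  proof -
    interpret I: module R "I i" by (rule I_module)
    obtain a b where ab: "a \<in> A" "b \<in> B'" "x = \<phi> a \<oplus>\<^bsub>E\<^esub> b" using iso'(9) x by blast
    have "f x = f (\<phi> a)"
      unfolding ab(3) module_hom_add[OF f(1) \<phi>c[OF ab(1)] c'[OF ab(2)]] f(2)[OF ab(2)]
      using module_hom_closed[OF f(1) \<phi>c[OF ab(1)]] by simp
    with ab(1) show ?thesis by blast
  qed
  show ?thesis
  proof
    assume V: "ext_zero A B j"
    show "ext_zero A' B' j"
    proof (rule ext_zeroI)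
      fix f :: "('c \<Rightarrow> 'a) \<Rightarrow> 'i" assume f: "cocycle A' B' (Suc j) f"
      note f' = cocycleD[OF f]
      have "cocycle A B (Suc j) (\<lambda>x. f (\<phi> x))"
        using module_hom_comp[OF iso'(1) f'(1)] f'(2,3) iso'(5,7,8) by (intro cocycleI) (auto simp: subset_iff)
      then obtain g where g: "g \<in> module_hom R E (I j)" "\<And>b. b \<in> B \<Longrightarrow> g b = \<zero>\<^bsub>I j\<^esub>"
        "\<And>a. a \<in> A \<Longrightarrow> f (\<phi> a) = \<delta> j (g a)"
        by (rule ext_zeroE[OF V]) auto
      obtain g' where g': "g' \<in> module_hom R E (I j)" "\<And>b. b \<in> B' \<Longrightarrow> g' b = \<zero>\<^bsub>I j\<^esub>"
        "\<And>a. a \<in> A \<Longrightarrow> g' (\<phi> a) = g a"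
        by (rule subquot_iso_lift[OF iso g(1,2)]) auto
      interpret I': module R "I (Suc j)" by (rule I_module)
      have d: "(\<lambda>x. f x \<ominus>\<^bsub>I (Suc j)\<^esub> \<delta> j (g' x)) \<in> module_hom R E (I (Suc j))"
        by (rule I'.module_hom_minus[OF f'(1) module_hom_comp[OF g'(1) \<delta>_hom]])
      have "f x = \<delta> j (g' x)" if x: "x \<in> A'" for x
      proof -
        have xc: "x \<in> carrier E" using A'(1) x by auto
        have "f b \<ominus>\<^bsub>I (Suc j)\<^esub> \<delta> j (g' b) = \<zero>\<^bsub>I (Suc j)\<^esub>" if "b \<in> B'" for b
          using f'(2)[OF that] g'(2)[OF that] by (simp add: \<delta>_zero I'.M.diff_self)
        from red[OF d this x] obtain a where a: "a \<in> A"
          "f x \<ominus>\<^bsub>I (Suc j)\<^esub> \<delta> j (g' x) = f (\<phi> a) \<ominus>\<^bsub>I (Suc j)\<^esub> \<delta> j (g' (\<phi> a))" by auto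
        have "f (\<phi> a) \<ominus>\<^bsub>I (Suc j)\<^esub> \<delta> j (g' (\<phi> a)) = \<zero>\<^bsub>I (Suc j)\<^esub>"
          using g(3)[OF a(1)] g'(3)[OF a(1)] module_hom_closed[OF f'(1) \<phi>c[OF a(1)]]
          by (simp add: I'.M.diff_self)
        with a show ?thesis
          using I'.M.diff_eq_zero_iff[OF module_hom_closed[OF f'(1) xc]
            module_hom_closed[OF \<delta>_hom module_hom_closed[OF g'(1) xc]]] by simp
      qed
      with g'(1,2) show "\<exists>g. g \<in> module_hom R E (I j) \<and> (\<forall>b\<in>B'. g b = \<zero>\<^bsub>I j\<^esub>) \<and> (\<forall>a\<in>A'. f a = \<delta> j (g a))"
        by blast
    qed
  next
    assume V: "ext_zero A' B' j"
    show "ext_zero A B j"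
    proof (rule ext_zeroI)
      fix f :: "('b \<Rightarrow> 'a) \<Rightarrow> 'i" assume f: "cocycle A B (Suc j) f"
      note f' = cocycleD[OF f]
      obtain h where h: "h \<in> module_hom R E (I (Suc j))" "\<And>b. b \<in> B' \<Longrightarrow> h b = \<zero>\<^bsub>I (Suc j)\<^esub>"
        "\<And>a. a \<in> A \<Longrightarrow> h (\<phi> a) = f a"
        by (rule subquot_iso_lift[OF iso f'(1,2)]) auto
      have "cocycle A' B' (Suc j) h"
      proof (rule cocycleI)
        fix x assume "x \<in> A'"
        from red[OF h(1,2) this] obtain a where "a \<in> A" "h x = h (\<phi> a)" by auto
        then show "\<delta> (Suc j) (h x) = \<zero>\<^bsub>I (Suc (Suc j))\<^esub>" using h(3) f'(3) by simp
      qed (use h in auto)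
      then obtain g where g: "g \<in> module_hom R E (I j)" "\<And>b. b \<in> B' \<Longrightarrow> g b = \<zero>\<^bsub>I j\<^esub>"
        "\<And>a. a \<in> A' \<Longrightarrow> h a = \<delta> j (g a)"
        by (rule ext_zeroE[OF V]) auto
      show "\<exists>g. g \<in> module_hom R E (I j) \<and> (\<forall>b\<in>B. g b = \<zero>\<^bsub>I j\<^esub>) \<and> (\<forall>a\<in>A. f a = \<delta> j (g a))"
        using module_hom_comp[OF iso'(1) g(1)] g(2,3) h(3) iso'(5,7,8)
        by (intro exI[of _ "\<lambda>x. g (\<phi> x)"]) (auto simp: subset_iff)
    qed
  qed
qed

text \<open>Free modules are projective: the value of the cocycle on each basis vector is a cycle of
  the resolution, hence some \<open>\<delta> j (c b)\<close>, and the \<open>c b\<close> prescribe a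
  homomorphism.\<close>

lemma ext_zero_free:
  fixes J :: "'b::countable set"
  assumes J: "finite J"
  shows "ext_zero (Fr J) {\<zero>\<^bsub>E\<^esub>} j"
proof (rule ext_zeroI)
  fix f :: "('b \<Rightarrow> 'a) \<Rightarrow> 'i" assume f: "cocycle (Fr J) {\<zero>\<^bsub>E\<^esub>} (Suc j) f"
  note f' = cocycleD[OF f]
  have "\<exists>y\<in>carrier (I j). f (basis_vec R b) = \<delta> j y" if "b \<in> J" for b
    using that by (intro ker_\<delta> f'(3) module_hom_closed[OF f'(1)] basis_vec_carrier) auto
  then obtain c where c: "\<And>b. b \<in> J \<Longrightarrow> c b \<in> carrier (I j)" "\<And>b. b \<in> J \<Longrightarrow> f (basis_vec R b) = \<delta> j (c b)"
    by metis
  define g where "g = (\<lambda>u. \<Oplus>\<^bsub>I j\<^esub>b\<in>J. u b \<odot>\<^bsub>I j\<^esub> c b)"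
  have g: "g \<in> module_hom R E (I j)"
    unfolding g_def by (rule module_hom_free[OF I_module c(1)])
  have gb: "g (basis_vec R b) = c b" if "b \<in> J" for b
    unfolding g_def by (rule module_hom_free_basis[OF I_module c(1) J that])
  have "f u = \<delta> j (g u)" if u: "u \<in> Fr J" for u
    by (rule module_hom_eqI[OF I_module f'(1) module_hom_comp[OF g \<delta>_hom] J _ u])
      (simp_all add: gb c(2))
  with g show "\<exists>g. g \<in> module_hom R E (I j) \<and> (\<forall>b\<in>{\<zero>\<^bsub>E\<^esub>}. g b = \<zero>\<^bsub>I j\<^esub>) \<and> (\<forall>a\<in>Fr J. f a = \<delta> j (g a))"
    using module_hom_zero[OF E_module I_module g] by auto
qed

lemma Fr_subset_E: "Fr J \<subseteq> carrier E"
  by (rule free_module_mono) simp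

lemma Fr_submodule: "submodule (Fr J) R E"
  by (rule submod_free) simp

text \<open>The first isomorphism theorem.\<close>

lemma subquot_iso_image:
  fixes \<phi> :: "('b::countable \<Rightarrow> 'a) \<Rightarrow> ('c::countable \<Rightarrow> 'a)"
  assumes \<phi>: "\<phi> \<in> module_hom R E E" and A: "submodule A R E"
  shows "subquot_iso \<phi> A {u \<in> A. \<phi> u = \<zero>\<^bsub>E\<^esub>} (\<phi> ` A) {\<zero>\<^bsub>E\<^esub>}"
proof -
  interpret E: module R "E :: ('a, 'b \<Rightarrow> 'a) module" by (rule E_module)
  interpret E': module R "E :: ('a, 'c \<Rightarrow> 'a) module" by (rule E_module)
  have sub: "submodule (\<phi> ` A) R E" by (rule submod_image[OF E_module E_module \<phi> A])
  show ?thesis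
  proof (rule subquot_isoI[OF \<phi> A sub E'.submod_zero])
    show "{\<zero>\<^bsub>E\<^esub>} \<subseteq> \<phi> ` A" using E'.submodD(2)[OF sub] by (simp del: free_module_simps)
    fix x assume "x \<in> \<phi> ` A"
    then obtain a where a: "a \<in> A" "x = \<phi> a" by auto
    have "\<phi> a \<in> carrier E" using E'.submodD(1)[OF sub] a by auto
    then have "x = \<phi> a \<oplus>\<^bsub>E\<^esub> \<zero>\<^bsub>E\<^esub>" using a(2) E'.M.r_zero by simp
    then show "\<exists>a\<in>A. \<exists>b\<in>{\<zero>\<^bsub>E\<^esub>}. x = \<phi> a \<oplus>\<^bsub>E\<^esub> b" using a(1) by blast
  qed (auto simp del: free_module_simps)
qed

lemma ker_submodule:
  fixes \<phi> :: "('b::countable \<Rightarrow> 'a) \<Rightarrow> ('c::countable \<Rightarrow> 'a)"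
  assumes \<phi>: "\<phi> \<in> module_hom R E E" and A: "submodule A R E"
  shows "submodule {u \<in> A. \<phi> u = \<zero>\<^bsub>E\<^esub>} R E"
proof -
  interpret E': module R "E :: ('a, 'c \<Rightarrow> 'a) module" by (rule E_module)
  show ?thesis
    using submod_preimage[OF E_module E_module \<phi> A E'.submod_zero] by (simp del: free_module_simps)
qed

end

section \<open>Noetherian local rings\<close>

text \<open>Zorn's lemma applies because a nonempty chain of ideals contains its union in a
  Noetherian ring.\<close>

lemma (in noetherian_ring) exists_maximal_ideal_in:
  assumes "C \<noteq> {}" "\<And>J. J \<in> C \<Longrightarrow> ideal J R"
  shows "\<exists>J\<in>C. \<forall>K\<in>C. J \<subseteq> K \<longrightarrow> K = J"
proof (rule subset_Zorn_nonempty[OF assms(1)])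
  fix D assume D: "D \<noteq> {}" "subset.chain C D"
  then have "subset.chain {I. ideal I R} D"
    using assms(2) by (auto simp: subset_chain_def)
  then show "\<Union>D \<in> C"
    using ideal_chain_is_trivial[OF D(1)] D(2) by (auto simp: subset_chain_def)
qed

lemma (in cring) ideal_iff_submodule: "ideal J R \<longleftrightarrow> submodule J R (ring_module R)"
proof
  interpret P: module R "ring_module R" by (rule ring_module_is_module)
  assume J: "ideal J R"
  then interpret J: ideal J R .
  show "submodule J R (ring_module R)"
    using J.a_subset by (intro P.submodI) (auto simp: J.I_l_closed)
next
  interpret P: module R "ring_module R" by (rule ring_module_is_module)
  assume J: "submodule J R (ring_module R)"
  note J' = P.submodD[OF J]
  have c: "x \<in> carrier R" if "x \<in> J" for x using J'(1) that by auto
  show "ideal J R"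
  proof (rule idealI[OF local.ring_axioms])
    show "subgroup J (add_monoid R)"
    proof (rule add.subgroupI)
      show "\<ominus> a \<in> J" if "a \<in> J" for a
        using J'(5)[OF _ that, of "\<ominus> \<one>"] c[OF that] by (simp add: l_minus)
    qed (use J' in auto)
    show "x \<otimes> a \<in> J" if "a \<in> J" "x \<in> carrier R" for a x
      using J'(5)[OF that(2,1)] by simp
    then show "a \<otimes> x \<in> J" if "a \<in> J" "x \<in> carrier R" for a x
      using that c m_comm by simp
  qed
qed

lemma (in cring) coord_hom: "(\<lambda>u. u b) \<in> module_hom R (free_module R B) (ring_module R)"
  by (rule module_homI) (simp_all add: free_module_closed)

text \<open>The map \<open>\<epsilon>\<close> reads only the first \<open>card S\<close> coordinates
  and sends the corresponding basis vectors to the generators, so it is defined on the whole ambient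
  module.\<close>

lemma (in cring) fin_gen_presentation:
  assumes P: "module R P" and S: "finite S" "S \<subseteq> carrier P"
  obtains n \<epsilon> where "\<epsilon> \<in> module_hom R (free_module R (UNIV :: nat set)) P"
    "\<epsilon> ` Fr {..<n::nat} = span_module R P S"
proof -
  interpret P: module R P by fact
  interpret F: module R "free_module R (UNIV :: nat set)" by (rule free_module_is_module)
  obtain s where s: "bij_betw s {..<card S} S"
    using ex_bij_betw_nat_finite[OF S(1)] by (auto simp: atLeast0LessThan)
  have sS: "s j \<in> S" if "j \<in> {..<card S}" for j using s that by (auto dest: bij_betwE)
  define \<epsilon> where "\<epsilon> = (\<lambda>u. \<Oplus>\<^bsub>P\<^esub>j\<in>{..<card S}. u j \<odot>\<^bsub>P\<^esub> s j)"
  have \<epsilon>: "\<epsilon> \<in> module_hom R (free_module R (UNIV :: nat set)) P"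
    unfolding \<epsilon>_def using sS S(2) by (intro module_hom_free[OF P]) auto
  note span = P.submod_span[OF S(2)]
  have "\<epsilon> ` Fr {..<card S} = span_module R P S"
  proof
    show "\<epsilon> ` Fr {..<card S} \<subseteq> span_module R P S"
    proof (rule image_subsetI)
      fix u assume u: "u \<in> Fr {..<card S}"
      show "\<epsilon> u \<in> span_module R P S"
        unfolding \<epsilon>_def using span(2) sS
        by (intro P.submod_finsum[OF span(1)] P.submodD(5)[OF span(1)] free_module_closed[OF u]) auto
    qed
    have sub: "submodule (\<epsilon> ` Fr {..<card S}) R P"
      by (rule submod_image[OF F.module_axioms P \<epsilon> submod_free]) simp
    show "span_module R P S \<subseteq> \<epsilon> ` Fr {..<card S}"
    proof (rule span(3)[OF sub subsetI])
      fix x assume "x \<in> S"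
      then obtain j where j: "j \<in> {..<card S}" "x = s j" using s by (auto simp: bij_betw_def)
      have "x = \<epsilon> (basis_vec R j)"
        unfolding \<epsilon>_def j(2) using sS S(2) j(1)
        by (intro module_hom_free_basis[OF P, symmetric]) auto
      then show "x \<in> \<epsilon> ` Fr {..<card S}"
        using basis_vec_carrier[OF j(1)] by blast
    qed
  qed
  with \<epsilon> that show ?thesis by blast
qed

locale noetherian_cring = cring + noetherian_ring
begin

text \<open>Induction on the rank. The last coordinates of the elements of \<open>K\<close> form an
  ideal; lifts \<open>v a\<close> of its finitely many generators, together with generators of the
  part of \<open>K\<close> with last coordinate zero, generate \<open>K\<close>.\<close>

lemma submodule_fin_gen:
  assumes "submodule K R (free_module R (UNIV :: nat set))" "K \<subseteq> Fr {..<n::nat}"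
  shows "\<exists>S. finite S \<and> S \<subseteq> carrier E \<and> span_module R E S = K"
  using assms
proof (induct n arbitrary: K)
  interpret F: module R "free_module R (UNIV :: nat set)" by (rule free_module_is_module)
  case 0
  note K = F.submodD[OF 0(1)]
  have "K \<subseteq> {\<zero>\<^bsub>E\<^esub>}"
    using 0(2) by (auto simp: free_module_carrier_finite fun_eq_iff)
  then have "K = {\<zero>\<^bsub>E\<^esub>}" using K(2) by blast
  moreover have "span_module R (free_module R (UNIV :: nat set)) {} = {\<zero>\<^bsub>E\<^esub>}"
    using F.submod_span(3)[OF _ F.submod_zero, of "{}"] F.submodD(2)[OF F.submod_span(1), of "{}"] by blast
  ultimately show ?case by (intro exI[of _ "{}"]) auto
next
  interpret F: module R "free_module R (UNIV :: nat set)" by (rule free_module_is_module)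
  let ?F = "free_module R (UNIV :: nat set)"
  case (Suc n)
  note K = F.submodD[OF Suc(2)]
  have Kc: "u \<in> carrier ?F" if "u \<in> K" for u using K(1) that by auto
  note top = submod_image[OF free_module_is_module ring_module_is_module coord_hom]
  have idK: "ideal ((\<lambda>u. u n) ` K) R"
    unfolding ideal_iff_submodule by (rule top[OF Suc(2)])
  obtain A where A: "finite A" "A \<subseteq> carrier R" "(\<lambda>u. u n) ` K = Idl A"
    using finetely_gen[OF idK] by auto
  have AJ: "A \<subseteq> (\<lambda>u. u n) ` K" unfolding A(3) by (rule genideal_self[OF A(2)])
  have "\<forall>a\<in>A. \<exists>u\<in>K. u n = a"
  proof
    fix a assume "a \<in> A"
    then have "a \<in> (\<lambda>u. u n) ` K" using AJ by (rule rev_subsetD)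
    then show "\<exists>u\<in>K. u n = a" by (elim imageE) auto
  qed
  then obtain v where v: "\<And>a. a \<in> A \<Longrightarrow> v a \<in> K" "\<And>a. a \<in> A \<Longrightarrow> v a n = a" by metis
  let ?K = "{u \<in> K. u n \<in> {\<zero>}}"
  have sK: "submodule ?K R ?F"
    by (rule submod_preimage[OF free_module_is_module ring_module_is_module coord_hom Suc(2)])
       (simp add: ideal_iff_submodule[symmetric] zeroideal)
  have "?K \<subseteq> Fr {..<n}"
  proof
    fix u assume u: "u \<in> ?K"
    then have "u \<in> Fr {..<Suc n}" "u n = \<zero>" using Suc(3) by auto
    then show "u \<in> Fr {..<n}"
      by (simp add: free_module_carrier_finite less_Suc_eq) metis
  qed
  from Suc(1)[OF sK this] obtain S where S: "finite S" "S \<subseteq> carrier ?F" "span_module R ?F S = ?K"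
    by blast
  define T where "T = S \<union> v ` A"
  have SK: "S \<subseteq> ?K" using F.submod_span(2)[OF S(2)] S(3) by simp
  have TK: "T \<subseteq> K" unfolding T_def using SK v(1) by auto
  then have Tc: "T \<subseteq> carrier ?F" using K(1) by auto
  note span = F.submod_span[OF Tc]
  note H = F.submodD[OF span(1)]
  have "span_module R ?F T = K"
  proof
    show HK: "span_module R ?F T \<subseteq> K" by (rule span(3)[OF Suc(2) TK])
    have "ideal ((\<lambda>u. u n) ` span_module R ?F T) R"
      unfolding ideal_iff_submodule by (rule top[OF span(1)])
    moreover have "A \<subseteq> (\<lambda>u. u n) ` span_module R ?F T"
    proof
      fix a assume a: "a \<in> A"
      then have "v a \<in> span_module R ?F T" using span(2) unfolding T_def by auto
      then show "a \<in> (\<lambda>u. u n) ` span_module R ?F T" by (rule image_eqI[rotated]) (simp add: v(2)[OF a])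
    qed
    \<comment> \<open>Every last coordinate of an element of \<open>K\<close> already occurs in the
      span, so subtracting a suitable element of the span leads into \<open>?K\<close>.\<close>
    ultimately have J: "(\<lambda>u. u n) ` K \<subseteq> (\<lambda>u. u n) ` span_module R ?F T"
      unfolding A(3) by (rule genideal_minimal)
    have "span_module R ?F S \<subseteq> span_module R ?F T"
      using F.submod_span(3)[OF S(2) span(1)] span(2) unfolding T_def by auto
    then have KH: "?K \<subseteq> span_module R ?F T" unfolding S(3) .
    show "K \<subseteq> span_module R ?F T"
    proof
      fix u assume u: "u \<in> K"
      then have "u n \<in> (\<lambda>u. u n) ` span_module R ?F T" using J by (blast intro: imageI)
      then obtain h where h: "h \<in> span_module R ?F T" "u n = h n" by (elim imageE)
      have hK: "h \<in> K" using HK h by auto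
      have "u \<ominus>\<^bsub>?F\<^esub> h \<in> ?K"
        using K(4)[OF u hK] h(2) free_module_diff[OF Kc[OF u] Kc[OF hK]] free_module_closed[OF Kc[OF hK]]
        by (simp add: diff_self)
      then have "h \<oplus>\<^bsub>?F\<^esub> (u \<ominus>\<^bsub>?F\<^esub> h) \<in> span_module R ?F T"
        using H(3)[OF h(1)] KH by blast
      then show "u \<in> span_module R ?F T"
        using F.M.add_diff_cancel[OF Kc[OF u] Kc[OF hK]] by (simp del: free_module_simps)
    qed
  qed
  moreover have "finite T" unfolding T_def using S(1) A(1) by simp
  ultimately show ?case using Tc by blast
qed

lemma submodule_presentation:
  assumes "submodule K R (free_module R (UNIV :: nat set))" "K \<subseteq> Fr {..<n::nat}"
  obtains n' \<phi> where "\<phi> \<in> module_hom R (free_module R (UNIV :: nat set)) (free_module R (UNIV :: nat set))"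
    "\<phi> ` Fr {..<n'::nat} = K"
proof -
  obtain S where S: "finite S" "S \<subseteq> carrier E"
      "span_module R E S = K"
    using submodule_fin_gen[OF assms] by blast
  obtain n' \<phi> where "\<phi> \<in> module_hom R (free_module R (UNIV :: nat set)) (free_module R (UNIV :: nat set))"
    "\<phi> ` Fr {..<n'::nat} = span_module R E S"
    by (rule fin_gen_presentation[OF free_module_is_module S(1,2)])
  with S(3) that show ?thesis by blast
qed

end

locale local_noetherian = noetherian_cring R for R :: "('a, 'r) ring_scheme" (structure) +
  fixes m :: "'a set"
  assumes m_max: "maximalideal m R" and m_unique: "\<And>m'. maximalideal m' R \<Longrightarrow> m' = m"
begin

lemma m_ideal: "ideal m R" using m_max by (simp add: maximalideal_def)

lemma one_notin_m: "\<one> \<notin> m"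
  using ideal.one_imp_carrier[OF m_ideal] maximalideal.I_notcarr[OF m_max] by auto

text \<open>An ideal that is maximal among those above \<open>J\<close> without
  \<open>\<one>\<close> is a maximal ideal, hence equal to \<open>m\<close>.\<close>

lemma proper_ideal_le_m:
  assumes J: "ideal J R" "\<one> \<notin> J"
  shows "J \<subseteq> m"
proof -
  let ?C = "{K. ideal K R \<and> J \<subseteq> K \<and> \<one> \<notin> K}"
  have ne: "?C \<noteq> {}" using J by auto
  have id: "ideal L R" if "L \<in> ?C" for L using that by simp
  obtain K where K1: "K \<in> ?C" and K2: "\<forall>L\<in>?C. K \<subseteq> L \<longrightarrow> L = K"
    using exists_maximal_ideal_in[OF ne id] by (rule bexE)
  note K = K1 K2[rule_format]
  have "maximalideal K R"
  proof (rule maximalidealI)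
    show "carrier R \<noteq> K" using K(1) by auto
    show "L = K \<or> L = carrier R" if L: "ideal L R" "K \<subseteq> L" "L \<subseteq> carrier R" for L
    proof (cases "\<one> \<in> L")
      case True then show ?thesis using ideal.one_imp_carrier[OF L(1)] by simp
    next
      case False
      then have "L \<in> ?C" using L K(1) by auto
      then show ?thesis using K(2) L by blast
    qed
  qed (use K in auto)
  then show ?thesis using m_unique K(1) by blast
qed

lemma unit_if_notin_m:
  assumes x: "x \<in> carrier R" "x \<notin> m"
  obtains y where "y \<in> carrier R" "y \<otimes> x = \<one>"
proof -
  have "\<one> \<in> PIdl x"
    using proper_ideal_le_m[OF cgenideal_ideal[OF x(1)]] cgenideal_self[OF x(1)] x(2) by blast
  then show ?thesis using that unfolding cgenideal_def by force
qed

end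

section \<open>Nakayama's lemma for Ext\<close>

locale local_gorenstein = finite_inj_res R I \<delta> \<eta> k + local_noetherian R m
  for R :: "('a, 'r) ring_scheme" (structure) and I :: "nat \<Rightarrow> ('a, 'i) module" and \<delta> \<eta> k m
begin

lemma coboundary_cong:
  assumes "coboundary A B i f" "\<And>a. a \<in> A \<Longrightarrow> g a = f a"
  shows "coboundary A B i g"
  using assms unfolding coboundary_def by (cases i) auto

lemma coboundary_zero:
  fixes A :: "('b::countable \<Rightarrow> 'a) set"
  shows "coboundary A B i (\<lambda>_. \<zero>\<^bsub>I i\<^esub>)"
proof (cases i)
  case (Suc j)
  interpret I: module R "I j" by (rule I_module)
  show ?thesis unfolding coboundary_def Suc
    using I.module_hom_zero_map by (auto intro!: bexI[of _ "\<lambda>_. \<zero>\<^bsub>I j\<^esub>"] simp: \<delta>_zero)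
qed (simp add: coboundary_def)

lemma coboundary_add:
  fixes A :: "('b::countable \<Rightarrow> 'a) set"
  assumes A: "A \<subseteq> carrier E" and f: "coboundary A B i f" and g: "coboundary A B i g"
  shows "coboundary A B i (\<lambda>x. f x \<oplus>\<^bsub>I i\<^esub> g x)"
proof (cases i)
  case 0
  interpret I: module R "I 0" by (rule I_module)
  show ?thesis using f g unfolding coboundary_def 0 by simp
next
  case (Suc j)
  interpret I: module R "I j" by (rule I_module)
  obtain f' where f': "f' \<in> module_hom R E (I j)" "\<And>b. b \<in> B \<Longrightarrow> f' b = \<zero>\<^bsub>I j\<^esub>" "\<And>a. a \<in> A \<Longrightarrow> f a = \<delta> j (f' a)"
    using f unfolding coboundary_def Suc by auto
  obtain g' where g': "g' \<in> module_hom R E (I j)" "\<And>b. b \<in> B \<Longrightarrow> g' b = \<zero>\<^bsub>I j\<^esub>" "\<And>a. a \<in> A \<Longrightarrow> g a = \<delta> j (g' a)"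
    using g unfolding coboundary_def Suc by auto
  have c: "a \<in> carrier E" if "a \<in> A" for a using A that by auto
  have "f a \<oplus>\<^bsub>I (Suc j)\<^esub> g a = \<delta> j (f' a \<oplus>\<^bsub>I j\<^esub> g' a)" if "a \<in> A" for a
    using module_hom_add[OF \<delta>_hom module_hom_closed[OF f'(1) c[OF that]] module_hom_closed[OF g'(1) c[OF that]]]
      f'(3)[OF that] g'(3)[OF that] by simp
  then show ?thesis unfolding coboundary_def Suc
    using I.module_hom_plus[OF f'(1) g'(1)] f'(2) g'(2)
    by (auto intro!: bexI[of _ "\<lambda>x. f' x \<oplus>\<^bsub>I j\<^esub> g' x"])
qed

lemma coboundary_smult:
  fixes A :: "('b::countable \<Rightarrow> 'a) set"
  assumes A: "A \<subseteq> carrier E" and f: "coboundary A B i f" and r: "r \<in> carrier R"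
  shows "coboundary A B i (\<lambda>x. r \<odot>\<^bsub>I i\<^esub> f x)"
proof (cases i)
  case 0
  interpret I: module R "I 0" by (rule I_module)
  show ?thesis using f r unfolding coboundary_def 0 by simp
next
  case (Suc j)
  interpret I: module R "I j" by (rule I_module)
  obtain f' where f': "f' \<in> module_hom R E (I j)" "\<And>b. b \<in> B \<Longrightarrow> f' b = \<zero>\<^bsub>I j\<^esub>" "\<And>a. a \<in> A \<Longrightarrow> f a = \<delta> j (f' a)"
    using f unfolding coboundary_def Suc by auto
  have c: "a \<in> carrier E" if "a \<in> A" for a using A that by auto
  have "r \<odot>\<^bsub>I (Suc j)\<^esub> f a = \<delta> j (r \<odot>\<^bsub>I j\<^esub> f' a)" if "a \<in> A" for a
    using module_hom_smult[OF \<delta>_hom r module_hom_closed[OF f'(1) c[OF that]]] f'(3)[OF that] by simp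
  then show ?thesis unfolding coboundary_def Suc
    using I.module_hom_smult_map[OF f'(1) r] f'(2) r
    by (auto intro!: bexI[of _ "\<lambda>x. r \<odot>\<^bsub>I j\<^esub> f' x"])
qed

lemma cocycle_zero:
  fixes A :: "('b::countable \<Rightarrow> 'a) set"
  shows "cocycle A B i (\<lambda>_. \<zero>\<^bsub>I i\<^esub>)"
proof -
  interpret I: module R "I i" by (rule I_module)
  show ?thesis by (rule cocycleI) (simp_all add: I.module_hom_zero_map \<delta>_zero)
qed

lemma cocycle_add:
  fixes A :: "('b::countable \<Rightarrow> 'a) set"
  assumes A: "A \<subseteq> carrier E" and f: "cocycle A B i f" and g: "cocycle A B i g"
  shows "cocycle A B i (\<lambda>x. f x \<oplus>\<^bsub>I i\<^esub> g x)"
proof -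
  interpret I: module R "I i" by (rule I_module)
  interpret I': module R "I (Suc i)" by (rule I_module)
  note f' = cocycleD[OF f] and g' = cocycleD[OF g]
  have c: "a \<in> carrier E" if "a \<in> A" for a using A that by auto
  show ?thesis
  proof (rule cocycleI)
    show "\<delta> i (f a \<oplus>\<^bsub>I i\<^esub> g a) = \<zero>\<^bsub>I (Suc i)\<^esub>" if "a \<in> A" for a
      using module_hom_add[OF \<delta>_hom module_hom_closed[OF f'(1) c[OF that]] module_hom_closed[OF g'(1) c[OF that]]]
        f'(3)[OF that] g'(3)[OF that] by simp
  qed (use I.module_hom_plus[OF f'(1) g'(1)] f'(2) g'(2) in auto)
qed

lemma cocycle_smult:
  fixes A :: "('b::countable \<Rightarrow> 'a) set"
  assumes A: "A \<subseteq> carrier E" and f: "cocycle A B i f" and r: "r \<in> carrier R"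
  shows "cocycle A B i (\<lambda>x. r \<odot>\<^bsub>I i\<^esub> f x)"
proof -
  interpret I: module R "I i" by (rule I_module)
  interpret I': module R "I (Suc i)" by (rule I_module)
  note f' = cocycleD[OF f]
  have c: "a \<in> carrier E" if "a \<in> A" for a using A that by auto
  show ?thesis
  proof (rule cocycleI)
    show "\<delta> i (r \<odot>\<^bsub>I i\<^esub> f a) = \<zero>\<^bsub>I (Suc i)\<^esub>" if "a \<in> A" for a
      using module_hom_smult[OF \<delta>_hom r module_hom_closed[OF f'(1) c[OF that]]] f'(3)[OF that] r by simp
  qed (use I.module_hom_smult_map[OF f'(1) r] f'(2) r in auto)
qed

lemma cocycle_diff:
  fixes A :: "('b::countable \<Rightarrow> 'a) set"
  assumes A: "A \<subseteq> carrier E" and f: "cocycle A B i f" and g: "cocycle A B i g"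
  shows "cocycle A B i (\<lambda>x. f x \<ominus>\<^bsub>I i\<^esub> g x)"
proof -
  interpret I: module R "I i" by (rule I_module)
  interpret I': module R "I (Suc i)" by (rule I_module)
  note f' = cocycleD[OF f] and g' = cocycleD[OF g]
  have c: "a \<in> carrier E" if "a \<in> A" for a using A that by auto
  show ?thesis
  proof (rule cocycleI)
    show "\<delta> i (f a \<ominus>\<^bsub>I i\<^esub> g a) = \<zero>\<^bsub>I (Suc i)\<^esub>" if "a \<in> A" for a
      using module_hom_diff[OF I_module I_module \<delta>_hom module_hom_closed[OF f'(1) c[OF that]]
          module_hom_closed[OF g'(1) c[OF that]]]
        f'(3)[OF that] g'(3)[OF that] by (simp add: I'.M.diff_self)
  qed (use I.module_hom_minus[OF f'(1) g'(1)] f'(2) g'(2) in \<open>auto simp: I.M.diff_self\<close>)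
qed

text \<open>
  The sets of cocycles that correspond to submodules of \<open>Ext\<close>; working with them avoids forming
  the quotient module. Accordingly \<open>ext_fin_gen A B i\<close> says that \<open>Ext\<close> of \<open>A/B\<close> and \<open>R\<close> is
  finitely generated in degree \<open>i\<close>.
\<close>

definition cocycle_submod ::
    "('b::countable \<Rightarrow> 'a) set \<Rightarrow> ('b \<Rightarrow> 'a) set \<Rightarrow> nat \<Rightarrow> (('b \<Rightarrow> 'a) \<Rightarrow> 'i) set \<Rightarrow> bool" where
  "cocycle_submod A B i H \<longleftrightarrow> H \<subseteq> Collect (cocycle A B i) \<and> (\<lambda>_. \<zero>\<^bsub>I i\<^esub>) \<in> H \<and>
     (\<forall>f\<in>H. \<forall>g\<in>H. (\<lambda>x. f x \<oplus>\<^bsub>I i\<^esub> g x) \<in> H) \<and>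
     (\<forall>r\<in>carrier R. \<forall>f\<in>H. (\<lambda>x. r \<odot>\<^bsub>I i\<^esub> f x) \<in> H) \<and>
     (\<forall>f\<in>H. \<forall>g. cocycle A B i g \<longrightarrow> coboundary A B i (\<lambda>x. f x \<ominus>\<^bsub>I i\<^esub> g x) \<longrightarrow> g \<in> H)"

lemma cocycle_submodI:
  assumes "\<And>f. f \<in> H \<Longrightarrow> cocycle A B i f" "(\<lambda>_. \<zero>\<^bsub>I i\<^esub>) \<in> H"
    "\<And>f g. f \<in> H \<Longrightarrow> g \<in> H \<Longrightarrow> (\<lambda>x. f x \<oplus>\<^bsub>I i\<^esub> g x) \<in> H"
    "\<And>r f. r \<in> carrier R \<Longrightarrow> f \<in> H \<Longrightarrow> (\<lambda>x. r \<odot>\<^bsub>I i\<^esub> f x) \<in> H"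
    "\<And>f g. f \<in> H \<Longrightarrow> cocycle A B i g \<Longrightarrow> coboundary A B i (\<lambda>x. f x \<ominus>\<^bsub>I i\<^esub> g x) \<Longrightarrow> g \<in> H"
  shows "cocycle_submod A B i H"
  using assms unfolding cocycle_submod_def by blast

lemma cocycle_submodD:
  assumes "cocycle_submod A B i H"
  shows "\<And>f. f \<in> H \<Longrightarrow> cocycle A B i f" "(\<lambda>_. \<zero>\<^bsub>I i\<^esub>) \<in> H"
    "\<And>f g. f \<in> H \<Longrightarrow> g \<in> H \<Longrightarrow> (\<lambda>x. f x \<oplus>\<^bsub>I i\<^esub> g x) \<in> H"
    "\<And>r f. r \<in> carrier R \<Longrightarrow> f \<in> H \<Longrightarrow> (\<lambda>x. r \<odot>\<^bsub>I i\<^esub> f x) \<in> H"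
    "\<And>f g. f \<in> H \<Longrightarrow> cocycle A B i g \<Longrightarrow> coboundary A B i (\<lambda>x. f x \<ominus>\<^bsub>I i\<^esub> g x) \<Longrightarrow> g \<in> H"
  using assms unfolding cocycle_submod_def by blast+

text \<open>Cocycles with the same values on \<open>A\<close> differ by the zero coboundary. This is
  applied whenever an identity of cocycles can be checked on \<open>A\<close> but fails as an
  identity of functions.\<close>

lemma cocycle_submod_cong:
  fixes A :: "('b::countable \<Rightarrow> 'a) set"
  assumes H: "cocycle_submod A B i H" and A: "A \<subseteq> carrier E" and f: "f \<in> H"
    and g: "cocycle A B i g" and e: "\<And>a. a \<in> A \<Longrightarrow> f a = g a"
  shows "g \<in> H"
proof (rule cocycle_submodD(5)[OF H f g], rule coboundary_cong[OF coboundary_zero])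
  interpret I: module R "I i" by (rule I_module)
  show "f a \<ominus>\<^bsub>I i\<^esub> g a = \<zero>\<^bsub>I i\<^esub>" if "a \<in> A" for a
    using e[OF that] module_hom_closed[OF cocycleD(1)[OF g], of a] A that
    by (auto simp: I.M.diff_self)
qed

definition ext_fin_gen :: "('b::countable \<Rightarrow> 'a) set \<Rightarrow> ('b \<Rightarrow> 'a) set \<Rightarrow> nat \<Rightarrow> bool" where
  "ext_fin_gen A B i \<longleftrightarrow> (\<exists>S. finite S \<and> S \<subseteq> Collect (cocycle A B i) \<and>
     (\<forall>H. cocycle_submod A B i H \<longrightarrow> S \<subseteq> H \<longrightarrow> Collect (cocycle A B i) \<subseteq> H))"

text \<open>This is the zero submodule of \<open>Ext\<close>.\<close>

lemma coboundary_submod: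
  fixes A :: "('b::countable \<Rightarrow> 'a) set"
  assumes A: "A \<subseteq> carrier E"
  shows "cocycle_submod A B i {f. cocycle A B i f \<and> coboundary A B i f}"
proof (rule cocycle_submodI)
  interpret I: module R "I i" by (rule I_module)
  fix f g assume f: "f \<in> {f. cocycle A B i f \<and> coboundary A B i f}" and g: "cocycle A B i g"
    and fg: "coboundary A B i (\<lambda>x. f x \<ominus>\<^bsub>I i\<^esub> g x)"
  \<comment> \<open>On \<open>A\<close> this function is \<open>g\<close>, written as
    \<open>f - (f - g)\<close>.\<close>
  have "coboundary A B i (\<lambda>x. f x \<oplus>\<^bsub>I i\<^esub> (\<ominus> \<one>) \<odot>\<^bsub>I i\<^esub> (f x \<ominus>\<^bsub>I i\<^esub> g x))"
    using f by (intro coboundary_add[OF A] coboundary_smult[OF A] fg) auto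
  then have "coboundary A B i g"
  proof (rule coboundary_cong)
    fix a assume "a \<in> A"
    then have a: "a \<in> carrier E" using A by auto
    have c: "f a \<in> carrier (I i)" "g a \<in> carrier (I i)"
      using module_hom_closed[OF cocycleD(1) a] f g by auto
    have "f a \<oplus>\<^bsub>I i\<^esub> (\<ominus> \<one>) \<odot>\<^bsub>I i\<^esub> (f a \<ominus>\<^bsub>I i\<^esub> g a) = f a \<ominus>\<^bsub>I i\<^esub> (f a \<ominus>\<^bsub>I i\<^esub> g a)"
      using c by (simp add: I.neg_eq_smult[symmetric] a_minus_def)
    also have "\<dots> = g a"
      using c I.M.add_diff_cancel[of "f a" "g a"] by (intro I.M.diff_eqI) (simp_all add: I.M.a_comm)
    finally show "g a = f a \<oplus>\<^bsub>I i\<^esub> (\<ominus> \<one>) \<odot>\<^bsub>I i\<^esub> (f a \<ominus>\<^bsub>I i\<^esub> g a)" ..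
  qed
  with g show "g \<in> {f. cocycle A B i f \<and> coboundary A B i f}" by simp
qed (auto simp: cocycle_zero coboundary_zero
    intro: cocycle_add[OF A] coboundary_add[OF A] cocycle_smult[OF A] coboundary_smult[OF A])

text \<open>Nakayama's lemma: multiplication by \<open>x\<close> is onto \<open>Ext\<close>, and
  generators are discarded one at a time. If \<open>s\<close> and \<open>S\<close> generate, then
  \<open>S\<close> alone does, so in the end the zero submodule is everything.\<close>

lemma ext_nakayama:
  fixes A :: "('b::countable \<Rightarrow> 'a) set"
  assumes A: "A \<subseteq> carrier E" and x: "x \<in> m" and fg: "ext_fin_gen A B i"
    and div: "\<And>f. cocycle A B i f \<Longrightarrow> \<exists>g. cocycle A B i g \<and> coboundary A B i (\<lambda>y. f y \<ominus>\<^bsub>I i\<^esub> x \<odot>\<^bsub>I i\<^esub> g y)"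
    and f: "cocycle A B i f"
  shows "coboundary A B i f"
proof -
  interpret I: module R "I i" by (rule I_module)
  have xR: "x \<in> carrier R" using x ideal.Icarr[OF m_ideal] by simp
  have cl: "f a \<in> carrier (I i)" if "cocycle A B i f" "a \<in> A" for f a
    using module_hom_closed[OF cocycleD(1)[OF that(1)], of a] that(2) A by auto
  have smult_diff: "(r \<ominus> s) \<odot>\<^bsub>I i\<^esub> p = r \<odot>\<^bsub>I i\<^esub> p \<ominus>\<^bsub>I i\<^esub> s \<odot>\<^bsub>I i\<^esub> p"
    if "r \<in> carrier R" "s \<in> carrier R" "p \<in> carrier (I i)" for r s p
    using that by (simp add: a_minus_def I.smult_l_distr I.smult_l_minus)
  have "Collect (cocycle A B i) \<subseteq> {f. cocycle A B i f \<and> coboundary A B i f}"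
    if "finite S" "S \<subseteq> Collect (cocycle A B i)"
      "\<forall>H. cocycle_submod A B i H \<longrightarrow> S \<subseteq> H \<longrightarrow> Collect (cocycle A B i) \<subseteq> H" for S
    using that
  proof (induct S)
    case empty
    \<comment> \<open>With no generators left, every submodule contains all cocycles, in particular
      the zero submodule.\<close>
    then show ?case using coboundary_submod[OF A] by blast
  next
    case (insert s S)
    have s: "cocycle A B i s" using insert(4) by simp
    show ?case
    proof (rule insert(3))
      show "S \<subseteq> Collect (cocycle A B i)" using insert(4) by simp
      show "\<forall>H. cocycle_submod A B i H \<longrightarrow> S \<subseteq> H \<longrightarrow> Collect (cocycle A B i) \<subseteq> H"
      proof (intro allI impI)
        fix H assume H: "cocycle_submod A B i H" and SH: "S \<subseteq> H"
        note H' = cocycle_submodD[OF H]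
        \<comment> \<open>The submodule generated by \<open>H\<close> and \<open>s\<close>. It
          contains all generators, hence everything.\<close>
        define Hs where "Hs = {f. cocycle A B i f \<and> (\<exists>r\<in>carrier R. (\<lambda>y. f y \<ominus>\<^bsub>I i\<^esub> r \<odot>\<^bsub>I i\<^esub> s y) \<in> H)}"
        have shift: "cocycle A B i (\<lambda>y. f y \<ominus>\<^bsub>I i\<^esub> r \<odot>\<^bsub>I i\<^esub> s y)"
          if "cocycle A B i f" "r \<in> carrier R" for f r
          by (rule cocycle_diff[OF A that(1) cocycle_smult[OF A s that(2)]])
        have HsI: "f \<in> Hs" if f: "cocycle A B i f" and r: "r \<in> carrier R" and h: "h \<in> H"
          and e: "\<And>a. a \<in> A \<Longrightarrow> h a = f a \<ominus>\<^bsub>I i\<^esub> r \<odot>\<^bsub>I i\<^esub> s a" for f r h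
          unfolding Hs_def using cocycle_submod_cong[OF H A h shift[OF f r] e] f r by blast
        have "cocycle_submod A B i Hs"
        proof (rule cocycle_submodI)
          show "cocycle A B i f" if "f \<in> Hs" for f using that unfolding Hs_def by simp
          show "(\<lambda>_. \<zero>\<^bsub>I i\<^esub>) \<in> Hs"
            by (rule HsI[OF cocycle_zero zero_closed H'(2)]) (simp add: cl[OF s] I.M.diff_self)
        next
          fix f g assume f: "f \<in> Hs" and g: "g \<in> Hs"
          obtain r where r: "cocycle A B i f" "r \<in> carrier R" "(\<lambda>y. f y \<ominus>\<^bsub>I i\<^esub> r \<odot>\<^bsub>I i\<^esub> s y) \<in> H"
            using f unfolding Hs_def by blast
          obtain r' where r': "cocycle A B i g" "r' \<in> carrier R" "(\<lambda>y. g y \<ominus>\<^bsub>I i\<^esub> r' \<odot>\<^bsub>I i\<^esub> s y) \<in> H"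
            using g unfolding Hs_def by blast
          show "(\<lambda>x. f x \<oplus>\<^bsub>I i\<^esub> g x) \<in> Hs"
          proof (rule HsI[OF cocycle_add[OF A r(1) r'(1)] _ H'(3)[OF r(3) r'(3)]])
            show "r \<oplus> r' \<in> carrier R" using r r' by simp
            show "f a \<ominus>\<^bsub>I i\<^esub> r \<odot>\<^bsub>I i\<^esub> s a \<oplus>\<^bsub>I i\<^esub> (g a \<ominus>\<^bsub>I i\<^esub> r' \<odot>\<^bsub>I i\<^esub> s a) =
                f a \<oplus>\<^bsub>I i\<^esub> g a \<ominus>\<^bsub>I i\<^esub> (r \<oplus> r') \<odot>\<^bsub>I i\<^esub> s a" if "a \<in> A" for a
              using cl[OF r(1) that] cl[OF r'(1) that] cl[OF s that] r(2) r'(2)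
              by (simp add: I.smult_l_distr I.M.add_diff_add)
          qed
        next
          fix t f assume t: "t \<in> carrier R" and f: "f \<in> Hs"
          obtain r where r: "cocycle A B i f" "r \<in> carrier R" "(\<lambda>y. f y \<ominus>\<^bsub>I i\<^esub> r \<odot>\<^bsub>I i\<^esub> s y) \<in> H"
            using f unfolding Hs_def by blast
          show "(\<lambda>x. t \<odot>\<^bsub>I i\<^esub> f x) \<in> Hs"
          proof (rule HsI[OF cocycle_smult[OF A r(1) t] _ H'(4)[OF t r(3)]])
            show "t \<otimes> r \<in> carrier R" using t r by simp
            show "t \<odot>\<^bsub>I i\<^esub> (f a \<ominus>\<^bsub>I i\<^esub> r \<odot>\<^bsub>I i\<^esub> s a) = t \<odot>\<^bsub>I i\<^esub> f a \<ominus>\<^bsub>I i\<^esub> (t \<otimes> r) \<odot>\<^bsub>I i\<^esub> s a"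
              if "a \<in> A" for a
              using cl[OF r(1) that] cl[OF s that] r(2) t by (simp add: I.smult_r_diff I.smult_assoc1)
          qed
        next
          fix f g assume f: "f \<in> Hs" and g: "cocycle A B i g"
            and fg: "coboundary A B i (\<lambda>x. f x \<ominus>\<^bsub>I i\<^esub> g x)"
          obtain r where r: "cocycle A B i f" "r \<in> carrier R" "(\<lambda>y. f y \<ominus>\<^bsub>I i\<^esub> r \<odot>\<^bsub>I i\<^esub> s y) \<in> H"
            using f unfolding Hs_def by blast
          have "(\<lambda>y. g y \<ominus>\<^bsub>I i\<^esub> r \<odot>\<^bsub>I i\<^esub> s y) \<in> H"
          proof (rule H'(5)[OF r(3) shift[OF g r(2)]], rule coboundary_cong[OF fg])
            fix a assume a: "a \<in> A"
            show "f a \<ominus>\<^bsub>I i\<^esub> r \<odot>\<^bsub>I i\<^esub> s a \<ominus>\<^bsub>I i\<^esub> (g a \<ominus>\<^bsub>I i\<^esub> r \<odot>\<^bsub>I i\<^esub> s a) = f a \<ominus>\<^bsub>I i\<^esub> g a"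
              unfolding I.M.minus_eq[of "f a" "r \<odot>\<^bsub>I i\<^esub> s a"] I.M.minus_eq[of "g a" "r \<odot>\<^bsub>I i\<^esub> s a"]
              using cl[OF r(1) a] cl[OF g a] cl[OF s a] r(2)
              by (simp add: I.M.add_diff_add I.M.diff_self)
          qed
          with g r(2) show "g \<in> Hs" unfolding Hs_def by blast
        qed
        moreover have "insert s S \<subseteq> Hs"
        proof
          fix f assume "f \<in> insert s S"
          then consider "f = s" | "f \<in> S" by auto
          then show "f \<in> Hs"
          proof cases
            case 1
            show ?thesis unfolding 1
              by (rule HsI[OF s one_closed H'(2)]) (simp add: cl[OF s] I.M.diff_self)
          next
            case 2
            then have f: "f \<in> H" using SH by auto
            show ?thesis
              by (rule HsI[OF H'(1)[OF f] zero_closed f])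
                (simp add: cl[OF s] cl[OF H'(1)[OF f]] I.M.diff_zero_right)
          qed
        qed
        ultimately have all: "Collect (cocycle A B i) \<subseteq> Hs" using insert(5) by blast
        \<comment> \<open>Modulo coboundaries \<open>s = x g\<close>, and modulo \<open>H\<close>
          the cocycle \<open>g\<close> is a multiple \<open>r s\<close>; so
          \<open>(1 - x r) s\<close> lies in \<open>H\<close>, and \<open>1 - x r\<close> is a unit
          because \<open>x\<close> is in \<open>m\<close>.\<close>
        obtain g where g: "cocycle A B i g" "coboundary A B i (\<lambda>y. s y \<ominus>\<^bsub>I i\<^esub> x \<odot>\<^bsub>I i\<^esub> g y)"
          using div[OF s] by blast
        then obtain r where r: "r \<in> carrier R" "(\<lambda>y. g y \<ominus>\<^bsub>I i\<^esub> r \<odot>\<^bsub>I i\<^esub> s y) \<in> H"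
          using all unfolding Hs_def by blast
        let ?u = "\<one> \<ominus> x \<otimes> r"
        have u: "?u \<in> carrier R" using xR r by simp
        have us: "(\<lambda>y. ?u \<odot>\<^bsub>I i\<^esub> s y) \<in> H"
        proof (rule H'(5)[OF H'(4)[OF xR r(2)] cocycle_smult[OF A s u]],
            rule coboundary_cong[OF coboundary_smult[OF A g(2), of "\<ominus> \<one>"]])
          fix a assume a: "a \<in> A"
          let ?p = "s a" and ?q = "g a"
          have c: "?p \<in> carrier (I i)" "?q \<in> carrier (I i)" "x \<odot>\<^bsub>I i\<^esub> ?q \<in> carrier (I i)"
            "(x \<otimes> r) \<odot>\<^bsub>I i\<^esub> ?p \<in> carrier (I i)"
            using cl[OF s a] cl[OF g(1) a] xR r by auto
          have "x \<odot>\<^bsub>I i\<^esub> (?q \<ominus>\<^bsub>I i\<^esub> r \<odot>\<^bsub>I i\<^esub> ?p) \<ominus>\<^bsub>I i\<^esub> ?u \<odot>\<^bsub>I i\<^esub> ?p =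
              (x \<odot>\<^bsub>I i\<^esub> ?q \<ominus>\<^bsub>I i\<^esub> (x \<otimes> r) \<odot>\<^bsub>I i\<^esub> ?p) \<ominus>\<^bsub>I i\<^esub> (?p \<ominus>\<^bsub>I i\<^esub> (x \<otimes> r) \<odot>\<^bsub>I i\<^esub> ?p)"
            using c xR r by (simp add: I.smult_r_diff smult_diff I.smult_assoc1)
          also have "\<dots> = x \<odot>\<^bsub>I i\<^esub> ?q \<ominus>\<^bsub>I i\<^esub> ?p"
            using c unfolding I.M.minus_eq[of _ "(x \<otimes> r) \<odot>\<^bsub>I i\<^esub> ?p"]
            by (simp add: I.M.add_diff_add I.M.diff_self)
          also have "\<dots> = (\<ominus> \<one>) \<odot>\<^bsub>I i\<^esub> (?p \<ominus>\<^bsub>I i\<^esub> x \<odot>\<^bsub>I i\<^esub> ?q)"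
            using c xR by (simp add: I.neg_eq_smult[symmetric] I.M.minus_eq I.M.minus_add I.M.a_comm)
          finally show "x \<odot>\<^bsub>I i\<^esub> (?q \<ominus>\<^bsub>I i\<^esub> r \<odot>\<^bsub>I i\<^esub> ?p) \<ominus>\<^bsub>I i\<^esub> ?u \<odot>\<^bsub>I i\<^esub> ?p =
            (\<ominus> \<one>) \<odot>\<^bsub>I i\<^esub> (?p \<ominus>\<^bsub>I i\<^esub> x \<odot>\<^bsub>I i\<^esub> ?q)" .
        qed simp
        have "?u \<notin> m"
        proof
          assume um: "?u \<in> m"
          have xr: "x \<otimes> r \<in> m" by (rule ideal.I_r_closed[OF m_ideal x r(1)])
          have "x \<otimes> r \<oplus> ?u = \<one>" by (rule add_diff_cancel) (use xR r in auto)
          moreover have "x \<otimes> r \<oplus> ?u \<in> m"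
            by (rule additive_subgroup.a_closed[OF ideal.axioms(1)[OF m_ideal] xr um])
          ultimately show False using one_notin_m by simp
        qed
        then obtain v where v: "v \<in> carrier R" "v \<otimes> ?u = \<one>" by (rule unit_if_notin_m[OF u])
        have "s \<in> H"
        proof (rule cocycle_submod_cong[OF H A H'(4)[OF v(1) us] s])
          show "v \<odot>\<^bsub>I i\<^esub> (?u \<odot>\<^bsub>I i\<^esub> s a) = s a" if "a \<in> A" for a
            using I.smult_assoc1[OF v(1) u cl[OF s that]] v(2) cl[OF s that] by simp
        qed
        with SH H insert(5) show "Collect (cocycle A B i) \<subseteq> H" by blast
      qed
    qed
  qed
  with fg f show ?thesis unfolding ext_fin_gen_def by blast
qed

end

section \<open>Regular elements and prime ideals\<close>

context cring
begin

definition add_principal :: "'a \<Rightarrow> 'a set \<Rightarrow> 'a set" where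
  "add_principal x J = {x \<otimes> r \<oplus> b | r b. r \<in> carrier R \<and> b \<in> J}"

text \<open>The ideal quotient \<open>(J : y)\<close>, which is the annihilator of \<open>y\<close>
  in \<open>R/J\<close>. Multiplication by \<open>y\<close> identifies \<open>R/(J : y)\<close> with
  \<open>(yR + J)/J\<close>.\<close>

definition colon :: "'a set \<Rightarrow> 'a \<Rightarrow> 'a set" where
  "colon J y = {r \<in> carrier R. y \<otimes> r \<in> J}"

lemma add_principal_ideal:
  assumes "ideal J R" "x \<in> carrier R"
  shows "ideal (add_principal x J) R"
proof -
  have "PIdl x = {x \<otimes> r | r. r \<in> carrier R}"
    unfolding cgenideal_def by (rule Collect_cong) (use m_comm[OF assms(2)] in metis)
  then have "add_principal x J = PIdl x <+> J"
    unfolding add_principal_def set_add_def' by auto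
  then show ?thesis using add_ideals[OF cgenideal_ideal[OF assms(2)] assms(1)] by simp
qed

lemma add_principal_mem:
  assumes "ideal J R" "x \<in> carrier R"
  shows "x \<in> add_principal x J" "J \<subseteq> add_principal x J"
proof -
  interpret J: ideal J R by fact
  have "x = x \<otimes> \<one> \<oplus> \<zero>" using assms(2) by simp
  then show "x \<in> add_principal x J"
    unfolding add_principal_def using J.zero_closed by blast
  show "J \<subseteq> add_principal x J"
  proof
    fix b assume "b \<in> J"
    moreover from this have "b = x \<otimes> \<zero> \<oplus> b" using assms(2) J.Icarr by simp
    ultimately show "b \<in> add_principal x J"
      unfolding add_principal_def by blast
  qed
qed

lemma colon_ideal:
  assumes "ideal J R" "y \<in> carrier R"
  shows "ideal (colon J y) R"
  unfolding colon_def by (rule ideal.helper_max_prime[OF assms(1) is_cring assms(2)])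

text \<open>From each \<open>Q\<close> in \<open>W\<close> an element outside of \<open>P\<close> is
  taken; their product lies in every \<open>Q\<close> but not in the prime \<open>P\<close>.\<close>

lemma prime_Inter_mem:
  assumes P: "primeideal P R" and W: "finite W" "\<And>Q. Q \<in> W \<Longrightarrow> ideal Q R" "\<And>Q. Q \<in> W \<Longrightarrow> \<not> Q \<subseteq> P"
  shows "\<exists>z\<in>carrier R. z \<notin> P \<and> (\<forall>Q\<in>W. z \<in> Q)"
  using W
proof (induct W)
  case empty
  then show ?case using primeideal.I_notcarr[OF P] ideal.one_imp_carrier[OF primeideal.axioms(1)[OF P]] by auto
next
  case (insert Q W)
  obtain z where z: "z \<in> carrier R" "z \<notin> P" "\<forall>Q\<in>W. z \<in> Q" using insert by auto
  obtain q where q: "q \<in> Q" "q \<notin> P" using insert(5) by blast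
  have qR: "q \<in> carrier R" using ideal.Icarr[OF insert(4)[of Q]] q by simp
  have "z \<otimes> q \<notin> P" using primeideal.I_prime[OF P z(1) qR] z(2) q(2) by blast
  moreover have "z \<otimes> q \<in> Q'" if "Q' \<in> insert Q W" for Q'
  proof (cases "Q' = Q")
    case True
    then show ?thesis using ideal.I_l_closed[OF insert(4)[of Q]] q z by simp
  next
    case False
    then show ?thesis using ideal.I_r_closed[OF insert(4)[of Q']] that z qR by simp
  qed
  ultimately show ?case using z qR by (intro bexI[of _ "z \<otimes> q"]) auto
qed

text \<open>Prime avoidance. If the \<open>x\<close> found for \<open>W\<close> lies in the new
  prime \<open>Q\<close>, then \<open>z z'\<close> is added, where \<open>z\<close> lies in every
  member of \<open>W\<close> but not in \<open>Q\<close> and \<open>z'\<close> lies in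
  \<open>P\<close> but not in \<open>Q\<close>. Such a \<open>z\<close> exists because the primes
  are incomparable.\<close>

lemma prime_avoidance_antichain:
  assumes P: "ideal P R" and W: "finite W" "\<And>Q. Q \<in> W \<Longrightarrow> primeideal Q R" "\<And>Q. Q \<in> W \<Longrightarrow> \<not> P \<subseteq> Q"
    and anti: "\<And>Q Q'. Q \<in> W \<Longrightarrow> Q' \<in> W \<Longrightarrow> Q \<subseteq> Q' \<Longrightarrow> Q = Q'"
  shows "\<exists>x\<in>P. \<forall>Q\<in>W. x \<notin> Q"
  using W anti
proof (induct W)
  case empty
  then show ?case using additive_subgroup.zero_closed[OF ideal.axioms(1)[OF P]] by auto
next
  case (insert Q W)
  have Pc: "a \<in> carrier R" if "a \<in> P" for a using ideal.Icarr[OF P that] .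
  note Pa = additive_subgroup.a_closed[OF ideal.axioms(1)[OF P]]
  have prime: "primeideal Q' R" if "Q' \<in> insert Q W" for Q' using insert(4) that .
  have anti: "Q1 = Q2" if "Q1 \<in> insert Q W" "Q2 \<in> insert Q W" "Q1 \<subseteq> Q2" for Q1 Q2
    using insert(6) that .
  have "\<exists>x\<in>P. \<forall>Q\<in>W. x \<notin> Q"
    by (rule insert(3)) (use insert(5) prime anti in auto)
  then obtain x where x: "x \<in> P" "\<forall>Q\<in>W. x \<notin> Q" by blast
  show ?case
  proof (cases "x \<in> Q")
    case False
    with x show ?thesis by auto
  next
    case True
    have id: "ideal Q' R" if "Q' \<in> insert Q W" for Q' using prime[OF that] by (rule primeideal.axioms(1))
    have "\<exists>z\<in>carrier R. z \<notin> Q \<and> (\<forall>Q'\<in>W. z \<in> Q')"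
      by (rule prime_Inter_mem[OF prime insert(1)]) (use id anti insert(2) in auto)
    then obtain z where z: "z \<in> carrier R" "z \<notin> Q" "\<forall>Q'\<in>W. z \<in> Q'" by blast
    obtain z' where z': "z' \<in> P" "z' \<notin> Q" using insert(5)[of Q] by blast
    have zz: "z \<otimes> z' \<notin> Q"
      using primeideal.I_prime[OF prime z(1) Pc[OF z'(1)]] z(2) z'(2) by blast
    have zP: "z \<otimes> z' \<in> P" using ideal.I_l_closed[OF P z'(1) z(1)] .
    \<comment> \<open>If exactly one of the two summands lies in an ideal, the sum does not.\<close>
    have *: "x \<oplus> z \<otimes> z' \<notin> Q'" if "Q' \<in> insert Q W" "(x \<in> Q') \<noteq> (z \<otimes> z' \<in> Q')" for Q'
    proof
      assume s: "x \<oplus> z \<otimes> z' \<in> Q'"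
      interpret Q': ideal Q' R by (rule id[OF that(1)])
      have c: "x \<in> carrier R" "z \<otimes> z' \<in> carrier R" using Pc x(1) zP by auto
      have e: "x = (x \<oplus> z \<otimes> z') \<ominus> z \<otimes> z'" "z \<otimes> z' = (x \<oplus> z \<otimes> z') \<ominus> x"
        using c by (auto intro!: diff_eqI[symmetric] simp: a_comm)
      have mc: "a \<ominus> b \<in> Q'" if "a \<in> Q'" "b \<in> Q'" for a b
        unfolding a_minus_def by (intro Q'.a_closed that Q'.a_inv_closed)
      show False using that(2) mc[OF s] e by metis
    qed
    have "z \<otimes> z' \<in> Q'" if "Q' \<in> W" for Q'
      using ideal.I_r_closed[OF id, of Q' z z'] that z(3) Pc[OF z'(1)] by auto
    then have "x \<oplus> z \<otimes> z' \<notin> Q'" if "Q' \<in> insert Q W" for Q'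
      using *[OF that] that x(2) True zz by auto
    then show ?thesis using Pa[OF x(1) zP] by blast
  qed
qed

end

context noetherian_cring
begin

text \<open>The maximal annihilators of elements of \<open>R/J\<close> are prime, they are finite in
  number, and every zero divisor on \<open>R/J\<close> lies in one of them. None of them contains
  \<open>P\<close>, so prime avoidance gives an element of \<open>P\<close> outside of all.\<close>

lemma exists_regular_element:
  assumes J: "ideal J R" and P: "ideal P R"
    and no: "\<And>y. y \<in> carrier R \<Longrightarrow> (\<And>x. x \<in> P \<Longrightarrow> y \<otimes> x \<in> J) \<Longrightarrow> y \<in> J"
  shows "\<exists>x\<in>P. \<forall>r\<in>carrier R. x \<otimes> r \<in> J \<longrightarrow> r \<in> J"
proof -
  interpret J: ideal J R by fact
  \<comment> \<open>The elements outside of \<open>J\<close> whose annihilator modulo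
    \<open>J\<close> is maximal.\<close>
  define Y where "Y = {y \<in> carrier R - J. \<forall>z\<in>carrier R - J. colon J y \<subseteq> colon J z \<longrightarrow> colon J z = colon J y}"
  have YR: "Y \<subseteq> carrier R" unfolding Y_def by auto
  have prime: "primeideal (colon J y) R" if y: "y \<in> Y" for y
  proof (rule primeidealI[OF colon_ideal[OF J] is_cring])
    have y': "y \<in> carrier R" "y \<notin> J" using y unfolding Y_def by auto
    show "y \<in> carrier R" by fact
    have "\<one> \<notin> colon J y" using y' unfolding colon_def by simp
    then show "carrier R \<noteq> colon J y" by auto
    \<comment> \<open>If \<open>b\<close> does not annihilate \<open>y\<close>, then the annihilator
      of \<open>y b\<close> contains that of \<open>y\<close> and equals it by maximality; when
      \<open>a b\<close> annihilates \<open>y\<close>, it also contains \<open>a\<close>.\<close>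
    fix a b assume ab: "a \<in> carrier R" "b \<in> carrier R" "a \<otimes> b \<in> colon J y"
    show "a \<in> colon J y \<or> b \<in> colon J y"
    proof (rule disjCI)
      assume "b \<notin> colon J y"
      then have "y \<otimes> b \<in> carrier R - J" using ab y' unfolding colon_def by auto
      moreover have "colon J y \<subseteq> colon J (y \<otimes> b)"
      proof
        fix r assume r: "r \<in> colon J y"
        then have "y \<otimes> b \<otimes> r = b \<otimes> (y \<otimes> r)" using ab y' unfolding colon_def by (simp add: m_ac)
        then show "r \<in> colon J (y \<otimes> b)" using r ab J.I_l_closed unfolding colon_def by auto
      qed
      ultimately have "colon J (y \<otimes> b) = colon J y" using y unfolding Y_def by auto
      moreover have "y \<otimes> b \<otimes> a = y \<otimes> (a \<otimes> b)" using ab y' by (simp add: m_ac)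
      then have "a \<in> colon J (y \<otimes> b)" using ab unfolding colon_def by simp
      ultimately show "a \<in> colon J y" by simp
    qed
  qed
  have below: "\<exists>y\<in>Y. colon J z \<subseteq> colon J y" if z: "z \<in> carrier R - J" for z
  proof -
    let ?C = "{colon J w | w. w \<in> carrier R - J \<and> colon J z \<subseteq> colon J w}"
    have ne: "?C \<noteq> {}" using z by blast
    have id: "ideal L R" if "L \<in> ?C" for L using that colon_ideal[OF J] by blast
    obtain K where K1: "K \<in> ?C" and K2: "\<forall>L\<in>?C. K \<subseteq> L \<longrightarrow> L = K"
      using exists_maximal_ideal_in[OF ne id] by (rule bexE)
    note K = K1 K2[rule_format]
    then obtain w where w: "w \<in> carrier R - J" "colon J z \<subseteq> colon J w" "K = colon J w" by blast
    have "w \<in> Y"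
      unfolding Y_def using w K(2) by blast
    with w show ?thesis by blast
  qed
  \<comment> \<open>A finite \<open>W\<close> for which the ideal generated by \<open>W\<close> and
    \<open>J\<close> is as large as possible has all of \<open>Y\<close> in that ideal. This is what
    yields the finiteness of the set of maximal annihilators.\<close>
  let ?C = "{Idl (W \<union> J) | W. finite W \<and> W \<subseteq> Y}"
  have ne: "?C \<noteq> {}" by blast
  have id: "ideal L R" if "L \<in> ?C" for L
  proof -
    obtain W where W: "W \<subseteq> Y" "L = Idl (W \<union> J)" using \<open>L \<in> ?C\<close> by blast
    then have "W \<union> J \<subseteq> carrier R" using YR J.a_subset by blast
    then show ?thesis unfolding W(2) by (rule genideal_ideal)
  qed
  obtain K where K1: "K \<in> ?C" and K2: "\<forall>L\<in>?C. K \<subseteq> L \<longrightarrow> L = K"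
    using exists_maximal_ideal_in[OF ne id] by (rule bexE)
  note K = K1 K2[rule_format]
  then obtain W where W: "finite W" "W \<subseteq> Y" "K = Idl (W \<union> J)" by blast
  have WR: "W \<union> J \<subseteq> carrier R" using W YR J.a_subset by auto
  have YK: "y \<in> K" if y: "y \<in> Y" for y
  proof -
    have iR: "insert y W \<union> J \<subseteq> carrier R" using WR YR y by auto
    have "Idl (insert y W \<union> J) \<in> ?C" using W y by blast
    moreover have "K \<subseteq> Idl (insert y W \<union> J)"
      unfolding W(3) by (rule subset_Idl_subset[OF iR]) auto
    ultimately have "Idl (insert y W \<union> J) = K" by (rule K(2))
    then show ?thesis using genideal_self[OF iR] by auto
  qed
  have max: "colon J y = colon J z" if "y \<in> Y" "z \<in> Y" "colon J y \<subseteq> colon J z" for y z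
    using that unfolding Y_def by auto
  \<comment> \<open>What annihilates all of \<open>W\<close> modulo \<open>J\<close> also
    annihilates \<open>y\<close>. So the prime \<open>colon J y\<close> contains the intersection of
    the finitely many \<open>colon J w\<close>, hence one of them, and equals it by
    maximality.\<close>
  have fin: "\<exists>w\<in>W. colon J w = colon J y" if y: "y \<in> Y" for y
  proof (rule ccontr)
    assume n: "\<not> ?thesis"
    have "\<exists>z\<in>carrier R. z \<notin> colon J y \<and> (\<forall>Q\<in>colon J ` W. z \<in> Q)"
    proof (rule prime_Inter_mem[OF prime[OF y]])
      show "\<not> Q \<subseteq> colon J y" if "Q \<in> colon J ` W" for Q
        using that n max y W(2) by blast
      show "ideal Q R" if "Q \<in> colon J ` W" for Q
        using that colon_ideal[OF J] WR by auto
    qed (use W in auto)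
    then obtain z where z: "z \<in> carrier R" "z \<notin> colon J y" "\<And>w. w \<in> W \<Longrightarrow> z \<in> colon J w" by auto
    have "W \<union> J \<subseteq> colon J z"
    proof
      fix a assume a: "a \<in> W \<union> J"
      then have aR: "a \<in> carrier R" using WR by auto
      from a show "a \<in> colon J z"
      proof
        assume "a \<in> W"
        then show ?thesis using z(3)[of a] z(1) aR unfolding colon_def by (simp add: m_comm)
      next
        assume "a \<in> J"
        then show ?thesis using J.I_l_closed z(1) aR unfolding colon_def by simp
      qed
    qed
    then have "K \<subseteq> colon J z"
      unfolding W(3) by (rule genideal_minimal[OF colon_ideal[OF J z(1)]])
    then have "y \<in> colon J z" using YK[OF y] by auto
    then have "z \<in> colon J y" using z(1) m_comm[of z y] unfolding colon_def by simp
    with z(2) show False by simp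
  qed
  show ?thesis
  proof (rule ccontr)
    assume n: "\<not> ?thesis"
    have "\<exists>x\<in>P. \<forall>Q\<in>colon J ` W. x \<notin> Q"
    proof (rule prime_avoidance_antichain[OF P])
      show "finite (colon J ` W)" using W by simp
      show "primeideal Q R" if "Q \<in> colon J ` W" for Q using that prime W by auto
      show "Q = Q'" if "Q \<in> colon J ` W" "Q' \<in> colon J ` W" "Q \<subseteq> Q'" for Q Q'
        using that max W(2) by blast
      show "\<not> P \<subseteq> Q" if "Q \<in> colon J ` W" for Q
      proof
        assume "P \<subseteq> Q"
        obtain w where w: "w \<in> W" "Q = colon J w" using \<open>Q \<in> colon J ` W\<close> by (rule imageE)
        have "w \<otimes> x \<in> J" if "x \<in> P" for x using \<open>P \<subseteq> Q\<close> that w(2) unfolding colon_def by auto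
        note * = this
        have "w \<in> carrier R" using w(1) WR by auto
        then have "w \<in> J" by (rule no) (rule *)
        then show False using w W(2) unfolding Y_def by auto
      qed
    qed
    then obtain x where x: "x \<in> P" "\<And>w. w \<in> W \<Longrightarrow> x \<notin> colon J w" by blast
    have xR: "x \<in> carrier R" using ideal.Icarr[OF P x(1)] .
    obtain r where r: "r \<in> carrier R" "x \<otimes> r \<in> J" "r \<notin> J" using n x(1) by blast
    obtain y where y: "y \<in> Y" "colon J r \<subseteq> colon J y" using below[of r] r by blast
    obtain w where w: "w \<in> W" "colon J w = colon J y" using fin[OF y(1)] by blast
    have "x \<in> colon J r" using r xR unfolding colon_def by (simp add: m_comm)
    then show False using y(2) w x(2) by auto
  qed
qed

text \<open>
  The prime ideal is one that is maximal among the ideals containing \<open>J\<close> and avoiding the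
  multiplicative set of all \<open>s \<otimes> x [^] n\<close> with \<open>s \<notin> p\<close>.
\<close>

lemma prime_below:
  assumes J: "ideal J R" and p: "primeideal p R" "J \<subseteq> p" and x: "x \<in> carrier R"
    and reg: "\<And>r. r \<in> carrier R \<Longrightarrow> x \<otimes> r \<in> J \<Longrightarrow> r \<in> J"
  shows "\<exists>q. primeideal q R \<and> J \<subseteq> q \<and> q \<subseteq> p \<and> x \<notin> q"
proof -
  interpret p: primeideal p R by fact
  let ?C = "{K. ideal K R \<and> J \<subseteq> K \<and> (\<forall>s\<in>carrier R - p. \<forall>n::nat. s \<otimes> x [^] n \<notin> K)}"
  have one: "\<one> \<notin> p" using p.I_notcarr p.one_imp_carrier by auto
  \<comment> \<open>Regularity of \<open>x\<close> strips off the powers of \<open>x\<close>, and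
    what remains is some \<open>s\<close> in \<open>J\<close>, hence in \<open>p\<close>.\<close>
  have "J \<in> ?C"
  proof -
    have "s \<in> J" if "s \<in> carrier R" "s \<otimes> x [^] n \<in> J" for s and n :: nat
      using that
    proof (induct n)
      case 0
      then show ?case by simp
    next
      case (Suc n)
      have "s \<otimes> x [^] Suc n = x \<otimes> (s \<otimes> x [^] n)" using Suc(2) x by (simp add: m_ac)
      then show ?case using reg[of "s \<otimes> x [^] n"] Suc x by simp
    qed
    then show ?thesis using J p(2) by auto
  qed
  then have ne: "?C \<noteq> {}" by blast
  have id: "ideal L R" if "L \<in> ?C" for L using that by simp
  obtain K where K1: "K \<in> ?C" and K2: "\<forall>L\<in>?C. K \<subseteq> L \<longrightarrow> L = K"
    using exists_maximal_ideal_in[OF ne id] by (rule bexE)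
  note K = K1 K2[rule_format]
  then have Ki: "ideal K R" and JK: "J \<subseteq> K"
    and avoid: "\<And>s n. s \<in> carrier R \<Longrightarrow> s \<notin> p \<Longrightarrow> s \<otimes> x [^] (n::nat) \<notin> K" by auto
  interpret K: ideal K R by (rule Ki)
  \<comment> \<open>Any ideal strictly larger than \<open>K\<close> meets the multiplicative set.
    For \<open>a\<close> and \<open>b\<close> outside of \<open>K\<close> with product in
    \<open>K\<close>, multiplying the two elements so found gives an element of that set in
    \<open>K\<close>, a contradiction.\<close>
  have hit: "\<exists>s (n::nat) r b. s \<in> carrier R \<and> s \<notin> p \<and> r \<in> carrier R \<and> b \<in> K \<and> s \<otimes> x [^] n = a \<otimes> r \<oplus> b"
    if a: "a \<in> carrier R" "a \<notin> K" for a
  proof -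
    have "add_principal a K \<noteq> K" using add_principal_mem[OF Ki a(1)] a(2) by auto
    then have "add_principal a K \<notin> ?C" using K(2) add_principal_mem[OF Ki a(1)] by blast
    then obtain s and n :: nat where "s \<in> carrier R - p" "s \<otimes> x [^] n \<in> add_principal a K"
      using add_principal_ideal[OF Ki a(1)] add_principal_mem[OF Ki a(1)] JK by auto
    then show ?thesis unfolding add_principal_def by blast
  qed
  have "primeideal K R"
  proof (rule primeidealI[OF Ki is_cring])
    show "carrier R \<noteq> K" using avoid[OF one_closed one, of 0] by auto
    fix a b assume ab: "a \<in> carrier R" "b \<in> carrier R" "a \<otimes> b \<in> K"
    show "a \<in> K \<or> b \<in> K"
    proof (rule ccontr)
      assume "\<not> (a \<in> K \<or> b \<in> K)"
      then obtain s r c t r' c' and n n' :: nat where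
        s: "s \<in> carrier R" "s \<notin> p" "r \<in> carrier R" "c \<in> K" "s \<otimes> x [^] n = a \<otimes> r \<oplus> c" and
        t: "t \<in> carrier R" "t \<notin> p" "r' \<in> carrier R" "c' \<in> K" "t \<otimes> x [^] n' = b \<otimes> r' \<oplus> c'"
        using hit[OF ab(1)] hit[OF ab(2)] by blast
      have cR: "c \<in> carrier R" "c' \<in> carrier R" using s t K.Icarr by auto
      have "(s \<otimes> t) \<otimes> x [^] (n + n') = (s \<otimes> x [^] n) \<otimes> (t \<otimes> x [^] n')"
        using s(1) t(1) x by (simp add: nat_pow_mult[symmetric] m_ac)
      also have "\<dots> = (a \<otimes> b) \<otimes> (r \<otimes> r') \<oplus> (c \<otimes> (b \<otimes> r') \<oplus> (a \<otimes> r \<oplus> c) \<otimes> c')"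
        unfolding s(5) t(5) using ab s(3) t(3) cR by (simp add: l_distr r_distr m_ac a_ac)
      also have "\<dots> \<in> K"
        using ab s(3,4) t(3,4) cR
        by (intro K.a_closed K.I_r_closed[OF ab(3)] K.I_r_closed[OF s(4)] K.I_l_closed[OF t(4)]) auto
      finally show False
        using avoid[of "s \<otimes> t" "n + n'"] s(1,2) t(1,2) p.I_prime[OF s(1) t(1)] by auto
    qed
  qed
  moreover have "K \<subseteq> p"
  proof
    fix s assume s: "s \<in> K"
    show "s \<in> p" using avoid[of s 0] s K.Icarr[OF s] by auto
  qed
  moreover have "x \<notin> K" using avoid[OF one_closed one, of 1] x by simp
  ultimately show ?thesis using JK by blast
qed

end

section \<open>Finite generation of Ext\<close>

context local_gorenstein
begin

lemma subquot_iso_agree: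
  fixes A B :: "('b::countable \<Rightarrow> 'a) set" and A' B' :: "('c::countable \<Rightarrow> 'a) set"
  assumes iso: "subquot_iso \<phi> A B A' B'"
    and f: "f \<in> module_hom R E (I i)" "\<And>b. b \<in> B' \<Longrightarrow> f b = \<zero>\<^bsub>I i\<^esub>"
    and g: "g \<in> module_hom R E (I i)" "\<And>b. b \<in> B' \<Longrightarrow> g b = \<zero>\<^bsub>I i\<^esub>"
    and e: "\<And>a. a \<in> A \<Longrightarrow> f (\<phi> a) = g (\<phi> a)" and x: "x \<in> A'"
  shows "f x = g x"
proof -
  interpret E: module R "E :: ('a, 'b \<Rightarrow> 'a) module" by (rule E_module)
  interpret E': module R "E :: ('a, 'c \<Rightarrow> 'a) module" by (rule E_module)
  note iso' = subquot_isoD[OF iso]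
  obtain a b where ab: "a \<in> A" "b \<in> B'" "x = \<phi> a \<oplus>\<^bsub>E\<^esub> b" using iso'(9) x by blast
  have c: "\<phi> a \<in> carrier E" "b \<in> carrier E"
    using ab E.submodD(1)[OF iso'(2)] E'.submodD(1)[OF iso'(4)] module_hom_closed[OF iso'(1)] by auto
  show ?thesis
    unfolding ab(3) module_hom_add[OF f(1) c] module_hom_add[OF g(1) c] f(2)[OF ab(2)] g(2)[OF ab(2)]
    using e[OF ab(1)] by simp
qed

lemma cocycle_pull:
  assumes iso: "subquot_iso \<phi> A B A' B'" and f: "cocycle A' B' i f"
  shows "cocycle A B i (\<lambda>x. f (\<phi> x))"
proof -
  note iso' = subquot_isoD[OF iso] and f' = cocycleD[OF f]
  show ?thesis
    using module_hom_comp[OF iso'(1) f'(1)] f'(2,3) iso'(5,7,8) by (intro cocycleI) (auto simp: subset_iff)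
qed

text \<open>The lifted homomorphism is again a cocycle because its composition with
  \<open>\<delta> i\<close> vanishes on the image of \<open>A\<close> and on \<open>B'\<close>,
  hence on \<open>A'\<close>.\<close>

lemma cocycle_lift:
  fixes A B :: "('b::countable \<Rightarrow> 'a) set" and A' B' :: "('c::countable \<Rightarrow> 'a) set"
  assumes iso: "subquot_iso \<phi> A B A' B'" and f: "cocycle A B i f"
  obtains f' where "cocycle A' B' i f'" "\<And>a. a \<in> A \<Longrightarrow> f' (\<phi> a) = f a"
proof -
  note iso' = subquot_isoD[OF iso] and f' = cocycleD[OF f]
  obtain h where h: "h \<in> module_hom R E (I i)" "\<And>b. b \<in> B' \<Longrightarrow> h b = \<zero>\<^bsub>I i\<^esub>"
    "\<And>a. a \<in> A \<Longrightarrow> h (\<phi> a) = f a"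
    by (rule subquot_iso_lift[OF iso f'(1,2)]) auto
  interpret I': module R "I (Suc i)" by (rule I_module)
  have "cocycle A' B' i h"
  proof (rule cocycleI[OF h(1,2)])
    fix x assume x: "x \<in> A'"
    show "\<delta> i (h x) = \<zero>\<^bsub>I (Suc i)\<^esub>"
      by (rule subquot_iso_agree[OF iso module_hom_comp[OF h(1) \<delta>_hom] _ I'.module_hom_zero_map _ _ x])
        (simp_all add: h(2,3) \<delta>_zero f'(3))
  qed
  with h(3) that show ?thesis by blast
qed

text \<open>A submodule \<open>H\<close> of cocycles for \<open>A'/B'\<close> is pulled back to
  \<open>K\<close>, to which the generators for \<open>A/B\<close> apply; the generators for
  \<open>A'/B'\<close> are lifts of those for \<open>A/B\<close>.\<close>

lemma ext_fin_gen_iso: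
  fixes A B :: "('b::countable \<Rightarrow> 'a) set" and A' B' :: "('c::countable \<Rightarrow> 'a) set"
  assumes iso: "subquot_iso \<phi> A B A' B'" and fg: "ext_fin_gen A B i"
  shows "ext_fin_gen A' B' i"
proof -
  interpret E: module R "E :: ('a, 'b \<Rightarrow> 'a) module" by (rule E_module)
  interpret E': module R "E :: ('a, 'c \<Rightarrow> 'a) module" by (rule E_module)
  interpret I: module R "I i" by (rule I_module)
  note iso' = subquot_isoD[OF iso]
  have A: "A \<subseteq> carrier E" using E.submodD(1)[OF iso'(2)] .
  have A': "A' \<subseteq> carrier E" using E'.submodD(1)[OF iso'(3)] .
  obtain S where S: "finite S" "S \<subseteq> Collect (cocycle A B i)"
    "\<And>H. cocycle_submod A B i H \<Longrightarrow> S \<subseteq> H \<Longrightarrow> Collect (cocycle A B i) \<subseteq> H"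
    using fg unfolding ext_fin_gen_def by blast
  have "\<forall>f\<in>S. \<exists>f'. cocycle A' B' i f' \<and> (\<forall>a\<in>A. f' (\<phi> a) = f a)"
    using cocycle_lift[OF iso] S(2) by (metis mem_Collect_eq subsetD)
  then obtain l where l: "\<And>f. f \<in> S \<Longrightarrow> cocycle A' B' i (l f)" "\<And>f a. f \<in> S \<Longrightarrow> a \<in> A \<Longrightarrow> l f (\<phi> a) = f a"
    by metis
  show ?thesis
    unfolding ext_fin_gen_def
  proof (intro exI[of _ "l ` S"] conjI allI impI)
    fix H assume H: "cocycle_submod A' B' i H" and SH: "l ` S \<subseteq> H"
    note H' = cocycle_submodD[OF H]
    define K where "K = {f. cocycle A B i f \<and> (\<exists>f'\<in>H. \<forall>a\<in>A. f' (\<phi> a) = f a)}"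
    have "cocycle_submod A B i K"
    proof (rule cocycle_submodI)
      show "(\<lambda>_. \<zero>\<^bsub>I i\<^esub>) \<in> K" unfolding K_def using H'(2) cocycle_zero by auto
      show "(\<lambda>x. f x \<oplus>\<^bsub>I i\<^esub> g x) \<in> K" if "f \<in> K" "g \<in> K" for f g
      proof -
        obtain f' where f': "f' \<in> H" "\<forall>a\<in>A. f' (\<phi> a) = f a" using \<open>f \<in> K\<close> unfolding K_def by auto
        obtain g' where g': "g' \<in> H" "\<forall>a\<in>A. g' (\<phi> a) = g a" using \<open>g \<in> K\<close> unfolding K_def by auto
        have "cocycle A B i (\<lambda>x. f x \<oplus>\<^bsub>I i\<^esub> g x)"
          using that unfolding K_def by (intro cocycle_add[OF A]) auto
        then show ?thesis
          unfolding K_def using H'(3)[OF f'(1) g'(1)] f'(2) g'(2)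
          by (auto intro!: bexI[of _ "\<lambda>x. f' x \<oplus>\<^bsub>I i\<^esub> g' x"])
      qed
      show "(\<lambda>x. r \<odot>\<^bsub>I i\<^esub> f x) \<in> K" if "r \<in> carrier R" "f \<in> K" for r f
      proof -
        obtain f' where f': "f' \<in> H" "\<forall>a\<in>A. f' (\<phi> a) = f a" using \<open>f \<in> K\<close> unfolding K_def by auto
        have "cocycle A B i (\<lambda>x. r \<odot>\<^bsub>I i\<^esub> f x)"
          using that unfolding K_def by (intro cocycle_smult[OF A]) auto
        then show ?thesis
          unfolding K_def using H'(4)[OF that(1) f'(1)] f'(2)
          by (auto intro!: bexI[of _ "\<lambda>x. r \<odot>\<^bsub>I i\<^esub> f' x"])
      qed
      show "g \<in> K" if f: "f \<in> K" and g: "cocycle A B i g" and cob: "coboundary A B i (\<lambda>x. f x \<ominus>\<^bsub>I i\<^esub> g x)" for f g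
      proof -
        obtain f' where f': "f' \<in> H" "\<And>a. a \<in> A \<Longrightarrow> f' (\<phi> a) = f a" using f unfolding K_def by auto
        obtain g' where g': "cocycle A' B' i g'" "\<And>a. a \<in> A \<Longrightarrow> g' (\<phi> a) = g a"
          by (rule cocycle_lift[OF iso g]) blast
        note fc = cocycleD[OF H'(1)[OF f'(1)]] and gc = cocycleD[OF g'(1)]
        have d: "(\<lambda>x. f' x \<ominus>\<^bsub>I i\<^esub> g' x) \<in> module_hom R E (I i)"
          by (rule I.module_hom_minus[OF fc(1) gc(1)])
        have db: "f' b \<ominus>\<^bsub>I i\<^esub> g' b = \<zero>\<^bsub>I i\<^esub>" if "b \<in> B'" for b
          using fc(2)[OF that] gc(2)[OF that] by (simp add: I.M.diff_self)
        \<comment> \<open>A cochain that bounds the difference on \<open>A/B\<close> is lifted too;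
          in degree 0 the difference vanishes on the image of \<open>A\<close> and so on all of
          \<open>A'\<close>.\<close>
        have "coboundary A' B' i (\<lambda>x. f' x \<ominus>\<^bsub>I i\<^esub> g' x)"
        proof (cases i)
          case 0
          have "f' x \<ominus>\<^bsub>I i\<^esub> g' x = \<zero>\<^bsub>I i\<^esub>" if x: "x \<in> A'" for x
          proof (rule subquot_iso_agree[OF iso d db I.module_hom_zero_map refl _ x])
            show "f' (\<phi> a) \<ominus>\<^bsub>I i\<^esub> g' (\<phi> a) = \<zero>\<^bsub>I i\<^esub>" if "a \<in> A" for a
              using cob that unfolding coboundary_def 0 by (simp add: f'(2) g'(2))
          qed
          then show ?thesis unfolding coboundary_def 0 by simp
        next
          case (Suc j)
          obtain h where h: "h \<in> module_hom R E (I j)" "\<And>b. b \<in> B \<Longrightarrow> h b = \<zero>\<^bsub>I j\<^esub>"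
            "\<And>a. a \<in> A \<Longrightarrow> f a \<ominus>\<^bsub>I i\<^esub> g a = \<delta> j (h a)"
            using cob unfolding coboundary_def Suc by auto
          obtain h' where h': "h' \<in> module_hom R E (I j)" "\<And>b. b \<in> B' \<Longrightarrow> h' b = \<zero>\<^bsub>I j\<^esub>"
            "\<And>a. a \<in> A \<Longrightarrow> h' (\<phi> a) = h a"
            by (rule subquot_iso_lift[OF iso h(1,2)]) auto
          have \<delta>h: "(\<lambda>x. \<delta> j (h' x)) \<in> module_hom R E (I i)"
            unfolding Suc by (rule module_hom_comp[OF h'(1) \<delta>_hom])
          have "f' x \<ominus>\<^bsub>I i\<^esub> g' x = \<delta> j (h' x)" if x: "x \<in> A'" for x
            by (rule subquot_iso_agree[OF iso d db \<delta>h _ _ x])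
              (simp_all add: f'(2) g'(2) h'(2,3) h(3) \<delta>_zero Suc[symmetric])
          with h'(1,2) show ?thesis unfolding coboundary_def Suc by auto
        qed
        then have "g' \<in> H" by (rule H'(5)[OF f'(1) g'(1)])
        with g g'(2) show ?thesis unfolding K_def by auto
      qed
    qed (auto simp: K_def)
    moreover have "S \<subseteq> K"
    proof
      fix f assume f: "f \<in> S"
      then have "l f \<in> H" "\<forall>a\<in>A. l f (\<phi> a) = f a" using SH l(2) by auto
      with f S(2) show "f \<in> K" unfolding K_def by auto
    qed
    ultimately have all: "Collect (cocycle A B i) \<subseteq> K" by (rule S(3))
    show "Collect (cocycle A' B' i) \<subseteq> H"
    proof
      fix f assume "f \<in> Collect (cocycle A' B' i)"
      then have f: "cocycle A' B' i f" by simp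
      note fc = cocycleD[OF f]
      obtain f' where f': "f' \<in> H" "\<And>a. a \<in> A \<Longrightarrow> f' (\<phi> a) = f (\<phi> a)"
        using all cocycle_pull[OF iso f] unfolding K_def by auto
      note fc' = cocycleD[OF H'(1)[OF f'(1)]]
      show "f \<in> H"
        by (rule cocycle_submod_cong[OF H A' f'(1) f], rule subquot_iso_agree[OF iso fc'(1,2) fc(1,2) f'(2)])
    qed
  qed (use S(1) l(1) in auto)
qed

text \<open>The connecting homomorphism from \<open>Ext\<close> of \<open>K\<close> in degree
  \<open>i\<close> to \<open>Ext\<close> of \<open>Fr J / K\<close> in degree \<open>i + 1\<close>
  is onto, as \<open>Ext\<close> of the free module vanishes in between. Hence the images
  \<open>\<delta> f\<close> of generators generate.\<close>

lemma ext_fin_gen_step: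
  fixes J :: "'b::countable set"
  assumes J: "finite J" and K: "K \<subseteq> Fr J" and fg: "ext_fin_gen K {\<zero>\<^bsub>E\<^esub>} i"
  shows "ext_fin_gen (Fr J) K (Suc i)"
proof -
  interpret I: module R "I i" by (rule I_module)
  interpret I': module R "I (Suc i)" by (rule I_module)
  have FE: "Fr J \<subseteq> carrier E" by (rule free_module_mono) simp
  have KE: "K \<subseteq> carrier E" using K FE by auto
  have cE: "a \<in> carrier E" if "a \<in> Fr J" for a using FE that by auto
  obtain S where S: "finite S" "S \<subseteq> Collect (cocycle K {\<zero>\<^bsub>E\<^esub>} i)"
    "\<And>H. cocycle_submod K {\<zero>\<^bsub>E\<^esub>} i H \<Longrightarrow> S \<subseteq> H \<Longrightarrow> Collect (cocycle K {\<zero>\<^bsub>E\<^esub>} i) \<subseteq> H"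
    using fg unfolding ext_fin_gen_def by blast
  have push: "cocycle (Fr J) K (Suc i) (\<lambda>x. \<delta> i (f x))" if f: "cocycle K {\<zero>\<^bsub>E\<^esub>} i f" for f
    using module_hom_comp[OF cocycleD(1)[OF f] \<delta>_hom] cocycleD(3)[OF f]
      \<delta>\<delta>[OF module_hom_closed[OF cocycleD(1)[OF f] cE]] by (intro cocycleI) auto
  show ?thesis
    unfolding ext_fin_gen_def
  proof (intro exI[of _ "(\<lambda>f x. \<delta> i (f x)) ` S"] conjI allI impI)
    show "(\<lambda>f x. \<delta> i (f x)) ` S \<subseteq> Collect (cocycle (Fr J) K (Suc i))"
      using S(2) push by auto
    fix H assume H: "cocycle_submod (Fr J) K (Suc i) H" and SH: "(\<lambda>f x. \<delta> i (f x)) ` S \<subseteq> H"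
    note H' = cocycle_submodD[OF H]
    define L where "L = {f. cocycle K {\<zero>\<^bsub>E\<^esub>} i f \<and> (\<lambda>x. \<delta> i (f x)) \<in> H}"
    have "cocycle_submod K {\<zero>\<^bsub>E\<^esub>} i L"
    proof (rule cocycle_submodI)
      show "(\<lambda>_. \<zero>\<^bsub>I i\<^esub>) \<in> L" unfolding L_def using H'(2) cocycle_zero by (auto simp: \<delta>_zero)
      show "(\<lambda>x. f x \<oplus>\<^bsub>I i\<^esub> g x) \<in> L" if f: "f \<in> L" and g: "g \<in> L" for f g
      proof -
        have fc: "cocycle K {\<zero>\<^bsub>E\<^esub>} i f" "cocycle K {\<zero>\<^bsub>E\<^esub>} i g" using f g unfolding L_def by auto
        have s: "cocycle K {\<zero>\<^bsub>E\<^esub>} i (\<lambda>x. f x \<oplus>\<^bsub>I i\<^esub> g x)" by (rule cocycle_add[OF KE fc])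
        have "(\<lambda>x. \<delta> i (f x) \<oplus>\<^bsub>I (Suc i)\<^esub> \<delta> i (g x)) \<in> H"
          using f g H'(3) unfolding L_def by blast
        then have "(\<lambda>x. \<delta> i (f x \<oplus>\<^bsub>I i\<^esub> g x)) \<in> H"
        proof (rule cocycle_submod_cong[OF H FE _ push[OF s]])
          fix a assume "a \<in> Fr J"
          then show "\<delta> i (f a) \<oplus>\<^bsub>I (Suc i)\<^esub> \<delta> i (g a) = \<delta> i (f a \<oplus>\<^bsub>I i\<^esub> g a)"
            using module_hom_add[OF \<delta>_hom module_hom_closed[OF cocycleD(1)[OF fc(1)] cE]
              module_hom_closed[OF cocycleD(1)[OF fc(2)] cE]] by simp
        qed
        with s show ?thesis unfolding L_def by blast
      qed
      show "(\<lambda>x. r \<odot>\<^bsub>I i\<^esub> f x) \<in> L" if r: "r \<in> carrier R" and f: "f \<in> L" for r f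
      proof -
        have fc: "cocycle K {\<zero>\<^bsub>E\<^esub>} i f" using f unfolding L_def by auto
        have s: "cocycle K {\<zero>\<^bsub>E\<^esub>} i (\<lambda>x. r \<odot>\<^bsub>I i\<^esub> f x)" by (rule cocycle_smult[OF KE fc r])
        have "(\<lambda>x. r \<odot>\<^bsub>I (Suc i)\<^esub> \<delta> i (f x)) \<in> H"
          using f r H'(4) unfolding L_def by blast
        then have "(\<lambda>x. \<delta> i (r \<odot>\<^bsub>I i\<^esub> f x)) \<in> H"
        proof (rule cocycle_submod_cong[OF H FE _ push[OF s]])
          fix a assume "a \<in> Fr J"
          then show "r \<odot>\<^bsub>I (Suc i)\<^esub> \<delta> i (f a) = \<delta> i (r \<odot>\<^bsub>I i\<^esub> f a)"
            using module_hom_smult[OF \<delta>_hom r module_hom_closed[OF cocycleD(1)[OF fc] cE]] by simp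
        qed
        with s show ?thesis unfolding L_def by blast
      qed
      show "g \<in> L" if f: "f \<in> L" and g: "cocycle K {\<zero>\<^bsub>E\<^esub>} i g"
        and cob: "coboundary K {\<zero>\<^bsub>E\<^esub>} i (\<lambda>x. f x \<ominus>\<^bsub>I i\<^esub> g x)" for f g
      proof -
        have fc: "cocycle K {\<zero>\<^bsub>E\<^esub>} i f" and fH: "(\<lambda>x. \<delta> i (f x)) \<in> H" using f unfolding L_def by auto
        have d: "(\<lambda>x. f x \<ominus>\<^bsub>I i\<^esub> g x) \<in> module_hom R E (I i)"
          by (rule I.module_hom_minus[OF cocycleD(1)[OF fc] cocycleD(1)[OF g]])
        have \<delta>d: "\<delta> i (f a) \<ominus>\<^bsub>I (Suc i)\<^esub> \<delta> i (g a) = \<delta> i (f a \<ominus>\<^bsub>I i\<^esub> g a)" if "a \<in> Fr J" for a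
          using module_hom_diff[OF I_module I_module \<delta>_hom module_hom_closed[OF cocycleD(1)[OF fc] cE[OF that]]
              module_hom_closed[OF cocycleD(1)[OF g] cE[OF that]]] by simp
        \<comment> \<open>The connecting homomorphism respects cohomology classes: if
          \<open>f - g\<close> is \<open>\<delta> h\<close> on \<open>K\<close>, then
          \<open>f - g - \<delta> h\<close> kills \<open>K\<close> and has the same image under
          \<open>\<delta>\<close> as \<open>f - g\<close>.\<close>
        have "\<exists>h\<in>module_hom R E (I i). (\<forall>b\<in>K. h b = \<zero>\<^bsub>I i\<^esub>) \<and>
            (\<forall>a\<in>Fr J. \<delta> i (f a \<ominus>\<^bsub>I i\<^esub> g a) = \<delta> i (h a))"
        proof (cases i)
          case 0
          with cob d show ?thesis unfolding coboundary_def 0 by (intro bexI[OF _ d[unfolded 0]]) auto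
        next
          case (Suc j)
          obtain h where h: "h \<in> module_hom R E (I j)" "\<And>a. a \<in> K \<Longrightarrow> f a \<ominus>\<^bsub>I i\<^esub> g a = \<delta> j (h a)"
            using cob unfolding coboundary_def Suc by auto
          have \<delta>h: "(\<lambda>x. \<delta> j (h x)) \<in> module_hom R E (I i)"
            unfolding Suc by (rule module_hom_comp[OF h(1) \<delta>_hom])
          show ?thesis
          proof (intro bexI conjI ballI)
            show "(\<lambda>x. (f x \<ominus>\<^bsub>I i\<^esub> g x) \<ominus>\<^bsub>I i\<^esub> \<delta> j (h x)) \<in> module_hom R E (I i)"
              by (rule I.module_hom_minus[OF d \<delta>h])
            show "f b \<ominus>\<^bsub>I i\<^esub> g b \<ominus>\<^bsub>I i\<^esub> \<delta> j (h b) = \<zero>\<^bsub>I i\<^esub>" if "b \<in> K" for b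
              using h(2)[OF that] module_hom_closed[OF \<delta>h, of b] that KE by (auto simp: I.M.diff_self)
            fix a assume a: "a \<in> Fr J"
            have "\<delta> i (\<delta> j (h a)) = \<zero>\<^bsub>I (Suc i)\<^esub>"
              unfolding Suc by (rule \<delta>\<delta>[OF module_hom_closed[OF h(1) cE[OF a]]])
            then show "\<delta> i (f a \<ominus>\<^bsub>I i\<^esub> g a) = \<delta> i (f a \<ominus>\<^bsub>I i\<^esub> g a \<ominus>\<^bsub>I i\<^esub> \<delta> j (h a))"
              using module_hom_diff[OF I_module I_module \<delta>_hom module_hom_closed[OF d cE[OF a]]
                  module_hom_closed[OF \<delta>h cE[OF a]]]
                module_hom_closed[OF \<delta>_hom module_hom_closed[OF d cE[OF a]]]
              by (simp add: I'.M.diff_zero_right)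
          qed
        qed
        then have "coboundary (Fr J) K (Suc i) (\<lambda>x. \<delta> i (f x) \<ominus>\<^bsub>I (Suc i)\<^esub> \<delta> i (g x))"
          unfolding coboundary_def by (simp add: \<delta>d)
        then have "(\<lambda>x. \<delta> i (g x)) \<in> H" by (rule H'(5)[OF fH push[OF g]])
        with g show ?thesis unfolding L_def by blast
      qed
    qed (auto simp: L_def)
    moreover have "S \<subseteq> L" unfolding L_def using S(2) SH by auto
    ultimately have all: "Collect (cocycle K {\<zero>\<^bsub>E\<^esub>} i) \<subseteq> L" by (rule S(3))
    show "Collect (cocycle (Fr J) K (Suc i)) \<subseteq> H"
    proof
      fix f assume "f \<in> Collect (cocycle (Fr J) K (Suc i))"
      then have f: "cocycle (Fr J) K (Suc i) f" by simp
      note fc = cocycleD[OF f]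
      \<comment> \<open>Surjectivity of the connecting homomorphism: over the free module the
        cocycle is some \<open>\<delta> u\<close>, and \<open>u\<close> restricted to
        \<open>K\<close> is a cocycle because \<open>f\<close> kills \<open>K\<close>.\<close>
      have "cocycle (Fr J) {\<zero>\<^bsub>E\<^esub>} (Suc i) f"
        using fc module_hom_zero[OF E_module I_module fc(1)] by (intro cocycleI) auto
      then obtain u where u: "u \<in> module_hom R E (I i)" "\<And>a. a \<in> Fr J \<Longrightarrow> f a = \<delta> i (u a)"
        by (rule ext_zeroE[OF ext_zero_free[OF J]]) auto
      have "cocycle K {\<zero>\<^bsub>E\<^esub>} i u"
        using u fc(2) K module_hom_zero[OF E_module I_module u(1)] by (intro cocycleI) (auto simp: subset_iff)
      then have "(\<lambda>x. \<delta> i (u x)) \<in> H" using all unfolding L_def by auto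
      then show "f \<in> H" by (rule cocycle_submod_cong[OF H FE _ f]) (simp add: u(2))
    qed
  qed (use S(1) in simp)
qed

text \<open>In degree 0 a cocycle maps to the kernel of \<open>\<delta> 0\<close>, which is a copy
  of \<open>R\<close>. Its values on the basis form a vector in \<open>R^n\<close>, and the vectors
  that occur form a submodule, finitely generated since \<open>R\<close> is Noetherian.\<close>

lemma ext_fin_gen_0:
  fixes K :: "(nat \<Rightarrow> 'a) set"
  shows "ext_fin_gen (Fr {..<n}) K 0"
proof -
  interpret E: module R "E :: ('a, nat \<Rightarrow> 'a) module" by (rule E_module)
  interpret I: module R "I 0" by (rule I_module)
  have FE: "Fr {..<n} \<subseteq> carrier E" by (rule free_module_mono) simp
  have bc: "basis_vec R j \<in> Fr {..<n}" if "j < n" for j using that by (intro basis_vec_carrier) simp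
  have bE: "basis_vec R j \<in> carrier E" for j :: nat by (intro basis_vec_carrier) simp
  define val where "val = (\<lambda>(u :: nat \<Rightarrow> 'a) (f :: (nat \<Rightarrow> 'a) \<Rightarrow> 'i). u \<in> Fr {..<n} \<and> (\<forall>j<n. \<eta> (u j) = f (basis_vec R j)))"
  have sub: "submodule {u. \<exists>f\<in>Q. val u f} R E"
    if Q: "Q \<subseteq> module_hom R E (I 0)" "(\<lambda>_. \<zero>\<^bsub>I 0\<^esub>) \<in> Q"
      "\<And>f g. f \<in> Q \<Longrightarrow> g \<in> Q \<Longrightarrow> (\<lambda>x. f x \<oplus>\<^bsub>I 0\<^esub> g x) \<in> Q"
      "\<And>r f. r \<in> carrier R \<Longrightarrow> f \<in> Q \<Longrightarrow> (\<lambda>x. r \<odot>\<^bsub>I 0\<^esub> f x) \<in> Q" for Q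
  proof -
    note F = E.submodD[OF submod_free[OF subset_UNIV, of "{..<n}"]]
    show ?thesis
    proof (rule E.submodI)
      show "{u. \<exists>f\<in>Q. val u f} \<subseteq> carrier E" using FE unfolding val_def by auto
      show "\<zero>\<^bsub>E\<^esub> \<in> {u. \<exists>f\<in>Q. val u f}"
        using F(2) Q(2) module_hom_zero[OF ring_module_is_module I_module \<eta>_hom] unfolding val_def by auto
      fix u assume "u \<in> {u. \<exists>f\<in>Q. val u f}"
      then obtain f where f: "f \<in> Q" "val u f" by auto
      have u: "u \<in> Fr {..<n}" using f unfolding val_def by auto
      show "u \<oplus>\<^bsub>E\<^esub> v \<in> {u. \<exists>f\<in>Q. val u f}" if v: "v \<in> {u. \<exists>f\<in>Q. val u f}" for v
      proof -
        obtain g where g: "g \<in> Q" "val v g" using v by auto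
        have vF: "v \<in> Fr {..<n}" using g unfolding val_def by auto
        have "val (u \<oplus>\<^bsub>E\<^esub> v) (\<lambda>x. f x \<oplus>\<^bsub>I 0\<^esub> g x)"
          using F(3)[OF u vF] f(2) g(2) unfolding val_def
          using module_hom_add[OF \<eta>_hom] free_module_closed[OF u] free_module_closed[OF vF] by simp
        then show ?thesis using Q(3)[OF f(1) g(1)] by blast
      qed
      show "r \<odot>\<^bsub>E\<^esub> u \<in> {u. \<exists>f\<in>Q. val u f}" if r: "r \<in> carrier R" for r
      proof -
        have "val (r \<odot>\<^bsub>E\<^esub> u) (\<lambda>x. r \<odot>\<^bsub>I 0\<^esub> f x)"
          using F(5)[OF r u] f(2) unfolding val_def
          using module_hom_smult[OF \<eta>_hom r] free_module_closed[OF u] by simp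
        then show ?thesis using Q(4)[OF r f(1)] by blast
      qed
    qed
  qed
  let ?Z = "Collect (cocycle (Fr {..<n}) K 0)"
  have sZ: "submodule {u. \<exists>f\<in>?Z. val u f} R E"
    using cocycle_add[OF FE] cocycle_smult[OF FE] cocycleD(1) cocycle_zero by (intro sub) auto
  have "{u. \<exists>f\<in>?Z. val u f} \<subseteq> Fr {..<n}" unfolding val_def by auto
  from submodule_fin_gen[OF sZ this] obtain T where T: "finite T" "T \<subseteq> carrier E"
    "span_module R E T = {u. \<exists>f\<in>?Z. val u f}" by blast
  have "\<forall>u\<in>T. \<exists>f\<in>?Z. val u f" using E.submod_span(2)[OF T(2)] T(3) by blast
  then obtain s where s: "\<And>u. u \<in> T \<Longrightarrow> s u \<in> ?Z" "\<And>u. u \<in> T \<Longrightarrow> val u (s u)" by metis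
  show ?thesis
    unfolding ext_fin_gen_def
  proof (intro exI[of _ "s ` T"] conjI allI impI)
    show "finite (s ` T)" "s ` T \<subseteq> ?Z" using T(1) s(1) by auto
    fix H assume H: "cocycle_submod (Fr {..<n}) K 0 H" and TH: "s ` T \<subseteq> H"
    note H' = cocycle_submodD[OF H]
    have sH: "submodule {u. \<exists>f\<in>H. val u f} R E"
    proof (rule sub)
      show "H \<subseteq> module_hom R E (I 0)" using cocycleD(1)[OF H'(1)] by blast
    qed (fact H'(2-4))+
    have "T \<subseteq> {u. \<exists>f\<in>H. val u f}" using s(2) TH by blast
    from E.submod_span(3)[OF T(2) sH this]
    have le: "{u. \<exists>f\<in>?Z. val u f} \<subseteq> {u. \<exists>f\<in>H. val u f}" unfolding T(3) .
    show "?Z \<subseteq> H"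
    proof
      fix f assume "f \<in> ?Z"
      then have f: "cocycle (Fr {..<n}) K 0 f" by simp
      note fc = cocycleD[OF f]
      have "\<exists>r\<in>carrier R. f (basis_vec R j) = \<eta> r" if "j < n" for j
        using fc(3)[OF bc[OF that]] module_hom_closed[OF fc(1) bE] by (intro ker_\<delta>0) auto
      then obtain r where r: "\<And>j. j < n \<Longrightarrow> r j \<in> carrier R" "\<And>j. j < n \<Longrightarrow> f (basis_vec R j) = \<eta> (r j)"
        by metis
      define u where "u = (\<lambda>j. if j < n then r j else \<zero>)"
      have "val u f" unfolding val_def u_def using r by (auto simp: free_module_carrier_finite)
      then obtain h where h: "h \<in> H" "val u h" using le f by blast
      have "h (basis_vec R j) = f (basis_vec R j)" if "j < n" for j
        using \<open>val u f\<close> h(2) that unfolding val_def by auto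
      then have "h a = f a" if "a \<in> Fr {..<n}" for a
        using that by (intro module_hom_eqI[OF I_module cocycleD(1)[OF H'(1)[OF h(1)]] fc(1) _ _ that]) auto
      then show "f \<in> H" by (rule cocycle_submod_cong[OF H FE h(1) f])
    qed
  qed
qed

text \<open>Induction on the degree, for all ranks and submodules at once: \<open>K\<close> is an
  image of some \<open>R^n'\<close>, hence isomorphic to a quotient of it, to which the induction
  hypothesis applies one degree lower.\<close>

lemma ext_fin_gen_free:
  fixes K :: "(nat \<Rightarrow> 'a) set"
  assumes "submodule K R E" "K \<subseteq> Fr {..<n}"
  shows "ext_fin_gen (Fr {..<n}) K i"
  using assms
proof (induct i arbitrary: n K)
  case 0
  show ?case by (rule ext_fin_gen_0)
next
  case (Suc i)
  obtain n' \<phi> where \<phi>: "\<phi> \<in> module_hom R E E" "\<phi> ` Fr {..<n'::nat} = K"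
    by (rule submodule_presentation[OF Suc(2,3)])
  have F: "submodule (Fr {..<n'}) R E" by (rule submod_free) simp
  have "ext_fin_gen (Fr {..<n'}) {u \<in> Fr {..<n'}. \<phi> u = \<zero>\<^bsub>E\<^esub>} i"
    by (rule Suc(1)[OF ker_submodule[OF \<phi>(1) F]]) auto
  from ext_fin_gen_iso[OF subquot_iso_image[OF \<phi>(1) F] this]
  have "ext_fin_gen K {\<zero>\<^bsub>E\<^esub>} i" unfolding \<phi>(2) .
  from ext_fin_gen_step[OF _ Suc(3) this] show ?case by simp
qed

end

section \<open>Vanishing of Ext for maximal Cohen--Macaulay modules\<close>

context local_gorenstein
begin

text \<open>The submodule \<open>x A + B\<close>. The quotient of \<open>A\<close> by it is
  \<open>A/B\<close> modulo \<open>x\<close>.\<close>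

definition add_scale :: "'a \<Rightarrow> (nat \<Rightarrow> 'a) set \<Rightarrow> (nat \<Rightarrow> 'a) set \<Rightarrow> (nat \<Rightarrow> 'a) set" where
  "add_scale x A B = {x \<odot>\<^bsub>E\<^esub> a \<oplus>\<^bsub>E\<^esub> b | a b. a \<in> A \<and> b \<in> B}"

lemma scale_hom: "x \<in> carrier R \<Longrightarrow> (\<lambda>u. x \<odot>\<^bsub>E\<^esub> u) \<in> module_hom R E E"
proof -
  interpret E: module R "E :: ('a, 'b \<Rightarrow> 'a) module" by (rule E_module)
  show "x \<in> carrier R \<Longrightarrow> (\<lambda>u. x \<odot>\<^bsub>E\<^esub> u) \<in> module_hom R (E :: ('a, 'b \<Rightarrow> 'a) module) E"
    by (rule E.module_hom_smult_map[OF module_hom_id])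
qed

lemma add_scale:
  assumes A: "submodule A R E" and B: "submodule B R E" and BA: "B \<subseteq> A" and x: "x \<in> carrier R"
  shows add_scale_submodule: "submodule (add_scale x A B) R E"
    and add_scale_lower: "B \<subseteq> add_scale x A B"
    and add_scale_upper: "add_scale x A B \<subseteq> A"
    and add_scale_iso: "subquot_iso (\<lambda>u. x \<odot>\<^bsub>E\<^esub> u) A {a \<in> A. x \<odot>\<^bsub>E\<^esub> a \<in> B} (add_scale x A B) B"
proof -
  interpret E: module R "E :: ('a, nat \<Rightarrow> 'a) module" by (rule E_module)
  note A' = E.submodD[OF A] and B' = E.submodD[OF B]
  have Bc: "b \<in> carrier E" if "b \<in> B" for b using B'(1) that by auto
  have eq: "add_scale x A B = {a \<oplus>\<^bsub>E\<^esub> b | a b. a \<in> (\<lambda>u. x \<odot>\<^bsub>E\<^esub> u) ` A \<and> b \<in> B}"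
    unfolding add_scale_def by blast
  show sub: "submodule (add_scale x A B) R E"
    unfolding eq by (rule E.submod_sum[OF submod_image[OF E_module E_module scale_hom[OF x] A] B])
  have lo: "x \<odot>\<^bsub>E\<^esub> \<zero>\<^bsub>E\<^esub> \<oplus>\<^bsub>E\<^esub> b = b" if "b \<in> B" for b
    using E.smult_r_null[OF x] E.M.l_zero[OF Bc[OF that]] by (simp only:)
  show low: "B \<subseteq> add_scale x A B"
  proof
    fix b assume b: "b \<in> B"
    show "b \<in> add_scale x A B"
      unfolding add_scale_def using lo[OF b] A'(2) b
      by (intro CollectI exI[of _ "\<zero>\<^bsub>E\<^esub>"] exI[of _ b]) (simp del: free_module_simps)
  qed
  show "add_scale x A B \<subseteq> A"
  proof
    fix v assume "v \<in> add_scale x A B"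
    then obtain a b where "a \<in> A" "b \<in> B" "v = x \<odot>\<^bsub>E\<^esub> a \<oplus>\<^bsub>E\<^esub> b" unfolding add_scale_def by blast
    then show "v \<in> A" using A'(3)[OF A'(5)[OF x]] BA by blast
  qed
  show "subquot_iso (\<lambda>u. x \<odot>\<^bsub>E\<^esub> u) A {a \<in> A. x \<odot>\<^bsub>E\<^esub> a \<in> B} (add_scale x A B) B"
  proof (rule subquot_isoI[OF scale_hom[OF x] A sub B _ low])
    fix a assume a: "a \<in> A"
    have "x \<odot>\<^bsub>E\<^esub> a = x \<odot>\<^bsub>E\<^esub> a \<oplus>\<^bsub>E\<^esub> \<zero>\<^bsub>E\<^esub>"
      using E.M.r_zero[OF E.smult_closed[OF x]] a A'(1) by (simp only: subset_iff)
    then show "x \<odot>\<^bsub>E\<^esub> a \<in> add_scale x A B"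
      unfolding add_scale_def using a B'(2) by blast
  next
    fix v assume "v \<in> add_scale x A B"
    then show "\<exists>a\<in>A. \<exists>b\<in>B. v = x \<odot>\<^bsub>E\<^esub> a \<oplus>\<^bsub>E\<^esub> b" unfolding add_scale_def by blast
  qed auto
qed

text \<open>From \<open>0 -> F/K -> F/K -> F/(xF + K) -> 0\<close> with multiplication by
  \<open>x\<close> as first map: \<open>Ext\<close> of the last term vanishes in degree
  \<open>l + 2\<close>, so \<open>x\<close> acts surjectively on \<open>Ext\<close> of
  \<open>F/K\<close> in degree \<open>l + 1\<close>, and Nakayama's lemma applies.\<close>

lemma ext_zero_nakayama:
  fixes K :: "(nat \<Rightarrow> 'a) set"
  assumes K: "submodule K R E" "K \<subseteq> Fr {..<n}" and x: "x \<in> m"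
    and reg: "\<And>a. a \<in> Fr {..<n} \<Longrightarrow> x \<odot>\<^bsub>E\<^esub> a \<in> K \<Longrightarrow> a \<in> K"
    and ext: "ext_zero (Fr {..<n}) (add_scale x (Fr {..<n}) K) (Suc l)"
  shows "ext_zero (Fr {..<n}) K l"
  unfolding ext_zero_def
proof (intro allI impI)
  interpret E: module R "E :: ('a, nat \<Rightarrow> 'a) module" by (rule E_module)
  interpret I: module R "I (Suc l)" by (rule I_module)
  interpret I': module R "I (Suc (Suc l))" by (rule I_module)
  let ?A = "Fr {..<n}"
  have A: "submodule ?A R E" by (rule submod_free) simp
  have AE: "?A \<subseteq> carrier E" using E.submodD(1)[OF A] .
  have cE: "a \<in> carrier E" if "a \<in> ?A" for a using AE that by auto
  have xR: "x \<in> carrier R" using x ideal.Icarr[OF m_ideal] by simp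
  note S = add_scale[OF A K xR]
  have ker: "{a \<in> ?A. x \<odot>\<^bsub>E\<^esub> a \<in> K} = K" using reg K(2) E.submodD(5)[OF K(1) xR] by blast
  note iso = S(4)[unfolded ker]
  fix f assume f: "cocycle ?A K (Suc l) f"
  show "coboundary ?A K (Suc l) f"
  proof (rule ext_nakayama[OF AE x ext_fin_gen_free[OF K] _ f])
    fix f assume f: "cocycle ?A K (Suc l) f"
    note fc = cocycleD[OF f]
    \<comment> \<open>Division of \<open>f\<close> by \<open>x\<close>, so far only as a cocycle on
      \<open>xF + K\<close>. Its image \<open>\<delta> h\<close> is the obstruction to extending it,
      and it bounds by hypothesis.\<close>
    obtain h where h: "cocycle (add_scale x ?A K) K (Suc l) h" "\<And>a. a \<in> ?A \<Longrightarrow> h (x \<odot>\<^bsub>E\<^esub> a) = f a"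
      by (rule cocycle_lift[OF iso f]) blast
    note hc = cocycleD[OF h(1)]
    have "cocycle ?A (add_scale x ?A K) (Suc (Suc l)) (\<lambda>y. \<delta> (Suc l) (h y))"
      using module_hom_comp[OF hc(1) \<delta>_hom] hc(3) \<delta>\<delta>[OF module_hom_closed[OF hc(1) cE]]
      by (intro cocycleI) auto
    then obtain u where u: "u \<in> module_hom R E (I (Suc l))"
      "\<And>b. b \<in> add_scale x ?A K \<Longrightarrow> u b = \<zero>\<^bsub>I (Suc l)\<^esub>"
      "\<And>a. a \<in> ?A \<Longrightarrow> \<delta> (Suc l) (h a) = \<delta> (Suc l) (u a)"
      by (rule ext_zeroE[OF ext]) auto
    \<comment> \<open>Subtracting \<open>u\<close>, which kills \<open>xF + K\<close>, leaves the
      values there unchanged and makes \<open>h\<close> a cocycle on all of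
      \<open>F\<close>.\<close>
    define g where "g = (\<lambda>y. h y \<ominus>\<^bsub>I (Suc l)\<^esub> u y)"
    have g: "g \<in> module_hom R E (I (Suc l))"
      unfolding g_def by (rule I.module_hom_minus[OF hc(1) u(1)])
    have "cocycle ?A K (Suc l) g"
    proof (rule cocycleI[OF g])
      show "g b = \<zero>\<^bsub>I (Suc l)\<^esub>" if "b \<in> K" for b
        using hc(2)[OF that] u(2)[of b] S(2) that unfolding g_def by (auto simp: I.M.diff_self)
      show "\<delta> (Suc l) (g a) = \<zero>\<^bsub>I (Suc (Suc l))\<^esub>" if "a \<in> ?A" for a
        unfolding g_def
        using module_hom_diff[OF I_module I_module \<delta>_hom module_hom_closed[OF hc(1) cE[OF that]]
            module_hom_closed[OF u(1) cE[OF that]]] u(3)[OF that]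
          module_hom_closed[OF \<delta>_hom module_hom_closed[OF u(1) cE[OF that]]]
        by (simp add: I'.M.diff_self)
    qed
    moreover have "coboundary ?A K (Suc l) (\<lambda>y. f y \<ominus>\<^bsub>I (Suc l)\<^esub> x \<odot>\<^bsub>I (Suc l)\<^esub> g y)"
    proof (rule coboundary_cong[OF coboundary_zero])
      fix a assume a: "a \<in> ?A"
      have xa: "x \<odot>\<^bsub>E\<^esub> a \<in> add_scale x ?A K" using subquot_isoD(7)[OF iso a] .
      have "x \<odot>\<^bsub>I (Suc l)\<^esub> g a = g (x \<odot>\<^bsub>E\<^esub> a)"
        by (rule module_hom_smult[OF g xR cE[OF a], symmetric])
      also have "\<dots> = f a \<ominus>\<^bsub>I (Suc l)\<^esub> \<zero>\<^bsub>I (Suc l)\<^esub>"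
        unfolding g_def h(2)[OF a] u(2)[OF xa] ..
      also have "\<dots> = f a" by (rule I.M.diff_zero_right[OF module_hom_closed[OF fc(1) cE[OF a]]])
      finally show "f a \<ominus>\<^bsub>I (Suc l)\<^esub> x \<odot>\<^bsub>I (Suc l)\<^esub> g a = \<zero>\<^bsub>I (Suc l)\<^esub>"
        using I.M.diff_self[OF module_hom_closed[OF fc(1) cE[OF a]]] by simp
    qed
    ultimately show "\<exists>g. cocycle ?A K (Suc l) g \<and>
        coboundary ?A K (Suc l) (\<lambda>y. f y \<ominus>\<^bsub>I (Suc l)\<^esub> x \<odot>\<^bsub>I (Suc l)\<^esub> g y)" by blast
  qed
qed

section \<open>Cyclic modules and filtrations by them\<close>

text \<open>The ideal \<open>J\<close> as a submodule of the free module of rank one, so that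
  \<open>Fr {..<1}\<close> modulo \<open>cyc J\<close> is \<open>R/J\<close>.\<close>

definition cyc :: "'a set \<Rightarrow> (nat \<Rightarrow> 'a) set" where
  "cyc J = {u \<in> Fr {..<1}. u 0 \<in> J}"

definition axis :: "'a \<Rightarrow> nat \<Rightarrow> 'a" where
  "axis r = (\<lambda>n. if n = 0 then r else \<zero>)"

lemma axis_mem: "r \<in> carrier R \<Longrightarrow> axis r \<in> Fr {..<1}"
  by (simp add: free_module_carrier_finite axis_def)

lemma axis_eq: "u \<in> Fr {..<1} \<Longrightarrow> u = axis (u 0)"
  by (auto simp: free_module_carrier_finite axis_def fun_eq_iff)

lemma axis_cyc: "r \<in> carrier R \<Longrightarrow> axis r \<in> cyc J \<longleftrightarrow> r \<in> J"
  unfolding cyc_def using axis_mem by (simp add: axis_def)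

lemma cyc_submodule: "ideal J R \<Longrightarrow> submodule (cyc J) R E"
  unfolding cyc_def ideal_iff_submodule
  by (rule submod_preimage[OF E_module ring_module_is_module coord_hom submod_free]) simp_all

lemma cyc_subset: "cyc J \<subseteq> Fr {..<1}"
  unfolding cyc_def by auto

lemma add_scale_cyc:
  assumes J: "ideal J R" and x: "x \<in> carrier R"
  shows "add_scale x (Fr {..<1}) (cyc J) = cyc (add_principal x J)"
proof -
  have F: "submodule (Fr {..<1::nat}) R E" by (rule submod_free) simp
  note S = add_scale[OF F cyc_submodule[OF J] cyc_subset x]
  show ?thesis
  proof (intro equalityI subsetI)
    fix u assume u: "u \<in> add_scale x (Fr {..<1}) (cyc J)"
    then obtain a b where ab: "a \<in> Fr {..<1}" "b \<in> cyc J" "u = x \<odot>\<^bsub>E\<^esub> a \<oplus>\<^bsub>E\<^esub> b"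
      unfolding add_scale_def by blast
    then have "u 0 = x \<otimes> a 0 \<oplus> b 0" "a 0 \<in> carrier R" "b 0 \<in> J"
      unfolding cyc_def by (auto simp: free_module_closed)
    then have "u 0 \<in> add_principal x J"
      unfolding add_principal_def by blast
    then show "u \<in> cyc (add_principal x J)" using S(3) u unfolding cyc_def by auto
  next
    fix u assume u: "u \<in> cyc (add_principal x J)"
    then obtain r b where rb: "r \<in> carrier R" "b \<in> J" "u 0 = x \<otimes> r \<oplus> b"
      unfolding cyc_def add_principal_def by auto
    have bR: "b \<in> carrier R" using ideal.Icarr[OF J rb(2)] .
    have "u = x \<odot>\<^bsub>E\<^esub> axis r \<oplus>\<^bsub>E\<^esub> axis b"
      using axis_eq[of u] u rb x bR unfolding cyc_def by (auto simp: axis_def fun_eq_iff)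
    then show "u \<in> add_scale x (Fr {..<1}) (cyc J)"
      unfolding add_scale_def using axis_mem[OF rb(1)] axis_cyc[OF bR] rb(2) by blast
  qed
qed

lemma scale_cyc_mem:
  assumes "a \<in> Fr {..<1}" "x \<in> carrier R" "ideal J R"
  shows "x \<odot>\<^bsub>E\<^esub> a \<in> cyc J \<longleftrightarrow> x \<otimes> a 0 \<in> J"
proof -
  interpret E: module R "E :: ('a, nat \<Rightarrow> 'a) module" by (rule E_module)
  have "submodule (Fr {..<1::nat}) R E" by (rule submod_free) simp
  then have "x \<odot>\<^bsub>E\<^esub> a \<in> Fr {..<1}" using E.submodD(5) assms by blast
  then show ?thesis unfolding cyc_def by simp
qed

lemma scale_cyc_colon:
  assumes "x \<in> carrier R" "ideal J R"
  shows "{a \<in> Fr {..<1}. x \<odot>\<^bsub>E\<^esub> a \<in> cyc J} = cyc (colon J x)"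
  using scale_cyc_mem[OF _ assms] unfolding colon_def
  by (auto simp: cyc_def[of "{r \<in> carrier R. x \<otimes> r \<in> J}"] free_module_closed simp del: free_module_simps)

text \<open>Multiplication by \<open>x\<close> induces an isomorphism from \<open>R/(J : x)\<close>
  to \<open>(xR + J)/J\<close>.\<close>

lemma ext_zero_cyclic_iso:
  assumes "x \<in> carrier R" "ideal J R"
  shows "ext_zero (Fr {..<1}) (cyc (colon J x)) l \<longleftrightarrow> ext_zero (cyc (add_principal x J)) (cyc J) l"
proof -
  have F: "submodule (Fr {..<1::nat}) R E" by (rule submod_free) simp
  note S = add_scale[OF F cyc_submodule[OF assms(2)] cyc_subset assms(1)]
  show ?thesis
    using ext_zero_iso[OF S(4)] unfolding scale_cyc_colon[OF assms] add_scale_cyc[OF assms(2,1)] .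
qed

text \<open>Induction on the number of generators. \<open>R^(n+1)/K\<close> has the submodule
  generated by the first \<open>n\<close> basis vectors, which is a quotient of \<open>R^n\<close>,
  and the quotient by it is \<open>R/J\<close>, with \<open>J\<close> the ideal of last coordinates
  of \<open>K\<close>.\<close>

lemma ext_zero_from_cyclic:
  fixes K :: "(nat \<Rightarrow> 'a) set"
  assumes cyclic: "\<And>J. ideal J R \<Longrightarrow> ext_zero (Fr {..<1}) (cyc J) l"
    and K: "submodule K R E" "K \<subseteq> Fr {..<n}"
  shows "ext_zero (Fr {..<n}) K l"
  using K
proof (induct n arbitrary: K)
  interpret E: module R "E :: ('a, nat \<Rightarrow> 'a) module" by (rule E_module)
  case 0
  have "Fr {..<0::nat} = {\<zero>\<^bsub>E\<^esub>}" by (auto simp: free_module_carrier_finite fun_eq_iff)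
  then have "K = Fr {..<0}"
    using 0(2) subset_singletonD[of K "\<zero>\<^bsub>E\<^esub>"] E.submodD(2)[OF 0(1)] by (metis empty_iff)
  then show ?case by (simp add: ext_zero_self)
next
  interpret E: module R "E :: ('a, nat \<Rightarrow> 'a) module" by (rule E_module)
  case (Suc n)
  note K = E.submodD[OF Suc(2)]
  note F = E.submodD[OF Fr_submodule[of "{..<n}"]] and F' = E.submodD[OF Fr_submodule[of "{..<Suc n}"]]
  have FF: "Fr {..<n} \<subseteq> Fr {..<Suc n}" by (rule free_module_mono) auto
  let ?L = "{u \<in> Fr {..<n}. u \<in> K}"
  let ?D = "{u \<oplus>\<^bsub>E\<^esub> v | u v. u \<in> Fr {..<n} \<and> v \<in> K}"
  have L: "submodule ?L R E"
    by (rule submod_preimage[OF E_module E_module module_hom_id Fr_submodule Suc(2)])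
  have D: "submodule ?D R E" by (rule E.submod_sum[OF Fr_submodule Suc(2)])
  have KD: "K \<subseteq> ?D"
  proof
    fix v assume v: "v \<in> K"
    have "v = \<zero>\<^bsub>E\<^esub> \<oplus>\<^bsub>E\<^esub> v" using E.M.l_zero[of v] v K(1) by (auto simp del: free_module_simps)
    then show "v \<in> ?D" using v F(2) by blast
  qed
  have FD: "Fr {..<n} \<subseteq> ?D"
  proof
    fix v assume v: "v \<in> Fr {..<n}"
    have "v = v \<oplus>\<^bsub>E\<^esub> \<zero>\<^bsub>E\<^esub>" using E.M.r_zero[of v] v F(1) by (auto simp del: free_module_simps)
    then show "v \<in> ?D" using v K(2) by blast
  qed
  have DF: "?D \<subseteq> Fr {..<Suc n}" using F'(3) FF Suc(3) by blast
  \<comment> \<open>The second isomorphism theorem; the identity serves as the ambient map.\<close>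
  have "subquot_iso (\<lambda>u. u) (Fr {..<n}) ?L ?D K"
    by (rule subquot_isoI[OF module_hom_id Fr_submodule D Suc(2) _ KD]) (use FD in blast)+
  from ext_zero_iso[OF this] have DK: "ext_zero ?D K l" using Suc(1)[OF L] by blast
  define J where "J = (\<lambda>u. u n) ` K"
  have J: "ideal J R"
    unfolding ideal_iff_submodule J_def
    by (rule submod_image[OF E_module ring_module_is_module coord_hom Suc(2)])
  define e :: "'a \<Rightarrow> nat \<Rightarrow> 'a" where "e = (\<lambda>r j. if j = n then r else \<zero>)"
  have eF: "e r \<in> Fr {..<Suc n}" if "r \<in> carrier R" for r
    using that by (simp add: free_module_carrier_finite e_def)
  have drop: "u \<ominus>\<^bsub>E\<^esub> v \<in> Fr {..<n}" if "u \<in> Fr {..<Suc n}" "v \<in> Fr {..<Suc n}" "u n = v n" for u v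
  proof -
    have uv: "u \<in> carrier E" "v \<in> carrier E" using that F'(1) by auto
    have "u \<ominus>\<^bsub>E\<^esub> v \<in> Fr {..<Suc n}" using F'(4) that by blast
    moreover have "(u \<ominus>\<^bsub>E\<^esub> v) n = \<zero>"
      using that(3) free_module_closed[OF uv(2)] by (simp add: free_module_diff[OF uv] diff_self)
    ultimately show ?thesis by (simp add: free_module_carrier_finite less_Suc_eq) metis
  qed
  have e_hom: "(\<lambda>u :: nat \<Rightarrow> 'a. e (u 0)) \<in> module_hom R E E"
  proof (rule module_homI)
    fix u :: "nat \<Rightarrow> 'a" assume "u \<in> carrier E"
    then have "u 0 \<in> carrier R" by (rule free_module_closed)
    then show "e (u 0) \<in> carrier E" using subsetD[OF F'(1) eF] by blast
  qed (auto simp: e_def fun_eq_iff)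
  \<comment> \<open>The generator of \<open>R/J\<close> is sent to the last basis vector.\<close>
  have "subquot_iso (\<lambda>u. e (u 0)) (Fr {..<1}) (cyc J) (Fr {..<Suc n}) ?D"
  proof (rule subquot_isoI[OF e_hom Fr_submodule Fr_submodule D cyc_subset DF])
    fix u :: "nat \<Rightarrow> 'a" assume u: "u \<in> Fr {..<1}"
    have u0: "u 0 \<in> carrier R" using free_module_closed[OF u] .
    show "e (u 0) \<in> Fr {..<Suc n}" by (rule eF[OF u0])
    show "e (u 0) \<in> ?D \<longleftrightarrow> u \<in> cyc J"
    proof
      assume "e (u 0) \<in> ?D"
      then obtain a v where av: "a \<in> Fr {..<n}" "v \<in> K" "e (u 0) = a \<oplus>\<^bsub>E\<^esub> v" by blast
      have "a n = \<zero>" using free_module_eq_zero[OF av(1), of n] by simp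
      moreover have "v n \<in> carrier R" using av(2) K(1) by (auto simp: free_module_closed)
      ultimately have "u 0 = v n" using fun_cong[OF av(3), of n] by (simp add: e_def)
      then show "u \<in> cyc J" using u av(2) unfolding cyc_def J_def by auto
    next
      assume "u \<in> cyc J"
      then obtain v where v: "v \<in> K" "u 0 = v n" unfolding cyc_def J_def by auto
      have vF: "v \<in> Fr {..<Suc n}" using v Suc(3) by auto
      have d: "e (u 0) \<ominus>\<^bsub>E\<^esub> v \<in> Fr {..<n}" by (rule drop[OF eF[OF u0] vF]) (simp add: e_def v)
      have "(e (u 0) \<ominus>\<^bsub>E\<^esub> v) \<oplus>\<^bsub>E\<^esub> v = v \<oplus>\<^bsub>E\<^esub> (e (u 0) \<ominus>\<^bsub>E\<^esub> v)"
        using d F(1) v(1) K(1) by (intro E.M.a_comm) auto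
      also have "\<dots> = e (u 0)"
        using eF[OF u0] F'(1) v(1) K(1) by (intro E.M.add_diff_cancel) auto
      finally have "e (u 0) = (e (u 0) \<ominus>\<^bsub>E\<^esub> v) \<oplus>\<^bsub>E\<^esub> v" ..
      then show "e (u 0) \<in> ?D" using d v(1) by blast
    qed
  next
    fix x :: "nat \<Rightarrow> 'a" assume x: "x \<in> Fr {..<Suc n}"
    have xn: "x n \<in> carrier R" using free_module_closed[OF x] .
    have d: "x \<ominus>\<^bsub>E\<^esub> e (x n) \<in> ?D" using drop[OF x eF[OF xn]] FD by (auto simp: e_def)
    have "x = e (axis (x n) 0) \<oplus>\<^bsub>E\<^esub> (x \<ominus>\<^bsub>E\<^esub> e (x n))"
      using E.M.add_diff_cancel[OF subsetD[OF F'(1) x] subsetD[OF F'(1) eF[OF xn]]]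
      by (simp add: axis_def del: free_module_simps)
    then show "\<exists>a\<in>Fr {..<1::nat}. \<exists>b\<in>?D. x = e (a 0) \<oplus>\<^bsub>E\<^esub> b"
      by (rule bexI[OF bexI[OF _ d] axis_mem[OF xn]])
  qed
  from ext_zero_iso[OF this] have "ext_zero (Fr {..<Suc n}) ?D l" using cyclic[OF J] by simp
  then show ?case by (rule ext_zero_middle[OF KD DF F'(1) DK])
qed

end

context local_gorenstein
begin

text \<open>
  In the top degree where Ext does not vanish identically, it does not vanish on the residue field:
  a maximal ideal \<open>J\<close> with nonvanishing Ext of \<open>R/J\<close> must be the maximal ideal, since
  multiplication by an element of \<open>m\<close> outside of \<open>J\<close> would otherwise contradict Nakayama's lemma or
  the maximality of \<open>J\<close>.
\<close>

lemma ext_residue_field: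
  assumes top: "\<And>n K. submodule K R E \<Longrightarrow> K \<subseteq> Fr {..<n} \<Longrightarrow> ext_zero (Fr {..<n::nat}) K (Suc l)"
    and residue: "ext_zero (Fr {..<1}) (cyc m) l"
    and J: "ideal J R"
  shows "ext_zero (Fr {..<1}) (cyc J) l"
proof (rule ccontr)
  assume nJ: "\<not> ?thesis"
  let ?C = "{J. ideal J R \<and> \<not> ext_zero (Fr {..<1}) (cyc J) l}"
  have ne: "?C \<noteq> {}" using J nJ by auto
  have id: "ideal L R" if "L \<in> ?C" for L using that by simp
  obtain K where K1: "K \<in> ?C" and K2: "\<forall>L\<in>?C. K \<subseteq> L \<longrightarrow> L = K"
    using exists_maximal_ideal_in[OF ne id] by (rule bexE)
  have K: "ideal K R" "\<not> ext_zero (Fr {..<1}) (cyc K) l" using K1 by auto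
  have K3: "ext_zero (Fr {..<1}) (cyc L) l" if "ideal L R" "K \<subseteq> L" "L \<noteq> K" for L
    using K2 that by auto
  have "\<one> \<notin> K"
  proof
    assume "\<one> \<in> K"
    then have "K = carrier R" by (rule ideal.one_imp_carrier[OF K(1)])
    then have "cyc K = Fr {..<1}" unfolding cyc_def by (auto simp: free_module_closed)
    then show False using K(2) by (simp add: ext_zero_self)
  qed
  then have "K \<subseteq> m" by (rule proper_ideal_le_m[OF K(1)])
  moreover have "K \<noteq> m" using K(2) residue by auto
  ultimately obtain a where a: "a \<in> m" "a \<notin> K" by auto
  have aR: "a \<in> carrier R" using ideal.Icarr[OF m_ideal a(1)] .
  note ap = add_principal_mem[OF K(1) aR] and api = add_principal_ideal[OF K(1) aR]
  have colon_le: "K \<subseteq> colon K a"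
    unfolding colon_def using ideal.I_l_closed[OF K(1)] aR ideal.Icarr[OF K(1)] by auto
  show False
  proof (cases "colon K a = K")
    case True
    \<comment> \<open>Here \<open>a\<close> is regular on \<open>R/K\<close>, and \<open>Ext\<close>
      of \<open>R/(aR + K)\<close> vanishes one degree higher by the assumption
      \<open>top\<close>.\<close>
    have "ext_zero (Fr {..<1}) (cyc K) l"
    proof (rule ext_zero_nakayama[OF cyc_submodule[OF K(1)] cyc_subset a(1)])
      show "u \<in> cyc K" if u: "u \<in> Fr {..<1}" "a \<odot>\<^bsub>E\<^esub> u \<in> cyc K" for u
        using scale_cyc_colon[OF aR K(1)] u unfolding True by blast
      show "ext_zero (Fr {..<1}) (add_scale a (Fr {..<1}) (cyc K)) (Suc l)"
        unfolding add_scale_cyc[OF K(1) aR] by (rule top[OF cyc_submodule[OF api] cyc_subset])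
    qed
    with K(2) show False ..
  next
    case False
    \<comment> \<open>Here \<open>R/K\<close> is an extension of \<open>R/(aR + K)\<close> by a copy
      of \<open>R/(K : a)\<close>, and both ideals are strictly larger than
      \<open>K\<close>.\<close>
    have "ext_zero (cyc (add_principal a K)) (cyc K) l"
      using ext_zero_cyclic_iso[OF aR K(1)] K3[OF colon_ideal[OF K(1) aR] colon_le False] by simp
    moreover have "ext_zero (Fr {..<1}) (cyc (add_principal a K)) l"
      using ap a(2) by (intro K3[OF api]) auto
    moreover have "cyc K \<subseteq> cyc (add_principal a K)" using ap(2) unfolding cyc_def by auto
    ultimately have "ext_zero (Fr {..<1}) (cyc K) l"
      using ext_zero_middle[OF _ cyc_subset Fr_subset_E] by blast
    with K(2) show False ..
  qed
qed

text \<open>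
  If Ext of the residue field does not vanish in degree \<open>l + 1\<close>, which is the largest degree with
  nonvanishing Ext, then \<open>R\<close> has a regular sequence of length \<open>l + 1\<close>. Only the ideals \<open>J\<close>
  generated by its initial segments are kept here, together with the chains of prime ideals that they
  force.
\<close>

lemma regular_sequence_chain:
  assumes top: "\<And>j n K. j > l \<Longrightarrow> submodule K R E \<Longrightarrow> K \<subseteq> Fr {..<n} \<Longrightarrow> ext_zero (Fr {..<n::nat}) K j"
    and residue: "\<not> ext_zero (Fr {..<1}) (cyc m) l" and s: "s \<le> Suc l"
  shows "\<exists>J. ideal J R \<and> J \<subseteq> m \<and> (\<forall>j\<ge>s. ext_zero (Fr {..<1}) (cyc J) j) \<and>
    (\<forall>p. primeideal p R \<and> J \<subseteq> p \<longrightarrow>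
      (\<exists>q. (\<forall>i\<le>s. primeideal (q i) R) \<and> (\<forall>i<s. q i \<subset> q (Suc i)) \<and> q s = p))"
  using s
proof (induct s)
  case 0
  have "cyc {\<zero>} = {\<zero>\<^bsub>E\<^esub>}"
  proof
    show "cyc {\<zero>} \<subseteq> {\<zero>\<^bsub>E\<^esub>}"
    proof
      fix u assume "u \<in> cyc {\<zero>}"
      then have "u = axis \<zero>" using axis_eq[of u] unfolding cyc_def by simp
      then show "u \<in> {\<zero>\<^bsub>E\<^esub>}" by (simp add: axis_def fun_eq_iff)
    qed
    show "{\<zero>\<^bsub>E\<^esub>} \<subseteq> cyc {\<zero>}" unfolding cyc_def by (simp add: free_module_carrier_finite)
  qed
  \<comment> \<open>The empty sequence: the ideal is zero, \<open>R\<close> itself is free, and the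
    chain consists of \<open>p\<close> alone.\<close>
  then have "ext_zero (Fr {..<1}) (cyc {\<zero>}) j" for j using ext_zero_free[of "{..<1::nat}" j] by simp
  moreover have "{\<zero>} \<subseteq> m" using additive_subgroup.zero_closed[OF ideal.axioms(1)[OF m_ideal]] by simp
  ultimately show ?case
    using zeroideal by (intro exI[of _ "{\<zero>}"]) auto
next
  case (Suc s)
  then obtain J where J: "ideal J R" "J \<subseteq> m" and ext: "\<And>j. j \<ge> s \<Longrightarrow> ext_zero (Fr {..<1}) (cyc J) j"
    and chain: "\<And>p. primeideal p R \<Longrightarrow> J \<subseteq> p \<Longrightarrow>
      \<exists>q. (\<forall>i\<le>s. primeideal (q i) R) \<and> (\<forall>i<s. q i \<subset> q (Suc i)) \<and> q s = p"
    by auto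
  have sl: "s \<le> l" using Suc(2) by simp
  \<comment> \<open>Otherwise some \<open>y\<close> outside of \<open>J\<close> has annihilator
    \<open>m\<close> modulo \<open>J\<close>, and the residue field embeds in \<open>R/J\<close>.
    Since \<open>Ext\<close> of \<open>R/J\<close> vanishes in degree \<open>l + 1\<close> and all
    \<open>Ext\<close> vanish in degree \<open>l + 2\<close>, the residue field would have no
    \<open>Ext\<close> in degree \<open>l + 1\<close>.\<close>
  have "\<exists>x\<in>m. \<forall>r\<in>carrier R. x \<otimes> r \<in> J \<longrightarrow> r \<in> J"
  proof (rule exists_regular_element[OF J(1) m_ideal], rule ccontr)
    fix y assume y: "y \<in> carrier R" "\<And>x. x \<in> m \<Longrightarrow> y \<otimes> x \<in> J" "y \<notin> J"
    have "colon J y = m"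
    proof
      show "m \<subseteq> colon J y" using y(2) ideal.Icarr[OF m_ideal] unfolding colon_def by auto
      have "\<one> \<notin> colon J y" using y unfolding colon_def by simp
      then show "colon J y \<subseteq> m" by (rule proper_ideal_le_m[OF colon_ideal[OF J(1) y(1)]])
    qed
    moreover have "ext_zero (cyc (add_principal y J)) (cyc J) l"
    proof (rule ext_zero_sub[OF _ cyc_subset Fr_subset_E ext[OF sl]])
      show "cyc J \<subseteq> cyc (add_principal y J)"
        using add_principal_mem(2)[OF J(1) y(1)] unfolding cyc_def by auto
      show "ext_zero (Fr {..<1}) (cyc (add_principal y J)) (Suc l)"
        using cyc_submodule[OF add_principal_ideal[OF J(1) y(1)]] cyc_subset by (intro top) auto
    qed
    ultimately show False using ext_zero_cyclic_iso[OF y(1) J(1), of l] residue by simp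
  qed
  then obtain x where x: "x \<in> m" and reg: "\<And>r. r \<in> carrier R \<Longrightarrow> x \<otimes> r \<in> J \<Longrightarrow> r \<in> J" by auto
  have xR: "x \<in> carrier R" using ideal.Icarr[OF m_ideal x] .
  note ap = add_principal_mem[OF J(1) xR] and api = add_principal_ideal[OF J(1) xR]
  have colon: "colon J x = J"
    using reg ideal.I_l_closed[OF J(1) _ xR] ideal.Icarr[OF J(1)] unfolding colon_def by auto
  \<comment> \<open>Passing to the quotient by the regular element \<open>x\<close> raises the first
    degree of known vanishing by one.\<close>
  have "ext_zero (Fr {..<1}) (cyc (add_principal x J)) j" if "j \<ge> Suc s" for j
  proof -
    obtain i where i: "j = Suc i" "i \<ge> s" using \<open>j \<ge> Suc s\<close> by (cases j) auto
    have "ext_zero (cyc (add_principal x J)) (cyc J) i"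
      using ext_zero_cyclic_iso[OF xR J(1), of i] ext[OF i(2)] unfolding colon by simp
    moreover have "ext_zero (Fr {..<1}) (cyc J) (Suc i)" using ext i(2) by simp
    moreover have "cyc J \<subseteq> cyc (add_principal x J)" using ap(2) unfolding cyc_def by auto
    ultimately show ?thesis unfolding i(1) using ext_zero_quot[OF _ cyc_subset Fr_subset_E] by blast
  qed
  moreover have "add_principal x J \<subseteq> m"
  proof
    fix v assume "v \<in> add_principal x J"
    then obtain r b where rb: "r \<in> carrier R" "b \<in> J" "v = x \<otimes> r \<oplus> b" unfolding add_principal_def by auto
    then show "v \<in> m"
      using ideal.I_r_closed[OF m_ideal x] J(2) additive_subgroup.a_closed[OF ideal.axioms(1)[OF m_ideal]] by auto
  qed
  moreover have "\<exists>q. (\<forall>i\<le>Suc s. primeideal (q i) R) \<and> (\<forall>i<Suc s. q i \<subset> q (Suc i)) \<and> q (Suc s) = p"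
    if p: "primeideal p R" "add_principal x J \<subseteq> p" for p
  proof -
    have Jp: "J \<subseteq> p" and xp: "x \<in> p" using p(2) ap by auto
    \<comment> \<open>The chain for \<open>J\<close> ends in a prime below \<open>p\<close> that
      avoids \<open>x\<close>; as \<open>x\<close> lies in \<open>p\<close>, adding \<open>p\<close>
      makes the chain strictly longer.\<close>
    obtain p' where p': "primeideal p' R" "J \<subseteq> p'" "p' \<subseteq> p" "x \<notin> p'"
      using prime_below[OF J(1) p(1) Jp xR reg] by blast
    obtain q where q: "\<forall>i\<le>s. primeideal (q i) R" "\<forall>i<s. q i \<subset> q (Suc i)" "q s = p'"
      using chain[OF p'(1,2)] by blast
    have "p' \<subset> p" using p' xp by auto
    then show ?thesis
      using q p(1) by (intro exI[of _ "\<lambda>i. if i \<le> s then q i else p"]) (auto simp: less_Suc_eq le_Suc_eq)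
  qed
  ultimately show ?case using api by blast
qed

text \<open>In the top degree \<open>l + 1\<close> of nonvanishing \<open>Ext\<close>, the residue
  field cannot have vanishing \<open>Ext\<close>. A chain of \<open>l + 2\<close> primes ending in
  \<open>m\<close> then forces \<open>l + 1\<close> to be at most the dimension.\<close>

lemma ext_zero_above_dim:
  fixes K :: "(nat \<Rightarrow> 'a) set"
  assumes "krull_dim R < enat (Suc j)" "submodule K R E" "K \<subseteq> Fr {..<n}"
  shows "ext_zero (Fr {..<n}) K j"
proof (rule ccontr)
  assume nz: "\<not> ?thesis"
  define P where "P = (\<lambda>j. \<exists>n K. submodule K R E \<and> K \<subseteq> Fr {..<n::nat} \<and> \<not> ext_zero (Fr {..<n}) K j)"
  have Pj: "P j" unfolding P_def using nz assms by blast
  have bound: "i \<le> k" if "P i" for i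
    using that ext_zero_large[OF _ Fr_subset_E] unfolding P_def by (meson nat_le_linear)
  \<comment> \<open>The greatest index exists since none exceeds the length \<open>k\<close> of the
    injective resolution.\<close>
  define l where "l = Greatest P"
  have l: "P l" "j \<le> l"
    unfolding l_def using GreatestI_nat[of P j k] Greatest_le_nat[of P j k] Pj bound by auto
  have top: "ext_zero (Fr {..<n::nat}) K i" if "i > l" "submodule K R E" "K \<subseteq> Fr {..<n}" for i n K
  proof (rule ccontr)
    assume "\<not> ?thesis"
    then have "P i" unfolding P_def using that by blast
    then show False using Greatest_le_nat[of P i k] bound that(1) unfolding l_def by auto
  qed
  have residue: "\<not> ext_zero (Fr {..<1}) (cyc m) l"
  proof
    assume res: "ext_zero (Fr {..<1}) (cyc m) l"
    have "ext_zero (Fr {..<1}) (cyc J) l" if "ideal J R" for J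
      by (rule ext_residue_field[OF top res that]) auto
    from ext_zero_from_cyclic[OF this] show False using l(1) unfolding P_def by blast
  qed
  obtain J where "J \<subseteq> m" and J: "\<And>p. primeideal p R \<Longrightarrow> J \<subseteq> p \<Longrightarrow>
      \<exists>q. (\<forall>i\<le>Suc l. primeideal (q i) R) \<and> (\<forall>i<Suc l. q i \<subset> q (Suc i)) \<and> q (Suc l) = p"
    using regular_sequence_chain[of l "Suc l", OF top residue] by blast
  then obtain q where "\<forall>i\<le>Suc l. primeideal (q i) R" "\<forall>i<Suc l. q i \<subset> q (Suc i)"
    using J[OF maximalideal_prime[OF m_max] \<open>J \<subseteq> m\<close>] by blast
  then have "enat (Suc l) \<le> krull_dim R"
    unfolding krull_dim_def by (intro Sup_upper) blast
  also have "\<dots> < enat (Suc j)" by (rule assms(1))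
  finally show False using l(2) by simp
qed

section \<open>Ext of maximal Cohen--Macaulay modules\<close>

lemma max_ideal_eq: "max_ideal R = m"
  unfolding max_ideal_def using m_max m_unique by (rule the_equality)

text \<open>
  Ascend from the quotient by a regular sequence of length \<open>depth\<close>, one element at a time, by
  Nakayama's lemma.
\<close>

lemma ext_zero_mcm:
  fixes N :: "('a, 'n, 'y) module_scheme"
  assumes mcm: "maximal_cohen_macaulay R N"
    and \<epsilon>: "\<epsilon> \<in> module_hom R (free_module R {..<n::nat}) N" "\<epsilon> ` Fr {..<n} = carrier N"
  shows "ext_zero (Fr {..<n}) {u \<in> Fr {..<n}. \<epsilon> u = \<zero>\<^bsub>N\<^esub>} j"
proof -
  interpret E: module R "E :: ('a, nat \<Rightarrow> 'a) module" by (rule E_module)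
  have N: "module R N" using mcm unfolding maximal_cohen_macaulay_def fin_gen_module_def by simp
  interpret N: module R N by (rule N)
  obtain \<pi> where \<pi>: "\<pi> \<in> module_hom R E N" "\<And>u. u \<in> Fr {..<n} \<Longrightarrow> \<pi> u = \<epsilon> u"
    by (rule module_hom_extend[OF \<epsilon>(1)]) blast
  have surj: "\<pi> ` Fr {..<n} = carrier N" using \<epsilon>(2) \<pi>(2) by (metis image_cong)
  let ?A = "Fr {..<n}"
  note A = E.submodD[OF Fr_submodule[of "{..<n}"]]
  \<comment> \<open>Quotients of \<open>N\<close> are handled as quotients of \<open>R^n\<close> by
    preimages under \<open>\<pi>\<close>.\<close>
  define pre where "pre = (\<lambda>H. {u \<in> ?A. \<pi> u \<in> H})"
  have pre_sub: "submodule (pre H) R E" if "submodule H R N" for H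
    unfolding pre_def by (rule submod_preimage[OF E_module N \<pi>(1) Fr_submodule that])
  have preA: "pre H \<subseteq> ?A" for H unfolding pre_def by auto
  have K: "{u \<in> ?A. \<epsilon> u = \<zero>\<^bsub>N\<^esub>} = pre {\<zero>\<^bsub>N\<^esub>}" unfolding pre_def using \<pi>(2) by auto
  have all: "ext_zero ?A H i" if "krull_dim R < enat (Suc i)" "submodule H R E" "H \<subseteq> ?A" for H i
    using ext_zero_above_dim[OF that] .
  show ?thesis
  proof (cases "zero_module N \<or> krull_dim R < enat (Suc j)")
    case True
    then show ?thesis
    proof
      assume "zero_module N"
      then have "\<epsilon> u = \<zero>\<^bsub>N\<^esub>" if "u \<in> ?A" for u
        using \<epsilon>(2) that unfolding zero_module_def by blast
      then have "{u \<in> ?A. \<epsilon> u = \<zero>\<^bsub>N\<^esub>} = ?A" by auto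
      then show ?thesis by (simp add: ext_zero_self)
    next
      assume "krull_dim R < enat (Suc j)"
      then show ?thesis unfolding K using all pre_sub[OF N.submod_zero] preA by blast
    qed
  next
    case False
    \<comment> \<open>If \<open>krull_dim R\<close> is infinite, then \<open>k\<close> takes its
      place: \<open>Ext\<close> vanishes beyond the end of the resolution in any case, and
      \<open>d\<close> is at most the depth in both cases.\<close>
    obtain d where d: "krull_dim R \<ge> enat d" "\<And>i. i \<ge> d \<Longrightarrow> i \<ge> k \<or> krull_dim R < enat (Suc i)"
    proof (cases "krull_dim R")
      case (enat d)
      then show ?thesis using that[of d] by simp
    next
      case infinity
      then show ?thesis using that[of k] by simp
    qed
    have base: "ext_zero ?A H i" if "i \<ge> d" "submodule H R E" "H \<subseteq> ?A" for H i
      using d(2)[OF that(1)] all that ext_zero_large[OF _ Fr_subset_E] by blast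
    have depth: "depth R N = krull_dim R" using mcm False unfolding maximal_cohen_macaulay_def by simp
    have "\<exists>xs. d \<le> length xs \<and> set xs \<subseteq> m \<and> (\<forall>i<length xs. \<forall>y\<in>carrier N.
        (xs ! i) \<odot>\<^bsub>N\<^esub> y \<in> list_smult R N (take i xs) \<longrightarrow> y \<in> list_smult R N (take i xs))"
    proof (cases d)
      case 0
      then show ?thesis by (intro exI[of _ "[]"]) simp
    next
      case (Suc d')
      \<comment> \<open>The depth is a supremum, so a regular sequence of length at least
        \<open>d\<close> is found by being longer than \<open>d - 1\<close>.\<close>
      have "enat d' < depth R N" using d(1) unfolding depth Suc
        by (metis enat_ord_simps(2) lessI less_le_trans)
      then obtain xs where "enat d' < enat (length xs)" "set xs \<subseteq> m" "regular_sequence R N xs"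
        unfolding depth_def less_Sup_iff max_ideal_eq by auto
      then show ?thesis unfolding Suc regular_sequence_def by (intro exI[of _ xs]) auto
    qed
    then obtain xs where xs: "d \<le> length xs" "set xs \<subseteq> m"
      and reg: "\<And>i y. i < length xs \<Longrightarrow> y \<in> carrier N \<Longrightarrow>
        (xs ! i) \<odot>\<^bsub>N\<^esub> y \<in> list_smult R N (take i xs) \<Longrightarrow> y \<in> list_smult R N (take i xs)" by blast
    have mR: "m \<subseteq> carrier R" using ideal.Icarr[OF m_ideal] by auto
    have gens: "{x \<odot>\<^bsub>N\<^esub> y | x y. x \<in> set (take i xs) \<and> y \<in> carrier N} \<subseteq> carrier N" for i
      using xs(2) mR set_take_subset[of i xs] by blast
    note span = N.submod_span[OF gens, folded list_smult_def]
    \<comment> \<open>The induction drops the last of the first \<open>d\<close> elements one by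
      one; each drop lowers by one the degree from which on \<open>Ext\<close> is known to vanish.
      At \<open>s = d\<close> nothing is left to divide by.\<close>
    have "ext_zero ?A (pre (list_smult R N (take (d - s) xs))) i" if "i \<ge> d - s" "s \<le> d" for i s
      using that
    proof (induct s arbitrary: i)
      case 0
      then show ?case using base pre_sub[OF span(1)] preA by simp
    next
      case (Suc s)
      define t where "t = d - Suc s"
      have t: "d - s = Suc t" "t < length xs" "i \<ge> t" using Suc(2,3) xs(1) unfolding t_def by auto
      let ?H = "list_smult R N (take t xs)" and ?H' = "list_smult R N (take (Suc t) xs)"
      have xm: "xs ! t \<in> m" using xs(2) t(2) by auto
      have xR: "xs ! t \<in> carrier R" using xm mR by auto
      have HH: "?H \<subseteq> ?H'"
      proof (rule span(3)[OF span(1)])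
        show "{x \<odot>\<^bsub>N\<^esub> y | x y. x \<in> set (take t xs) \<and> y \<in> carrier N} \<subseteq> ?H'"
          using span(2)[of "Suc t"] set_take_subset_set_take[of t "Suc t" xs] by auto
      qed
      have xH: "xs ! t \<odot>\<^bsub>N\<^esub> y \<in> ?H'" if "y \<in> carrier N" for y
      proof -
        have "xs ! t \<in> set (take (Suc t) xs)" using t(2) by (simp add: take_Suc_conv_app_nth)
        then show ?thesis using span(2)[of "Suc t"] that by blast
      qed
      have scale: "\<pi> (xs ! t \<odot>\<^bsub>E\<^esub> u) = xs ! t \<odot>\<^bsub>N\<^esub> \<pi> u" if "u \<in> ?A" for u
        using module_hom_smult[OF \<pi>(1) xR] that A(1) by blast
      \<comment> \<open>Dividing by the next element of the sequence upstairs in \<open>R^n\<close>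
        gives the next quotient of \<open>N\<close>, so the induction hypothesis supplies the
        vanishing required for Nakayama's lemma.\<close>
      have "add_scale (xs ! t) ?A (pre ?H) = pre ?H'"
      proof
        note add = add_scale[OF Fr_submodule pre_sub[OF span(1)] preA xR]
        show "add_scale (xs ! t) ?A (pre ?H) \<subseteq> pre ?H'"
        proof
          fix v assume v: "v \<in> add_scale (xs ! t) ?A (pre ?H)"
          then obtain a b where ab: "a \<in> ?A" "b \<in> pre ?H" "v = xs ! t \<odot>\<^bsub>E\<^esub> a \<oplus>\<^bsub>E\<^esub> b"
            unfolding add_scale_def by blast
          have "\<pi> v = xs ! t \<odot>\<^bsub>N\<^esub> \<pi> a \<oplus>\<^bsub>N\<^esub> \<pi> b"
            unfolding ab(3) scale[OF ab(1), symmetric]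
            using A(5)[OF xR ab(1)] ab(2) A(1) preA by (intro module_hom_add[OF \<pi>(1)]) blast+
          moreover have "\<pi> b \<in> ?H'" using ab(2) HH unfolding pre_def by auto
          moreover have "\<pi> a \<in> carrier N" using ab(1) A(1) module_hom_closed[OF \<pi>(1)] by blast
          ultimately have "\<pi> v \<in> ?H'" using N.submodD(3)[OF span(1) xH] by simp
          moreover have "v \<in> ?A" using v add(3) by blast
          ultimately show "v \<in> pre ?H'" unfolding pre_def by simp
        qed
        have sub: "submodule (\<pi> ` add_scale (xs ! t) ?A (pre ?H)) R N"
          by (rule submod_image[OF E_module N \<pi>(1) add(1)])
        have "?H' \<subseteq> \<pi> ` add_scale (xs ! t) ?A (pre ?H)"
        proof (rule span(3)[OF sub], rule subsetI)
          fix z assume "z \<in> {x \<odot>\<^bsub>N\<^esub> y | x y. x \<in> set (take (Suc t) xs) \<and> y \<in> carrier N}"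
          then obtain x y where z: "x \<in> set (take (Suc t) xs)" "y \<in> carrier N" "z = x \<odot>\<^bsub>N\<^esub> y" by blast
          from z(1) consider "x \<in> set (take t xs)" | "x = xs ! t"
            using t(2) by (auto simp: take_Suc_conv_app_nth)
          then show "z \<in> \<pi> ` add_scale (xs ! t) ?A (pre ?H)"
          proof cases
            case 1
            then have zH: "z \<in> ?H" using span(2)[of t] z by blast
            then have "z \<in> carrier N" using N.submodD(1)[OF span(1)] by blast
            then obtain u where u: "u \<in> ?A" "z = \<pi> u" using surj by blast
            then have "u \<in> pre ?H" using zH unfolding pre_def by simp
            then show ?thesis using add(2) u(2) by blast
          next
            case 2
            obtain u where u: "u \<in> ?A" "y = \<pi> u" using surj z(2) by blast
            have "xs ! t \<odot>\<^bsub>E\<^esub> u \<in> add_scale (xs ! t) ?A (pre ?H)" by (rule subquot_isoD(7)[OF add(4) u(1)])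
            moreover have "z = \<pi> (xs ! t \<odot>\<^bsub>E\<^esub> u)" unfolding z(3) 2 u(2) scale[OF u(1)] ..
            ultimately show ?thesis by blast
          qed
        qed
        show "pre ?H' \<subseteq> add_scale (xs ! t) ?A (pre ?H)"
        proof
          fix v assume v: "v \<in> pre ?H'"
          then obtain w where w: "w \<in> add_scale (xs ! t) ?A (pre ?H)" "\<pi> v = \<pi> w"
            using \<open>?H' \<subseteq> _\<close> unfolding pre_def by blast
          have vA: "v \<in> ?A" and wA: "w \<in> ?A" using v w(1) preA add(3) by blast+
          have vE: "v \<in> carrier E" and wE: "w \<in> carrier E" using vA wA A(1) by blast+
          have "\<pi> (v \<ominus>\<^bsub>E\<^esub> w) = \<zero>\<^bsub>N\<^esub>"
            using module_hom_diff[OF E_module N \<pi>(1) vE wE] w(2) N.M.diff_self[OF module_hom_closed[OF \<pi>(1) wE]]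
            by simp
          then have "v \<ominus>\<^bsub>E\<^esub> w \<in> pre ?H"
            unfolding pre_def using A(4)[OF vA wA] N.submodD(2)[OF span(1)] by simp
          then have "w \<oplus>\<^bsub>E\<^esub> (v \<ominus>\<^bsub>E\<^esub> w) \<in> add_scale (xs ! t) ?A (pre ?H)"
            using E.submodD(3)[OF add(1) w(1)] add(2) by blast
          then show "v \<in> add_scale (xs ! t) ?A (pre ?H)"
            unfolding E.M.add_diff_cancel[OF vE wE] .
        qed
      qed
      then have "ext_zero ?A (add_scale (xs ! t) ?A (pre ?H)) (Suc i)"
        using Suc(1)[of "Suc i"] Suc(3) t by simp
      then have "ext_zero ?A (pre ?H) i"
      proof (rule ext_zero_nakayama[OF pre_sub[OF span(1)] preA xm, rotated])
        fix a assume a: "a \<in> ?A" "xs ! t \<odot>\<^bsub>E\<^esub> a \<in> pre ?H"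
        have "\<pi> a \<in> carrier N" using a(1) A(1) module_hom_closed[OF \<pi>(1)] by blast
        then have "\<pi> a \<in> ?H" using reg[OF t(2)] a(2) scale[OF a(1)] unfolding pre_def by simp
        then show "a \<in> pre ?H" using a(1) unfolding pre_def by simp
      qed
      then show ?case unfolding t_def .
    qed
    from this[of d j] have "ext_zero ?A (pre (list_smult R N [])) j" by simp
    moreover have "list_smult R N [] = {\<zero>\<^bsub>N\<^esub>}"
    proof
      show "list_smult R N [] \<subseteq> {\<zero>\<^bsub>N\<^esub>}"
        using span(3)[OF N.submod_zero, of 0] by simp
      show "{\<zero>\<^bsub>N\<^esub>} \<subseteq> list_smult R N []" using N.submodD(2)[OF span(1)[of 0]] by simp
    qed
    ultimately show ?thesis unfolding K by simp
  qed
qed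

end

section \<open>Complexes of free modules and their duals\<close>

lemma module_hom_cong:
  assumes M: "module R M" and f: "f \<in> module_hom R M N" and e: "\<And>x. x \<in> carrier M \<Longrightarrow> g x = f x"
  shows "g \<in> module_hom R M N"
proof -
  interpret M: module R M by fact
  show ?thesis
    by (rule module_homI)
      (simp_all add: e module_hom_closed[OF f] module_hom_add[OF f] module_hom_smult[OF f])
qed

context cring
begin

text \<open>The dot product. For finite \<open>J\<close> it identifies \<open>Fr J\<close> with its
  dual, so that the dual of a complex of free modules lives on the same modules, with transposed
  maps.\<close>

definition pairing :: "'j set \<Rightarrow> ('j \<Rightarrow> 'a) \<Rightarrow> ('j \<Rightarrow> 'a) \<Rightarrow> 'a" where
  "pairing J u t = (\<Oplus>x\<in>J. u x \<otimes> t x)"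

lemma pairing_closed:
  "(\<And>x. x \<in> J \<Longrightarrow> u x \<in> carrier R) \<Longrightarrow> (\<And>x. x \<in> J \<Longrightarrow> t x \<in> carrier R) \<Longrightarrow> pairing J u t \<in> carrier R"
  unfolding pairing_def by (rule finsum_closed) auto

lemma pairing_comm:
  assumes "\<And>x. x \<in> J \<Longrightarrow> u x \<in> carrier R" "\<And>x. x \<in> J \<Longrightarrow> t x \<in> carrier R"
  shows "pairing J u t = pairing J t u"
  unfolding pairing_def using assms by (intro finsum_cong') (auto simp: m_comm)

lemma pairing_hom:
  assumes u: "\<And>x. x \<in> J \<Longrightarrow> u x \<in> carrier R"
  shows "pairing J u \<in> module_hom R (free_module R B) (ring_module R)"
proof -
  have "(\<lambda>t. \<Oplus>\<^bsub>ring_module R\<^esub>x\<in>J. t x \<odot>\<^bsub>ring_module R\<^esub> u x) \<in> module_hom R (free_module R B) (ring_module R)"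
    by (rule module_hom_free[OF ring_module_is_module]) (simp add: u)
  then show ?thesis
  proof (rule module_hom_cong[OF free_module_is_module])
    fix t assume "t \<in> Fr B"
    note tc = free_module_closed[OF this]
    have "(\<Oplus>\<^bsub>ring_module R\<^esub>x\<in>J. t x \<odot>\<^bsub>ring_module R\<^esub> u x) = (\<Oplus>x\<in>J. t x \<otimes> u x)"
      using u tc by (subst ring_module_finsum) auto
    also have "\<dots> = pairing J u t"
      unfolding pairing_def using u tc by (intro finsum_cong') (auto simp: m_comm)
    finally show "pairing J u t = (\<Oplus>\<^bsub>ring_module R\<^esub>x\<in>J. t x \<odot>\<^bsub>ring_module R\<^esub> u x)" ..
  qed
qed

lemma pairing_basis:
  assumes "\<And>x. x \<in> J \<Longrightarrow> u x \<in> carrier R" "finite J" "x \<in> J"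
  shows "pairing J u (basis_vec R x) = u x"
proof -
  have "pairing J u (basis_vec R x) = (\<Oplus>y\<in>J. if x = y then u y else \<zero>)"
    unfolding pairing_def using assms(1) by (intro finsum_cong') (auto simp: basis_vec_def)
  also have "\<dots> = u x" using assms by (subst finsum_singleton) auto
  finally show ?thesis .
qed

lemma pairing_eqI:
  assumes J: "finite J" and u: "u \<in> Fr J" and v: "v \<in> Fr J"
    and e: "\<And>t. t \<in> Fr J \<Longrightarrow> pairing J u t = pairing J v t"
  shows "u = v"
proof
  fix x
  note c = free_module_closed[OF u] free_module_closed[OF v]
  show "u x = v x"
  proof (cases "x \<in> J")
    case True
    then show ?thesis
      using e[OF basis_vec_carrier[OF True]] pairing_basis[OF c(1) J True] pairing_basis[OF c(2) J True] by simp
  next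
    case False
    then show ?thesis using free_module_eq_zero[OF u] free_module_eq_zero[OF v] by simp
  qed
qed

lemma pairing_zero: "(\<And>x. x \<in> J \<Longrightarrow> t x \<in> carrier R) \<Longrightarrow> pairing J (\<lambda>_. \<zero>) t = \<zero>"
proof -
  assume t: "\<And>x. x \<in> J \<Longrightarrow> t x \<in> carrier R"
  have "pairing J (\<lambda>_. \<zero>) t = (\<Oplus>x\<in>J. \<zero>)"
    unfolding pairing_def using t by (intro finsum_cong') auto
  then show ?thesis by simp
qed

lemma pairing_diff_left:
  assumes u: "u \<in> Fr B" and v: "v \<in> Fr B" and t: "t \<in> Fr B"
  shows "pairing J (u \<ominus>\<^bsub>free_module R B\<^esub> v) t = pairing J u t \<ominus> pairing J v t"
proof -
  interpret B: module R "free_module R B" by (rule free_module_is_module)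
  note c = free_module_closed[OF u] free_module_closed[OF v] free_module_closed[OF t]
  have d: "u \<ominus>\<^bsub>free_module R B\<^esub> v \<in> Fr B" using u v by simp
  show ?thesis
    using module_hom_diff[OF free_module_is_module ring_module_is_module pairing_hom u v, of J t]
      pairing_comm[of J "u \<ominus>\<^bsub>free_module R B\<^esub> v" t] pairing_comm[of J u t] pairing_comm[of J v t]
      free_module_closed[OF d] c pairing_closed[of J]
    by (simp add: ring_module_diff)
qed

end

context finite_inj_res
begin

text \<open>A functional on \<open>A/B\<close> is one on \<open>Z/K\<close>, and the obstruction to
  extending it from \<open>Z\<close> to \<open>Fr J\<close> lies in \<open>Ext\<close> of
  \<open>Fr J / Z\<close> in degree 1. A functional on \<open>Fr J\<close> is the pairing with a
  vector \<open>s\<close>.\<close>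

lemma functional_lift:
  fixes A B :: "('b::countable \<Rightarrow> 'a) set" and Z K :: "('c::countable \<Rightarrow> 'a) set"
  assumes iso: "subquot_iso \<phi> A B Z K" and J: "finite J" and ZJ: "Z \<subseteq> Fr J"
    and ext: "ext_zero (Fr J) Z 0"
    and f: "f \<in> module_hom R E (ring_module R)" "\<And>b. b \<in> B \<Longrightarrow> f b = \<zero>"
  obtains s where "s \<in> Fr J" "\<And>b. b \<in> K \<Longrightarrow> pairing J s b = \<zero>"
    "\<And>a. a \<in> A \<Longrightarrow> pairing J s (\<phi> a) = f a"
proof -
  interpret E: module R "E :: ('a, 'b \<Rightarrow> 'a) module" by (rule E_module)
  interpret E': module R "E :: ('a, 'c \<Rightarrow> 'a) module" by (rule E_module)
  interpret I0: module R "I 0" by (rule I_module)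
  interpret I1: module R "I (Suc 0)" by (rule I_module)
  note iso' = subquot_isoD[OF iso]
  note A = E.submodD[OF iso'(2)] and Z = E'.submodD[OF iso'(3)]
  have \<eta>0: "\<eta> \<zero> = \<zero>\<^bsub>I 0\<^esub>"
    using module_hom_zero[OF ring_module_is_module I_module \<eta>_hom] by simp
  have \<eta>f: "(\<lambda>x. \<eta> (f x)) \<in> module_hom R E (I 0)" by (rule module_hom_comp[OF f(1) \<eta>_hom])
  have fc: "f a \<in> carrier R" if "a \<in> A" for a
    using module_hom_closed[OF f(1), of a] that A(1) by auto
  obtain F where F: "F \<in> module_hom R E (I 0)" "\<And>b. b \<in> K \<Longrightarrow> F b = \<zero>\<^bsub>I 0\<^esub>"
    "\<And>a. a \<in> A \<Longrightarrow> F (\<phi> a) = \<eta> (f a)"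
    by (rule subquot_iso_lift[OF iso \<eta>f]) (auto simp: f(2) \<eta>0)
  have "\<delta> 0 (F x) = \<zero>\<^bsub>I (Suc 0)\<^esub>" if x: "x \<in> Z" for x
  proof -
    obtain a b where ab: "a \<in> A" "b \<in> K" "x = \<phi> a \<oplus>\<^bsub>E\<^esub> b" using iso'(9)[OF x] by blast
    have c: "\<phi> a \<in> carrier E" "b \<in> carrier E"
      using iso'(6,7) ab Z(1) by blast+
    have "F x = \<eta> (f a)"
      unfolding ab(3) module_hom_add[OF F(1) c] F(2)[OF ab(2)] F(3)[OF ab(1)]
      using module_hom_closed[OF \<eta>_hom, of "f a"] fc[OF ab(1)] by simp
    then show ?thesis using \<delta>0_\<eta>[OF fc[OF ab(1)]] by simp
  qed
  moreover have \<delta>F: "(\<lambda>x. \<delta> 0 (F x)) \<in> module_hom R E (I (Suc 0))" by (rule module_hom_comp[OF F(1) \<delta>_hom])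
  moreover have JE: "Fr J \<subseteq> carrier E" using E'.submodD(1)[OF Fr_submodule] .
  \<comment> \<open>This class is the obstruction: \<open>F\<close> extends the functional as a map
    to \<open>I 0\<close>, but off \<open>Z\<close> its values need not come from
    \<open>R\<close>.\<close>
  ultimately have "cocycle (Fr J) Z (Suc 0) (\<lambda>x. \<delta> 0 (F x))"
    using \<delta>\<delta>[OF module_hom_closed[OF F(1)]] by (intro cocycleI) auto
  then obtain g where g: "g \<in> module_hom R E (I 0)" "\<And>b. b \<in> Z \<Longrightarrow> g b = \<zero>\<^bsub>I 0\<^esub>"
    "\<And>a. a \<in> Fr J \<Longrightarrow> \<delta> 0 (F a) = \<delta> 0 (g a)"
    by (rule ext_zeroE[OF ext]) auto
  \<comment> \<open>It agrees with \<open>F\<close> on \<open>Z\<close>, and its values on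
    \<open>Fr J\<close> are in the kernel of \<open>\<delta> 0\<close>, hence come from
    \<open>R\<close>.\<close>
  define H where "H = (\<lambda>x. F x \<ominus>\<^bsub>I 0\<^esub> g x)"
  have H: "H \<in> module_hom R E (I 0)" unfolding H_def by (rule I0.module_hom_minus[OF F(1) g(1)])
  have "\<exists>r\<in>carrier R. H (basis_vec R x) = \<eta> r" if x: "x \<in> J" for x
  proof (rule ker_\<delta>0)
    have b: "basis_vec R x \<in> Fr J" "basis_vec R x \<in> carrier E"
      using basis_vec_carrier[OF x] JE by auto
    note c = module_hom_closed[OF F(1) b(2)] module_hom_closed[OF g(1) b(2)]
    show "\<delta> 0 (H (basis_vec R x)) = \<zero>\<^bsub>I (Suc 0)\<^esub>"
      unfolding H_def module_hom_diff[OF I_module I_module \<delta>_hom c] g(3)[OF b(1)]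
      by (rule I1.M.diff_self[OF module_hom_closed[OF \<delta>_hom c(2)]])
    show "H (basis_vec R x) \<in> carrier (I 0)" by (rule module_hom_closed[OF H b(2)])
  qed
  then obtain r where r: "\<And>x. x \<in> J \<Longrightarrow> r x \<in> carrier R" "\<And>x. x \<in> J \<Longrightarrow> H (basis_vec R x) = \<eta> (r x)"
    by metis
  define s where "s = (\<lambda>x. if x \<in> J then r x else \<zero>)"
  have s: "s \<in> Fr J" unfolding s_def using r(1) J by (simp add: free_module_carrier_finite)
  have sc: "s x \<in> carrier R" for x by (rule free_module_closed[OF s])
  have Hs: "H u = \<eta> (pairing J s u)" if u: "u \<in> Fr J" for u
  proof (rule module_hom_eqI[OF I_module H module_hom_comp[OF pairing_hom[OF sc] \<eta>_hom] J _ u])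
    fix x assume x: "x \<in> J"
    show "H (basis_vec R x) = \<eta> (pairing J s (basis_vec R x))"
      unfolding pairing_basis[OF sc J x] r(2)[OF x] using x by (simp add: s_def)
  qed simp
  have HZ: "\<eta> (pairing J s z) = F z" if "z \<in> Z" for z
    using Hs[of z] that ZJ g(2)[OF that] I0.M.diff_zero_right[OF module_hom_closed[OF F(1)]] Z(1)
    unfolding H_def by (auto simp: subset_iff)
  have pc: "pairing J s z \<in> carrier R" if "z \<in> Z" for z
    by (rule pairing_closed[OF sc free_module_closed[OF subsetD[OF ZJ that]]])
  show ?thesis
  proof (rule that[OF s])
    show "pairing J s b = \<zero>" if b: "b \<in> K" for b
    proof -
      have bZ: "b \<in> Z" using iso'(6) b by auto
      show ?thesis
        using inj_onD[OF \<eta>_inj _ pc[OF bZ] zero_closed] HZ[OF bZ] F(2)[OF b] \<eta>0 by simp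
    qed
    show "pairing J s (\<phi> a) = f a" if a: "a \<in> A" for a
      using inj_onD[OF \<eta>_inj _ pc[OF iso'(7)[OF a]] fc[OF a]] HZ[OF iso'(7)[OF a]] F(3)[OF a] by simp
  qed
qed

end

text \<open>A complex with terms \<open>T j / K j\<close> and differentials \<open>\<phi>\<close>,
  together with its dual: the functionals on \<open>T j / K j\<close> are the vectors orthogonal to
  \<open>K j\<close>, and the transposes \<open>\<psi>\<close> act on them.\<close>

locale dual_complex = finite_inj_res R I \<delta> \<eta> k
  for R :: "('a, 'r) ring_scheme" (structure) and I :: "nat \<Rightarrow> ('a, 'i) module" and \<delta> \<eta> k +
  fixes J :: "nat \<Rightarrow> 'b::countable set" and \<phi> \<psi> :: "nat \<Rightarrow> ('b \<Rightarrow> 'a) \<Rightarrow> 'b \<Rightarrow> 'a"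
    and K :: "nat \<Rightarrow> ('b \<Rightarrow> 'a) set"
  assumes J_finite: "\<And>j. finite (J j)"
    and \<phi>_hom: "\<And>j. \<phi> j \<in> module_hom R E E" and \<psi>_hom: "\<And>j. \<psi> j \<in> module_hom R E E"
    and \<phi>_mem: "\<And>j u. u \<in> Fr (J (Suc j)) \<Longrightarrow> \<phi> j u \<in> Fr (J j)"
    and \<psi>_mem: "\<And>j t. t \<in> Fr (J j) \<Longrightarrow> \<psi> j t \<in> Fr (J (Suc j))"
    and adjoint: "\<And>j u t. u \<in> Fr (J (Suc j)) \<Longrightarrow> t \<in> Fr (J j) \<Longrightarrow>
      pairing (J j) (\<phi> j u) t = pairing (J (Suc j)) u (\<psi> j t)"
    and \<phi>\<phi>: "\<And>j u. u \<in> Fr (J (Suc (Suc j))) \<Longrightarrow> \<phi> j (\<phi> (Suc j) u) = \<zero>\<^bsub>E\<^esub>"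
    and K_sub: "\<And>j. submodule (K j) R E" and K_mem: "\<And>j. K j \<subseteq> Fr (J j)"
    and \<phi>_K: "\<And>j u. u \<in> K (Suc j) \<Longrightarrow> \<phi> j u \<in> K j"
begin

abbreviation T :: "nat \<Rightarrow> ('b \<Rightarrow> 'a) set" where "T j \<equiv> Fr (J j)"

definition perp :: "nat \<Rightarrow> ('b \<Rightarrow> 'a) set" where
  "perp j = {t \<in> T j. \<forall>b\<in>K j. pairing (J j) t b = \<zero>}"

text \<open>The preimage in \<open>T j\<close> of the boundaries of the quotient complex.\<close>

definition bound :: "nat \<Rightarrow> ('b \<Rightarrow> 'a) set" where
  "bound j = {\<phi> j u \<oplus>\<^bsub>E\<^esub> b | u b. u \<in> T (Suc j) \<and> b \<in> K j}"

text \<open>Exactness of \<open>T j / K j\<close> and of the dual complex \<open>perp j\<close>, in degree \<open>j + 1\<close>.\<close>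

definition exact :: "nat \<Rightarrow> bool" where
  "exact j \<longleftrightarrow> (\<forall>u\<in>T (Suc j). \<phi> j u \<in> K j \<longrightarrow> u \<in> bound (Suc j))"

definition coexact :: "nat \<Rightarrow> bool" where
  "coexact j \<longleftrightarrow> (\<forall>t\<in>perp (Suc j). \<psi> (Suc j) t = \<zero>\<^bsub>E\<^esub> \<longrightarrow> (\<exists>s\<in>perp j. t = \<psi> j s))"

lemma TE: "T j \<subseteq> carrier E"
  by (rule free_module_mono) simp

lemma pairing_T_comm: "u \<in> T j \<Longrightarrow> t \<in> T j \<Longrightarrow> pairing (J j) u t = pairing (J j) t u"
  by (rule pairing_comm) (simp_all add: free_module_closed[where R = R])

lemma \<psi>\<psi>:
  assumes t: "t \<in> T j"
  shows "\<psi> (Suc j) (\<psi> j t) = \<zero>\<^bsub>E\<^esub>"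
proof (rule pairing_eqI[OF J_finite \<psi>_mem[OF \<psi>_mem[OF t]]])
  interpret E: module R "E :: ('a, 'b \<Rightarrow> 'a) module" by (rule E_module)
  show z: "\<zero>\<^bsub>E\<^esub> \<in> T (Suc (Suc j))" by (rule E.submodD(2)[OF Fr_submodule])
  fix u assume u: "u \<in> T (Suc (Suc j))"
  have "pairing (J (Suc (Suc j))) (\<psi> (Suc j) (\<psi> j t)) u = pairing (J j) (\<phi> j (\<phi> (Suc j) u)) t"
    using pairing_T_comm[OF \<psi>_mem[OF \<psi>_mem[OF t]] u] adjoint[OF u \<psi>_mem[OF t]] adjoint[OF \<phi>_mem[OF u] t]
    by simp
  also have "\<dots> = \<zero>" unfolding \<phi>\<phi>[OF u] using free_module_closed[OF t] by (simp add: pairing_zero)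
  also have "\<dots> = pairing (J (Suc (Suc j))) \<zero>\<^bsub>E\<^esub> u" using free_module_closed[OF u] by (simp add: pairing_zero)
  finally show "pairing (J (Suc (Suc j))) (\<psi> (Suc j) (\<psi> j t)) u = pairing (J (Suc (Suc j))) \<zero>\<^bsub>E\<^esub> u" .
qed

lemma bound_sub: "submodule (bound j) R E"
proof -
  interpret E: module R "E :: ('a, 'b \<Rightarrow> 'a) module" by (rule E_module)
  have "bound j = {a \<oplus>\<^bsub>E\<^esub> b | a b. a \<in> \<phi> j ` T (Suc j) \<and> b \<in> K j}" unfolding bound_def by blast
  then show ?thesis
    using E.submod_sum[OF submod_image[OF E_module E_module \<phi>_hom Fr_submodule] K_sub] by simp
qed

lemma bound_mem: "bound j \<subseteq> T j"
proof -
  interpret E: module R "E :: ('a, 'b \<Rightarrow> 'a) module" by (rule E_module)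
  show ?thesis
  proof
    fix x assume "x \<in> bound j"
    then obtain u b where "u \<in> T (Suc j)" "b \<in> K j" "x = \<phi> j u \<oplus>\<^bsub>E\<^esub> b" unfolding bound_def by blast
    then show "x \<in> T j" using E.submodD(3)[OF Fr_submodule \<phi>_mem] K_mem by blast
  qed
qed

lemma K_bound: "K j \<subseteq> bound j"
proof
  interpret E: module R "E :: ('a, 'b \<Rightarrow> 'a) module" by (rule E_module)
  fix b assume b: "b \<in> K j"
  have bE: "b \<in> carrier E" using b K_mem TE by blast
  have "b = \<phi> j \<zero>\<^bsub>E\<^esub> \<oplus>\<^bsub>E\<^esub> b"
    unfolding module_hom_zero[OF E_module E_module \<phi>_hom] using E.M.l_zero[OF bE] by simp
  then show "b \<in> bound j" unfolding bound_def using b E.submodD(2)[OF Fr_submodule] by blast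
qed

lemma \<phi>_bound: "u \<in> T (Suc j) \<Longrightarrow> \<phi> j u \<in> bound j"
proof -
  interpret E: module R "E :: ('a, 'b \<Rightarrow> 'a) module" by (rule E_module)
  assume u: "u \<in> T (Suc j)"
  have "\<phi> j u = \<phi> j u \<oplus>\<^bsub>E\<^esub> \<zero>\<^bsub>E\<^esub>"
    using E.M.r_zero[OF subsetD[OF TE \<phi>_mem[OF u]]] by simp
  then show ?thesis unfolding bound_def using u E.submodD(2)[OF K_sub] by blast
qed

text \<open>Exactness in degree \<open>j + 1\<close> identifies the cokernel there with the
  boundaries in degree \<open>j\<close>, which sit inside \<open>T j / K j\<close>.\<close>

lemma exact_iso:
  assumes "exact j"
  shows "subquot_iso (\<phi> j) (T (Suc j)) (bound (Suc j)) (bound j) (K j)"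
proof (rule subquot_isoI[OF \<phi>_hom Fr_submodule bound_sub K_sub bound_mem K_bound \<phi>_bound])
  interpret E: module R "E :: ('a, 'b \<Rightarrow> 'a) module" by (rule E_module)
  fix a assume a: "a \<in> T (Suc j)"
  show "\<phi> j a \<in> K j \<longleftrightarrow> a \<in> bound (Suc j)"
  proof
    assume "a \<in> bound (Suc j)"
    then obtain u b where ub: "u \<in> T (Suc (Suc j))" "b \<in> K (Suc j)" "a = \<phi> (Suc j) u \<oplus>\<^bsub>E\<^esub> b"
      unfolding bound_def by blast
    have c: "\<phi> (Suc j) u \<in> carrier E" "b \<in> carrier E"
      using \<phi>_mem[OF ub(1)] ub(2) K_mem TE by blast+
    have "\<phi> j a = \<phi> j b"
      unfolding ub(3) module_hom_add[OF \<phi>_hom c] \<phi>\<phi>[OF ub(1)]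
      by (rule E.M.l_zero[OF module_hom_closed[OF \<phi>_hom c(2)]])
    then show "\<phi> j a \<in> K j" using \<phi>_K[OF ub(2)] by simp
  qed (use assms a in \<open>auto simp: exact_def\<close>)
next
  fix x assume "x \<in> bound j"
  then show "\<exists>a\<in>T (Suc j). \<exists>b\<in>K j. x = \<phi> j a \<oplus>\<^bsub>E\<^esub> b" unfolding bound_def by blast
qed

text \<open>Dimension shifting. As \<open>T j / K j\<close> has no \<open>Ext\<close>, that of its
  boundaries in one degree follows from that of its cokernel one degree higher, and by exactness
  these boundaries are the next cokernel. After \<open>c\<close> steps nothing is left.\<close>

lemma ext_zero_bound:
  assumes ex: "\<And>j. j \<ge> k0 \<Longrightarrow> exact j" and ext: "\<And>j l. ext_zero (T j) (K j) l"
    and base: "\<And>l. l \<ge> c \<Longrightarrow> ext_zero (T k0) (bound k0) l"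
  shows "l + i \<ge> c \<Longrightarrow> ext_zero (T (k0 + i)) (bound (k0 + i)) l"
proof (induct i arbitrary: l)
  case 0
  then show ?case using base by simp
next
  case (Suc i)
  have "ext_zero (T (k0 + i)) (bound (k0 + i)) (Suc l)" using Suc by simp
  from ext_zero_sub[OF K_bound bound_mem TE ext this]
  have "ext_zero (bound (k0 + i)) (K (k0 + i)) l" .
  then show ?case using ext_zero_iso[OF exact_iso[OF ex, of "k0 + i"]] by simp
qed

text \<open>A cocycle \<open>t\<close> is a functional on the cokernel in degree
  \<open>j + 1\<close>, that is, on the boundaries in degree \<open>j\<close>. It extends to
  \<open>T j\<close> since \<open>Ext\<close> of the cokernel in degree \<open>j\<close> vanishes,
  and the vector representing the extension is mapped to \<open>t\<close>.\<close>

lemma coexact_if_exact: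
  assumes ex: "exact j" and ext: "ext_zero (T j) (bound j) 0"
  shows "coexact j"
  unfolding coexact_def
proof (intro ballI impI)
  interpret E: module R "E :: ('a, 'b \<Rightarrow> 'a) module" by (rule E_module)
  fix t assume t: "t \<in> perp (Suc j)" and \<psi>t: "\<psi> (Suc j) t = \<zero>\<^bsub>E\<^esub>"
  have tT: "t \<in> T (Suc j)" using t unfolding perp_def by simp
  note tc = free_module_closed[OF tT]
  have hom: "pairing (J (Suc j)) t \<in> module_hom R E (ring_module R)" by (rule pairing_hom[OF tc])
  \<comment> \<open>On \<open>K\<close> because \<open>t\<close> is in \<open>perp\<close>, on the
    image of \<open>\<phi>\<close> because \<open>\<psi>\<close> sends \<open>t\<close> to
    zero.\<close>
  have "pairing (J (Suc j)) t x = \<zero>" if x: "x \<in> bound (Suc j)" for x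
  proof -
    obtain u b where ub: "u \<in> T (Suc (Suc j))" "b \<in> K (Suc j)" "x = \<phi> (Suc j) u \<oplus>\<^bsub>E\<^esub> b"
      using x unfolding bound_def by blast
    have c: "\<phi> (Suc j) u \<in> carrier E" "b \<in> carrier E"
      using \<phi>_mem[OF ub(1)] ub(2) K_mem TE by blast+
    have "pairing (J (Suc j)) t (\<phi> (Suc j) u) = \<zero>"
      using pairing_T_comm[OF tT \<phi>_mem[OF ub(1)]] adjoint[OF ub(1) tT] \<psi>t
        pairing_T_comm[OF ub(1), of "\<zero>\<^bsub>E\<^esub>"] E.submodD(2)[OF Fr_submodule] free_module_closed[OF ub(1)]
      by (simp add: pairing_zero)
    moreover have "pairing (J (Suc j)) t b = \<zero>" using t ub(2) unfolding perp_def by blast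
    ultimately show ?thesis unfolding ub(3) module_hom_add[OF hom c] by simp
  qed
  with functional_lift[OF exact_iso[OF ex] J_finite bound_mem ext hom]
  obtain s where s: "s \<in> T j" "\<And>b. b \<in> K j \<Longrightarrow> pairing (J j) s b = \<zero>"
    "\<And>a. a \<in> T (Suc j) \<Longrightarrow> pairing (J j) s (\<phi> j a) = pairing (J (Suc j)) t a" by blast
  have "t = \<psi> j s"
  proof (rule pairing_eqI[OF J_finite tT \<psi>_mem[OF s(1)]])
    fix a assume a: "a \<in> T (Suc j)"
    show "pairing (J (Suc j)) t a = pairing (J (Suc j)) (\<psi> j s) a"
      using s(3)[OF a] pairing_T_comm[OF s(1) \<phi>_mem[OF a]] adjoint[OF a s(1)]
        pairing_T_comm[OF a \<psi>_mem[OF s(1)]] by simp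
  qed
  then show "\<exists>s\<in>perp j. t = \<psi> j s" using s(1,2) unfolding perp_def by blast
qed

lemma perp_sub: "submodule (perp j) R E"
proof -
  interpret E: module R "E :: ('a, 'b \<Rightarrow> 'a) module" by (rule E_module)
  note F = E.submodD[OF Fr_submodule[of "J j"]]
  have Kc: "b x \<in> carrier R" if "b \<in> K j" for b x
    by (rule free_module_closed[OF subsetD[OF K_mem that]])
  have c: "pairing (J j) t b = pairing (J j) b t" if "t \<in> T j" "b \<in> K j" for t b
    using pairing_T_comm that K_mem by blast
  show ?thesis
  proof (rule E.submodI)
    show "perp j \<subseteq> carrier E" unfolding perp_def using F(1) by blast
    show "\<zero>\<^bsub>E\<^esub> \<in> perp j" unfolding perp_def using F(2) Kc by (auto simp: pairing_zero)
    fix t assume "t \<in> perp j"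
    then have t: "t \<in> T j" "\<And>b. b \<in> K j \<Longrightarrow> pairing (J j) b t = \<zero>" using c unfolding perp_def by auto
    show "t \<oplus>\<^bsub>E\<^esub> s \<in> perp j" if "s \<in> perp j" for s
    proof -
      have s: "s \<in> T j" "\<And>b. b \<in> K j \<Longrightarrow> pairing (J j) b s = \<zero>" using c \<open>s \<in> perp j\<close> unfolding perp_def by auto
      have "pairing (J j) b (t \<oplus>\<^bsub>E\<^esub> s) = \<zero>" if b: "b \<in> K j" for b
        using module_hom_add[OF pairing_hom[of "J j" b UNIV, OF Kc[OF b]] subsetD[OF F(1) t(1)] subsetD[OF F(1) s(1)]]
          t(2)[OF b] s(2)[OF b] by simp
      then show ?thesis using c[OF F(3)[OF t(1) s(1)]] F(3)[OF t(1) s(1)] unfolding perp_def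
        by (simp del: free_module_simps)
    qed
    show "r \<odot>\<^bsub>E\<^esub> t \<in> perp j" if r: "r \<in> carrier R" for r
    proof -
      have "pairing (J j) b (r \<odot>\<^bsub>E\<^esub> t) = \<zero>" if b: "b \<in> K j" for b
        using module_hom_smult[OF pairing_hom[of "J j" b UNIV, OF Kc[OF b]] r subsetD[OF F(1) t(1)]] t(2)[OF b] r by simp
      then show ?thesis using c[OF F(5)[OF r t(1)]] F(5)[OF r t(1)] unfolding perp_def
        by (simp del: free_module_simps)
    qed
  qed
qed

lemma perp_T: "perp j \<subseteq> T j"
  unfolding perp_def by auto

lemma \<psi>_perp: "t \<in> perp j \<Longrightarrow> \<psi> j t \<in> perp (Suc j)"
proof -
  assume "t \<in> perp j"
  then have t: "t \<in> T j" "\<And>b. b \<in> K j \<Longrightarrow> pairing (J j) t b = \<zero>" unfolding perp_def by auto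
  have "pairing (J (Suc j)) (\<psi> j t) b = \<zero>" if b: "b \<in> K (Suc j)" for b
  proof -
    have bT: "b \<in> T (Suc j)" using b K_mem by blast
    show ?thesis
      using pairing_T_comm[OF \<psi>_mem[OF t(1)] bT] adjoint[OF bT t(1)]
        pairing_T_comm[OF \<phi>_mem[OF bT] t(1)] t(2)[OF \<phi>_K[OF b]] by simp
  qed
  then show ?thesis unfolding perp_def using \<psi>_mem[OF t(1)] by simp
qed

lemma coexact_iso:
  assumes "coexact j"
  shows "subquot_iso (\<psi> (Suc j)) (perp (Suc j)) (\<psi> j ` perp j) (\<psi> (Suc j) ` perp (Suc j)) {\<zero>\<^bsub>E\<^esub>}"
proof -
  have "{u \<in> perp (Suc j). \<psi> (Suc j) u = \<zero>\<^bsub>E\<^esub>} = \<psi> j ` perp j"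
  proof
    show "{u \<in> perp (Suc j). \<psi> (Suc j) u = \<zero>\<^bsub>E\<^esub>} \<subseteq> \<psi> j ` perp j"
      using assms unfolding coexact_def by blast
    show "\<psi> j ` perp j \<subseteq> {u \<in> perp (Suc j). \<psi> (Suc j) u = \<zero>\<^bsub>E\<^esub>}"
      using \<psi>_perp \<psi>\<psi> perp_T by blast
  qed
  then show ?thesis using subquot_iso_image[OF \<psi>_hom perp_sub, of "Suc j" "Suc j"] by simp
qed

text \<open>Dimension shifting towards higher terms: the cokernel at \<open>j + 1\<close> embeds
  into the acyclic \<open>perp (j + 2)\<close>, whose cokernel is considered one \<open>Ext\<close>
  degree higher. After at most \<open>k\<close> steps the end of the injective resolution is
  passed.\<close>

lemma ext_zero_coexact:
  assumes ex: "\<And>j. j \<ge> k0 \<Longrightarrow> coexact j" and ext: "\<And>j l. ext_zero (perp j) {\<zero>\<^bsub>E\<^esub>} l"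
  shows "j \<ge> k0 \<Longrightarrow> ext_zero (perp (Suc j)) (\<psi> j ` perp j) l"
proof -
  have pE: "perp j \<subseteq> carrier E" for j using perp_T TE by blast
  have "ext_zero (perp (Suc j)) (\<psi> j ` perp j) l" if "l + i \<ge> k" "j \<ge> k0" for i
    using that
  proof (induct i arbitrary: j l)
    case 0
    then show ?case using ext_zero_large[OF _ pE] by simp
  next
    case (Suc i)
    interpret E: module R "E :: ('a, 'b \<Rightarrow> 'a) module" by (rule E_module)
    let ?B = "\<psi> (Suc j) ` perp (Suc j)"
    have sub: "submodule ?B R E" by (rule submod_image[OF E_module E_module \<psi>_hom perp_sub])
    have z: "{\<zero>\<^bsub>E\<^esub>} \<subseteq> ?B" using E.submodD(2)[OF sub] by blast
    have le: "?B \<subseteq> perp (Suc (Suc j))" using \<psi>_perp by blast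
    have "ext_zero (perp (Suc (Suc j))) ?B (Suc l)" using Suc by simp
    from ext_zero_sub[OF z le pE ext this] have "ext_zero ?B {\<zero>\<^bsub>E\<^esub>} l" .
    then show ?case using ext_zero_iso[OF coexact_iso[OF ex[OF Suc(3)]]] by simp
  qed
  from this[of k] show "j \<ge> k0 \<Longrightarrow> ext_zero (perp (Suc j)) (\<psi> j ` perp j) l" by simp
qed

text \<open>A cycle \<open>u\<close> is a functional on \<open>perp (j + 1)\<close> that kills the
  coboundaries, so it extends to \<open>T (j + 2)\<close> as pairing with some \<open>s\<close>.
  Then \<open>u - \<phi> s\<close> pairs to zero with all of \<open>perp (j + 1)\<close>, and
  reflexivity, the assumption \<open>refl\<close>, puts it in \<open>K\<close>.\<close>

lemma exact_if_coexact:
  assumes ex: "coexact j" and ext: "ext_zero (T (Suc (Suc j))) (\<psi> (Suc j) ` perp (Suc j)) 0"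
    and refl: "\<And>u. u \<in> T (Suc j) \<Longrightarrow> (\<And>t. t \<in> perp (Suc j) \<Longrightarrow> pairing (J (Suc j)) u t = \<zero>) \<Longrightarrow> u \<in> K (Suc j)"
  shows "exact j"
  unfolding exact_def
proof (intro ballI impI)
  interpret E: module R "E :: ('a, 'b \<Rightarrow> 'a) module" by (rule E_module)
  fix u assume u: "u \<in> T (Suc j)" and \<phi>u: "\<phi> j u \<in> K j"
  note uc = free_module_closed[OF u]
  have hom: "pairing (J (Suc j)) u \<in> module_hom R E (ring_module R)" by (rule pairing_hom[OF uc])
  have kill: "pairing (J (Suc j)) u b = \<zero>" if "b \<in> \<psi> j ` perp j" for b
  proof -
    obtain t where t: "t \<in> perp j" "b = \<psi> j t" using \<open>b \<in> \<psi> j ` perp j\<close> by blast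
    have tT: "t \<in> T j" using t perp_T by blast
    have "pairing (J j) t (\<phi> j u) = \<zero>" using t(1) \<phi>u unfolding perp_def by blast
    then show ?thesis
      unfolding t(2) using adjoint[OF u tT] pairing_T_comm[OF \<phi>_mem[OF u] tT] by simp
  qed
  have BT: "\<psi> (Suc j) ` perp (Suc j) \<subseteq> T (Suc (Suc j))" using \<psi>_perp perp_T by blast
  obtain s where s: "s \<in> T (Suc (Suc j))"
    "\<And>a. a \<in> perp (Suc j) \<Longrightarrow> pairing (J (Suc (Suc j))) s (\<psi> (Suc j) a) = pairing (J (Suc j)) u a"
  proof (rule functional_lift[OF coexact_iso[OF ex] J_finite BT ext hom kill])
    fix b assume "b \<in> \<psi> j ` perp j" then show "b \<in> \<psi> j ` perp j" .
  next
    fix s assume "s \<in> T (Suc (Suc j))"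
      and "\<And>a. a \<in> perp (Suc j) \<Longrightarrow> pairing (J (Suc (Suc j))) s (\<psi> (Suc j) a) = pairing (J (Suc j)) u a"
    then show thesis by (rule that)
  qed
  note uE = subsetD[OF TE u] and sE = subsetD[OF TE \<phi>_mem[OF s(1)]]
  have d: "u \<ominus>\<^bsub>E\<^esub> \<phi> (Suc j) s \<in> T (Suc j)" by (rule E.submodD(4)[OF Fr_submodule u \<phi>_mem[OF s(1)]])
  have "u \<ominus>\<^bsub>E\<^esub> \<phi> (Suc j) s \<in> K (Suc j)"
  proof (rule refl[OF d])
    fix t assume t: "t \<in> perp (Suc j)"
    have tT: "t \<in> T (Suc j)" using t perp_T by blast
    have "pairing (J (Suc j)) (u \<ominus>\<^bsub>E\<^esub> \<phi> (Suc j) s) t = pairing (J (Suc j)) u t \<ominus> pairing (J (Suc j)) u t"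
      unfolding pairing_diff_left[OF uE sE subsetD[OF TE tT]] using adjoint[OF s(1) tT] s(2)[OF t] by simp
    then show "pairing (J (Suc j)) (u \<ominus>\<^bsub>E\<^esub> \<phi> (Suc j) s) t = \<zero>"
      using pairing_closed[of "J (Suc j)" u t] uc free_module_closed[OF tT] by (simp add: diff_self)
  qed
  moreover have "u = \<phi> (Suc j) s \<oplus>\<^bsub>E\<^esub> (u \<ominus>\<^bsub>E\<^esub> \<phi> (Suc j) s)"
    using E.M.add_diff_cancel[OF uE sE] by simp
  ultimately show "u \<in> bound (Suc j)" unfolding bound_def using s(1) by blast
qed

end

section \<open>Matrices\<close>

context cring
begin

lemma free_module_UNIV: "u \<in> Fr B \<Longrightarrow> u \<in> carrier E"
  by (simp add: free_module_carrier)

lemma pairing_Times_cols: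
  assumes "finite A" "finite B" "\<And>x. u x \<in> carrier R" "\<And>x. t x \<in> carrier R"
  shows "pairing (A \<times> B) u t = (\<Oplus>b\<in>B. pairing A (\<lambda>a. u (a, b)) (\<lambda>a. t (a, b)))"
  using assms(2)
proof (induct B)
  case empty
  show ?case by (simp add: pairing_def)
next
  case (insert b B)
  have "pairing (A \<times> insert b B) u t = (\<Oplus>x\<in>(\<lambda>a. (a, b)) ` A \<union> A \<times> B. u x \<otimes> t x)"
    unfolding pairing_def by (intro finsum_cong') (use assms in auto)
  also have "\<dots> = (\<Oplus>x\<in>(\<lambda>a. (a, b)) ` A. u x \<otimes> t x) \<oplus> (\<Oplus>x\<in>A \<times> B. u x \<otimes> t x)"
    using assms insert(1,2) by (intro finsum_Un_disjoint) auto
  also have "(\<Oplus>x\<in>(\<lambda>a. (a, b)) ` A. u x \<otimes> t x) = pairing A (\<lambda>a. u (a, b)) (\<lambda>a. t (a, b))"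
    unfolding pairing_def using assms by (subst finsum_reindex) (auto simp: inj_on_def)
  also have "(\<Oplus>x\<in>A \<times> B. u x \<otimes> t x) = (\<Oplus>b\<in>B. pairing A (\<lambda>a. u (a, b)) (\<lambda>a. t (a, b)))"
    using insert(3) unfolding pairing_def by simp
  finally show ?case
    using insert(1,2) assms by (simp add: pairing_closed)
qed

lemma pairing_Times_rows:
  assumes "finite A" "finite B" "\<And>x. u x \<in> carrier R" "\<And>x. t x \<in> carrier R"
  shows "pairing (A \<times> B) u t = (\<Oplus>a\<in>A. pairing B (\<lambda>b. u (a, b)) (\<lambda>b. t (a, b)))"
proof -
  have e: "A \<times> B = prod.swap ` (B \<times> A)" by auto
  have "pairing (A \<times> B) u t = (\<Oplus>x\<in>B \<times> A. u (prod.swap x) \<otimes> t (prod.swap x))"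
    unfolding pairing_def e using assms by (subst finsum_reindex) auto
  also have "\<dots> = (\<Oplus>a\<in>A. pairing B (\<lambda>b. u (a, b)) (\<lambda>b. t (a, b)))"
    using pairing_Times_cols[of B A "\<lambda>x. u (prod.swap x)" "\<lambda>x. t (prod.swap x)"] assms
    unfolding pairing_def by simp
  finally show ?thesis .
qed

text \<open>The \<open>p\<close> by \<open>q\<close> corner of \<open>A\<close> acts on all vectors:
  coordinates from \<open>q\<close> on are ignored, and those of the result from \<open>p\<close> on
  are zero. Thus it is a map of the ambient module with values in \<open>Fr {..<p}\<close>.\<close>

definition mat_op :: "(nat \<Rightarrow> nat \<Rightarrow> 'a) \<Rightarrow> nat \<Rightarrow> nat \<Rightarrow> (nat \<Rightarrow> 'a) \<Rightarrow> nat \<Rightarrow> 'a" where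
  "mat_op A p q u = (\<lambda>a. if a < p then pairing {..<q} (A a) u else \<zero>)"

abbreviation (input) transp :: "(nat \<Rightarrow> nat \<Rightarrow> 'a) \<Rightarrow> nat \<Rightarrow> nat \<Rightarrow> 'a" where
  "transp A \<equiv> \<lambda>a b. A b a"

lemma mat_op_mem:
  assumes "\<And>a b. A a b \<in> carrier R" "\<And>x. u x \<in> carrier R"
  shows "mat_op A p q u \<in> Fr {..<p}"
  using assms by (simp add: free_module_carrier_finite mat_op_def pairing_closed)

lemma mat_op_hom:
  assumes A: "\<And>a b. A a b \<in> carrier R"
  shows "mat_op A p q \<in> module_hom R E E"
proof (rule module_homI)
  have hom: "pairing {..<q} (A a) \<in> module_hom R E (ring_module R)" for a
    by (rule pairing_hom) (rule A)
  fix u :: "nat \<Rightarrow> 'a" assume u: "u \<in> carrier E"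
  show "mat_op A p q u \<in> carrier E"
    by (rule free_module_UNIV[OF mat_op_mem[of A u p q, OF A free_module_closed[OF u]]])
  show "mat_op A p q (u \<oplus>\<^bsub>E\<^esub> v) = mat_op A p q u \<oplus>\<^bsub>E\<^esub> mat_op A p q v"
    if v: "v \<in> carrier E" for v
    using module_hom_add[OF hom u v] by (simp add: mat_op_def fun_eq_iff)
  show "mat_op A p q (r \<odot>\<^bsub>E\<^esub> u) = r \<odot>\<^bsub>E\<^esub> mat_op A p q u"
    if r: "r \<in> carrier R" for r
    using module_hom_smult[OF hom r u] r by (simp add: mat_op_def fun_eq_iff)
qed

lemma mat_op_adjoint:
  assumes A: "\<And>a b. A a b \<in> carrier R"
    and u: "u \<in> Fr {..<q}" and t: "t \<in> Fr {..<p}"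
  shows "pairing {..<p} (mat_op A p q u) t = pairing {..<q} u (mat_op (transp A) q p t)"
proof -
  note tc = free_module_closed[OF t] and uc = free_module_closed[OF u]
  note tm = mat_op_mem[of "transp A" t q p, OF A tc]
  note tmc = free_module_closed[OF tm]
  have f: "(\<lambda>u. pairing {..<p} t (mat_op A p q u)) \<in> module_hom R E (ring_module R)"
    by (rule module_hom_comp[OF mat_op_hom pairing_hom]) (simp_all add: A tc)
  have g: "pairing {..<q} (mat_op (transp A) q p t) \<in> module_hom R E (ring_module R)"
    by (rule pairing_hom) (simp add: tmc)
  have "pairing {..<p} t (mat_op A p q u) = pairing {..<q} (mat_op (transp A) q p t) u"
  proof (rule module_hom_eqI[OF ring_module_is_module f g _ _ u])
    fix j assume j: "j \<in> {..<q}"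
    have "pairing {..<p} t (mat_op A p q (basis_vec R j)) = (\<Oplus>a\<in>{..<p}. t a \<otimes> A a j)"
      unfolding pairing_def[of "{..<p}"]
    proof (rule finsum_cong')
      fix a assume "a \<in> {..<p}"
      then show "t a \<otimes> mat_op A p q (basis_vec R j) a = t a \<otimes> A a j"
        using pairing_basis[of "{..<q}" "A a" j] j A by (simp add: mat_op_def)
    qed (use tc A in auto)
    also have "\<dots> = mat_op (transp A) q p t j"
      using j tc A unfolding mat_op_def pairing_def by (auto simp: m_comm intro!: finsum_cong')
    also have "\<dots> = pairing {..<q} (mat_op (transp A) q p t) (basis_vec R j)"
      by (rule pairing_basis[OF tmc _ j, symmetric]) simp
    finally show "pairing {..<p} t (mat_op A p q (basis_vec R j)) =
      pairing {..<q} (mat_op (transp A) q p t) (basis_vec R j)" .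
  qed simp_all
  moreover have "mat_op A p q u x \<in> carrier R" for x
    by (rule free_module_closed[OF mat_op_mem[of A u p q, OF A uc]])
  ultimately show ?thesis
    using pairing_comm[of "{..<p}" t "mat_op A p q u"] pairing_comm[of "{..<q}" u "mat_op (transp A) q p t"]
      tc uc tmc by simp
qed

text \<open>The elements of \<open>R\<^bsup>p \<times> c\<^esup>\<close> are the elements of the free module on \<open>nat \<times> nat\<close> supported in
  \<open>{..<p} \<times> {..<c}\<close>, and \<open>mat_op2 A\<close> is multiplication by \<open>A\<close> from the left.\<close>

definition mat_op2 :: "(nat \<Rightarrow> nat \<Rightarrow> 'a) \<Rightarrow> nat \<Rightarrow> nat \<Rightarrow> nat \<Rightarrow> (nat \<times> nat \<Rightarrow> 'a) \<Rightarrow> nat \<times> nat \<Rightarrow> 'a" where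
  "mat_op2 A p q c u = (\<lambda>(a, b). if b < c then mat_op A p q (\<lambda>x. u (x, b)) a else \<zero>)"

lemma col_hom: "(\<lambda>u a. u (a, b)) \<in> module_hom R (free_module R (UNIV :: ('p \<times> 'q) set)) E"
proof (rule module_homI)
  fix u :: "'p \<times> 'q \<Rightarrow> 'a" assume u: "u \<in> carrier E"
  have *: "{a. u (a, b) \<noteq> \<zero>} \<subseteq> fst ` {x. u x \<noteq> \<zero>}" by force
  have "finite {a. u (a, b) \<noteq> \<zero>}"
    by (rule finite_subset[OF *]) (use u in \<open>auto simp: free_module_carrier\<close>)
  then show "(\<lambda>a. u (a, b)) \<in> carrier E"
    using free_module_closed[OF u] by (simp add: free_module_carrier)
qed simp_all

lemma row_hom: "(\<lambda>u b. u (a, b)) \<in> module_hom R (free_module R (UNIV :: ('p \<times> 'q) set)) E"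
proof (rule module_homI)
  fix u :: "'p \<times> 'q \<Rightarrow> 'a" assume u: "u \<in> carrier E"
  have *: "{b. u (a, b) \<noteq> \<zero>} \<subseteq> snd ` {x. u x \<noteq> \<zero>}" by force
  have "finite {b. u (a, b) \<noteq> \<zero>}"
    by (rule finite_subset[OF *]) (use u in \<open>auto simp: free_module_carrier\<close>)
  then show "(\<lambda>b. u (a, b)) \<in> carrier E"
    using free_module_closed[OF u] by (simp add: free_module_carrier)
qed simp_all

definition inj_row :: "'p \<Rightarrow> ('q \<Rightarrow> 'a) \<Rightarrow> 'p \<times> 'q \<Rightarrow> 'a" where
  "inj_row a v = (\<lambda>(x, b). if x = a then v b else \<zero>)"

lemma inj_row_hom: "inj_row a \<in> module_hom R E E"
proof (rule module_homI)
  fix v :: "'q \<Rightarrow> 'a" assume v: "v \<in> carrier E"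
  have *: "{x. inj_row a v x \<noteq> \<zero>} \<subseteq> Pair a ` {b. v b \<noteq> \<zero>}"
    by (auto simp: inj_row_def split: if_splits)
  have "finite {x. inj_row a v x \<noteq> \<zero>}"
    by (rule finite_subset[OF *]) (use v in \<open>auto simp: free_module_carrier\<close>)
  then show "inj_row a v \<in> carrier E"
    using free_module_closed[OF v] by (auto simp: free_module_carrier inj_row_def)
qed (auto simp: inj_row_def fun_eq_iff)

lemma mat_op2_mem:
  assumes A: "\<And>a b. A a b \<in> carrier R" and u: "\<And>x. u x \<in> carrier R"
  shows "mat_op2 A p q c u \<in> Fr ({..<p} \<times> {..<c})"
  using mat_op_mem[of A "\<lambda>x. u (x, b)" p q for b, OF A u]
  by (auto simp: free_module_carrier_finite mat_op2_def)

lemma mat_op2_hom: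
  assumes A: "\<And>a b. A a b \<in> carrier R"
  shows "mat_op2 A p q c \<in> module_hom R E E"
proof (rule module_homI)
  have hom: "(\<lambda>u. mat_op A p q (\<lambda>a. u (a, b))) \<in> module_hom R (free_module R (UNIV :: (nat \<times> nat) set)) E" for b
    by (rule module_hom_comp[OF col_hom mat_op_hom]) (rule A)
  fix u :: "nat \<times> nat \<Rightarrow> 'a" assume u: "u \<in> carrier E"
  show "mat_op2 A p q c u \<in> carrier E"
    by (rule free_module_UNIV[OF mat_op2_mem[of A u p q c, OF A free_module_closed[OF u]]])
  show "mat_op2 A p q c (u \<oplus>\<^bsub>E\<^esub> v) = mat_op2 A p q c u \<oplus>\<^bsub>E\<^esub> mat_op2 A p q c v"
    if v: "v \<in> carrier E" for v
    using module_hom_add[OF hom u v] by (auto simp: mat_op2_def fun_eq_iff)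
  show "mat_op2 A p q c (r \<odot>\<^bsub>E\<^esub> u) = r \<odot>\<^bsub>E\<^esub> mat_op2 A p q c u"
    if r: "r \<in> carrier R" for r
    using module_hom_smult[OF hom r u] r by (auto simp: mat_op2_def fun_eq_iff)
qed

lemma col_mem:
  assumes "u \<in> Fr ({..<p::nat} \<times> {..<c::nat})"
  shows "(\<lambda>a. u (a, b)) \<in> Fr {..<p::nat}"
  using assms by (auto simp: free_module_carrier_finite)

lemma row_mem:
  assumes "u \<in> Fr ({..<p::nat} \<times> {..<c::nat})"
  shows "(\<lambda>b. u (a, b)) \<in> Fr {..<c::nat}"
  using assms by (auto simp: free_module_carrier_finite)

lemma mat_op2_adjoint:
  assumes A: "\<And>a b. A a b \<in> carrier R"
    and u: "u \<in> Fr ({..<q} \<times> {..<c})" and t: "t \<in> Fr ({..<p} \<times> {..<c})"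
  shows "pairing ({..<p} \<times> {..<c}) (mat_op2 A p q c u) t = pairing ({..<q} \<times> {..<c}) u (mat_op2 (transp A) q p c t)"
proof -
  note tc = free_module_closed[OF t] and uc = free_module_closed[OF u]
  note u' = free_module_closed[OF mat_op2_mem[of A u p q c, OF A uc]]
  note t' = free_module_closed[OF mat_op2_mem[of "transp A" t q p c, OF A tc]]
  have "pairing ({..<p} \<times> {..<c}) (mat_op2 A p q c u) t =
      (\<Oplus>b\<in>{..<c}. pairing {..<p} (\<lambda>a. mat_op2 A p q c u (a, b)) (\<lambda>a. t (a, b)))"
    using u' tc by (intro pairing_Times_cols) auto
  also have "\<dots> = (\<Oplus>b\<in>{..<c}. pairing {..<q} (\<lambda>a. u (a, b)) (\<lambda>a. mat_op2 (transp A) q p c t (a, b)))"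
  proof (rule finsum_cong'[OF refl])
    show "(\<lambda>b. pairing {..<q} (\<lambda>a. u (a, b)) (\<lambda>a. mat_op2 (transp A) q p c t (a, b))) \<in> {..<c} \<rightarrow> carrier R"
      using uc t' by (auto intro: pairing_closed)
    fix b assume "b \<in> {..<c}"
    then show "pairing {..<p} (\<lambda>a. mat_op2 A p q c u (a, b)) (\<lambda>a. t (a, b)) =
        pairing {..<q} (\<lambda>a. u (a, b)) (\<lambda>a. mat_op2 (transp A) q p c t (a, b))"
      using mat_op_adjoint[of A "\<lambda>a. u (a, b)" q "\<lambda>a. t (a, b)" p, OF A col_mem[OF u] col_mem[OF t]]
      by (simp add: mat_op2_def)
  qed
  also have "\<dots> = pairing ({..<q} \<times> {..<c}) u (mat_op2 (transp A) q p c t)"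
    using uc t' by (intro pairing_Times_cols[symmetric]) auto
  finally show ?thesis .
qed

text \<open>Multiplication from the left only takes scalar combinations of rows, so it preserves
  every condition that asks all rows to lie in a given submodule.\<close>

lemma mat_op2_row:
  assumes A: "\<And>a b. A a b \<in> carrier R" and u: "u \<in> Fr ({..<q} \<times> {..<c})" and a: "a < p"
  shows "(\<lambda>b. mat_op2 A p q c u (a, b)) =
    (\<Oplus>\<^bsub>E\<^esub>x\<in>{..<q}. A a x \<odot>\<^bsub>E\<^esub> (\<lambda>b. u (x, b)))"
proof
  fix b
  interpret E: module R "free_module R (UNIV :: nat set)" by (rule free_module_is_module)
  have cl: "(\<lambda>x. A a x \<odot>\<^bsub>E\<^esub> (\<lambda>b. u (x, b))) \<in> {..<q} \<rightarrow> Fr (UNIV :: nat set)"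
    by (rule Pi_I, rule E.smult_closed[OF A free_module_UNIV[OF row_mem[OF u]]])
  have "(\<Oplus>x\<in>{..<q}. A a x \<otimes> u (x, b)) = mat_op2 A p q c u (a, b)"
  proof (cases "b < c")
    case True
    then show ?thesis using a by (simp add: mat_op2_def mat_op_def pairing_def)
  next
    case False
    then have "u (x, b) = \<zero>" for x using free_module_eq_zero[OF u, of "(x, b)"] by simp
    then have "(\<Oplus>x\<in>{..<q}. A a x \<otimes> u (x, b)) = (\<Oplus>x\<in>{..<q}. \<zero>)"
      using A by (intro finsum_cong') auto
    then show ?thesis using False by (simp add: mat_op2_def)
  qed
  then show "mat_op2 A p q c u (a, b) =
      (\<Oplus>\<^bsub>E\<^esub>x\<in>{..<q}. A a x \<odot>\<^bsub>E\<^esub> (\<lambda>b. u (x, b))) b"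
    unfolding free_module_finsum[OF cl] by simp
qed

text \<open>The power \<open>A^p\<close> as arrays with \<open>p\<close> rows. For a submodule
  \<open>K\<close> of \<open>R^c\<close>, the quotient of \<open>R^(p x c)\<close> by
  \<open>row_power K p\<close> is the \<open>p\<close>-th power of \<open>R^c/K\<close>, that is,
  its tensor product with \<open>R^p\<close>.\<close>

definition row_power :: "('q \<Rightarrow> 'a) set \<Rightarrow> nat \<Rightarrow> (nat \<times> 'q \<Rightarrow> 'a) set" where
  "row_power A p = {u \<in> carrier E. (\<forall>a<p. (\<lambda>b. u (a, b)) \<in> A) \<and>
     (\<forall>a\<ge>p. \<forall>b. u (a, b) = \<zero>)}"

lemma row_power_sub:
  fixes A :: "('q \<Rightarrow> 'a) set"
  assumes A: "submodule A R E"
  shows "submodule (row_power A p) R E"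
proof -
  interpret E: module R "free_module R (UNIV :: 'q set)" by (rule free_module_is_module)
  interpret E2: module R "free_module R (UNIV :: (nat \<times> 'q) set)" by (rule free_module_is_module)
  note A' = E.submodD[OF A]
  show ?thesis
  proof (rule E2.submodI)
    show "row_power A p \<subseteq> carrier E" unfolding row_power_def by blast
    show "\<zero>\<^bsub>E\<^esub> \<in> row_power A p"
      unfolding row_power_def using A'(2) E2.M.zero_closed by simp
    fix u assume "u \<in> row_power A p"
    then have u: "u \<in> carrier E" "\<And>a. a < p \<Longrightarrow> (\<lambda>b. u (a, b)) \<in> A" "\<And>a b. a \<ge> p \<Longrightarrow> u (a, b) = \<zero>"
      unfolding row_power_def by auto
    show "u \<oplus>\<^bsub>E\<^esub> v \<in> row_power A p" if "v \<in> row_power A p" for v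
    proof -
      have v: "v \<in> carrier E" "\<And>a. a < p \<Longrightarrow> (\<lambda>b. v (a, b)) \<in> A" "\<And>a b. a \<ge> p \<Longrightarrow> v (a, b) = \<zero>"
        using that unfolding row_power_def by auto
      show ?thesis
        unfolding row_power_def using E2.M.a_closed[OF u(1) v(1)] A'(3)[OF u(2) v(2)] u(3) v(3) by simp
    qed
    show "r \<odot>\<^bsub>E\<^esub> u \<in> row_power A p" if r: "r \<in> carrier R" for r
      unfolding row_power_def using E2.smult_closed[OF r u(1)] A'(5)[OF r u(2)] u(3) r by simp
  qed
qed

lemma row_power_Fr: "row_power (Fr {..<c::nat}) p = Fr ({..<p} \<times> {..<c})"
proof
  show "row_power (Fr {..<c::nat}) p \<subseteq> Fr ({..<p} \<times> {..<c})"
  proof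
    fix u assume "u \<in> row_power (Fr {..<c::nat}) p"
    then have u: "u \<in> carrier E" "\<And>a. a < p \<Longrightarrow> (\<lambda>b. u (a, b)) \<in> Fr {..<c}"
      "\<And>a b. a \<ge> p \<Longrightarrow> u (a, b) = \<zero>"
      unfolding row_power_def by auto
    have "u (a, b) = \<zero>" if "(a, b) \<notin> {..<p} \<times> {..<c}" for a b
      using that u(2)[of a] u(3)[of a b] by (cases "a < p") (auto simp: free_module_carrier_finite)
    then show "u \<in> Fr ({..<p} \<times> {..<c})"
      using free_module_closed[OF u(1)] by (auto simp: free_module_carrier_finite)
  qed
  show "Fr ({..<p} \<times> {..<c}) \<subseteq> row_power (Fr {..<c::nat}) p"
  proof
    fix u assume u: "u \<in> Fr ({..<p} \<times> {..<c})"
    have "u (a, b) = \<zero>" if "a \<ge> p" for a b using free_module_eq_zero[OF u, of "(a, b)"] that by simp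
    then show "u \<in> row_power (Fr {..<c}) p"
      unfolding row_power_def using row_mem[OF u] free_module_UNIV[OF u] by simp
  qed
qed

lemma row_power_mono: "A \<subseteq> B \<Longrightarrow> row_power A p \<subseteq> row_power B p"
  unfolding row_power_def by auto

lemma row_power_zero: "row_power {\<lambda>_ :: 'q. \<zero>} p = {\<lambda>_. \<zero>}"
proof -
  interpret E2: module R "free_module R (UNIV :: (nat \<times> 'q) set)" by (rule free_module_is_module)
  have "u = (\<lambda>_. \<zero>)" if u: "u \<in> row_power {\<lambda>_. \<zero>} p" for u :: "nat \<times> 'q \<Rightarrow> 'a"
  proof
    fix x :: "nat \<times> 'q"
    obtain a b where x: "x = (a, b)" by (cases x)
    show "u x = \<zero>"
    proof (cases "a < p")
      case True
      then have "(\<lambda>b. u (a, b)) = (\<lambda>_. \<zero>)" using u unfolding row_power_def by simp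
      from fun_cong[OF this, of b] show ?thesis using x by simp
    qed (use u x in \<open>simp add: row_power_def\<close>)
  qed
  moreover have "(\<lambda>_. \<zero>) \<in> row_power {\<lambda>_ :: 'q. \<zero>} p"
    using E2.M.zero_closed unfolding row_power_def by simp
  ultimately show ?thesis by blast
qed

lemma inj_row_power:
  fixes A :: "('q \<Rightarrow> 'a) set"
  assumes A: "submodule A R E" and v: "v \<in> A" and a: "a < p"
  shows "inj_row a v \<in> row_power A p"
proof -
  interpret E: module R "free_module R (UNIV :: 'q set)" by (rule free_module_is_module)
  note A' = E.submodD[OF A]
  have "inj_row a v \<in> carrier E"
    by (rule module_hom_closed[OF inj_row_hom subsetD[OF A'(1) v]])
  moreover have "(\<lambda>b. inj_row a v (x, b)) \<in> A" for x
    using A'(2) v by (cases "x = a") (simp_all add: inj_row_def)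
  ultimately show ?thesis using a unfolding row_power_def by (auto simp: inj_row_def)
qed

lemma row_power_expand:
  fixes u :: "nat \<times> 'q \<Rightarrow> 'a"
  assumes u: "u \<in> row_power A p"
  shows "u = (\<Oplus>\<^bsub>E\<^esub>a\<in>{..<p}. inj_row a (\<lambda>b. u (a, b)))"
proof -
  have uE: "u \<in> carrier E" using u unfolding row_power_def by auto
  have c: "(\<lambda>a. inj_row a (\<lambda>b. u (a, b))) \<in> {..<p} \<rightarrow> carrier E"
    using module_hom_closed[OF inj_row_hom module_hom_closed[OF row_hom uE]] by auto
  have "(\<Oplus>a\<in>{..<p}. inj_row a (\<lambda>b. u (a, b)) x) = u x" for x
  proof -
    obtain x1 x2 where x: "x = (x1, x2)" by (cases x)
    have "(\<Oplus>a\<in>{..<p}. inj_row a (\<lambda>b. u (a, b)) x) = (\<Oplus>a\<in>{..<p}. if x1 = a then u (a, x2) else \<zero>)"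
      using free_module_closed[OF uE] x by (intro finsum_cong') (auto simp: inj_row_def)
    also have "\<dots> = u x"
    proof (cases "x1 < p")
      case True
      then show ?thesis using free_module_closed[OF uE] x by (subst finsum_singleton) auto
    next
      case False
      have "(\<Oplus>a\<in>{..<p}. if x1 = a then u (a, x2) else \<zero>) = (\<Oplus>a\<in>{..<p}. \<zero>)"
        using False by (intro finsum_cong') auto
      then show ?thesis using False u x unfolding row_power_def by simp
    qed
    finally show ?thesis .
  qed
  then show ?thesis by (simp add: free_module_finsum[OF c])
qed

end

context finite_inj_res
begin

text \<open>Additivity of \<open>Ext\<close>: the cocycle is restricted to each row, bounded there,
  and the bounding cochains are summed.\<close>

lemma ext_zero_row_power:
  fixes A B :: "('q::countable \<Rightarrow> 'a) set"
  assumes A: "submodule A R E" and B: "submodule B R E" and ext: "ext_zero A B l"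
  shows "ext_zero (row_power A p) (row_power B p) l"
proof (rule ext_zeroI)
  interpret E2: module R "E :: ('a, nat \<times> 'q \<Rightarrow> 'a) module" by (rule E_module)
  interpret E: module R "E :: ('a, 'q \<Rightarrow> 'a) module" by (rule E_module)
  interpret I0: module R "I l" by (rule I_module)
  interpret I1: module R "I (Suc l)" by (rule I_module)
  fix f :: "(nat \<times> 'q \<Rightarrow> 'a) \<Rightarrow> 'i" assume f: "cocycle (row_power A p) (row_power B p) (Suc l) f"
  note fc = cocycleD[OF f]
  have "\<exists>g. g \<in> module_hom R E (I l) \<and> (\<forall>b\<in>B. g b = \<zero>\<^bsub>I l\<^esub>) \<and> (\<forall>v\<in>A. f (inj_row a v) = \<delta> l (g v))"
    if a: "a < p" for a
  proof -
    have "cocycle A B (Suc l) (\<lambda>v. f (inj_row a v))"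
      using module_hom_comp[OF inj_row_hom fc(1)] fc(2)[OF inj_row_power[OF B _ a]] fc(3)[OF inj_row_power[OF A _ a]]
      by (intro cocycleI)
    then show ?thesis by (rule ext_zeroE[OF ext]) auto
  qed
  then obtain g where g: "\<And>a. a < p \<Longrightarrow> g a \<in> module_hom R E (I l)" "\<And>a b. a < p \<Longrightarrow> b \<in> B \<Longrightarrow> g a b = \<zero>\<^bsub>I l\<^esub>"
    "\<And>a v. a < p \<Longrightarrow> v \<in> A \<Longrightarrow> f (inj_row a v) = \<delta> l (g a v)" by metis
  define h where "h = (\<lambda>u. \<Oplus>\<^bsub>I l\<^esub>a\<in>{..<p}. g a (\<lambda>b. u (a, b)))"
  have h: "h \<in> module_hom R E (I l)"
    unfolding h_def
  proof (rule I0.module_hom_sum_map)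
    fix a assume "a \<in> {..<p}"
    then show "(\<lambda>u. g a (\<lambda>b. u (a, b))) \<in> module_hom R E (I l)"
      by (intro module_hom_comp[OF row_hom g(1)]) simp
  qed
  have "h b = \<zero>\<^bsub>I l\<^esub>" if b: "b \<in> row_power B p" for b
  proof -
    have "h b = (\<Oplus>\<^bsub>I l\<^esub>a\<in>{..<p}. \<zero>\<^bsub>I l\<^esub>)"
      unfolding h_def using b g(2) unfolding row_power_def by (intro I0.M.finsum_cong') auto
    then show ?thesis by simp
  qed
  moreover have "f u = \<delta> l (h u)" if u: "u \<in> row_power A p" for u
  proof -
    have uE: "u \<in> carrier E" and r: "\<And>a. a < p \<Longrightarrow> (\<lambda>b. u (a, b)) \<in> A" using u unfolding row_power_def by auto
    have c: "(\<lambda>a. inj_row a (\<lambda>b. u (a, b))) \<in> {..<p} \<rightarrow> carrier E"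
      using module_hom_closed[OF inj_row_hom module_hom_closed[OF row_hom uE]] by auto
    have gc: "g a (\<lambda>b. u (a, b)) \<in> carrier (I l)" if "a < p" for a
      using module_hom_closed[OF g(1)[OF that] module_hom_closed[OF row_hom uE]] .
    have "f u = f (\<Oplus>\<^bsub>E\<^esub>a\<in>{..<p}. inj_row a (\<lambda>b. u (a, b)))"
      using row_power_expand[OF u] by simp
    also have "\<dots> = (\<Oplus>\<^bsub>I (Suc l)\<^esub>a\<in>{..<p}. f (inj_row a (\<lambda>b. u (a, b))))"
      by (rule module_hom_finsum[OF E_module I_module fc(1) c])
    also have "\<dots> = (\<Oplus>\<^bsub>I (Suc l)\<^esub>a\<in>{..<p}. \<delta> l (g a (\<lambda>b. u (a, b))))"
      using g(3)[OF _ r] gc module_hom_closed[OF \<delta>_hom] by (intro I1.M.finsum_cong') auto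
    also have "\<dots> = \<delta> l (h u)"
      unfolding h_def using gc by (intro module_hom_finsum[OF I_module I_module \<delta>_hom, symmetric]) auto
    finally show ?thesis .
  qed
  ultimately show "\<exists>g. g \<in> module_hom R E (I l) \<and> (\<forall>b\<in>row_power B p. g b = \<zero>\<^bsub>I l\<^esub>) \<and>
      (\<forall>a\<in>row_power A p. f a = \<delta> l (g a))" using h by blast
qed

end

section \<open>Complexes of free modules with coefficients\<close>

text \<open>The differentials are matrices because these act on powers of any module; with
  coefficients in \<open>N\<close> they compute \<open>Tor\<close>, and their transposes compute
  \<open>Ext\<close>.\<close>

locale free_complex = finite_inj_res R I \<delta> \<eta> k
  for R :: "('a, 'r) ring_scheme" (structure) and I :: "nat \<Rightarrow> ('a, 'i) module" and \<delta> \<eta> k +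
  fixes A :: "nat \<Rightarrow> nat \<Rightarrow> nat \<Rightarrow> 'a" and n :: "nat \<Rightarrow> nat"
  assumes A_closed: "\<And>j a b. A j a b \<in> carrier R"
    and A_complex: "\<And>j u. u \<in> carrier (free_module R {..<n (Suc (Suc j))}) \<Longrightarrow>
      mat_op (A j) (n j) (n (Suc j)) (mat_op (A (Suc j)) (n (Suc j)) (n (Suc (Suc j))) u) = (\<lambda>_. \<zero>)"
begin

abbreviation D :: "nat \<Rightarrow> (nat \<Rightarrow> 'a) \<Rightarrow> nat \<Rightarrow> 'a" where
  "D j \<equiv> mat_op (A j) (n j) (n (Suc j))"

abbreviation Dt :: "nat \<Rightarrow> (nat \<Rightarrow> 'a) \<Rightarrow> nat \<Rightarrow> 'a" where
  "Dt j \<equiv> mat_op (\<lambda>a b. A j b a) (n (Suc j)) (n j)"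

abbreviation D2 :: "nat \<Rightarrow> nat \<Rightarrow> (nat \<times> nat \<Rightarrow> 'a) \<Rightarrow> nat \<times> nat \<Rightarrow> 'a" where
  "D2 c j \<equiv> mat_op2 (A j) (n j) (n (Suc j)) c"

abbreviation Dt2 :: "nat \<Rightarrow> nat \<Rightarrow> (nat \<times> nat \<Rightarrow> 'a) \<Rightarrow> nat \<times> nat \<Rightarrow> 'a" where
  "Dt2 c j \<equiv> mat_op2 (\<lambda>a b. A j b a) (n (Suc j)) (n j) c"

lemma D_mem: "u \<in> Fr B \<Longrightarrow> D j u \<in> Fr {..<n j}"
  by (rule mat_op_mem) (simp_all add: A_closed free_module_closed[where R = R])

lemma Dt_mem: "u \<in> Fr B \<Longrightarrow> Dt j u \<in> Fr {..<n (Suc j)}"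
  by (rule mat_op_mem) (simp_all add: A_closed free_module_closed[where R = R])

lemma D_hom: "D j \<in> module_hom R E E" and Dt_hom: "Dt j \<in> module_hom R E E"
  by (rule mat_op_hom, rule A_closed)+

lemma D_adjoint:
  "u \<in> Fr {..<n (Suc j)} \<Longrightarrow> t \<in> Fr {..<n j} \<Longrightarrow>
    pairing {..<n j} (D j u) t = pairing {..<n (Suc j)} u (Dt j t)"
  by (rule mat_op_adjoint) (simp_all add: A_closed)

text \<open>The complex itself, without coefficients: with \<open>K = 0\<close> the orthogonal
  complement is everything and the dual is the complex of transposes.\<close>

sublocale V: dual_complex R I \<delta> \<eta> k "\<lambda>j. {..<n j}" D Dt "\<lambda>_. {\<zero>\<^bsub>E\<^esub>}"
proof (intro dual_complex.intro dual_complex_axioms.intro)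
  interpret E: module R "E :: ('a, nat \<Rightarrow> 'a) module" by (rule E_module)
  fix j
  show "submodule {\<zero>\<^bsub>E\<^esub>} R (E :: ('a, nat \<Rightarrow> 'a) module)" by (rule E.submod_zero)
  show "{\<zero>\<^bsub>E\<^esub>} \<subseteq> Fr {..<n j}" using E.submodD(2)[OF Fr_submodule] by blast
  show "D j u \<in> {\<zero>\<^bsub>E\<^esub>}" if "u \<in> {\<zero>\<^bsub>E\<^esub>}" for u
    using that module_hom_zero[OF E_module E_module D_hom] by blast
qed (simp_all add: D_hom Dt_hom D_mem Dt_mem D_adjoint A_complex finite_inj_res_axioms)

lemma V_perp: "V.perp j = Fr {..<n j}"
proof -
  have "pairing {..<n j} t \<zero>\<^bsub>E\<^esub> = \<zero>" if "t \<in> Fr {..<n j}" for t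
    using pairing_comm[of "{..<n j}" t "\<zero>\<^bsub>E\<^esub>"] free_module_closed[OF that] by (simp add: pairing_zero)
  then show ?thesis unfolding V.perp_def by auto
qed

lemma V_bound: "V.bound j = D j ` Fr {..<n (Suc j)}"
proof -
  interpret E: module R "E :: ('a, nat \<Rightarrow> 'a) module" by (rule E_module)
  have "D j u \<oplus>\<^bsub>E\<^esub> \<zero>\<^bsub>E\<^esub> = D j u" if "u \<in> Fr {..<n (Suc j)}" for u
    by (rule E.M.r_zero[OF subsetD[OF Fr_subset_E D_mem[OF that]]])
  then have "(\<lambda>u. D j u \<oplus>\<^bsub>E\<^esub> \<zero>\<^bsub>E\<^esub>) ` Fr {..<n (Suc j)} = D j ` Fr {..<n (Suc j)}"
    by (rule image_cong[OF refl])
  moreover have "V.bound j = (\<lambda>u. D j u \<oplus>\<^bsub>E\<^esub> \<zero>\<^bsub>E\<^esub>) ` Fr {..<n (Suc j)}"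
    unfolding V.bound_def by blast
  ultimately show ?thesis by simp
qed

text \<open>These vectors are the functionals on \<open>R^c/K\<close>.\<close>

definition perp_of :: "nat \<Rightarrow> (nat \<Rightarrow> 'a) set \<Rightarrow> (nat \<Rightarrow> 'a) set" where
  "perp_of c K = {t \<in> Fr {..<c}. \<forall>b\<in>K. pairing {..<c} t b = \<zero>}"

abbreviation Zp :: "(nat \<Rightarrow> 'a) set" where
  "Zp \<equiv> perp_of (n 0) (D 0 ` Fr {..<n (Suc 0)})"

text \<open>Here \<open>D\<close> is a free resolution of \<open>R\<^bsup>n 0\<^esup>/Z\<close>, where \<open>Z\<close> is the image of \<open>D 0\<close>; the dual
  of this module is \<open>Zp\<close>.\<close>

context
  assumes D_exact: "\<And>j u. u \<in> Fr {..<n (Suc j)} \<Longrightarrow> D j u = \<zero>\<^bsub>E\<^esub> \<Longrightarrow> u \<in> D (Suc j) ` Fr {..<n (Suc (Suc j))}"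
    and D_ext: "\<And>l. ext_zero (Fr {..<n 0}) (D 0 ` Fr {..<n (Suc 0)}) l"
begin

text \<open>The cokernel at the end of the resolution has no \<open>Ext\<close> by assumption, so
  dimension shifting starts with threshold 0 and the dual is exact at every positive term.\<close>

lemma V_coexact: "V.coexact j"
proof -
  have ex: "V.exact j" for j
    unfolding V.exact_def V_bound using D_exact by blast
  have "ext_zero (Fr {..<n (0 + j)}) (V.bound (0 + j)) 0"
    by (rule V.ext_zero_bound[where c = 0]) (simp_all add: ex D_ext V_bound ext_zero_free del: free_module_simps)
  then show ?thesis using V.coexact_if_exact[OF ex] by simp
qed

lemma Dt_exact: "t \<in> Fr {..<n (Suc j)} \<Longrightarrow> Dt (Suc j) t = \<zero>\<^bsub>E\<^esub> \<Longrightarrow> \<exists>s\<in>Fr {..<n j}. t = Dt j s"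
  using V_coexact[of j] unfolding V.coexact_def V_perp by blast

lemma Zp_ker: "Zp = {t \<in> Fr {..<n 0}. Dt 0 t = \<zero>\<^bsub>E\<^esub>}"
proof -
  interpret E: module R "E :: ('a, nat \<Rightarrow> 'a) module" by (rule E_module)
  have "(\<forall>b\<in>D 0 ` Fr {..<n (Suc 0)}. pairing {..<n 0} t b = \<zero>) \<longleftrightarrow> Dt 0 t = \<zero>\<^bsub>E\<^esub>" if t: "t \<in> Fr {..<n 0}" for t
  proof -
    have e: "pairing {..<n 0} t (D 0 u) = pairing {..<n (Suc 0)} (Dt 0 t) u" if u: "u \<in> Fr {..<n (Suc 0)}" for u
      using D_adjoint[OF u t] V.pairing_T_comm[OF t D_mem[OF u]] V.pairing_T_comm[OF u Dt_mem[OF t]] by simp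
    show ?thesis
    proof
      assume a: "\<forall>b\<in>D 0 ` Fr {..<n (Suc 0)}. pairing {..<n 0} t b = \<zero>"
      show "Dt 0 t = \<zero>\<^bsub>E\<^esub>"
      proof (rule pairing_eqI[OF _ Dt_mem[OF t] E.submodD(2)[OF Fr_submodule]])
        fix u assume u: "u \<in> Fr {..<n (Suc 0)}"
        have "pairing {..<n (Suc 0)} (Dt 0 t) u = \<zero>" using a u e[OF u] by auto
        moreover have "pairing {..<n (Suc 0)} \<zero>\<^bsub>E\<^esub> u = \<zero>"
          using free_module_closed[OF u] by (simp add: pairing_zero)
        ultimately show "pairing {..<n (Suc 0)} (Dt 0 t) u = pairing {..<n (Suc 0)} \<zero>\<^bsub>E\<^esub> u" by simp
      qed simp
    next
      assume "Dt 0 t = \<zero>\<^bsub>E\<^esub>"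
      then show "\<forall>b\<in>D 0 ` Fr {..<n (Suc 0)}. pairing {..<n 0} t b = \<zero>"
        using e by (auto simp: pairing_zero free_module_closed)
    qed
  qed
  then show ?thesis unfolding perp_of_def by blast
qed

lemma Zp_iso: "subquot_iso (Dt 0) (Fr {..<n 0}) Zp (Dt 0 ` Fr {..<n 0}) {\<zero>\<^bsub>E\<^esub>}"
  unfolding Zp_ker by (rule subquot_iso_image[OF Dt_hom Fr_submodule])

text \<open>The dual complex is exact all the way up, so the cokernel of its first map is an
  arbitrarily high syzygy and inherits vanishing from beyond the end of the injective
  resolution.\<close>

lemma ext_zero_Dt: "ext_zero (Fr {..<n (Suc 0)}) (Dt 0 ` Fr {..<n 0}) l"
  using V.ext_zero_coexact[of 0, OF V_coexact, of 0 l] unfolding V_perp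
  by (simp add: ext_zero_free del: free_module_simps)

text \<open>By \<open>Zp_iso\<close> this quotient is the image of \<open>Dt 0\<close>, a submodule
  of a free module with acyclic cokernel.\<close>

lemma ext_zero_Zp: "ext_zero (Fr {..<n 0}) Zp l"
proof -
  interpret E: module R "E :: ('a, nat \<Rightarrow> 'a) module" by (rule E_module)
  have "{\<zero>\<^bsub>E\<^esub>} \<subseteq> Dt 0 ` Fr {..<n 0}"
    using E.submodD(2)[OF submod_image[OF E_module E_module Dt_hom[of 0] Fr_submodule[of "{..<n 0}"]]] by blast
  moreover have "Dt 0 ` Fr {..<n 0} \<subseteq> Fr {..<n (Suc 0)}" using Dt_mem by blast
  ultimately have "ext_zero (Dt 0 ` Fr {..<n 0}) {\<zero>\<^bsub>E\<^esub>} l"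
    by (rule ext_zero_sub[OF _ _ Fr_subset_E ext_zero_free ext_zero_Dt]) simp
  then show ?thesis using ext_zero_iso[OF Zp_iso] by simp
qed

lemma Zp_sub: "submodule Zp R E"
  unfolding Zp_ker by (rule ker_submodule[OF Dt_hom Fr_submodule])

lemma Zp_le: "Zp \<subseteq> Fr {..<n 0}"
  unfolding perp_of_def by blast

lemma ext_zero_dual: "ext_zero Zp {\<zero>\<^bsub>E\<^esub>} l"
proof -
  interpret E: module R "E :: ('a, nat \<Rightarrow> 'a) module" by (rule E_module)
  have "{\<zero>\<^bsub>E\<^esub>} \<subseteq> Zp" using E.submodD(2)[OF Zp_sub] by blast
  then show ?thesis
    by (rule ext_zero_sub[OF _ Zp_le Fr_subset_E ext_zero_free ext_zero_Zp]) simp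
qed

text \<open>\<open>R^(n 0)/Z\<close> embeds in its bidual: the pairing with \<open>u\<close> is a
  functional on the image of \<open>Dt 0\<close>, it extends to \<open>R^(n 1)\<close> as pairing
  with some \<open>s\<close> because the cokernel has no \<open>Ext\<close> in degree 1, and by
  adjointness \<open>u\<close> is \<open>D 0 s\<close>.\<close>

lemma Zp_reflexive:
  assumes u: "u \<in> Fr {..<n 0}" and kill: "\<And>t. t \<in> Zp \<Longrightarrow> pairing {..<n 0} u t = \<zero>"
  shows "u \<in> D 0 ` Fr {..<n (Suc 0)}"
proof -
  have hom: "pairing {..<n 0} u \<in> module_hom R E (ring_module R)"
    by (rule pairing_hom) (simp add: free_module_closed[OF u])
  have le: "Dt 0 ` Fr {..<n 0} \<subseteq> Fr {..<n (Suc 0)}" using Dt_mem by blast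
  obtain s where s: "s \<in> Fr {..<n (Suc 0)}"
    "\<And>t. t \<in> Fr {..<n 0} \<Longrightarrow> pairing {..<n (Suc 0)} s (Dt 0 t) = pairing {..<n 0} u t"
  proof (rule functional_lift[OF Zp_iso _ le ext_zero_Dt hom kill])
    fix s assume "s \<in> Fr {..<n (Suc 0)}"
      and "\<And>t. t \<in> Fr {..<n 0} \<Longrightarrow> pairing {..<n (Suc 0)} s (Dt 0 t) = pairing {..<n 0} u t"
    then show thesis by (rule that)
  qed simp_all
  have "u = D 0 s"
    by (rule pairing_eqI[OF _ u D_mem[OF s(1)]]) (simp_all add: D_adjoint[OF s(1)] s(2))
  then show ?thesis using s(1) by blast
qed

end

text \<open>The complex \<open>D \<otimes> (R\<^bsup>c\<^esup>/K)\<close> and its dual.\<close>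

lemma coeff_complex:
  assumes K: "submodule K R E" "K \<subseteq> Fr {..<c::nat}"
  shows "dual_complex R I \<delta> \<eta> k (\<lambda>j. {..<n j} \<times> {..<c}) (D2 c) (Dt2 c) (\<lambda>j. row_power K (n j))"
proof (intro dual_complex.intro dual_complex_axioms.intro)
  show "finite_inj_res R I \<delta> \<eta> k" by (rule finite_inj_res_axioms)
  interpret E: module R "E :: ('a, nat \<Rightarrow> 'a) module" by (rule E_module)
  interpret E2: module R "E :: ('a, nat \<times> nat \<Rightarrow> 'a) module" by (rule E_module)
  fix j
  show "finite ({..<n j} \<times> {..<c})" by simp
  show "D2 c j \<in> module_hom R E E" "Dt2 c j \<in> module_hom R E E"
    by (rule mat_op2_hom, rule A_closed)+
  show mem: "D2 c j u \<in> Fr ({..<n j} \<times> {..<c})" if "u \<in> Fr ({..<n (Suc j)} \<times> {..<c})" for u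
    using free_module_closed[OF that] by (intro mat_op2_mem A_closed)
  show "Dt2 c j u \<in> Fr ({..<n (Suc j)} \<times> {..<c})" if "u \<in> Fr ({..<n j} \<times> {..<c})" for u
    using free_module_closed[OF that] by (intro mat_op2_mem A_closed)
  show "pairing ({..<n j} \<times> {..<c}) (D2 c j u) t = pairing ({..<n (Suc j)} \<times> {..<c}) u (Dt2 c j t)"
    if "u \<in> Fr ({..<n (Suc j)} \<times> {..<c})" "t \<in> Fr ({..<n j} \<times> {..<c})" for u t
    using that by (intro mat_op2_adjoint A_closed)
  show "D2 c j (D2 c (Suc j) u) = \<zero>\<^bsub>E\<^esub>" if u: "u \<in> Fr ({..<n (Suc (Suc j))} \<times> {..<c})" for u
  proof
    fix x :: "nat \<times> nat"
    obtain a b where x: "x = (a, b)" by (cases x)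
    have "mat_op (A j) (n j) (n (Suc j)) (\<lambda>y. D2 c (Suc j) u (y, b)) a = \<zero>" if "b < c"
      using A_complex[OF col_mem[OF u], of b] that by (simp add: mat_op2_def fun_eq_iff)
    then show "D2 c j (D2 c (Suc j) u) x = \<zero>\<^bsub>E\<^esub> x" unfolding x mat_op2_def[of "A j"] by simp
  qed
  show "submodule (row_power K (n j)) R E" by (rule row_power_sub[OF K(1)])
  show "row_power K (n j) \<subseteq> Fr ({..<n j} \<times> {..<c})"
    using row_power_mono[OF K(2)] unfolding row_power_Fr .
  show "D2 c j u \<in> row_power K (n j)" if u: "u \<in> row_power K (n (Suc j))" for u
  proof -
    have uF: "u \<in> Fr ({..<n (Suc j)} \<times> {..<c})" using u row_power_mono[OF K(2)] unfolding row_power_Fr by blast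
    note uc = free_module_closed[OF uF]
    have r: "(\<lambda>b. u (a, b)) \<in> K" if "a < n (Suc j)" for a using u that unfolding row_power_def by blast
    have "(\<lambda>b. D2 c j u (a, b)) \<in> K" if a: "a < n j" for a
    proof -
      have "(\<Oplus>\<^bsub>E\<^esub>x\<in>{..<n (Suc j)}. A j a x \<odot>\<^bsub>E\<^esub> (\<lambda>b. u (x, b))) \<in> K"
        by (rule E.submod_finsum[OF K(1)], rule E.submodD(5)[OF K(1) A_closed]) (simp add: r)
      then show ?thesis unfolding mat_op2_row[of "A j", OF A_closed uF a] .
    qed
    moreover have "D2 c j u (a, b) = \<zero>" if "a \<ge> n j" for a b
      using that by (simp add: mat_op2_def mat_op_def)
    ultimately show ?thesis
      unfolding row_power_def using free_module_UNIV[OF mem[OF uF]] by blast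
  qed
qed

lemma pairing_inj_row:
  assumes t: "t \<in> Fr ({..<p} \<times> {..<c})" and v: "v \<in> Fr {..<c::nat}" and a: "a < (p::nat)"
  shows "pairing ({..<p} \<times> {..<c}) t (inj_row a v) = pairing {..<c} (\<lambda>b. t (a, b)) v"
proof -
  note tc = free_module_closed[OF t] and vc = free_module_closed[OF v]
  have pc: "pairing {..<c} (\<lambda>b. t (x, b)) v \<in> carrier R" for x
    by (rule pairing_closed) (simp_all add: tc vc)
  have ic: "inj_row a v x \<in> carrier R" for x using vc by (cases x) (simp add: inj_row_def)
  have "pairing ({..<p} \<times> {..<c}) t (inj_row a v) =
      (\<Oplus>x\<in>{..<p}. pairing {..<c} (\<lambda>b. t (x, b)) (\<lambda>b. inj_row a v (x, b)))"
    by (rule pairing_Times_rows) (simp_all add: tc ic)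
  also have "\<dots> = (\<Oplus>x\<in>{..<p}. if a = x then pairing {..<c} (\<lambda>b. t (x, b)) v else \<zero>)"
  proof (rule finsum_cong'[OF refl])
    show "(\<lambda>x. if a = x then pairing {..<c} (\<lambda>b. t (x, b)) v else \<zero>) \<in> {..<p} \<rightarrow> carrier R"
      using pc by auto
    fix x
    show "pairing {..<c} (\<lambda>b. t (x, b)) (\<lambda>b. inj_row a v (x, b)) =
        (if a = x then pairing {..<c} (\<lambda>b. t (x, b)) v else \<zero>)"
      using pairing_comm[of "{..<c}" "\<lambda>b. t (x, b)" "\<lambda>_. \<zero>"] tc by (auto simp: inj_row_def pairing_zero)
  qed
  also have "\<dots> = pairing {..<c} (\<lambda>b. t (a, b)) v"
    using a pc by (subst finsum_singleton) auto
  finally show ?thesis .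
qed

text \<open>Being orthogonal to all arrays with rows in \<open>K\<close> can be tested on arrays
  with a single nonzero row, so it is a condition on each row separately.\<close>

lemma coeff_perp:
  assumes K: "submodule K R E" "K \<subseteq> Fr {..<c::nat}"
  shows "dual_complex.perp R (\<lambda>j. {..<n j} \<times> {..<c}) (\<lambda>j. row_power K (n j)) j = row_power (perp_of c K) (n j)"
proof -
  interpret W: dual_complex R I \<delta> \<eta> k "\<lambda>j. {..<n j} \<times> {..<c}" "D2 c" "Dt2 c" "\<lambda>j. row_power K (n j)"
    by (rule coeff_complex[OF K])
  show ?thesis
  proof
    show "W.perp j \<subseteq> row_power (perp_of c K) (n j)"
    proof
      fix t assume "t \<in> W.perp j"
      then have t: "t \<in> Fr ({..<n j} \<times> {..<c})"
        "\<And>b. b \<in> row_power K (n j) \<Longrightarrow> pairing ({..<n j} \<times> {..<c}) t b = \<zero>"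
        unfolding W.perp_def by auto
      have "(\<lambda>b. t (a, b)) \<in> perp_of c K" if a: "a < n j" for a
        unfolding perp_of_def
      proof (intro CollectI conjI ballI)
        show "(\<lambda>b. t (a, b)) \<in> Fr {..<c}" by (rule row_mem[OF t(1)])
        fix v assume v: "v \<in> K"
        show "pairing {..<c} (\<lambda>b. t (a, b)) v = \<zero>"
          using pairing_inj_row[OF t(1) subsetD[OF K(2) v] a] t(2)[OF inj_row_power[OF K(1) v a]] by simp
      qed
      moreover have "t (a, b) = \<zero>" if "a \<ge> n j" for a b using free_module_eq_zero[OF t(1), of "(a, b)"] that by simp
      ultimately show "t \<in> row_power (perp_of c K) (n j)"
        unfolding row_power_def using free_module_UNIV[OF t(1)] by blast
    qed
    show "row_power (perp_of c K) (n j) \<subseteq> W.perp j"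
    proof
      fix t assume t: "t \<in> row_power (perp_of c K) (n j)"
      have le: "perp_of c K \<subseteq> Fr {..<c}" unfolding perp_of_def by blast
      have tF: "t \<in> Fr ({..<n j} \<times> {..<c})" using t row_power_mono[OF le] unfolding row_power_Fr by blast
      have "pairing ({..<n j} \<times> {..<c}) t b = \<zero>" if b: "b \<in> row_power K (n j)" for b
      proof -
        have bF: "b \<in> Fr ({..<n j} \<times> {..<c})" using b row_power_mono[OF K(2)] unfolding row_power_Fr by blast
        have "pairing ({..<n j} \<times> {..<c}) t b = (\<Oplus>a\<in>{..<n j}. pairing {..<c} (\<lambda>y. t (a, y)) (\<lambda>y. b (a, y)))"
          by (rule pairing_Times_rows) (simp_all add: free_module_closed[OF tF] free_module_closed[OF bF])
        also have "\<dots> = (\<Oplus>a\<in>{..<n j}. \<zero>)"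
          using t b unfolding row_power_def perp_of_def by (intro finsum_cong') auto
        finally show ?thesis by simp
      qed
      then show "t \<in> W.perp j" unfolding W.perp_def using tF by blast
    qed
  qed
qed

text \<open>The assumptions on \<open>K\<close> say that \<open>R^c/K\<close> and its dual have no
  higher \<open>Ext\<close> and that \<open>R^c/K\<close> embeds in its bidual. They pass to powers,
  that is, to all terms of the complex with coefficients and of its dual.\<close>

lemma eventually_exact_iff_coexact:
  fixes K :: "(nat \<Rightarrow> 'a) set" and c :: nat
  defines "J \<equiv> \<lambda>j. {..<n j} \<times> {..<c}" and "KK \<equiv> \<lambda>j. row_power K (n j)"
  assumes K: "submodule K R E" "K \<subseteq> Fr {..<c}"
    and Kp: "submodule (perp_of c K) R E"
    and ext: "\<And>l. ext_zero (Fr {..<c}) K l" "\<And>l. ext_zero (perp_of c K) {\<zero>\<^bsub>E\<^esub>} l"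
      "\<And>l. ext_zero (Fr {..<c}) (perp_of c K) l"
    and refl: "\<And>u. u \<in> Fr {..<c} \<Longrightarrow> (\<And>t. t \<in> perp_of c K \<Longrightarrow> pairing {..<c} u t = \<zero>) \<Longrightarrow> u \<in> K"
  shows "(\<exists>k0. \<forall>j\<ge>k0. dual_complex.exact R J (D2 c) KK j) \<longleftrightarrow>
    (\<exists>k0. \<forall>j\<ge>k0. dual_complex.coexact R J (Dt2 c) KK j)"
proof -
  interpret W: dual_complex R I \<delta> \<eta> k J "D2 c" "Dt2 c" KK
    unfolding J_def KK_def by (rule coeff_complex[OF K])
  interpret E: module R "E :: ('a, nat \<Rightarrow> 'a) module" by (rule E_module)
  have T: "W.T j = row_power (Fr {..<c}) (n j)" for j unfolding J_def row_power_Fr ..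
  have perp: "W.perp j = row_power (perp_of c K) (n j)" for j
    using coeff_perp[OF K] unfolding J_def KK_def .
  have z: "row_power {\<zero>\<^bsub>E\<^esub>} p = {\<zero>\<^bsub>E :: ('a, nat \<times> nat \<Rightarrow> 'a) module\<^esub>}" for p
    by (simp add: row_power_zero)
  have extTK: "ext_zero (W.T j) (KK j) l" for j l
    unfolding T KK_def by (rule ext_zero_row_power[OF Fr_submodule K(1) ext(1)])
  have extp: "ext_zero (W.perp j) {\<zero>\<^bsub>E\<^esub>} l" for j l
    using ext_zero_row_power[OF Kp E.submod_zero ext(2), of "n j" l] unfolding perp z .
  have extTp: "ext_zero (W.T j) (W.perp j) l" for j l
    unfolding T perp by (rule ext_zero_row_power[OF Fr_submodule Kp ext(3)])
  show ?thesis
  proof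
    assume "\<exists>k0. \<forall>j\<ge>k0. W.exact j"
    then obtain k0 where ex: "\<And>j. j \<ge> k0 \<Longrightarrow> W.exact j" by blast
    \<comment> \<open>At \<open>k0\<close> the cokernel has no \<open>Ext\<close> beyond the end of
      the resolution; \<open>k\<close> shifts are needed to bring this threshold down to 0.\<close>
    have "W.coexact j" if "j \<ge> k0 + k" for j
    proof (rule W.coexact_if_exact)
      show "W.exact j" using ex that by simp
      define i where "i = j - k0"
      have i: "j = k0 + i" "i \<ge> k" using that unfolding i_def by simp_all
      have "ext_zero (W.T (k0 + i)) (W.bound (k0 + i)) 0"
        by (rule W.ext_zero_bound[OF ex extTK, of k0 k])
          (use ext_zero_large[OF _ W.TE] i in auto)
      then show "ext_zero (W.T j) (W.bound j) 0" unfolding i(1) .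
    qed
    then show "\<exists>k0. \<forall>j\<ge>k0. W.coexact j" by blast
  next
    assume "\<exists>k0. \<forall>j\<ge>k0. W.coexact j"
    then obtain k0 where ex: "\<And>j. j \<ge> k0 \<Longrightarrow> W.coexact j" by blast
    have "W.exact j" if j: "j \<ge> k0" for j
    proof (rule W.exact_if_coexact[OF ex[OF j]])
      have e: "ext_zero (W.perp (Suc (Suc j))) (Dt2 c (Suc j) ` W.perp (Suc j)) 0"
        using j by (intro W.ext_zero_coexact[OF ex extp]) auto
      have le: "Dt2 c (Suc j) ` W.perp (Suc j) \<subseteq> W.perp (Suc (Suc j))" using W.\<psi>_perp by blast
      \<comment> \<open>The quotient by the coboundaries is an extension of \<open>T / perp\<close>
        by \<open>perp\<close> modulo coboundaries; the former has no \<open>Ext\<close> by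
        \<open>extTp\<close>.\<close>
      show "ext_zero (W.T (Suc (Suc j))) (Dt2 c (Suc j) ` W.perp (Suc j)) 0"
        by (rule ext_zero_middle[OF le W.perp_T W.TE e extTp])
      fix u assume u: "u \<in> W.T (Suc j)"
        and kill: "\<And>t. t \<in> W.perp (Suc j) \<Longrightarrow> pairing (J (Suc j)) u t = \<zero>"
      have uF: "u \<in> Fr ({..<n (Suc j)} \<times> {..<c})" using u unfolding J_def .
      have "(\<lambda>b. u (a, b)) \<in> K" if a: "a < n (Suc j)" for a
      proof (rule refl[OF row_mem[OF uF]])
        fix v assume v: "v \<in> perp_of c K"
        have vF: "v \<in> Fr {..<c}" using v unfolding perp_of_def by blast
        have "inj_row a v \<in> W.perp (Suc j)" unfolding perp by (rule inj_row_power[OF Kp v a])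
        from kill[OF this] show "pairing {..<c} (\<lambda>b. u (a, b)) v = \<zero>"
          unfolding J_def pairing_inj_row[OF uF vF a] .
      qed
      moreover have "u (a, b) = \<zero>" if "a \<ge> n (Suc j)" for a b using free_module_eq_zero[OF uF, of "(a, b)"] that by simp
      ultimately show "u \<in> KK (Suc j)"
        unfolding KK_def row_power_def using free_module_UNIV[OF uF] by blast
    qed
    then show "\<exists>k0. \<forall>j\<ge>k0. W.exact j" by blast
  qed
qed

end

section \<open>Balancing\<close>

text \<open>A double complex with exact rows and columns, except for the two edges \<open>Y 0 q\<close> and
  \<open>Y p 0\<close>; these are the augmentations, which make the rows and columns exact.\<close>

locale double_complex = abelian_group G for G (structure) +
  fixes Y :: "nat \<Rightarrow> nat \<Rightarrow> 'a set" and h v :: "nat \<Rightarrow> nat \<Rightarrow> 'a \<Rightarrow> 'a"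
  assumes Y_closed: "\<And>p q x. x \<in> Y p q \<Longrightarrow> x \<in> carrier G"
    and Y_minus: "\<And>p q x y. x \<in> Y p q \<Longrightarrow> y \<in> Y p q \<Longrightarrow> x \<ominus> y \<in> Y p q"
    and h_mem: "\<And>p q x. x \<in> Y p q \<Longrightarrow> h p q x \<in> Y (Suc p) q"
    and v_mem: "\<And>p q x. x \<in> Y p q \<Longrightarrow> v p q x \<in> Y p (Suc q)"
    and h_diff: "\<And>p q x y. x \<in> Y p q \<Longrightarrow> y \<in> Y p q \<Longrightarrow> h p q (x \<ominus> y) = h p q x \<ominus> h p q y"
    and v_diff: "\<And>p q x y. x \<in> Y p q \<Longrightarrow> y \<in> Y p q \<Longrightarrow> v p q (x \<ominus> y) = v p q x \<ominus> v p q y"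
    and hv: "\<And>p q x. x \<in> Y p q \<Longrightarrow> h p (Suc q) (v p q x) = v (Suc p) q (h p q x)"
    and hh: "\<And>p q x. x \<in> Y p q \<Longrightarrow> h (Suc p) q (h p q x) = \<zero>"
    and vv: "\<And>p q x. x \<in> Y p q \<Longrightarrow> v p (Suc q) (v p q x) = \<zero>"
    and row: "\<And>p q x. x \<in> Y (Suc p) (Suc q) \<Longrightarrow> h (Suc p) (Suc q) x = \<zero> \<Longrightarrow> \<exists>y\<in>Y p (Suc q). x = h p (Suc q) y"
    and col: "\<And>p q x. x \<in> Y (Suc p) (Suc q) \<Longrightarrow> v (Suc p) (Suc q) x = \<zero> \<Longrightarrow> \<exists>y\<in>Y (Suc p) q. x = v (Suc p) q y"
begin

text \<open>All the \<open>bicycles_bound p q\<close> with fixed \<open>p + q\<close> are equivalent; those at the edges express the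
  exactness of the augmentation complexes.\<close>

definition bicycles_bound :: "nat \<Rightarrow> nat \<Rightarrow> bool" where
  "bicycles_bound p q \<longleftrightarrow> (\<forall>x\<in>Y (Suc p) (Suc q). h (Suc p) (Suc q) x = \<zero> \<longrightarrow> v (Suc p) (Suc q) x = \<zero> \<longrightarrow>
     (\<exists>t\<in>Y p q. x = h p (Suc q) (v p q t)))"

text \<open>A diagram chase. Write \<open>x = h y\<close>; then \<open>v y\<close> is a bicycle one
  step further along the antidiagonal, so \<open>v y = h v t\<close>. Now \<open>y - h t\<close> is
  killed by \<open>v\<close>, hence equals \<open>v s\<close>, and \<open>x = h v s\<close>.\<close>

lemma bicycles_bound_step:
  assumes "bicycles_bound p (Suc q)"
  shows "bicycles_bound (Suc p) q"
  unfolding bicycles_bound_def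
proof (intro ballI impI)
  fix x assume x: "x \<in> Y (Suc (Suc p)) (Suc q)" "h (Suc (Suc p)) (Suc q) x = \<zero>" "v (Suc (Suc p)) (Suc q) x = \<zero>"
  obtain y where y: "y \<in> Y (Suc p) (Suc q)" "x = h (Suc p) (Suc q) y" using row[OF x(1,2)] by blast
  let ?z = "v (Suc p) (Suc q) y"
  have z: "?z \<in> Y (Suc p) (Suc (Suc q))" by (rule v_mem[OF y(1)])
  have "h (Suc p) (Suc (Suc q)) ?z = \<zero>" using hv[OF y(1)] x(3) y(2) by simp
  then obtain t where t: "t \<in> Y p (Suc q)" "?z = h p (Suc (Suc q)) (v p (Suc q) t)"
    using assms z vv[OF y(1)] unfolding bicycles_bound_def by blast
  have ht: "h p (Suc q) t \<in> Y (Suc p) (Suc q)" by (rule h_mem[OF t(1)])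
  have "v (Suc p) (Suc q) (y \<ominus> h p (Suc q) t) = \<zero>"
    using v_diff[OF y(1) ht] t(2) hv[OF t(1)] Y_closed[OF z] by (simp add: diff_self)
  then obtain s where s: "s \<in> Y (Suc p) q" "y \<ominus> h p (Suc q) t = v (Suc p) q s"
    using col[OF Y_minus[OF y(1) ht]] by blast
  have "x = h (Suc p) (Suc q) (y \<ominus> h p (Suc q) t)"
    using h_diff[OF y(1) ht] hh[OF t(1)] y(2) Y_closed[OF x(1)] by (simp add: diff_zero_right)
  then show "\<exists>t\<in>Y (Suc p) q. x = h (Suc p) (Suc q) (v (Suc p) q t)" using s by auto
qed

lemma bicycles_bound_shift: "bicycles_bound p (q + d) \<Longrightarrow> bicycles_bound (p + d) q"
proof (induct d arbitrary: p)
  case (Suc d)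
  then have "bicycles_bound (Suc p) (q + d)" using bicycles_bound_step[of p "q + d"] by simp
  from Suc(1)[OF this] show ?case by simp
qed simp

end

text \<open>Walking along the antidiagonal gives one implication; the other is the same walk in the
  transposed double complex.\<close>

lemma double_complex_balance:
  assumes "double_complex G Y h v"
  shows "double_complex.bicycles_bound G Y h v 0 i \<longleftrightarrow> double_complex.bicycles_bound G Y h v i 0"
proof -
  interpret A: double_complex G Y h v by fact
  interpret B: double_complex G "\<lambda>p q. Y q p" "\<lambda>p q. v q p" "\<lambda>p q. h q p"
    by (intro double_complex.intro double_complex_axioms.intro A.abelian_group_axioms)
      (simp_all add: A.Y_closed A.Y_minus A.h_mem A.v_mem A.h_diff A.v_diff A.hv A.hh A.vv A.row A.col)
  have eq: "A.bicycles_bound p q \<longleftrightarrow> B.bicycles_bound q p" for p q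
    unfolding A.bicycles_bound_def B.bicycles_bound_def using A.hv by (metis (no_types, lifting))
  show ?thesis
    using A.bicycles_bound_shift[of 0 0 i] B.bicycles_bound_shift[of 0 0 i] unfolding eq by auto
qed

lemma (in cring) swap_hom:
  "(\<lambda>u. u \<circ> prod.swap) \<in> module_hom R (free_module R (UNIV :: ('p \<times> 'q) set)) E"
proof (rule module_homI)
  fix u :: "'p \<times> 'q \<Rightarrow> 'a" assume u: "u \<in> carrier E"
  have *: "{x. (u \<circ> prod.swap) x \<noteq> \<zero>} = prod.swap ` {x. u x \<noteq> \<zero>}" by (auto simp: image_iff)
  have "finite {x. (u \<circ> prod.swap) x \<noteq> \<zero>}" unfolding * using u by (simp add: free_module_carrier)
  then show "u \<circ> prod.swap \<in> carrier E"
    using free_module_closed[OF u] by (simp add: free_module_carrier)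
qed (auto simp: fun_eq_iff)

lemma (in cring) swap_mem:
  assumes "u \<in> Fr ({..<p::nat} \<times> {..<q::nat})"
  shows "u \<circ> prod.swap \<in> Fr ({..<q} \<times> {..<p})"
  using assms by (auto simp: free_module_carrier_finite)

text \<open>Multiplication from the left commutes with multiplication from the right.\<close>

lemma (in cring) mat_op2_swap_commute:
  assumes A: "\<And>a b. A a b \<in> carrier R" and B: "\<And>a b. B a b \<in> carrier R" and u: "\<And>x. u x \<in> carrier R"
  shows "mat_op2 A p' p q' (mat_op2 B q' q p (u \<circ> prod.swap) \<circ> prod.swap) =
    mat_op2 B q' q p' (mat_op2 A p' p q u \<circ> prod.swap) \<circ> prod.swap"
proof
  fix x :: "nat \<times> nat"
  obtain a b where x: "x = (a, b)" by (cases x)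
  \<comment> \<open>Both sides are the pairing of \<open>u\<close> with this array, summed over rows
    or over columns first.\<close>
  define w where "w = (\<lambda>(y, z). A a y \<otimes> B b z)"
  have w: "w x \<in> carrier R" for x using A B unfolding w_def by (cases x) simp
  have pc: "pairing J (A a) (\<lambda>y. u (y, z)) \<in> carrier R" "pairing J (B b) (\<lambda>z. u (y, z)) \<in> carrier R" for J y z
    by (rule pairing_closed; simp add: A B u)+
  have r: "pairing {..<p} (A a) (\<lambda>y. pairing {..<q} (B b) (\<lambda>z. u (y, z))) = pairing ({..<p} \<times> {..<q}) w u"
  proof -
    have "pairing ({..<p} \<times> {..<q}) w u = (\<Oplus>y\<in>{..<p}. pairing {..<q} (\<lambda>z. w (y, z)) (\<lambda>z. u (y, z)))"
      by (rule pairing_Times_rows) (simp_all add: w u)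
    also have "\<dots> = (\<Oplus>y\<in>{..<p}. A a y \<otimes> pairing {..<q} (B b) (\<lambda>z. u (y, z)))"
    proof (rule finsum_cong'[OF refl])
      show "(\<lambda>y. A a y \<otimes> pairing {..<q} (B b) (\<lambda>z. u (y, z))) \<in> {..<p} \<rightarrow> carrier R"
        using A pc by auto
      fix y
      show "pairing {..<q} (\<lambda>z. w (y, z)) (\<lambda>z. u (y, z)) = A a y \<otimes> pairing {..<q} (B b) (\<lambda>z. u (y, z))"
        unfolding pairing_def w_def using A B u
        by (subst finsum_rdistr) (auto simp: m_assoc intro!: finsum_cong')
    qed
    finally show ?thesis unfolding pairing_def[of _ "A a"] by simp
  qed
  have c: "pairing {..<q} (B b) (\<lambda>z. pairing {..<p} (A a) (\<lambda>y. u (y, z))) = pairing ({..<p} \<times> {..<q}) w u"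
  proof -
    have "pairing ({..<p} \<times> {..<q}) w u = (\<Oplus>z\<in>{..<q}. pairing {..<p} (\<lambda>y. w (y, z)) (\<lambda>y. u (y, z)))"
      by (rule pairing_Times_cols) (simp_all add: w u)
    also have "\<dots> = (\<Oplus>z\<in>{..<q}. B b z \<otimes> pairing {..<p} (A a) (\<lambda>y. u (y, z)))"
    proof (rule finsum_cong'[OF refl])
      show "(\<lambda>z. B b z \<otimes> pairing {..<p} (A a) (\<lambda>y. u (y, z))) \<in> {..<q} \<rightarrow> carrier R"
        using B pc by auto
      fix z
      show "pairing {..<p} (\<lambda>y. w (y, z)) (\<lambda>y. u (y, z)) = B b z \<otimes> pairing {..<p} (A a) (\<lambda>y. u (y, z))"
        unfolding pairing_def w_def using A B u
        by (subst finsum_rdistr) (auto simp: m_ac intro!: finsum_cong')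
    qed
    finally show ?thesis unfolding pairing_def[of _ "B b"] by simp
  qed
  have e1: "mat_op2 A p' p q' (mat_op2 B q' q p (u \<circ> prod.swap) \<circ> prod.swap) (a, b) =
      (if b < q' \<and> a < p' then pairing {..<p} (A a) (\<lambda>y. pairing {..<q} (B b) (\<lambda>z. u (y, z))) else \<zero>)"
    using pc A by (auto simp: mat_op2_def mat_op_def comp_def pairing_def[of _ "A a"] intro!: finsum_cong')
  have e2: "mat_op2 B q' q p' (mat_op2 A p' p q u \<circ> prod.swap) (b, a) =
      (if b < q' \<and> a < p' then pairing {..<q} (B b) (\<lambda>z. pairing {..<p} (A a) (\<lambda>y. u (y, z))) else \<zero>)"
    using pc B by (auto simp: mat_op2_def mat_op_def comp_def pairing_def[of _ "B b"] intro!: finsum_cong')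
  show "mat_op2 A p' p q' (mat_op2 B q' q p (u \<circ> prod.swap) \<circ> prod.swap) x =
    (mat_op2 B q' q p' (mat_op2 A p' p q u \<circ> prod.swap) \<circ> prod.swap) x"
    unfolding x using e1 e2 r c by simp
qed

section \<open>The double complex of two resolutions\<close>

context free_complex
begin

lemma Dt2_complex:
  assumes u: "u \<in> Fr ({..<n j} \<times> {..<c::nat})"
  shows "Dt2 c (Suc j) (Dt2 c j u) = \<zero>\<^bsub>E\<^esub>"
proof
  fix x :: "nat \<times> nat"
  obtain a b where x: "x = (a, b)" by (cases x)
  show "Dt2 c (Suc j) (Dt2 c j u) x = \<zero>\<^bsub>E\<^esub> x"
  proof (cases "b < c")
    case True
    then show ?thesis
      unfolding x mat_op2_def using fun_cong[OF V.\<psi>\<psi>[OF col_mem[OF u, of b]], of a] by simp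
  qed (simp add: x mat_op2_def)
qed

text \<open>Multiplication from the left acts on each column separately, so preimages can be chosen
  column by column.\<close>

lemma Dt2_exact:
  assumes ex: "\<And>t. t \<in> Fr {..<n (Suc j)} \<Longrightarrow> Dt (Suc j) t = \<zero>\<^bsub>E\<^esub> \<Longrightarrow> \<exists>s\<in>Fr {..<n j}. t = Dt j s"
    and u: "u \<in> Fr ({..<n (Suc j)} \<times> {..<c::nat})" and zero: "Dt2 c (Suc j) u = \<zero>\<^bsub>E\<^esub>"
  shows "\<exists>s\<in>Fr ({..<n j} \<times> {..<c}). u = Dt2 c j s"
proof -
  have "\<exists>s\<in>Fr {..<n j}. (\<lambda>a. u (a, b)) = Dt j s" if b: "b < c" for b
  proof (rule ex[OF col_mem[OF u]])
    show "Dt (Suc j) (\<lambda>a. u (a, b)) = \<zero>\<^bsub>E\<^esub>"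
    proof
      fix a
      show "Dt (Suc j) (\<lambda>a. u (a, b)) a = \<zero>\<^bsub>E\<^esub> a"
        using fun_cong[OF zero, of "(a, b)"] b by (simp add: mat_op2_def)
    qed
  qed
  then obtain s where s: "\<And>b. b < c \<Longrightarrow> s b \<in> Fr {..<n j}" "\<And>b. b < c \<Longrightarrow> (\<lambda>a. u (a, b)) = Dt j (s b)"
    by metis
  define t where "t = (\<lambda>(a, b). if b < c then s b a else \<zero>)"
  have "t \<in> Fr ({..<n j} \<times> {..<c})"
    using s(1) unfolding t_def by (auto simp: free_module_carrier_finite)
  moreover have "u = Dt2 c j t"
  proof
    fix x :: "nat \<times> nat"
    obtain a b where x: "x = (a, b)" by (cases x)
    show "u x = Dt2 c j t x"
    proof (cases "b < c")
      case True
      then show ?thesis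
        unfolding x mat_op2_def t_def using fun_cong[OF s(2), of b a] by simp
    next
      case False
      then show ?thesis using free_module_eq_zero[OF u, of "(a, b)"] by (simp add: x mat_op2_def)
    qed
  qed
  ultimately show ?thesis by blast
qed

end

text \<open>For resolutions \<open>F\<close> and \<open>G\<close> the term
  \<open>Hom(F p \<otimes> G q, R)\<close> consists of \<open>n p\<close> by \<open>m q\<close>
  arrays, and the two assumptions make its rows and columns exact at positive positions.\<close>

locale two_complexes = finite_inj_res R I \<delta> \<eta> k +
    F: free_complex R I \<delta> \<eta> k A n + G: free_complex R I \<delta> \<eta> k B m
  for R :: "('a, 'r) ring_scheme" (structure) and I :: "nat \<Rightarrow> ('a, 'i) module" and \<delta> \<eta> k A n B m +
  assumes F_exact: "\<And>j t. t \<in> Fr {..<n (Suc j)} \<Longrightarrow> F.Dt (Suc j) t = \<zero>\<^bsub>E\<^esub> \<Longrightarrow> \<exists>s\<in>Fr {..<n j}. t = F.Dt j s"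
    and G_exact: "\<And>j t. t \<in> Fr {..<m (Suc j)} \<Longrightarrow> G.Dt (Suc j) t = \<zero>\<^bsub>E\<^esub> \<Longrightarrow> \<exists>s\<in>Fr {..<m j}. t = G.Dt j s"
begin

definition H :: "nat \<Rightarrow> nat \<Rightarrow> (nat \<times> nat \<Rightarrow> 'a) \<Rightarrow> nat \<times> nat \<Rightarrow> 'a" where
  "H p q u = F.Dt2 (m q) p u"

text \<open>Transposition turns multiplication from the left into multiplication from the
  right.\<close>

definition V :: "nat \<Rightarrow> nat \<Rightarrow> (nat \<times> nat \<Rightarrow> 'a) \<Rightarrow> nat \<times> nat \<Rightarrow> 'a" where
  "V p q u = G.Dt2 (n p) q (u \<circ> prod.swap) \<circ> prod.swap"

definition X :: "nat \<Rightarrow> nat \<Rightarrow> (nat \<times> nat \<Rightarrow> 'a) set" where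
  "X p q = Fr ({..<n p} \<times> {..<m q})"

lemma X_swap: "u \<in> X p q \<Longrightarrow> u \<circ> prod.swap \<in> Fr ({..<m q} \<times> {..<n p})"
  unfolding X_def by (rule swap_mem)

lemma swap_swap: "u \<circ> prod.swap \<circ> prod.swap = u"
  by (auto simp: fun_eq_iff)

lemma H_mem: "u \<in> X p q \<Longrightarrow> H p q u \<in> X (Suc p) q"
  unfolding H_def X_def by (intro mat_op2_mem F.A_closed) (rule free_module_closed)

lemma V_mem: "u \<in> X p q \<Longrightarrow> V p q u \<in> X p (Suc q)"
  unfolding V_def X_def
  by (intro swap_mem mat_op2_mem G.A_closed) (rule free_module_closed[OF swap_mem])

lemma H_hom: "H p q \<in> module_hom R E E"
  unfolding H_def[abs_def] by (intro mat_op2_hom F.A_closed)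

lemma V_hom: "V p q \<in> module_hom R E E"
  unfolding V_def[abs_def]
  by (rule module_hom_comp[OF module_hom_comp[OF swap_hom mat_op2_hom] swap_hom]) (rule G.A_closed)

lemma HV: "u \<in> X p q \<Longrightarrow> H p (Suc q) (V p q u) = V (Suc p) q (H p q u)"
  unfolding H_def V_def X_def
  by (rule mat_op2_swap_commute) (auto intro: F.A_closed G.A_closed free_module_closed)

lemma HH: "u \<in> X p q \<Longrightarrow> H (Suc p) q (H p q u) = \<zero>\<^bsub>E\<^esub>"
  unfolding H_def X_def by (rule F.Dt2_complex)

lemma VV: "u \<in> X p q \<Longrightarrow> V p (Suc q) (V p q u) = \<zero>\<^bsub>E\<^esub>"
  unfolding V_def swap_swap using G.Dt2_complex[OF X_swap, of u p q] by (auto simp: fun_eq_iff)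

lemma H_exact: "u \<in> X (Suc p) q \<Longrightarrow> H (Suc p) q u = \<zero>\<^bsub>E\<^esub> \<Longrightarrow> \<exists>s\<in>X p q. u = H p q s"
  unfolding H_def X_def by (rule F.Dt2_exact[OF F_exact])

lemma V_exact:
  assumes u: "u \<in> X p (Suc q)" and z: "V p (Suc q) u = \<zero>\<^bsub>E\<^esub>"
  shows "\<exists>s\<in>X p q. u = V p q s"
proof -
  have "G.Dt2 (n p) (Suc q) (u \<circ> prod.swap) = \<zero>\<^bsub>E\<^esub>"
  proof
    fix x
    show "G.Dt2 (n p) (Suc q) (u \<circ> prod.swap) x = \<zero>\<^bsub>E\<^esub> x"
      using fun_cong[OF z, of "prod.swap x"] unfolding V_def by simp
  qed
  then obtain s where s: "s \<in> Fr ({..<m q} \<times> {..<n p})" "u \<circ> prod.swap = G.Dt2 (n p) q s"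
    using G.Dt2_exact[OF G_exact X_swap[OF u]] by blast
  have "u = V p q (s \<circ> prod.swap)"
    unfolding V_def swap_swap s(2)[symmetric] ..
  moreover have "s \<circ> prod.swap \<in> X p q" unfolding X_def by (rule swap_mem[OF s(1)])
  ultimately show ?thesis by blast
qed

text \<open>The arrays shifted by one in both directions, to make room for the augmentations: the
  kernels of the first maps are put at the edges, with the inclusions as differentials, and zero in
  the corner.\<close>

definition Y :: "nat \<Rightarrow> nat \<Rightarrow> (nat \<times> nat \<Rightarrow> 'a) set" where
  "Y p q = (case p of 0 \<Rightarrow> (case q of 0 \<Rightarrow> {\<zero>\<^bsub>E\<^esub>} | Suc q' \<Rightarrow> {u \<in> X 0 q'. H 0 q' u = \<zero>\<^bsub>E\<^esub>})
     | Suc p' \<Rightarrow> (case q of 0 \<Rightarrow> {u \<in> X p' 0. V p' 0 u = \<zero>\<^bsub>E\<^esub>} | Suc q' \<Rightarrow> X p' q'))"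

definition h :: "nat \<Rightarrow> nat \<Rightarrow> (nat \<times> nat \<Rightarrow> 'a) \<Rightarrow> nat \<times> nat \<Rightarrow> 'a" where
  "h p q u = (case p of 0 \<Rightarrow> u | Suc p' \<Rightarrow> H p' (q - 1) u)"

definition v :: "nat \<Rightarrow> nat \<Rightarrow> (nat \<times> nat \<Rightarrow> 'a) \<Rightarrow> nat \<times> nat \<Rightarrow> 'a" where
  "v p q u = (case q of 0 \<Rightarrow> u | Suc q' \<Rightarrow> V (p - 1) q' u)"

lemma Y_simps:
  "Y 0 0 = {\<zero>\<^bsub>E\<^esub>}" "Y 0 (Suc q) = {u \<in> X 0 q. H 0 q u = \<zero>\<^bsub>E\<^esub>}"
  "Y (Suc p) 0 = {u \<in> X p 0. V p 0 u = \<zero>\<^bsub>E\<^esub>}" "Y (Suc p) (Suc q) = X p q"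
  "h 0 q u = u" "h (Suc p) 0 u = H p 0 u" "h (Suc p) (Suc q) u = H p q u"
  "v p 0 u = u" "v 0 (Suc q) u = V 0 q u" "v (Suc p) (Suc q) u = V p q u"
  by (simp_all add: Y_def h_def v_def)

lemma Y_sub: "submodule (Y p q) R E"
proof -
  interpret E2: module R "E :: ('a, nat \<times> nat \<Rightarrow> 'a) module" by (rule E_module)
  have X: "submodule (X p q) R E" for p q unfolding X_def by (rule Fr_submodule)
  show ?thesis
    using E2.submod_zero ker_submodule[OF H_hom X] ker_submodule[OF V_hom X] X
    by (cases p; cases q) (simp_all only: Y_simps)
qed

lemma zero_X: "\<zero>\<^bsub>E\<^esub> \<in> X p q"
proof -
  interpret E2: module R "E :: ('a, nat \<times> nat \<Rightarrow> 'a) module" by (rule E_module)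
  show ?thesis unfolding X_def by (rule E2.submodD(2)[OF Fr_submodule])
qed

lemma H_zero: "H p q \<zero>\<^bsub>E\<^esub> = \<zero>\<^bsub>E\<^esub>"
  by (rule module_hom_zero[OF E_module E_module H_hom])

lemma V_zero: "V p q \<zero>\<^bsub>E\<^esub> = \<zero>\<^bsub>E\<^esub>"
  by (rule module_hom_zero[OF E_module E_module V_hom])

lemma h_hom: "h p q \<in> module_hom R E E"
  using module_hom_id H_hom by (cases p) (simp_all add: h_def[abs_def])

lemma v_hom: "v p q \<in> module_hom R E E"
  using module_hom_id V_hom by (cases q) (simp_all add: v_def[abs_def])

lemma Y_double_complex: "double_complex (E :: ('a, nat \<times> nat \<Rightarrow> 'a) module) Y h v"
proof (intro double_complex.intro double_complex_axioms.intro)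
  interpret E2: module R "E :: ('a, nat \<times> nat \<Rightarrow> 'a) module" by (rule E_module)
  note E2c = E2.submodD(1)[OF Y_sub]
  show "abelian_group (E :: ('a, nat \<times> nat \<Rightarrow> 'a) module)" by (rule E2.abelian_group_axioms)
  fix p q x
  show "x \<in> carrier E" if "x \<in> Y p q" using E2c that by blast
  show "x \<ominus>\<^bsub>E\<^esub> y \<in> Y p q" if "x \<in> Y p q" "y \<in> Y p q" for y by (rule E2.submodD(4)[OF Y_sub that])
  show "h p q x \<in> Y (Suc p) q" if "x \<in> Y p q"
    using that HV[of x "p - 1" 0] H_mem zero_X V_zero H_zero
    by (cases p; cases q) (auto simp: Y_simps simp del: free_module_simps)
  show "v p q x \<in> Y p (Suc q)" if "x \<in> Y p q"
    using that HV[of x 0 "q - 1"] V_mem zero_X V_zero H_zero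
    by (cases p; cases q) (auto simp: Y_simps simp del: free_module_simps)
  show "h p q (x \<ominus>\<^bsub>E\<^esub> y) = h p q x \<ominus>\<^bsub>E\<^esub> h p q y" if "x \<in> Y p q" "y \<in> Y p q" for y
    using that E2c by (intro module_hom_diff[OF E_module E_module h_hom]) auto
  show "v p q (x \<ominus>\<^bsub>E\<^esub> y) = v p q x \<ominus>\<^bsub>E\<^esub> v p q y" if "x \<in> Y p q" "y \<in> Y p q" for y
    using that E2c by (intro module_hom_diff[OF E_module E_module v_hom]) auto
  show "h p (Suc q) (v p q x) = v (Suc p) q (h p q x)" if "x \<in> Y p q"
    using that HV by (cases p; cases q) (auto simp: Y_simps simp del: free_module_simps)
  show "h (Suc p) q (h p q x) = \<zero>\<^bsub>E\<^esub>" if "x \<in> Y p q"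
    using that HH H_zero by (cases p; cases q) (auto simp: Y_simps simp del: free_module_simps)
  show "v p (Suc q) (v p q x) = \<zero>\<^bsub>E\<^esub>" if "x \<in> Y p q"
    using that VV V_zero by (cases p; cases q) (auto simp: Y_simps simp del: free_module_simps)
  show "\<exists>y\<in>Y p (Suc q). x = h p (Suc q) y" if "x \<in> Y (Suc p) (Suc q)" "h (Suc p) (Suc q) x = \<zero>\<^bsub>E\<^esub>"
    using that H_exact by (cases p) (auto simp: Y_simps simp del: free_module_simps)
  show "\<exists>y\<in>Y (Suc p) q. x = v (Suc p) q y" if "x \<in> Y (Suc p) (Suc q)" "v (Suc p) (Suc q) x = \<zero>\<^bsub>E\<^esub>"
    using that V_exact by (cases q) (auto simp: Y_simps simp del: free_module_simps)
qed

text \<open>On each row, \<open>V p 0\<close> acts as the first transposed differential of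
  \<open>G\<close>. When \<open>G\<close> resolves \<open>N\<close>, the kernel of the latter is the
  dual of \<open>N\<close>, and its powers are the homomorphisms from \<open>F p\<close> to that
  dual.\<close>

lemma row_power_ker_V:
  "row_power {t \<in> Fr {..<m 0}. G.Dt 0 t = \<zero>\<^bsub>E\<^esub>} (n p) = Y (Suc p) 0"
proof -
  let ?Z = "{t \<in> Fr {..<m 0}. G.Dt 0 t = \<zero>\<^bsub>E\<^esub>}"
  have "u \<in> row_power ?Z (n p) \<longleftrightarrow> V p 0 u = \<zero>\<^bsub>E\<^esub>" if u: "u \<in> X p 0" for u
  proof -
    have uF: "u \<in> Fr ({..<n p} \<times> {..<m 0})" using u unfolding X_def .
    have z: "u (a, b) = \<zero>" if "a \<ge> n p" for a b using free_module_eq_zero[OF uF, of "(a, b)"] that by simp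
    have e: "V p 0 u (a, b) = (if a < n p then G.Dt 0 (\<lambda>y. u (a, y)) b else \<zero>)" for a b
      unfolding V_def mat_op2_def by simp
    have "u \<in> row_power ?Z (n p) \<longleftrightarrow> (\<forall>a<n p. G.Dt 0 (\<lambda>y. u (a, y)) = \<zero>\<^bsub>E\<^esub>)"
      unfolding row_power_def using free_module_UNIV[OF uF] row_mem[OF uF] z by blast
    also have "\<dots> \<longleftrightarrow> V p 0 u = \<zero>\<^bsub>E\<^esub>"
      using e by (auto simp: fun_eq_iff)
    finally show ?thesis .
  qed
  moreover have "row_power ?Z (n p) \<subseteq> X p 0"
    using row_power_mono[of ?Z "Fr {..<m 0}" "n p"] unfolding row_power_Fr X_def by blast
  ultimately show ?thesis unfolding Y_simps by blast
qed

text \<open>At the edge the vertical map is an inclusion, so being bounded means being a coboundary.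
  With \<open>G\<close> resolving \<open>N\<close>, this is exactness in degree \<open>j + 1\<close>
  of the complex of homomorphisms from \<open>F\<close> to the dual of \<open>N\<close>.\<close>

lemma bicycles_bound_F:
  "double_complex.bicycles_bound (E :: ('a, nat \<times> nat \<Rightarrow> 'a) module) Y h v (Suc j) 0 \<longleftrightarrow>
    (\<forall>t\<in>row_power {t \<in> Fr {..<m 0}. G.Dt 0 t = \<zero>\<^bsub>E\<^esub>} (n (Suc j)). F.Dt2 (m 0) (Suc j) t = \<zero>\<^bsub>E\<^esub> \<longrightarrow>
      (\<exists>s\<in>row_power {t \<in> Fr {..<m 0}. G.Dt 0 t = \<zero>\<^bsub>E\<^esub>} (n j). t = F.Dt2 (m 0) j s))"
  unfolding double_complex.bicycles_bound_def[OF Y_double_complex] row_power_ker_V Y_simps H_def[of _ 0, symmetric]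
  by blast

end

lemma two_complexes_swap:
  assumes "two_complexes R I \<delta> \<eta> k A n B m"
  shows "two_complexes R I \<delta> \<eta> k B m A n"
proof -
  interpret two_complexes R I \<delta> \<eta> k A n B m by fact
  show ?thesis
    by (intro two_complexes.intro two_complexes_axioms.intro finite_inj_res_axioms
        F.free_complex_axioms G.free_complex_axioms F_exact G_exact)
qed

context two_complexes
begin

text \<open>The Y-complex of the swapped pair consists of the transposes.\<close>

lemma bicycles_bound_G:
  "double_complex.bicycles_bound (E :: ('a, nat \<times> nat \<Rightarrow> 'a) module) Y h v 0 (Suc j) \<longleftrightarrow>
    (\<forall>t\<in>row_power {t \<in> Fr {..<n 0}. F.Dt 0 t = \<zero>\<^bsub>E\<^esub>} (m (Suc j)). G.Dt2 (n 0) (Suc j) t = \<zero>\<^bsub>E\<^esub> \<longrightarrow>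
      (\<exists>s\<in>row_power {t \<in> Fr {..<n 0}. F.Dt 0 t = \<zero>\<^bsub>E\<^esub>} (m j). t = G.Dt2 (n 0) j s))"
proof -
  interpret S: two_complexes R I \<delta> \<eta> k B m A n by (rule two_complexes_swap[OF two_complexes_axioms])
  have XS: "u \<circ> prod.swap \<in> S.X q p \<longleftrightarrow> u \<in> X p q" for u p q
    using swap_mem[of u "n p" "m q"] swap_mem[of "u \<circ> prod.swap" "m q" "n p"] swap_swap[of u]
    unfolding X_def S.X_def by auto
  have HS: "S.H q p (u \<circ> prod.swap) = V p q u \<circ> prod.swap" for u p q
    unfolding S.H_def V_def swap_swap ..
  have VS: "S.V q p (u \<circ> prod.swap) = H p q u \<circ> prod.swap" for u p q
    unfolding S.V_def H_def swap_swap ..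
  have inj: "u \<circ> prod.swap = w \<circ> prod.swap \<longleftrightarrow> u = w" for u w :: "nat \<times> nat \<Rightarrow> 'a"
    by (metis swap_swap)
  have z: "(u \<circ> prod.swap = \<zero>\<^bsub>E\<^esub>) \<longleftrightarrow> u = \<zero>\<^bsub>E\<^esub>" for u :: "nat \<times> nat \<Rightarrow> 'a"
    using inj[of u "\<zero>\<^bsub>E\<^esub>"] by (simp add: comp_def)
  \<comment> \<open>Transposition is a bijection, so quantifiers may range over transposes.\<close>
  have ball: "(\<forall>u. P u) \<longleftrightarrow> (\<forall>u. P (u \<circ> prod.swap))" "(\<exists>u. P u) \<longleftrightarrow> (\<exists>u. P (u \<circ> prod.swap))"
    for P :: "(nat \<times> nat \<Rightarrow> 'a) \<Rightarrow> bool"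
    by (metis swap_swap)+
  have "double_complex.bicycles_bound (E :: ('a, nat \<times> nat \<Rightarrow> 'a) module) Y h v 0 (Suc j) \<longleftrightarrow>
      (\<forall>u. u \<in> X 0 (Suc j) \<longrightarrow> H 0 (Suc j) u = \<zero>\<^bsub>E\<^esub> \<longrightarrow> V 0 (Suc j) u = \<zero>\<^bsub>E\<^esub> \<longrightarrow>
        (\<exists>t. t \<in> X 0 j \<and> H 0 j t = \<zero>\<^bsub>E\<^esub> \<and> u = V 0 j t))"
    unfolding double_complex.bicycles_bound_def[OF Y_double_complex] Y_simps by blast
  also have "\<dots> \<longleftrightarrow> (\<forall>u. u \<circ> prod.swap \<in> S.X (Suc j) 0 \<longrightarrow> S.V (Suc j) 0 (u \<circ> prod.swap) = \<zero>\<^bsub>E\<^esub> \<longrightarrow>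
      S.H (Suc j) 0 (u \<circ> prod.swap) = \<zero>\<^bsub>E\<^esub> \<longrightarrow>
      (\<exists>t. t \<circ> prod.swap \<in> S.X j 0 \<and> S.V j 0 (t \<circ> prod.swap) = \<zero>\<^bsub>E\<^esub> \<and>
        u \<circ> prod.swap = S.H j 0 (t \<circ> prod.swap)))"
    unfolding XS HS VS z inj ..
  also have "\<dots> \<longleftrightarrow> (\<forall>u. u \<in> S.X (Suc j) 0 \<longrightarrow> S.V (Suc j) 0 u = \<zero>\<^bsub>E\<^esub> \<longrightarrow>
      S.H (Suc j) 0 u = \<zero>\<^bsub>E\<^esub> \<longrightarrow> (\<exists>t. t \<in> S.X j 0 \<and> S.V j 0 t = \<zero>\<^bsub>E\<^esub> \<and> u = S.H j 0 t))"
    unfolding ball(1)[of "\<lambda>u. u \<in> S.X (Suc j) 0 \<longrightarrow> S.V (Suc j) 0 u = \<zero>\<^bsub>E\<^esub> \<longrightarrow>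
      S.H (Suc j) 0 u = \<zero>\<^bsub>E\<^esub> \<longrightarrow> (\<exists>t. t \<in> S.X j 0 \<and> S.V j 0 t = \<zero>\<^bsub>E\<^esub> \<and> u = S.H j 0 t)"]
    unfolding ball(2)[of "\<lambda>t. t \<in> S.X j 0 \<and> S.V j 0 t = \<zero>\<^bsub>E\<^esub> \<and> u = S.H j 0 t" for u] ..
  finally show ?thesis
    unfolding S.row_power_ker_V S.Y_simps S.H_def[of _ 0, symmetric] by blast
qed

lemma coexact_balance:
  "(\<forall>t\<in>row_power {t \<in> Fr {..<m 0}. G.Dt 0 t = \<zero>\<^bsub>E\<^esub>} (n (Suc j)). F.Dt2 (m 0) (Suc j) t = \<zero>\<^bsub>E\<^esub> \<longrightarrow>
      (\<exists>s\<in>row_power {t \<in> Fr {..<m 0}. G.Dt 0 t = \<zero>\<^bsub>E\<^esub>} (n j). t = F.Dt2 (m 0) j s)) \<longleftrightarrow>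
   (\<forall>t\<in>row_power {t \<in> Fr {..<n 0}. F.Dt 0 t = \<zero>\<^bsub>E\<^esub>} (m (Suc j)). G.Dt2 (n 0) (Suc j) t = \<zero>\<^bsub>E\<^esub> \<longrightarrow>
      (\<exists>s\<in>row_power {t \<in> Fr {..<n 0}. F.Dt 0 t = \<zero>\<^bsub>E\<^esub>} (m j). t = G.Dt2 (n 0) j s))"
  using double_complex_balance[OF Y_double_complex, of "Suc j"]
  unfolding bicycles_bound_F bicycles_bound_G by (rule sym)

end

section \<open>Quotients and tensor products\<close>

context module
begin

lemma quotient_module_zero: "\<zero>\<^bsub>quotient_module M K\<^esub> = K"
  by (simp add: quotient_module_def)

lemma quotient_module_carrier:
  "C \<in> carrier (quotient_module M K) \<longleftrightarrow> (\<exists>x\<in>carrier M. C = K +>\<^bsub>M\<^esub> x)"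
  by (auto simp: quotient_module_def A_RCOSETS_def')

context
  fixes K
  assumes K: "submodule K R M"
begin

lemma mem_coset_iff:
  assumes x: "x \<in> carrier M"
  shows "z \<in> K +>\<^bsub>M\<^esub> x \<longleftrightarrow> z \<in> carrier M \<and> z \<ominus>\<^bsub>M\<^esub> x \<in> K"
proof
  assume "z \<in> K +>\<^bsub>M\<^esub> x"
  then obtain h where h: "h \<in> K" "z = h \<oplus>\<^bsub>M\<^esub> x" unfolding a_r_coset_def' by auto
  have hc: "h \<in> carrier M" using h submodD(1)[OF K] by auto
  have "z \<ominus>\<^bsub>M\<^esub> x = h"
    by (rule M.diff_eqI) (use h hc x M.a_comm in auto)
  then show "z \<in> carrier M \<and> z \<ominus>\<^bsub>M\<^esub> x \<in> K" using h hc x by simp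
next
  assume z: "z \<in> carrier M \<and> z \<ominus>\<^bsub>M\<^esub> x \<in> K"
  have "z = (z \<ominus>\<^bsub>M\<^esub> x) \<oplus>\<^bsub>M\<^esub> x"
    using M.add_diff_cancel[of z x] M.a_comm[of x "z \<ominus>\<^bsub>M\<^esub> x"] z x by simp
  then show "z \<in> K +>\<^bsub>M\<^esub> x" unfolding a_r_coset_def' using z by blast
qed

lemma coset_eq_iff:
  assumes x: "x \<in> carrier M" and y: "y \<in> carrier M"
  shows "K +>\<^bsub>M\<^esub> x = K +>\<^bsub>M\<^esub> y \<longleftrightarrow> x \<ominus>\<^bsub>M\<^esub> y \<in> K"
proof
  have "x \<in> K +>\<^bsub>M\<^esub> x" using mem_coset_iff[OF x] x submodD(2)[OF K] by (simp add: M.diff_self)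
  then show "x \<ominus>\<^bsub>M\<^esub> y \<in> K" if "K +>\<^bsub>M\<^esub> x = K +>\<^bsub>M\<^esub> y" using that mem_coset_iff[OF y] by simp
next
  assume d: "x \<ominus>\<^bsub>M\<^esub> y \<in> K"
  have step: "z \<ominus>\<^bsub>M\<^esub> b \<in> K"
    if "z \<in> carrier M" "a \<in> carrier M" "b \<in> carrier M" "a \<ominus>\<^bsub>M\<^esub> b \<in> K" "z \<ominus>\<^bsub>M\<^esub> a \<in> K" for z a b
  proof -
    have "z \<ominus>\<^bsub>M\<^esub> b = (a \<ominus>\<^bsub>M\<^esub> b) \<oplus>\<^bsub>M\<^esub> (z \<ominus>\<^bsub>M\<^esub> a)"
      by (rule M.diff_eqI) (use that in \<open>simp_all add: M.a_assoc[symmetric] M.add_diff_cancel\<close>)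
    then show ?thesis using submodD(3)[OF K] that by simp
  qed
  have "\<zero>\<^bsub>M\<^esub> \<ominus>\<^bsub>M\<^esub> (x \<ominus>\<^bsub>M\<^esub> y) = y \<ominus>\<^bsub>M\<^esub> x"
    by (rule M.diff_eqI)
      (use x y in \<open>simp_all add: M.add_diff_add[symmetric] M.a_comm[of y x] M.diff_self\<close>)
  then have d': "y \<ominus>\<^bsub>M\<^esub> x \<in> K" using submodD(4)[OF K submodD(2)[OF K] d] by simp
  have "z \<ominus>\<^bsub>M\<^esub> x \<in> K \<longleftrightarrow> z \<ominus>\<^bsub>M\<^esub> y \<in> K" if "z \<in> carrier M" for z
    using step[OF that x y d] step[OF that y x d'] by blast
  then show "K +>\<^bsub>M\<^esub> x = K +>\<^bsub>M\<^esub> y" using mem_coset_iff x y by blast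
qed

lemma coset_zero: "K +>\<^bsub>M\<^esub> \<zero>\<^bsub>M\<^esub> = K"
  using mem_coset_iff[OF M.zero_closed] submodD(1)[OF K] by (auto simp: M.diff_zero_right)

lemma coset_eq_self_iff: "x \<in> carrier M \<Longrightarrow> K +>\<^bsub>M\<^esub> x = K \<longleftrightarrow> x \<in> K"
  using coset_eq_iff[of x "\<zero>\<^bsub>M\<^esub>"] by (simp add: coset_zero M.diff_zero_right)

lemma quotient_module_add:
  assumes "x \<in> carrier M" "y \<in> carrier M"
  shows "(K +>\<^bsub>M\<^esub> x) \<oplus>\<^bsub>quotient_module M K\<^esub> (K +>\<^bsub>M\<^esub> y) = K +>\<^bsub>M\<^esub> (x \<oplus>\<^bsub>M\<^esub> y)"
proof -
  have sub: "abelian_subgroup K M"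
    by (rule abelian_subgroupI3[OF additive_subgroup.intro M.abelian_group_axioms], rule submodule.axioms(1)[OF K])
  have "K +>\<^bsub>M\<^esub> x <+>\<^bsub>M\<^esub> (K +>\<^bsub>M\<^esub> y) = K +>\<^bsub>M\<^esub> (x \<oplus>\<^bsub>M\<^esub> y)"
    by (rule abelian_subgroup.a_rcos_sum[OF sub assms])
  then show ?thesis by (simp only: quotient_module_def ring.simps)
qed

lemma quotient_module_smult:
  assumes r: "r \<in> carrier R" and x: "x \<in> carrier M"
  shows "r \<odot>\<^bsub>quotient_module M K\<^esub> (K +>\<^bsub>M\<^esub> x) = K +>\<^bsub>M\<^esub> (r \<odot>\<^bsub>M\<^esub> x)"
proof -
  have "K +>\<^bsub>M\<^esub> (r \<odot>\<^bsub>M\<^esub> z) = K +>\<^bsub>M\<^esub> (r \<odot>\<^bsub>M\<^esub> x)" if "z \<in> K +>\<^bsub>M\<^esub> x" for z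
  proof -
    have z: "z \<in> carrier M" "z \<ominus>\<^bsub>M\<^esub> x \<in> K" using that mem_coset_iff[OF x] by auto
    have "r \<odot>\<^bsub>M\<^esub> z \<ominus>\<^bsub>M\<^esub> r \<odot>\<^bsub>M\<^esub> x \<in> K"
      using submodD(5)[OF K r z(2)] by (simp add: smult_r_diff r z x)
    then show ?thesis using coset_eq_iff r z x by simp
  qed
  moreover have "x \<in> K +>\<^bsub>M\<^esub> x" using mem_coset_iff[OF x] x submodD(2)[OF K] by (simp add: M.diff_self)
  ultimately have "(\<Union>z\<in>K +>\<^bsub>M\<^esub> x. K +>\<^bsub>M\<^esub> (r \<odot>\<^bsub>M\<^esub> z)) = K +>\<^bsub>M\<^esub> (r \<odot>\<^bsub>M\<^esub> x)"
    by (intro UN_constant_eq ballI)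
  then show ?thesis by (simp only: quotient_module_def module.simps)
qed

lemma quotient_module_is_module: "module R (quotient_module M K)"
proof -
  let ?Q = "quotient_module M K"
  have coset: "\<exists>x\<in>carrier M. C = K +>\<^bsub>M\<^esub> x" if "C \<in> carrier ?Q" for C
    using that unfolding quotient_module_carrier .
  have mem: "K +>\<^bsub>M\<^esub> x \<in> carrier ?Q" if "x \<in> carrier M" for x
    unfolding quotient_module_carrier by (rule bexI[OF refl that])
  have zero: "\<zero>\<^bsub>?Q\<^esub> = K +>\<^bsub>M\<^esub> \<zero>\<^bsub>M\<^esub>" by (simp add: quotient_module_zero coset_zero)
  note simps = zero mem quotient_module_add quotient_module_smult
  show ?thesis
  proof (rule moduleI[OF R.is_cring])
    show "abelian_group ?Q"
    proof (rule abelian_groupI)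
      fix C assume C: "C \<in> carrier ?Q"
      obtain x where x: "x \<in> carrier M" "C = K +>\<^bsub>M\<^esub> x" using coset[OF C] by (rule bexE)
      show "\<exists>y\<in>carrier ?Q. y \<oplus>\<^bsub>?Q\<^esub> C = \<zero>\<^bsub>?Q\<^esub>"
        by (rule bexI[of _ "K +>\<^bsub>M\<^esub> (\<ominus>\<^bsub>M\<^esub> x)"]) (simp_all add: simps x M.l_neg)
      show "\<zero>\<^bsub>?Q\<^esub> \<oplus>\<^bsub>?Q\<^esub> C = C" by (simp add: simps x)
      fix C' assume C': "C' \<in> carrier ?Q"
      obtain x' where x': "x' \<in> carrier M" "C' = K +>\<^bsub>M\<^esub> x'" using coset[OF C'] by (rule bexE)
      show "C \<oplus>\<^bsub>?Q\<^esub> C' \<in> carrier ?Q" by (simp add: simps x x')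
      show "C \<oplus>\<^bsub>?Q\<^esub> C' = C' \<oplus>\<^bsub>?Q\<^esub> C" by (simp add: simps x x' M.a_comm)
      fix C'' assume C'': "C'' \<in> carrier ?Q"
      obtain x'' where x'': "x'' \<in> carrier M" "C'' = K +>\<^bsub>M\<^esub> x''" using coset[OF C''] by (rule bexE)
      show "C \<oplus>\<^bsub>?Q\<^esub> C' \<oplus>\<^bsub>?Q\<^esub> C'' = C \<oplus>\<^bsub>?Q\<^esub> (C' \<oplus>\<^bsub>?Q\<^esub> C'')"
        by (simp add: simps x x' x'' M.a_assoc)
    qed (simp add: simps)
    fix C assume C: "C \<in> carrier ?Q"
    obtain x where x: "x \<in> carrier M" "C = K +>\<^bsub>M\<^esub> x" using coset[OF C] by (rule bexE)
    show "\<one> \<odot>\<^bsub>?Q\<^esub> C = C" by (simp add: simps x)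
    fix a assume a: "a \<in> carrier R"
    show "a \<odot>\<^bsub>?Q\<^esub> C \<in> carrier ?Q" by (simp add: simps x a)
    show "(a \<oplus> b) \<odot>\<^bsub>?Q\<^esub> C = a \<odot>\<^bsub>?Q\<^esub> C \<oplus>\<^bsub>?Q\<^esub> b \<odot>\<^bsub>?Q\<^esub> C" if "b \<in> carrier R" for b
      by (simp add: simps x a that smult_l_distr)
    show "(a \<otimes> b) \<odot>\<^bsub>?Q\<^esub> C = a \<odot>\<^bsub>?Q\<^esub> (b \<odot>\<^bsub>?Q\<^esub> C)" if "b \<in> carrier R" for b
      by (simp add: simps x a that smult_assoc1)
    fix C' assume C': "C' \<in> carrier ?Q"
    obtain x' where x': "x' \<in> carrier M" "C' = K +>\<^bsub>M\<^esub> x'" using coset[OF C'] by (rule bexE)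
    show "a \<odot>\<^bsub>?Q\<^esub> (C \<oplus>\<^bsub>?Q\<^esub> C') = a \<odot>\<^bsub>?Q\<^esub> C \<oplus>\<^bsub>?Q\<^esub> a \<odot>\<^bsub>?Q\<^esub> C'"
      by (simp add: simps x x' a smult_r_distr)
  qed
qed

lemma coset_hom: "(\<lambda>x. K +>\<^bsub>M\<^esub> x) \<in> module_hom R M (quotient_module M K)"
  by (rule module_homI) (auto simp: quotient_module_carrier quotient_module_add quotient_module_smult)

lemma quotient_module_lift:
  assumes P: "module R P" and f: "f \<in> module_hom R M P" and fK: "\<And>x. x \<in> K \<Longrightarrow> f x = \<zero>\<^bsub>P\<^esub>"
  obtains g where "g \<in> module_hom R (quotient_module M K) P"
    "\<And>x. x \<in> carrier M \<Longrightarrow> g (K +>\<^bsub>M\<^esub> x) = f x"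
proof -
  interpret P: module R P by fact
  define g where "g = (\<lambda>C. f (SOME x. x \<in> carrier M \<and> C = K +>\<^bsub>M\<^esub> x))"
  have g: "g (K +>\<^bsub>M\<^esub> x) = f x" if x: "x \<in> carrier M" for x
  proof -
    define y where "y = (SOME y. y \<in> carrier M \<and> K +>\<^bsub>M\<^esub> x = K +>\<^bsub>M\<^esub> y)"
    have "y \<in> carrier M \<and> K +>\<^bsub>M\<^esub> x = K +>\<^bsub>M\<^esub> y" unfolding y_def by (rule someI[of _ x]) (simp add: x)
    then have y: "y \<in> carrier M" "x \<ominus>\<^bsub>M\<^esub> y \<in> K" using coset_eq_iff[OF x] by auto
    have "f x \<ominus>\<^bsub>P\<^esub> f y = \<zero>\<^bsub>P\<^esub>"
      using fK[OF y(2)] module_hom_diff[OF module_axioms P f x y(1)] by simp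
    then show ?thesis
      unfolding g_def y_def[symmetric] using P.M.diff_eq_zero_iff module_hom_closed[OF f] x y(1) by simp
  qed
  have "g \<in> module_hom R (quotient_module M K) P"
    by (rule module_homI)
      (auto simp: quotient_module_carrier quotient_module_add quotient_module_smult g
        module_hom_closed[OF f] module_hom_add[OF f] module_hom_smult[OF f])
  then show thesis using g that by blast
qed

end

text \<open>Homology is formed by restricting the carrier to the cycles \<open>Z\<close> and then
  taking cosets. This turns its vanishing into an inclusion of cycles in boundaries.\<close>

lemma zero_quotient_iff:
  assumes K: "submodule K R M" and Z: "Z \<subseteq> carrier M" "\<zero>\<^bsub>M\<^esub> \<in> Z"
  shows "zero_module (quotient_module (M\<lparr>carrier := Z\<rparr>) K) \<longleftrightarrow> Z \<subseteq> K"
proof -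
  have c: "carrier (quotient_module (M\<lparr>carrier := Z\<rparr>) K) = (\<lambda>x. K +>\<^bsub>M\<^esub> x) ` Z"
    by (auto simp: quotient_module_def A_RCOSETS_def' a_r_coset_def')
  have "zero_module (quotient_module (M\<lparr>carrier := Z\<rparr>) K) \<longleftrightarrow> (\<lambda>x. K +>\<^bsub>M\<^esub> x) ` Z = {K}"
    unfolding zero_module_def c by (simp add: quotient_module_def)
  also have "\<dots> \<longleftrightarrow> (\<forall>x\<in>Z. K +>\<^bsub>M\<^esub> x = K)" using Z(2) by auto
  also have "\<dots> \<longleftrightarrow> Z \<subseteq> K" using coset_eq_self_iff[OF K] Z(1) by blast
  finally show ?thesis .
qed

end

section \<open>Tensor products and their universal property\<close>

text \<open>The basis may be infinite, as it is for the free module behind a tensor product. The sum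
  runs over the support of \<open>u\<close>; for additivity, supports are enlarged to a common
  finite set.\<close>

lemma (in cring) module_hom_free_all:
  assumes P: "module R P" and c: "\<And>j. j \<in> B \<Longrightarrow> c j \<in> carrier P"
  obtains f where "f \<in> module_hom R (free_module R B) P" "\<And>j. j \<in> B \<Longrightarrow> f (basis_vec R j) = c j"
proof -
  interpret P: module R P by fact
  interpret B: module R "free_module R B" by (rule free_module_is_module)
  define f where "f = (\<lambda>u. \<Oplus>\<^bsub>P\<^esub>j\<in>{j. u j \<noteq> \<zero>}. u j \<odot>\<^bsub>P\<^esub> c j)"
  have f: "f u = (\<Oplus>\<^bsub>P\<^esub>j\<in>J. u j \<odot>\<^bsub>P\<^esub> c j)"
    if "u \<in> Fr B" "finite J" "{j. u j \<noteq> \<zero>} \<subseteq> J" "J \<subseteq> B" for u J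
    unfolding f_def using that c free_module_closed[OF that(1)]
    by (intro P.M.add.finprod_mono_neutral_cong_left) auto
  have supp: "finite {j. u j \<noteq> \<zero>}" "{j. u j \<noteq> \<zero>} \<subseteq> B" if "u \<in> Fr B" for u
    using that unfolding free_module_carrier by auto
  have hom: "(\<lambda>u. \<Oplus>\<^bsub>P\<^esub>j\<in>J. u j \<odot>\<^bsub>P\<^esub> c j) \<in> module_hom R (free_module R B) P" if "J \<subseteq> B" for J
    using that c by (intro module_hom_free[OF P]) auto
  have "f \<in> module_hom R (free_module R B) P"
  proof (rule module_homI)
    fix u assume u: "u \<in> Fr B"
    note u' = supp[OF u]
    show "f u \<in> carrier P" using module_hom_closed[OF hom[OF u'(2)] u] unfolding f_def .
    show "f (u \<oplus>\<^bsub>free_module R B\<^esub> v) = f u \<oplus>\<^bsub>P\<^esub> f v" if v: "v \<in> Fr B" for v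
    proof -
      note v' = supp[OF v]
      let ?J = "{j. u j \<noteq> \<zero>} \<union> {j. v j \<noteq> \<zero>}"
      have J: "finite ?J" "?J \<subseteq> B" using u' v' by auto
      have "{j. (u \<oplus>\<^bsub>free_module R B\<^esub> v) j \<noteq> \<zero>} \<subseteq> ?J" by auto
      then show ?thesis
        using f[OF u J(1) _ J(2)] f[OF v J(1) _ J(2)] f[OF B.a_closed[OF u v] J(1) _ J(2)]
          module_hom_add[OF hom[OF J(2)] u v] by auto
    qed
    show "f (r \<odot>\<^bsub>free_module R B\<^esub> u) = r \<odot>\<^bsub>P\<^esub> f u" if r: "r \<in> carrier R" for r
    proof -
      have "{j. (r \<odot>\<^bsub>free_module R B\<^esub> u) j \<noteq> \<zero>} \<subseteq> {j. u j \<noteq> \<zero>}" using r by auto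
      then show ?thesis
        using f[OF u u'(1) _ u'(2)] f[OF B.smult_closed[OF r u] u'(1) _ u'(2)]
          module_hom_smult[OF hom[OF u'(2)] r u] by auto
    qed
  qed
  moreover have "f (basis_vec R i) = c i" if i: "i \<in> B" for i
  proof -
    have "f (basis_vec R i) = (\<Oplus>\<^bsub>P\<^esub>j\<in>{i}. basis_vec R i j \<odot>\<^bsub>P\<^esub> c j)"
      using i by (intro f basis_vec_carrier) (auto simp: basis_vec_def)
    also have "\<dots> = c i" using i c by (intro module_hom_free_basis[OF P]) auto
    finally show ?thesis .
  qed
  ultimately show thesis using that by blast
qed

locale tensor_product = cring R + M: module R M + N: module R N
  for R :: "('a, 'r) ring_scheme" (structure)
    and M :: "('a, 'm, 'x) module_scheme" and N :: "('a, 'n, 'y) module_scheme"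
begin

abbreviation "F \<equiv> free_module R (carrier M \<times> carrier N)"
abbreviation "K \<equiv> tensor_relations R M N"
abbreviation "T \<equiv> tensor_module R M N"
abbreviation "e x y \<equiv> basis_vec R (x, y)"

lemma e_mem: "x \<in> carrier M \<Longrightarrow> y \<in> carrier N \<Longrightarrow> e x y \<in> carrier F"
  by (simp add: basis_vec_carrier)

sublocale F: module R F by (rule free_module_is_module)

definition gens :: "('m \<times> 'n \<Rightarrow> 'a) set" where
  "gens = {e (x \<oplus>\<^bsub>M\<^esub> x') y \<ominus>\<^bsub>F\<^esub> (e x y \<oplus>\<^bsub>F\<^esub> e x' y) | x x' y.
          x \<in> carrier M \<and> x' \<in> carrier M \<and> y \<in> carrier N} \<union>
       {e x (y \<oplus>\<^bsub>N\<^esub> y') \<ominus>\<^bsub>F\<^esub> (e x y \<oplus>\<^bsub>F\<^esub> e x y') | x y y'.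
          x \<in> carrier M \<and> y \<in> carrier N \<and> y' \<in> carrier N} \<union>
       {e (r \<odot>\<^bsub>M\<^esub> x) y \<ominus>\<^bsub>F\<^esub> r \<odot>\<^bsub>F\<^esub> e x y | r x y.
          r \<in> carrier R \<and> x \<in> carrier M \<and> y \<in> carrier N} \<union>
       {e x (r \<odot>\<^bsub>N\<^esub> y) \<ominus>\<^bsub>F\<^esub> r \<odot>\<^bsub>F\<^esub> e x y | r x y.
          r \<in> carrier R \<and> x \<in> carrier M \<and> y \<in> carrier N}"

lemma gensI:
  "x \<in> carrier M \<Longrightarrow> x' \<in> carrier M \<Longrightarrow> y \<in> carrier N \<Longrightarrow>
    e (x \<oplus>\<^bsub>M\<^esub> x') y \<ominus>\<^bsub>F\<^esub> (e x y \<oplus>\<^bsub>F\<^esub> e x' y) \<in> gens"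
  "x \<in> carrier M \<Longrightarrow> y \<in> carrier N \<Longrightarrow> y' \<in> carrier N \<Longrightarrow>
    e x (y \<oplus>\<^bsub>N\<^esub> y') \<ominus>\<^bsub>F\<^esub> (e x y \<oplus>\<^bsub>F\<^esub> e x y') \<in> gens"
  "r \<in> carrier R \<Longrightarrow> x \<in> carrier M \<Longrightarrow> y \<in> carrier N \<Longrightarrow>
    e (r \<odot>\<^bsub>M\<^esub> x) y \<ominus>\<^bsub>F\<^esub> r \<odot>\<^bsub>F\<^esub> e x y \<in> gens"
  "r \<in> carrier R \<Longrightarrow> x \<in> carrier M \<Longrightarrow> y \<in> carrier N \<Longrightarrow>
    e x (r \<odot>\<^bsub>N\<^esub> y) \<ominus>\<^bsub>F\<^esub> r \<odot>\<^bsub>F\<^esub> e x y \<in> gens"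
  unfolding gens_def by blast+

lemma K_span: "K = span_module R F gens"
  unfolding tensor_relations_def gens_def Let_def ..

lemma gens_F: "gens \<subseteq> carrier F"
  unfolding gens_def
  by (intro Un_least; clarify; intro F.M.minus_closed F.M.a_closed F.smult_closed e_mem; simp del: free_module_simps)

lemma K_sub: "submodule K R F"
  unfolding K_span by (rule F.submod_span(1)[OF gens_F])

lemma T_module: "module R T"
  unfolding tensor_module_def by (rule F.quotient_module_is_module[OF K_sub])

sublocale T: module R T by (rule T_module)

lemma pure_hom_left:
  assumes y: "y \<in> carrier N"
  shows "(\<lambda>x. pure_tensor R M N x y) \<in> module_hom R M T"
proof (rule module_homI)
  note g = subsetD[OF F.submod_span(2)[OF gens_F], folded K_span]
  fix x assume x: "x \<in> carrier M"
  show "pure_tensor R M N x y \<in> carrier T"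
    unfolding pure_tensor_def tensor_module_def F.quotient_module_carrier by (rule bexI[OF refl e_mem[OF x y]])
  show "pure_tensor R M N (x \<oplus>\<^bsub>M\<^esub> x') y = pure_tensor R M N x y \<oplus>\<^bsub>T\<^esub> pure_tensor R M N x' y"
    if x': "x' \<in> carrier M" for x'
    unfolding pure_tensor_def tensor_module_def F.quotient_module_add[OF K_sub e_mem[OF x y] e_mem[OF x' y]]
      F.coset_eq_iff[OF K_sub e_mem[OF M.a_closed[OF x x'] y] F.a_closed[OF e_mem[OF x y] e_mem[OF x' y]]]
    by (rule g[OF gensI(1)[OF x x' y]])
  show "pure_tensor R M N (r \<odot>\<^bsub>M\<^esub> x) y = r \<odot>\<^bsub>T\<^esub> pure_tensor R M N x y" if r: "r \<in> carrier R" for r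
    unfolding pure_tensor_def tensor_module_def F.quotient_module_smult[OF K_sub r e_mem[OF x y]]
      F.coset_eq_iff[OF K_sub e_mem[OF M.smult_closed[OF r x] y] F.smult_closed[OF r e_mem[OF x y]]]
    by (rule g[OF gensI(3)[OF r x y]])
qed

lemma pure_hom_right:
  assumes x: "x \<in> carrier M"
  shows "(\<lambda>y. pure_tensor R M N x y) \<in> module_hom R N T"
proof (rule module_homI)
  note g = subsetD[OF F.submod_span(2)[OF gens_F], folded K_span]
  fix y assume y: "y \<in> carrier N"
  show "pure_tensor R M N x y \<in> carrier T" by (rule module_hom_closed[OF pure_hom_left[OF y] x])
  show "pure_tensor R M N x (y \<oplus>\<^bsub>N\<^esub> y') = pure_tensor R M N x y \<oplus>\<^bsub>T\<^esub> pure_tensor R M N x y'"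
    if y': "y' \<in> carrier N" for y'
    unfolding pure_tensor_def tensor_module_def F.quotient_module_add[OF K_sub e_mem[OF x y] e_mem[OF x y']]
      F.coset_eq_iff[OF K_sub e_mem[OF x N.a_closed[OF y y']] F.a_closed[OF e_mem[OF x y] e_mem[OF x y']]]
    by (rule g[OF gensI(2)[OF x y y']])
  show "pure_tensor R M N x (r \<odot>\<^bsub>N\<^esub> y) = r \<odot>\<^bsub>T\<^esub> pure_tensor R M N x y" if r: "r \<in> carrier R" for r
    unfolding pure_tensor_def tensor_module_def F.quotient_module_smult[OF K_sub r e_mem[OF x y]]
      F.coset_eq_iff[OF K_sub e_mem[OF x N.smult_closed[OF r y]] F.smult_closed[OF r e_mem[OF x y]]]
    by (rule g[OF gensI(4)[OF r x y]])
qed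

lemma tensor_hom_eqI:
  assumes P: "module R P" and f: "f \<in> module_hom R T P" and g: "g \<in> module_hom R T P"
    and eq: "\<And>x y. x \<in> carrier M \<Longrightarrow> y \<in> carrier N \<Longrightarrow> f (pure_tensor R M N x y) = g (pure_tensor R M N x y)"
    and t: "t \<in> carrier T"
  shows "f t = g t"
proof -
  from t have "\<exists>u\<in>carrier F. t = K +>\<^bsub>F\<^esub> u"
    unfolding tensor_module_def F.quotient_module_carrier .
  then obtain u where u: "u \<in> carrier F" "t = K +>\<^bsub>F\<^esub> u" by (rule bexE)
  let ?J = "{b. u b \<noteq> \<zero>}"
  have J: "finite ?J" "?J \<subseteq> carrier M \<times> carrier N" "u \<in> Fr ?J"
    using u(1) unfolding free_module_carrier by simp_all
  note c = F.coset_hom[OF K_sub, folded tensor_module_def]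
  have "(\<lambda>u. f (K +>\<^bsub>F\<^esub> u)) u = (\<lambda>u. g (K +>\<^bsub>F\<^esub> u)) u"
    by (rule module_hom_eqI[OF P module_hom_comp[OF c f] module_hom_comp[OF c g] J])
      (use J(2) eq in \<open>auto simp: pure_tensor_def\<close>)
  then show ?thesis using u(2) by simp
qed

lemma tensor_lift:
  assumes P: "module R P" and l: "\<And>y. y \<in> carrier N \<Longrightarrow> (\<lambda>x. \<beta> x y) \<in> module_hom R M P"
    and r: "\<And>x. x \<in> carrier M \<Longrightarrow> \<beta> x \<in> module_hom R N P"
  obtains h where "h \<in> module_hom R T P"
    "\<And>x y. x \<in> carrier M \<Longrightarrow> y \<in> carrier N \<Longrightarrow> h (pure_tensor R M N x y) = \<beta> x y"
proof -
  interpret P: module R P by fact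
  have cl: "(case b of (x, y) \<Rightarrow> \<beta> x y) \<in> carrier P" if "b \<in> carrier M \<times> carrier N" for b
    using that module_hom_closed[OF l] by (cases b) simp
  obtain f where f: "f \<in> module_hom R F P"
    "\<And>b. b \<in> carrier M \<times> carrier N \<Longrightarrow> f (basis_vec R b) = (case b of (x, y) \<Rightarrow> \<beta> x y)"
  proof (rule module_hom_free_all[OF P cl])
    fix f assume "f \<in> module_hom R F P"
      "\<And>b. b \<in> carrier M \<times> carrier N \<Longrightarrow> f (basis_vec R b) = (case b of (x, y) \<Rightarrow> \<beta> x y)"
    then show thesis by (rule that)
  qed
  have fe: "f (e x y) = \<beta> x y" if "x \<in> carrier M" "y \<in> carrier N" for x y using f(2) that by simp
  have fd: "f (u \<ominus>\<^bsub>F\<^esub> v) = \<zero>\<^bsub>P\<^esub>" if "u \<in> carrier F" "v \<in> carrier F" "f u = f v" for u v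
    using module_hom_diff[OF F.module_axioms P f(1) that(1,2)] that(3) module_hom_closed[OF f(1) that(2)]
    by (simp add: P.M.diff_self)
  note bc = module_hom_closed[OF l]
  have k1: "f (e (x \<oplus>\<^bsub>M\<^esub> x') y \<ominus>\<^bsub>F\<^esub> (e x y \<oplus>\<^bsub>F\<^esub> e x' y)) = \<zero>\<^bsub>P\<^esub>"
    if "x \<in> carrier M" "x' \<in> carrier M" "y \<in> carrier N" for x x' y
    by (rule fd[OF e_mem F.a_closed[OF e_mem e_mem]])
      (simp_all add: that fe module_hom_add[OF f(1)] e_mem module_hom_add[OF l] del: free_module_simps)
  have k2: "f (e x (y \<oplus>\<^bsub>N\<^esub> y') \<ominus>\<^bsub>F\<^esub> (e x y \<oplus>\<^bsub>F\<^esub> e x y')) = \<zero>\<^bsub>P\<^esub>"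
    if "x \<in> carrier M" "y \<in> carrier N" "y' \<in> carrier N" for x y y'
    by (rule fd[OF e_mem F.a_closed[OF e_mem e_mem]])
      (simp_all add: that fe module_hom_add[OF f(1)] e_mem module_hom_add[OF r] del: free_module_simps)
  have k3: "f (e (s \<odot>\<^bsub>M\<^esub> x) y \<ominus>\<^bsub>F\<^esub> s \<odot>\<^bsub>F\<^esub> e x y) = \<zero>\<^bsub>P\<^esub>"
    if "s \<in> carrier R" "x \<in> carrier M" "y \<in> carrier N" for s x y
    by (rule fd[OF e_mem F.smult_closed[OF _ e_mem]])
      (simp_all add: that fe module_hom_smult[OF f(1)] e_mem module_hom_smult[OF l] del: free_module_simps)
  have k4: "f (e x (s \<odot>\<^bsub>N\<^esub> y) \<ominus>\<^bsub>F\<^esub> s \<odot>\<^bsub>F\<^esub> e x y) = \<zero>\<^bsub>P\<^esub>"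
    if "s \<in> carrier R" "x \<in> carrier M" "y \<in> carrier N" for s x y
    by (rule fd[OF e_mem F.smult_closed[OF _ e_mem]])
      (simp_all add: that fe module_hom_smult[OF f(1)] e_mem module_hom_smult[OF r] del: free_module_simps)
  have "f w = \<zero>\<^bsub>P\<^esub>" if "w \<in> gens" for w
    using that unfolding gens_def by (elim UnE CollectE exE conjE) (simp_all only: k1 k2 k3 k4)
  then have "gens \<subseteq> {u \<in> carrier F. f u \<in> {\<zero>\<^bsub>P\<^esub>}}"
    using gens_F by (intro subsetI CollectI conjI) (rule subsetD, simp_all only: singleton_iff)
  then have "K \<subseteq> {u \<in> carrier F. f u \<in> {\<zero>\<^bsub>P\<^esub>}}"
    unfolding K_span
    by (rule F.submod_span(3)[OF gens_F submod_preimage[OF F.module_axioms P f(1) F.carrier_is_submodule P.submod_zero]])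
  then have fK: "f u = \<zero>\<^bsub>P\<^esub>" if "u \<in> K" for u using that by blast
  obtain h where h: "h \<in> module_hom R T P" "\<And>u. u \<in> carrier F \<Longrightarrow> h (K +>\<^bsub>F\<^esub> u) = f u"
    unfolding tensor_module_def by (rule F.quotient_module_lift[OF K_sub P f(1) fK]) blast+
  show thesis
    by (rule that[OF h(1)]) (simp add: pure_tensor_def h(2) e_mem fe)
qed

end

text \<open>\<open>tensor_map\<close> is a definite description, so unique existence has to be
  shown: the universal property gives existence, and generation by pure tensors with extensionality
  gives uniqueness.\<close>

lemma tensor_map_hom:
  assumes M: "module R M" and M': "module R M'" and N: "module R N" and f: "f \<in> module_hom R M M'"
  shows "tensor_map R M M' N f \<in> module_hom R (tensor_module R M N) (tensor_module R M' N)"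
    and "\<And>x y. x \<in> carrier M \<Longrightarrow> y \<in> carrier N \<Longrightarrow>
      tensor_map R M M' N f (pure_tensor R M N x y) = pure_tensor R M' N (f x) y"
proof -
  interpret M: module R M by fact
  interpret tensor_product R M N
    by (intro tensor_product.intro M N M.R.is_cring)
  interpret T': tensor_product R M' N
    by (intro tensor_product.intro M' N M.R.is_cring)
  let ?P = "\<lambda>h. h \<in> module_hom R T T'.T \<and> h \<in> extensional (carrier T) \<and>
     (\<forall>x\<in>carrier M. \<forall>y\<in>carrier N. h (pure_tensor R M N x y) = pure_tensor R M' N (f x) y)"
  have "\<exists>!h. ?P h"
  proof (rule ex_ex1I)
    have l: "(\<lambda>x. pure_tensor R M' N (f x) y) \<in> module_hom R M T'.T" if "y \<in> carrier N" for y
      by (rule module_hom_comp[OF f T'.pure_hom_left[OF that]])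
    have r: "pure_tensor R M' N (f x) \<in> module_hom R N T'.T" if "x \<in> carrier M" for x
      by (rule T'.pure_hom_right[OF module_hom_closed[OF f that]])
    obtain h where h: "h \<in> module_hom R T T'.T"
      "\<And>x y. x \<in> carrier M \<Longrightarrow> y \<in> carrier N \<Longrightarrow> h (pure_tensor R M N x y) = pure_tensor R M' N (f x) y"
      by (rule tensor_lift[OF T'.T_module l r]) blast+
    have "restrict h (carrier T) \<in> module_hom R T T'.T"
      by (rule module_hom_cong[OF T_module h(1)]) simp
    moreover have "pure_tensor R M N x y \<in> carrier T" if "x \<in> carrier M" "y \<in> carrier N" for x y
      by (rule module_hom_closed[OF pure_hom_left[OF that(2)] that(1)])
    ultimately have "?P (restrict h (carrier T))" using h(2) by simp
    from exI[of ?P, OF this] show "\<exists>h. ?P h" .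
  next
    fix g h assume gh: "?P g" "?P h"
    show "g = h"
    proof (rule extensionalityI)
      show "g \<in> extensional (carrier T)" "h \<in> extensional (carrier T)" using gh by blast+
      show "g t = h t" if "t \<in> carrier T" for t
        by (rule tensor_hom_eqI[OF T'.T_module _ _ _ that]) (use gh in auto)
    qed
  qed
  from theI'[OF this, folded tensor_map_def]
  show "tensor_map R M M' N f \<in> module_hom R T T'.T"
    "\<And>x y. x \<in> carrier M \<Longrightarrow> y \<in> carrier N \<Longrightarrow>
      tensor_map R M M' N f (pure_tensor R M N x y) = pure_tensor R M' N (f x) y"
    by blast+
qed

section \<open>Vanishing of Tor and Ext in terms of matrices\<close>

text \<open>Exactness of \<open>Q\<^sup>r \<rightarrow> Q\<^sup>q \<rightarrow> Q\<^sup>p\<close> for the maps given by the matrices \<open>B\<close> and \<open>A\<close>.\<close>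

definition mat_exact ::
    "('a, 'r) ring_scheme \<Rightarrow> ('a, 'q, 'z) module_scheme \<Rightarrow> (nat \<Rightarrow> nat \<Rightarrow> 'a) \<Rightarrow> nat \<Rightarrow> nat \<Rightarrow>
      (nat \<Rightarrow> nat \<Rightarrow> 'a) \<Rightarrow> nat \<Rightarrow> bool" where
  "mat_exact R Q A p q B r \<longleftrightarrow>
    (\<forall>y\<in>{..<q} \<rightarrow> carrier Q. (\<forall>a<p. (\<Oplus>\<^bsub>Q\<^esub>x\<in>{..<q}. A a x \<odot>\<^bsub>Q\<^esub> y x) = \<zero>\<^bsub>Q\<^esub>) \<longrightarrow>
      (\<exists>z\<in>{..<r} \<rightarrow> carrier Q. \<forall>x<q. y x = (\<Oplus>\<^bsub>Q\<^esub>w\<in>{..<r}. B x w \<odot>\<^bsub>Q\<^esub> z w)))"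

lemma a_kernel_iff: "x \<in> a_kernel M N f \<longleftrightarrow> x \<in> carrier M \<and> f x = \<zero>\<^bsub>N\<^esub>"
  by (simp add: a_kernel_def')

lemma (in module) scalar_hom: "y \<in> carrier M \<Longrightarrow> (\<lambda>r. r \<odot>\<^bsub>M\<^esub> y) \<in> module_hom R (ring_module R) M"
  by (rule module_homI) (simp_all add: ring_module_def smult_l_distr smult_assoc1)

section \<open>Coordinates on the tensor product with a free module\<close>

context module
begin

abbreviation TP :: "nat \<Rightarrow> _" where "TP p \<equiv> tensor_module R (fin_free R p) M"
abbreviation pt :: "nat \<Rightarrow> _" where "pt p \<equiv> pure_tensor R (fin_free R p) M"

text \<open>The coordinate maps of the isomorphism of \<open>R^p \<otimes> M\<close> with
  \<open>M^p\<close>. The inverse is \<open>tensor_of\<close>.\<close>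

definition tensor_coord :: "nat \<Rightarrow> nat \<Rightarrow> _" where
  "tensor_coord p a = (SOME h. h \<in> module_hom R (TP p) M \<and>
     (\<forall>u\<in>carrier (fin_free R p). \<forall>y\<in>carrier M. h (pt p u y) = u a \<odot>\<^bsub>M\<^esub> y))"

lemma tensor_product_free: "tensor_product R (fin_free R p) M"
  by (intro tensor_product.intro R.free_module_is_module module_axioms R.is_cring)

lemma tensor_coord:
  "tensor_coord p a \<in> module_hom R (TP p) M"
  "u \<in> carrier (fin_free R p) \<Longrightarrow> y \<in> carrier M \<Longrightarrow> tensor_coord p a (pt p u y) = u a \<odot>\<^bsub>M\<^esub> y"
proof -
  have l: "(\<lambda>u. u a \<odot>\<^bsub>M\<^esub> y) \<in> module_hom R (fin_free R p) M" if "y \<in> carrier M" for y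
    by (rule module_hom_comp[OF R.coord_hom scalar_hom[OF that]])
  have r: "(\<lambda>y. u a \<odot>\<^bsub>M\<^esub> y) \<in> module_hom R M M" if "u \<in> carrier (fin_free R p)" for u
    by (rule module_hom_smult_map[OF module_hom_id free_module_closed[OF that]])
  have "\<exists>h. h \<in> module_hom R (TP p) M \<and>
     (\<forall>u\<in>carrier (fin_free R p). \<forall>y\<in>carrier M. h (pt p u y) = u a \<odot>\<^bsub>M\<^esub> y)"
  proof (rule tensor_product.tensor_lift[OF tensor_product_free module_axioms, of "\<lambda>u y. u a \<odot>\<^bsub>M\<^esub> y"])
    fix h assume "h \<in> module_hom R (TP p) M"
      "\<And>u y. u \<in> carrier (fin_free R p) \<Longrightarrow> y \<in> carrier M \<Longrightarrow> h (pt p u y) = u a \<odot>\<^bsub>M\<^esub> y"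
    then show ?thesis by (intro exI[of _ h]) simp
  qed (use l r in simp_all)
  from someI_ex[OF this, folded tensor_coord_def]
  show "tensor_coord p a \<in> module_hom R (TP p) M"
    "u \<in> carrier (fin_free R p) \<Longrightarrow> y \<in> carrier M \<Longrightarrow> tensor_coord p a (pt p u y) = u a \<odot>\<^bsub>M\<^esub> y"
    by simp_all
qed

definition tensor_of :: "nat \<Rightarrow> _" where
  "tensor_of p y = (\<Oplus>\<^bsub>TP p\<^esub>a\<in>{..<p}. pt p (basis_vec R a) (y a))"

lemma TP_module: "module R (TP p)"
  by (rule tensor_product.T_module[OF tensor_product_free])

lemma pt_basis_hom: "a \<in> {..<p} \<Longrightarrow> pt p (basis_vec R a) \<in> module_hom R M (TP p)"
  by (rule tensor_product.pure_hom_right[OF tensor_product_free R.basis_vec_carrier])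

lemma tensor_of_mem:
  assumes "y \<in> {..<p} \<rightarrow> carrier M"
  shows "tensor_of p y \<in> carrier (TP p)"
proof -
  interpret T: module R "TP p" by (rule TP_module)
  show ?thesis
    unfolding tensor_of_def
    by (rule T.finsum_closed, rule Pi_I, rule module_hom_closed[OF pt_basis_hom]) (use assms in auto)
qed

lemma tensor_coord_of:
  assumes y: "y \<in> {..<p} \<rightarrow> carrier M" and a: "a < p"
  shows "tensor_coord p a (tensor_of p y) = y a"
proof -
  have yc: "y x \<in> carrier M" if "x \<in> {..<p}" for x using y that by blast
  have c: "(\<lambda>a. pt p (basis_vec R a) (y a)) \<in> {..<p} \<rightarrow> carrier (TP p)"
    by (rule Pi_I, rule module_hom_closed[OF pt_basis_hom]) (simp_all add: yc)
  have "tensor_coord p a (tensor_of p y) = (\<Oplus>\<^bsub>M\<^esub>x\<in>{..<p}. tensor_coord p a (pt p (basis_vec R x) (y x)))"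
    unfolding tensor_of_def by (rule module_hom_finsum[OF TP_module module_axioms tensor_coord(1) c])
  also have "\<dots> = (\<Oplus>\<^bsub>M\<^esub>x\<in>{..<p}. if a = x then y x else \<zero>\<^bsub>M\<^esub>)"
  proof (rule M.finsum_cong')
    show "(\<lambda>x. if a = x then y x else \<zero>\<^bsub>M\<^esub>) \<in> {..<p} \<rightarrow> carrier M" using yc by auto
    fix x assume x: "x \<in> {..<p}"
    show "tensor_coord p a (pt p (basis_vec R x) (y x)) = (if a = x then y x else \<zero>\<^bsub>M\<^esub>)"
      unfolding tensor_coord(2)[OF R.basis_vec_carrier[OF x] yc[OF x]] using yc[OF x]
      by (simp add: basis_vec_def)
  qed simp
  also have "\<dots> = y a" using yc a by (subst M.finsum_singleton) auto
  finally show ?thesis .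
qed

lemma tensor_of_coord:
  assumes t: "t \<in> carrier (TP p)"
  shows "tensor_of p (\<lambda>a. tensor_coord p a t) = t"
proof -
  interpret T: module R "TP p" by (rule TP_module)
  note pc = module_hom_closed[OF pt_basis_hom]
  have "(\<lambda>t. tensor_of p (\<lambda>a. tensor_coord p a t)) t = (\<lambda>t. t) t"
  proof (rule tensor_product.tensor_hom_eqI[OF tensor_product_free TP_module _ module_hom_id _ t])
    show "(\<lambda>t. tensor_of p (\<lambda>a. tensor_coord p a t)) \<in> module_hom R (TP p) (TP p)"
      unfolding tensor_of_def
      by (rule T.module_hom_sum_map, rule module_hom_comp[OF tensor_coord(1) pt_basis_hom])
    fix u y assume u: "u \<in> carrier (fin_free R p)" and y: "y \<in> carrier M"
    have "tensor_of p (\<lambda>a. tensor_coord p a (pt p u y)) =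
        (\<Oplus>\<^bsub>TP p\<^esub>a\<in>{..<p}. u a \<odot>\<^bsub>TP p\<^esub> pt p (basis_vec R a) y)"
      unfolding tensor_of_def
      by (rule T.finsum_cong')
        (simp_all add: tensor_coord(2) u y free_module_closed[OF u] module_hom_smult[OF pt_basis_hom] pc)
    also have "\<dots> = pt p u y"
      by (rule R.module_hom_expand[OF TP_module tensor_product.pure_hom_left[OF tensor_product_free y] _ _ u, symmetric])
        simp_all
    finally show "tensor_of p (\<lambda>a. tensor_coord p a (pt p u y)) = pt p u y" .
  qed
  then show ?thesis .
qed

lemma tensor_coord_eqI:
  assumes s: "s \<in> carrier (TP p)" and t: "t \<in> carrier (TP p)"
    and e: "\<And>a. a < p \<Longrightarrow> tensor_coord p a s = tensor_coord p a t"
  shows "s = t"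
proof -
  interpret T: module R "TP p" by (rule TP_module)
  have "tensor_of p (\<lambda>a. tensor_coord p a s) = tensor_of p (\<lambda>a. tensor_coord p a t)"
    unfolding tensor_of_def
    by (rule T.finsum_cong')
      (simp_all add: e module_hom_closed[OF pt_basis_hom] module_hom_closed[OF tensor_coord(1)] t)
  then show ?thesis using tensor_of_coord[OF s] tensor_of_coord[OF t] by simp
qed

lemma tensor_coord_map:
  assumes d: "d \<in> module_hom R (fin_free R q) (fin_free R p)"
    and A: "\<And>a x. x < q \<Longrightarrow> A a x = d (basis_vec R x) a"
    and t: "t \<in> carrier (TP q)"
  shows "tensor_coord p a (tensor_map R (fin_free R q) (fin_free R p) M d t) =
    (\<Oplus>\<^bsub>M\<^esub>x\<in>{..<q}. A a x \<odot>\<^bsub>M\<^esub> tensor_coord q x t)"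
proof -
  note tm = tensor_map_hom[OF R.free_module_is_module R.free_module_is_module module_axioms d]
  have Ac: "A a x \<in> carrier R" if "x \<in> {..<q}" for x
    using A[of x a] that free_module_closed[OF module_hom_closed[OF d R.basis_vec_carrier[OF that]]] by simp
  have "(\<lambda>t. tensor_coord p a (tensor_map R (fin_free R q) (fin_free R p) M d t)) t =
      (\<lambda>t. \<Oplus>\<^bsub>M\<^esub>x\<in>{..<q}. A a x \<odot>\<^bsub>M\<^esub> tensor_coord q x t) t"
  proof (rule tensor_product.tensor_hom_eqI[OF tensor_product_free module_axioms
        module_hom_comp[OF tm(1) tensor_coord(1)] _ _ t])
    show "(\<lambda>t. \<Oplus>\<^bsub>M\<^esub>x\<in>{..<q}. A a x \<odot>\<^bsub>M\<^esub> tensor_coord q x t) \<in> module_hom R (TP q) M"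
      by (rule module_hom_sum_map, rule module_hom_smult_map[OF tensor_coord(1)]) (rule Ac)
    fix u y assume u: "u \<in> carrier (fin_free R q)" and y: "y \<in> carrier M"
    note uc = free_module_closed[OF u]
    have "tensor_coord p a (tensor_map R (fin_free R q) (fin_free R p) M d (pt q u y)) = d u a \<odot>\<^bsub>M\<^esub> y"
      by (simp add: tm(2) u y tensor_coord(2) module_hom_closed[OF d])
    also have "\<dots> = (\<Oplus>\<^bsub>M\<^esub>x\<in>{..<q}. u x \<odot>\<^bsub>M\<^esub> (d (basis_vec R x) a \<odot>\<^bsub>M\<^esub> y))"
      by (rule R.module_hom_expand[OF module_axioms
            module_hom_comp[OF module_hom_comp[OF d R.coord_hom] scalar_hom[OF y]] _ _ u]) simp_all
    also have "\<dots> = (\<Oplus>\<^bsub>M\<^esub>x\<in>{..<q}. A a x \<odot>\<^bsub>M\<^esub> tensor_coord q x (pt q u y))"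
    proof (rule M.finsum_cong'[OF refl])
      show "(\<lambda>x. A a x \<odot>\<^bsub>M\<^esub> tensor_coord q x (pt q u y)) \<in> {..<q} \<rightarrow> carrier M"
        using Ac uc y by (simp add: tensor_coord(2) u)
      fix x assume x: "x \<in> {..<q}"
      show "u x \<odot>\<^bsub>M\<^esub> (d (basis_vec R x) a \<odot>\<^bsub>M\<^esub> y) = A a x \<odot>\<^bsub>M\<^esub> tensor_coord q x (pt q u y)"
        using x Ac[OF x] uc y R.m_comm[of "u x" "A a x"]
        by (simp add: tensor_coord(2) u A[symmetric] smult_assoc1[symmetric])
    qed
    finally show "tensor_coord p a (tensor_map R (fin_free R q) (fin_free R p) M d (pt q u y)) =
      (\<Oplus>\<^bsub>M\<^esub>x\<in>{..<q}. A a x \<odot>\<^bsub>M\<^esub> tensor_coord q x (pt q u y))" .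
  qed
  then show ?thesis .
qed

text \<open>In coordinates the maps induced on tensor products are the matrices \<open>A\<close> and
  \<open>B\<close> acting on powers of \<open>M\<close>.\<close>

lemma tensor_homology_zero_iff:
  fixes p q r :: nat and d0 d1 :: "(nat \<Rightarrow> 'a) \<Rightarrow> nat \<Rightarrow> 'a"
  defines "D0 \<equiv> tensor_map R (fin_free R q) (fin_free R p) M d0"
    and "D1 \<equiv> tensor_map R (fin_free R r) (fin_free R q) M d1"
  assumes d0: "d0 \<in> module_hom R (fin_free R q) (fin_free R p)"
    and d1: "d1 \<in> module_hom R (fin_free R r) (fin_free R q)"
    and A: "\<And>a x. x < q \<Longrightarrow> A a x = d0 (basis_vec R x) a"
    and B: "\<And>a x. x < r \<Longrightarrow> B a x = d1 (basis_vec R x) a"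
  shows "zero_module (quotient_module (TP q\<lparr>carrier := a_kernel (TP q) (TP p) D0\<rparr>) (D1 ` carrier (TP r))) \<longleftrightarrow>
    mat_exact R M A p q B r"
proof -
  interpret Tq: module R "TP q" by (rule TP_module)
  interpret Tp: module R "TP p" by (rule TP_module)
  interpret Tr: module R "TP r" by (rule TP_module)
  have D0: "D0 \<in> module_hom R (TP q) (TP p)" and D1: "D1 \<in> module_hom R (TP r) (TP q)"
    unfolding D0_def D1_def
    by (rule tensor_map_hom(1)[OF R.free_module_is_module R.free_module_is_module module_axioms d0],
        rule tensor_map_hom(1)[OF R.free_module_is_module R.free_module_is_module module_axioms d1])
  have c0: "tensor_coord p a (D0 t) = (\<Oplus>\<^bsub>M\<^esub>x\<in>{..<q}. A a x \<odot>\<^bsub>M\<^esub> tensor_coord q x t)"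
    if "t \<in> carrier (TP q)" for a t
    unfolding D0_def by (rule tensor_coord_map[OF d0 A that])
  have c1: "tensor_coord q a (D1 t) = (\<Oplus>\<^bsub>M\<^esub>x\<in>{..<r}. B a x \<odot>\<^bsub>M\<^esub> tensor_coord r x t)"
    if "t \<in> carrier (TP r)" for a t
    unfolding D1_def by (rule tensor_coord_map[OF d1 B that])
  have Ac: "A a x \<in> carrier R" if "x \<in> {..<q}" for a x
    using A[of x a] that free_module_closed[OF module_hom_closed[OF d0 R.basis_vec_carrier[OF that]]] by simp
  have Bc: "B a x \<in> carrier R" if "x \<in> {..<r}" for a x
    using B[of x a] that free_module_closed[OF module_hom_closed[OF d1 R.basis_vec_carrier[OF that]]] by simp
  have z0: "tensor_coord p a \<zero>\<^bsub>TP p\<^esub> = \<zero>\<^bsub>M\<^esub>" for a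
    by (rule module_hom_zero[OF TP_module module_axioms tensor_coord(1)])
  have cc: "tensor_coord p a t \<in> carrier M" if "t \<in> carrier (TP p)" for p a t
    by (rule module_hom_closed[OF tensor_coord(1) that])
  have sub: "submodule (D1 ` carrier (TP r)) R (TP q)"
    by (rule submod_image[OF TP_module TP_module D1 Tr.carrier_is_submodule])
  have ker: "a_kernel (TP q) (TP p) D0 \<subseteq> carrier (TP q)" "\<zero>\<^bsub>TP q\<^esub> \<in> a_kernel (TP q) (TP p) D0"
    using module_hom_zero[OF TP_module TP_module D0] by (auto simp: a_kernel_iff)
  have "a_kernel (TP q) (TP p) D0 \<subseteq> D1 ` carrier (TP r) \<longleftrightarrow> mat_exact R M A p q B r"
  proof
    assume le: "a_kernel (TP q) (TP p) D0 \<subseteq> D1 ` carrier (TP r)"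
    show "mat_exact R M A p q B r"
      unfolding mat_exact_def
    proof (intro ballI impI)
      fix y assume y: "y \<in> {..<q} \<rightarrow> carrier M"
        and Ay: "\<forall>a<p. (\<Oplus>\<^bsub>M\<^esub>x\<in>{..<q}. A a x \<odot>\<^bsub>M\<^esub> y x) = \<zero>\<^bsub>M\<^esub>"
      let ?t = "tensor_of q y"
      note t = tensor_of_mem[OF y]
      have "D0 ?t = \<zero>\<^bsub>TP p\<^esub>"
      proof (rule tensor_coord_eqI[OF module_hom_closed[OF D0 t] Tp.zero_closed])
        fix a assume a: "a < p"
        have "(\<Oplus>\<^bsub>M\<^esub>x\<in>{..<q}. A a x \<odot>\<^bsub>M\<^esub> tensor_coord q x ?t) = (\<Oplus>\<^bsub>M\<^esub>x\<in>{..<q}. A a x \<odot>\<^bsub>M\<^esub> y x)"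
          using y Ac by (intro M.finsum_cong') (auto simp: tensor_coord_of)
        then show "tensor_coord p a (D0 ?t) = tensor_coord p a \<zero>\<^bsub>TP p\<^esub>"
          unfolding c0[OF t] z0 using Ay a by simp
      qed
      then have "?t \<in> D1 ` carrier (TP r)" using le t by (auto simp: a_kernel_iff)
      then obtain s where s: "s \<in> carrier (TP r)" "?t = D1 s" by blast
      have "y x = (\<Oplus>\<^bsub>M\<^esub>w\<in>{..<r}. B x w \<odot>\<^bsub>M\<^esub> tensor_coord r w s)" if "x < q" for x
        using tensor_coord_of[OF y that] c1[OF s(1), of x] s(2) by simp
      then show "\<exists>z\<in>{..<r} \<rightarrow> carrier M. \<forall>x<q. y x = (\<Oplus>\<^bsub>M\<^esub>w\<in>{..<r}. B x w \<odot>\<^bsub>M\<^esub> z w)"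
        using cc[OF s(1)] by (intro bexI[of _ "\<lambda>w. tensor_coord r w s"]) auto
    qed
  next
    assume ex: "mat_exact R M A p q B r"
    show "a_kernel (TP q) (TP p) D0 \<subseteq> D1 ` carrier (TP r)"
    proof
      fix t assume "t \<in> a_kernel (TP q) (TP p) D0"
      then have t: "t \<in> carrier (TP q)" "D0 t = \<zero>\<^bsub>TP p\<^esub>" by (auto simp: a_kernel_iff)
      have y: "(\<lambda>x. tensor_coord q x t) \<in> {..<q} \<rightarrow> carrier M" using cc[OF t(1)] by blast
      have Ay: "(\<Oplus>\<^bsub>M\<^esub>x\<in>{..<q}. A a x \<odot>\<^bsub>M\<^esub> tensor_coord q x t) = \<zero>\<^bsub>M\<^esub>" for a
        using c0[OF t(1), of a] t(2) z0 by simp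
      obtain z where z: "z \<in> {..<r} \<rightarrow> carrier M"
        "\<forall>x<q. tensor_coord q x t = (\<Oplus>\<^bsub>M\<^esub>w\<in>{..<r}. B x w \<odot>\<^bsub>M\<^esub> z w)"
        using ex[unfolded mat_exact_def, THEN bspec, OF y] Ay by auto
      note s = tensor_of_mem[OF z(1)]
      have "t = D1 (tensor_of r z)"
      proof (rule tensor_coord_eqI[OF t(1) module_hom_closed[OF D1 s]])
        fix a assume a: "a < q"
        have "(\<Oplus>\<^bsub>M\<^esub>x\<in>{..<r}. B a x \<odot>\<^bsub>M\<^esub> tensor_coord r x (tensor_of r z)) = (\<Oplus>\<^bsub>M\<^esub>x\<in>{..<r}. B a x \<odot>\<^bsub>M\<^esub> z x)"
          using z(1) Bc by (intro M.finsum_cong') (auto simp: tensor_coord_of)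
        then show "tensor_coord q a t = tensor_coord q a (D1 (tensor_of r z))"
          unfolding c1[OF s] using z(2) a by simp
      qed
      then show "t \<in> D1 ` carrier (TP r)" using s by blast
    qed
  qed
  then show ?thesis using Tq.zero_quotient_iff[OF sub ker] by simp
qed

end

section \<open>Coordinates on homomorphisms from a free module\<close>

lemma hom_module_simps:
  "f \<in> carrier (hom_module R L M) \<longleftrightarrow> f \<in> module_hom R L M \<and> f \<in> extensional (carrier L)"
  "\<zero>\<^bsub>hom_module R L M\<^esub> = (\<lambda>x\<in>carrier L. \<zero>\<^bsub>M\<^esub>)"
  "f \<oplus>\<^bsub>hom_module R L M\<^esub> g = (\<lambda>x\<in>carrier L. f x \<oplus>\<^bsub>M\<^esub> g x)"
  "r \<odot>\<^bsub>hom_module R L M\<^esub> f = (\<lambda>x\<in>carrier L. r \<odot>\<^bsub>M\<^esub> f x)"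
  by (auto simp: hom_module_def)

lemma hom_module_eqI:
  assumes "f \<in> carrier (hom_module R L M)" "g \<in> carrier (hom_module R L M)"
    and "\<And>x. x \<in> carrier L \<Longrightarrow> f x = g x"
  shows "f = g"
  by (rule extensionalityI[of _ "carrier L"]) (use assms in \<open>simp_all add: hom_module_simps\<close>)

lemma hom_module_restrict:
  assumes "module R L" "f \<in> module_hom R L M"
  shows "restrict f (carrier L) \<in> carrier (hom_module R L M)"
  using module_hom_cong[OF assms, of "restrict f (carrier L)"] by (simp add: hom_module_simps)

context module
begin

lemma hom_module_is_module:
  assumes L: "module R L"
  shows "module R (hom_module R L M)"
proof -
  interpret L: module R L by fact
  let ?H = "hom_module R L M"
  have hom: "f \<in> module_hom R L M" if "f \<in> carrier ?H" for f using that by (simp add: hom_module_simps)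
  have val: "f x \<in> carrier M" if "f \<in> carrier ?H" "x \<in> carrier L" for f x
    by (rule module_hom_closed[OF hom[OF that(1)] that(2)])
  have add: "f \<oplus>\<^bsub>?H\<^esub> g \<in> carrier ?H" if "f \<in> carrier ?H" "g \<in> carrier ?H" for f g
    unfolding hom_module_simps(3) by (rule hom_module_restrict[OF L module_hom_plus[OF hom[OF that(1)] hom[OF that(2)]]])
  have smult: "r \<odot>\<^bsub>?H\<^esub> f \<in> carrier ?H" if "r \<in> carrier R" "f \<in> carrier ?H" for r f
    unfolding hom_module_simps(4) by (rule hom_module_restrict[OF L module_hom_smult_map[OF hom[OF that(2)] that(1)]])
  have zero: "\<zero>\<^bsub>?H\<^esub> \<in> carrier ?H"
    unfolding hom_module_simps(2) by (rule hom_module_restrict[OF L module_hom_zero_map])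
  note ops = hom_module_simps(2-4)
  show ?thesis
  proof (rule moduleI[OF R.is_cring])
    show "abelian_group ?H"
    proof (rule abelian_groupI)
      fix f assume f: "f \<in> carrier ?H"
      have m: "(\<ominus>\<^bsub>R\<^esub> \<one>\<^bsub>R\<^esub>) \<odot>\<^bsub>?H\<^esub> f \<in> carrier ?H" by (rule smult[OF _ f]) simp
      have "(\<ominus>\<^bsub>R\<^esub> \<one>\<^bsub>R\<^esub>) \<odot>\<^bsub>?H\<^esub> f \<oplus>\<^bsub>?H\<^esub> f = \<zero>\<^bsub>?H\<^esub>"
        by (rule hom_module_eqI[OF add[OF m f] zero])
          (simp add: ops neg_eq_smult[symmetric] val[OF f] M.l_neg)
      then show "\<exists>y\<in>carrier ?H. y \<oplus>\<^bsub>?H\<^esub> f = \<zero>\<^bsub>?H\<^esub>" using m by blast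
      show "\<zero>\<^bsub>?H\<^esub> \<oplus>\<^bsub>?H\<^esub> f = f"
        by (rule hom_module_eqI[OF add[OF zero f] f]) (simp add: ops val[OF f])
      fix g assume g: "g \<in> carrier ?H"
      show "f \<oplus>\<^bsub>?H\<^esub> g = g \<oplus>\<^bsub>?H\<^esub> f"
        by (rule hom_module_eqI[OF add[OF f g] add[OF g f]]) (simp add: ops val[OF f] val[OF g] M.a_comm)
      fix h assume h: "h \<in> carrier ?H"
      show "f \<oplus>\<^bsub>?H\<^esub> g \<oplus>\<^bsub>?H\<^esub> h = f \<oplus>\<^bsub>?H\<^esub> (g \<oplus>\<^bsub>?H\<^esub> h)"
        by (rule hom_module_eqI[OF add[OF add[OF f g] h] add[OF f add[OF g h]]])
          (simp add: ops val[OF f] val[OF g] val[OF h] M.a_assoc)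
    qed (simp_all add: add zero)
    fix r f assume r: "r \<in> carrier R" and f: "f \<in> carrier ?H"
    show "r \<odot>\<^bsub>?H\<^esub> f \<in> carrier ?H" by (rule smult[OF r f])
    show "(r \<oplus>\<^bsub>R\<^esub> s) \<odot>\<^bsub>?H\<^esub> f = r \<odot>\<^bsub>?H\<^esub> f \<oplus>\<^bsub>?H\<^esub> s \<odot>\<^bsub>?H\<^esub> f" if s: "s \<in> carrier R" for s
      by (rule hom_module_eqI[OF smult[OF R.a_closed[OF r s] f] add[OF smult[OF r f] smult[OF s f]]])
        (simp add: ops val[OF f] r s smult_l_distr)
    show "(r \<otimes>\<^bsub>R\<^esub> s) \<odot>\<^bsub>?H\<^esub> f = r \<odot>\<^bsub>?H\<^esub> (s \<odot>\<^bsub>?H\<^esub> f)" if s: "s \<in> carrier R" for s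
      by (rule hom_module_eqI[OF smult[OF R.m_closed[OF r s] f] smult[OF r smult[OF s f]]])
        (simp add: ops val[OF f] r s smult_assoc1)
    show "r \<odot>\<^bsub>?H\<^esub> (f \<oplus>\<^bsub>?H\<^esub> g) = r \<odot>\<^bsub>?H\<^esub> f \<oplus>\<^bsub>?H\<^esub> r \<odot>\<^bsub>?H\<^esub> g" if g: "g \<in> carrier ?H" for g
      by (rule hom_module_eqI[OF smult[OF r add[OF f g]] add[OF smult[OF r f] smult[OF r g]]])
        (simp add: ops val[OF f] val[OF g] r smult_r_distr)
  next
    fix f assume f: "f \<in> carrier ?H"
    show "\<one>\<^bsub>R\<^esub> \<odot>\<^bsub>?H\<^esub> f = f"
      by (rule hom_module_eqI[OF smult[OF R.one_closed f] f]) (simp add: ops val[OF f])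
  qed
qed

lemma hom_free_expand:
  assumes "\<phi> \<in> carrier (hom_module R (fin_free R p) M)" "u \<in> carrier (fin_free R p)"
  shows "\<phi> u = (\<Oplus>\<^bsub>M\<^esub>a\<in>{..<p}. u a \<odot>\<^bsub>M\<^esub> \<phi> (basis_vec R a))"
  by (rule R.module_hom_expand[OF module_axioms, where B = "{..<p}", OF _ _ _ assms(2)]) (use assms(1) in \<open>simp_all add: hom_module_simps\<close>)

lemma hom_free_eqI:
  assumes "\<phi> \<in> carrier (hom_module R (fin_free R p) M)" "\<psi> \<in> carrier (hom_module R (fin_free R p) M)"
    and "\<And>a. a < p \<Longrightarrow> \<phi> (basis_vec R a) = \<psi> (basis_vec R a)"
  shows "\<phi> = \<psi>"
  by (rule hom_module_eqI[OF assms(1,2)], rule R.module_hom_eqI[OF module_axioms, where J = "{..<p}" and B = "{..<p}"])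
    (use assms in \<open>simp_all add: hom_module_simps\<close>)

lemma hom_free_of:
  assumes y: "y \<in> {..<p} \<rightarrow> carrier M"
  obtains \<phi> where "\<phi> \<in> carrier (hom_module R (fin_free R p) M)" "\<And>a. a < p \<Longrightarrow> \<phi> (basis_vec R a) = y a"
proof -
  let ?f = "\<lambda>u. \<Oplus>\<^bsub>M\<^esub>a\<in>{..<p}. u a \<odot>\<^bsub>M\<^esub> y a"
  have "?f \<in> module_hom R (fin_free R p) M"
    by (rule R.module_hom_free[OF module_axioms]) (use y in auto)
  then have "restrict ?f (carrier (fin_free R p)) \<in> carrier (hom_module R (fin_free R p) M)"
    by (rule hom_module_restrict[OF R.free_module_is_module])
  moreover have "restrict ?f (carrier (fin_free R p)) (basis_vec R a) = y a" if "a < p" for a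
  proof -
    have "?f (basis_vec R a) = y a"
      by (rule R.module_hom_free_basis[OF module_axioms]) (use y that in auto)
    then show ?thesis using that by (simp add: R.basis_vec_carrier)
  qed
  ultimately show thesis by (rule that)
qed

lemma hom_compose_mem:
  assumes d: "d \<in> module_hom R (fin_free R q) (fin_free R p)"
    and \<phi>: "\<phi> \<in> carrier (hom_module R (fin_free R p) M)"
  shows "compose (carrier (fin_free R q)) \<phi> d \<in> carrier (hom_module R (fin_free R q) M)"
proof -
  have "\<phi> \<in> module_hom R (fin_free R p) M" using \<phi> by (simp add: hom_module_simps)
  from module_hom_comp[OF d this] show ?thesis
    unfolding compose_def by (rule hom_module_restrict[OF R.free_module_is_module])
qed

lemma hom_compose_basis:
  assumes d: "d \<in> module_hom R (fin_free R q) (fin_free R p)"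
    and \<phi>: "\<phi> \<in> carrier (hom_module R (fin_free R p) M)" and x: "x < q"
  shows "compose (carrier (fin_free R q)) \<phi> d (basis_vec R x) =
    (\<Oplus>\<^bsub>M\<^esub>a\<in>{..<p}. d (basis_vec R x) a \<odot>\<^bsub>M\<^esub> \<phi> (basis_vec R a))"
proof -
  have b: "basis_vec R x \<in> carrier (fin_free R q)" using x by (simp add: R.basis_vec_carrier)
  show ?thesis
    unfolding compose_eq[OF b] by (rule hom_free_expand[OF \<phi> module_hom_closed[OF d b]])
qed

text \<open>Values on the basis identify homomorphisms from \<open>R^p\<close> to \<open>M\<close>
  with \<open>M^p\<close>. Composition with a map then becomes the transposed matrix, and the order
  of the two maps is reversed.\<close>

lemma hom_cohomology_zero_iff:
  fixes p q r :: nat and d0 d1 :: "(nat \<Rightarrow> 'a) \<Rightarrow> nat \<Rightarrow> 'a"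
  defines "C \<equiv> \<lambda>p. hom_module R (fin_free R p) M"
  defines "D0 \<equiv> \<lambda>\<phi>. compose (carrier (fin_free R q)) \<phi> d0"
    and "D1 \<equiv> \<lambda>\<phi>. compose (carrier (fin_free R r)) \<phi> d1"
  assumes d0: "d0 \<in> module_hom R (fin_free R q) (fin_free R p)"
    and d1: "d1 \<in> module_hom R (fin_free R r) (fin_free R q)"
    and A: "\<And>a x. x < q \<Longrightarrow> A a x = d0 (basis_vec R x) a"
    and B: "\<And>a x. x < r \<Longrightarrow> B a x = d1 (basis_vec R x) a"
  shows "zero_module (quotient_module (C q\<lparr>carrier := a_kernel (C q) (C r) D1\<rparr>) (D0 ` carrier (C p))) \<longleftrightarrow>
    mat_exact R M (\<lambda>a x. B x a) r q (\<lambda>a x. A x a) p"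
proof -
  have Cm: "module R (C p)" for p unfolding C_def by (rule hom_module_is_module[OF R.free_module_is_module])
  interpret Cp: module R "C p" by (rule Cm)
  interpret Cq: module R "C q" by (rule Cm)
  interpret Cr: module R "C r" by (rule Cm)
  have D0c: "D0 \<phi> \<in> carrier (C q)" if "\<phi> \<in> carrier (C p)" for \<phi>
    using that unfolding C_def D0_def by (rule hom_compose_mem[OF d0])
  have D1c: "D1 \<phi> \<in> carrier (C r)" if "\<phi> \<in> carrier (C q)" for \<phi>
    using that unfolding C_def D1_def by (rule hom_compose_mem[OF d1])
  have D0b: "D0 \<phi> (basis_vec R x) = (\<Oplus>\<^bsub>M\<^esub>a\<in>{..<p}. A a x \<odot>\<^bsub>M\<^esub> \<phi> (basis_vec R a))"
    if "\<phi> \<in> carrier (C p)" "x < q" for \<phi> x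
    unfolding D0_def A[OF that(2)] by (rule hom_compose_basis[OF d0 that(1)[unfolded C_def] that(2)])
  have D1b: "D1 \<phi> (basis_vec R x) = (\<Oplus>\<^bsub>M\<^esub>a\<in>{..<q}. B a x \<odot>\<^bsub>M\<^esub> \<phi> (basis_vec R a))"
    if "\<phi> \<in> carrier (C q)" "x < r" for \<phi> x
    unfolding D1_def B[OF that(2)] by (rule hom_compose_basis[OF d1 that(1)[unfolded C_def] that(2)])
  have hom: "\<phi> \<in> module_hom R (fin_free R p) M" if "\<phi> \<in> carrier (C p)" for \<phi> p
    using that unfolding C_def by (simp add: hom_module_simps)
  have val: "\<phi> (basis_vec R a) \<in> carrier M" if "\<phi> \<in> carrier (C p)" "a < p" for \<phi> p a
    by (rule module_hom_closed[OF hom[OF that(1)] R.basis_vec_carrier]) (simp add: that)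
  have zb: "\<zero>\<^bsub>C p\<^esub> (basis_vec R a) = \<zero>\<^bsub>M\<^esub>" if "a < p" for p a
    unfolding C_def hom_module_simps(2) using that by (simp add: R.basis_vec_carrier)
  have Ac: "A a x \<in> carrier R" if "x \<in> {..<q}" for a x
    using A[of x a] that free_module_closed[OF module_hom_closed[OF d0 R.basis_vec_carrier[OF that]]] by simp
  have Bc: "B a x \<in> carrier R" if "x \<in> {..<r}" for a x
    using B[of x a] that free_module_closed[OF module_hom_closed[OF d1 R.basis_vec_carrier[OF that]]] by simp
  have eqI: "\<phi> = \<psi>" if "\<phi> \<in> carrier (C p)" "\<psi> \<in> carrier (C p)"
    "\<And>a. a < p \<Longrightarrow> \<phi> (basis_vec R a) = \<psi> (basis_vec R a)" for \<phi> \<psi> p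
    using that unfolding C_def by (rule hom_free_eqI)
  have D0h: "D0 \<in> module_hom R (C p) (C q)"
  proof (rule module_homI)
    have dc: "d0 u \<in> carrier (fin_free R p)" if "u \<in> carrier (fin_free R q)" for u
      by (rule module_hom_closed[OF d0 that])
    fix \<phi> assume \<phi>: "\<phi> \<in> carrier (C p)"
    show "D0 \<phi> \<in> carrier (C q)" by (rule D0c[OF \<phi>])
    show "D0 (\<phi> \<oplus>\<^bsub>C p\<^esub> \<psi>) = D0 \<phi> \<oplus>\<^bsub>C q\<^esub> D0 \<psi>" if "\<psi> \<in> carrier (C p)" for \<psi>
      unfolding D0_def C_def hom_module_simps(3) compose_def using dc by (simp add: fun_eq_iff restrict_def)
    show "D0 (s \<odot>\<^bsub>C p\<^esub> \<phi>) = s \<odot>\<^bsub>C q\<^esub> D0 \<phi>" if "s \<in> carrier R" for s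
      unfolding D0_def C_def hom_module_simps(4) compose_def using dc by (simp add: fun_eq_iff restrict_def)
  qed
  have sub: "submodule (D0 ` carrier (C p)) R (C q)"
    by (rule submod_image[OF Cm Cm D0h Cp.carrier_is_submodule])
  have D1z: "D1 \<phi> = \<zero>\<^bsub>C r\<^esub> \<longleftrightarrow> (\<forall>x<r. (\<Oplus>\<^bsub>M\<^esub>a\<in>{..<q}. B a x \<odot>\<^bsub>M\<^esub> \<phi> (basis_vec R a)) = \<zero>\<^bsub>M\<^esub>)"
    if \<phi>: "\<phi> \<in> carrier (C q)" for \<phi>
  proof
    show "\<forall>x<r. (\<Oplus>\<^bsub>M\<^esub>a\<in>{..<q}. B a x \<odot>\<^bsub>M\<^esub> \<phi> (basis_vec R a)) = \<zero>\<^bsub>M\<^esub>" if "D1 \<phi> = \<zero>\<^bsub>C r\<^esub>"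
      using D1b[OF \<phi>] that zb by simp
    show "D1 \<phi> = \<zero>\<^bsub>C r\<^esub>" if "\<forall>x<r. (\<Oplus>\<^bsub>M\<^esub>a\<in>{..<q}. B a x \<odot>\<^bsub>M\<^esub> \<phi> (basis_vec R a)) = \<zero>\<^bsub>M\<^esub>"
      by (rule eqI[OF D1c[OF \<phi>] Cr.zero_closed]) (simp add: D1b[OF \<phi>] that zb)
  qed
  have ker: "a_kernel (C q) (C r) D1 \<subseteq> carrier (C q)" by (auto simp: a_kernel_iff)
  have "(\<Oplus>\<^bsub>M\<^esub>a\<in>{..<q}. B a x \<odot>\<^bsub>M\<^esub> \<zero>\<^bsub>C q\<^esub> (basis_vec R a)) = \<zero>\<^bsub>M\<^esub>" if "x < r" for x
  proof -
    have "(\<Oplus>\<^bsub>M\<^esub>a\<in>{..<q}. B a x \<odot>\<^bsub>M\<^esub> \<zero>\<^bsub>C q\<^esub> (basis_vec R a)) = (\<Oplus>\<^bsub>M\<^esub>a\<in>{..<q}. \<zero>\<^bsub>M\<^esub>)"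
      using Bc that by (intro M.finsum_cong') (simp_all add: zb)
    then show ?thesis by simp
  qed
  then have ker0: "\<zero>\<^bsub>C q\<^esub> \<in> a_kernel (C q) (C r) D1"
    by (simp add: a_kernel_iff D1z)
  have "a_kernel (C q) (C r) D1 \<subseteq> D0 ` carrier (C p) \<longleftrightarrow> mat_exact R M (\<lambda>a x. B x a) r q (\<lambda>a x. A x a) p"
  proof
    assume le: "a_kernel (C q) (C r) D1 \<subseteq> D0 ` carrier (C p)"
    show "mat_exact R M (\<lambda>a x. B x a) r q (\<lambda>a x. A x a) p"
      unfolding mat_exact_def
    proof (intro ballI impI)
      fix y assume y: "y \<in> {..<q} \<rightarrow> carrier M"
        and By: "\<forall>a<r. (\<Oplus>\<^bsub>M\<^esub>x\<in>{..<q}. B x a \<odot>\<^bsub>M\<^esub> y x) = \<zero>\<^bsub>M\<^esub>"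
      obtain \<phi> where \<phi>: "\<phi> \<in> carrier (C q)" "\<And>a. a < q \<Longrightarrow> \<phi> (basis_vec R a) = y a"
        unfolding C_def using hom_free_of[OF y] by blast
      have "(\<Oplus>\<^bsub>M\<^esub>x\<in>{..<q}. B x a \<odot>\<^bsub>M\<^esub> \<phi> (basis_vec R x)) = (\<Oplus>\<^bsub>M\<^esub>x\<in>{..<q}. B x a \<odot>\<^bsub>M\<^esub> y x)" if "a < r" for a
        using y Bc that by (intro M.finsum_cong') (auto simp: \<phi>(2))
      then have "\<phi> \<in> D0 ` carrier (C p)" using le D1z[OF \<phi>(1)] By \<phi>(1) by (auto simp: a_kernel_iff)
      then obtain \<psi> where \<psi>: "\<psi> \<in> carrier (C p)" "\<phi> = D0 \<psi>" by blast
      have "y x = (\<Oplus>\<^bsub>M\<^esub>w\<in>{..<p}. A w x \<odot>\<^bsub>M\<^esub> \<psi> (basis_vec R w))" if "x < q" for x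
        using \<phi>(2)[OF that] D0b[OF \<psi>(1) that] \<psi>(2) by simp
      then show "\<exists>z\<in>{..<p} \<rightarrow> carrier M. \<forall>x<q. y x = (\<Oplus>\<^bsub>M\<^esub>w\<in>{..<p}. A w x \<odot>\<^bsub>M\<^esub> z w)"
        using val[OF \<psi>(1)] by (intro bexI[of _ "\<lambda>w. \<psi> (basis_vec R w)"]) auto
    qed
  next
    assume ex: "mat_exact R M (\<lambda>a x. B x a) r q (\<lambda>a x. A x a) p"
    show "a_kernel (C q) (C r) D1 \<subseteq> D0 ` carrier (C p)"
    proof
      fix \<phi> assume "\<phi> \<in> a_kernel (C q) (C r) D1"
      then have \<phi>: "\<phi> \<in> carrier (C q)" "D1 \<phi> = \<zero>\<^bsub>C r\<^esub>" by (auto simp: a_kernel_iff)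
      have y: "(\<lambda>a. \<phi> (basis_vec R a)) \<in> {..<q} \<rightarrow> carrier M" using val[OF \<phi>(1)] by blast
      obtain z where z: "z \<in> {..<p} \<rightarrow> carrier M"
        "\<forall>x<q. \<phi> (basis_vec R x) = (\<Oplus>\<^bsub>M\<^esub>w\<in>{..<p}. A w x \<odot>\<^bsub>M\<^esub> z w)"
        using ex[unfolded mat_exact_def, THEN bspec, OF y] D1z[OF \<phi>(1)] \<phi>(2) by auto
      obtain \<psi> where \<psi>: "\<psi> \<in> carrier (C p)" "\<And>a. a < p \<Longrightarrow> \<psi> (basis_vec R a) = z a"
        unfolding C_def using hom_free_of[OF z(1)] by blast
      have "\<phi> = D0 \<psi>"
      proof (rule eqI[OF \<phi>(1) D0c[OF \<psi>(1)]])
        fix a assume a: "a < q"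
        have "(\<Oplus>\<^bsub>M\<^esub>x\<in>{..<p}. A x a \<odot>\<^bsub>M\<^esub> \<psi> (basis_vec R x)) = (\<Oplus>\<^bsub>M\<^esub>x\<in>{..<p}. A x a \<odot>\<^bsub>M\<^esub> z x)"
          using z(1) Ac a by (intro M.finsum_cong') (auto simp: \<psi>(2))
        then show "\<phi> (basis_vec R a) = D0 \<psi> (basis_vec R a)"
          unfolding D0b[OF \<psi>(1) a] using z(2) a by simp
      qed
      then show "\<phi> \<in> D0 ` carrier (C p)" using \<psi>(1) by blast
    qed
  qed
  then show ?thesis using Cq.zero_quotient_iff[OF sub ker ker0] by simp
qed

end

section \<open>Matrix exactness over a module given by a presentation\<close>

lemma (in module) finsum_submodule:
  assumes H: "submodule H R M" and c: "c \<in> J \<rightarrow> H"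
  shows "(\<Oplus>\<^bsub>M\<lparr>carrier := H\<rparr>\<^esub>j\<in>J. c j) = (\<Oplus>\<^bsub>M\<^esub>j\<in>J. c j)"
proof -
  interpret S: module R "M\<lparr>carrier := H\<rparr>" by (rule submod_module[OF H])
  note H' = submodD(1)[OF H]
  show ?thesis
    using c
  proof (induct J rule: infinite_finite_induct)
    case (insert j J)
    then have "c \<in> J \<rightarrow> H" "c j \<in> H" "c \<in> J \<rightarrow> carrier M" "c j \<in> carrier M" using H' by auto
    then show ?case using insert by simp
  qed simp_all
qed

context cring
begin

lemma row_power_iff:
  assumes V: "V \<subseteq> Fr {..<c::nat}"
  shows "u \<in> row_power V p \<longleftrightarrow> u \<in> Fr ({..<p} \<times> {..<c}) \<and> (\<forall>a<p. (\<lambda>b. u (a, b)) \<in> V)"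
proof -
  have "u (a, b) = \<zero>" if "u \<in> Fr ({..<p} \<times> {..<c})" "a \<ge> p" for a b
    using free_module_eq_zero[OF that(1), of "(a, b)"] that(2) by simp
  moreover have "u \<in> Fr ({..<p} \<times> {..<c})" if "u \<in> row_power V p"
    using row_power_mono[OF V] that unfolding row_power_Fr by blast
  ultimately show ?thesis unfolding row_power_def using free_module_UNIV[of u] by blast
qed

text \<open>Tuples over \<open>Q\<close> are represented by arrays with rows in \<open>V\<close>,
  and \<open>\<rho>\<close> commutes with left multiplication since the latter only combines rows.
  This serves both \<open>Tor\<close>, with \<open>V\<close> free and \<open>\<rho>\<close> the
  augmentation, and \<open>Ext\<close>, with \<open>V\<close> a model of the dual.\<close>

lemma mat_exact_iff:
  fixes V :: "(nat \<Rightarrow> 'a) set"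
  assumes Q: "module R Q" and V: "submodule V R E" "V \<subseteq> Fr {..<c}"
    and \<rho>: "\<rho> \<in> module_hom R (E\<lparr>carrier := V\<rparr>) Q" "\<rho> ` V = carrier Q"
    and A: "\<And>a b. A a b \<in> carrier R" and B: "\<And>a b. B a b \<in> carrier R"
  shows "mat_exact R Q A p q B r \<longleftrightarrow>
    (\<forall>u\<in>row_power V q. (\<forall>a<p. \<rho> (\<lambda>b. mat_op2 A p q c u (a, b)) = \<zero>\<^bsub>Q\<^esub>) \<longrightarrow>
      (\<exists>s\<in>row_power V r. \<forall>x<q. \<rho> (\<lambda>b. u (x, b)) = \<rho> (\<lambda>b. mat_op2 B q r c s (x, b))))"
proof -
  let ?E = "free_module R (UNIV :: nat set)"
  interpret E: module R ?E by (rule free_module_is_module)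
  interpret Q: module R Q by fact
  have Vm: "module R (?E\<lparr>carrier := V\<rparr>)" by (rule E.submod_module[OF V(1)])
  have row: "(\<lambda>b. u (a, b)) \<in> V" if "u \<in> row_power V q" "a < q" for u a q
    using that unfolding row_power_def by blast
  have \<rho>c: "\<rho> v \<in> carrier Q" if "v \<in> V" for v using \<rho>(2) that by blast
  have ev: "\<rho> (\<lambda>b. mat_op2 C p q c u (a, b)) = (\<Oplus>\<^bsub>Q\<^esub>x\<in>{..<q}. C a x \<odot>\<^bsub>Q\<^esub> \<rho> (\<lambda>b. u (x, b)))"
    if C: "\<And>a b. C a b \<in> carrier R" and u: "u \<in> row_power V q" and a: "a < p" for C p q u a
  proof -
    have uF: "u \<in> Fr ({..<q} \<times> {..<c})" using u unfolding row_power_iff[OF V(2)] by blast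
    have cl: "(\<lambda>x. C a x \<odot>\<^bsub>?E\<^esub> (\<lambda>b. u (x, b))) \<in> {..<q} \<rightarrow> V"
      by (rule Pi_I, rule E.submodD(5)[OF V(1) C row[OF u]]) simp
    have "\<rho> (\<lambda>b. mat_op2 C p q c u (a, b)) = \<rho> (\<Oplus>\<^bsub>?E\<lparr>carrier := V\<rparr>\<^esub>x\<in>{..<q}. C a x \<odot>\<^bsub>?E\<^esub> (\<lambda>b. u (x, b)))"
      unfolding mat_op2_row[of C, OF C uF a] E.finsum_submodule[OF V(1) cl] ..
    also have "\<dots> = (\<Oplus>\<^bsub>Q\<^esub>x\<in>{..<q}. \<rho> (C a x \<odot>\<^bsub>?E\<^esub> (\<lambda>b. u (x, b))))"
      by (rule module_hom_finsum[OF Vm Q \<rho>(1)]) (use cl in simp)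
    also have "\<dots> = (\<Oplus>\<^bsub>Q\<^esub>x\<in>{..<q}. C a x \<odot>\<^bsub>Q\<^esub> \<rho> (\<lambda>b. u (x, b)))"
    proof (rule Q.finsum_cong'[OF refl])
      show "(\<lambda>x. C a x \<odot>\<^bsub>Q\<^esub> \<rho> (\<lambda>b. u (x, b))) \<in> {..<q} \<rightarrow> carrier Q"
        using C \<rho>c row[OF u] by simp
      fix x assume "x \<in> {..<q}"
      then show "\<rho> (C a x \<odot>\<^bsub>?E\<^esub> (\<lambda>b. u (x, b))) = C a x \<odot>\<^bsub>Q\<^esub> \<rho> (\<lambda>b. u (x, b))"
        using module_hom_smult[OF \<rho>(1) C] row[OF u] by simp
    qed
    finally show ?thesis .
  qed
  have lift: "\<exists>u\<in>row_power V q. \<forall>x<q. \<rho> (\<lambda>b. u (x, b)) = y x" if y: "y \<in> {..<q} \<rightarrow> carrier Q" for y q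
  proof -
    have "\<exists>v\<in>V. \<rho> v = y x" if x: "x < q" for x
    proof -
      have "y x \<in> \<rho> ` V" using y x \<rho>(2) by auto
      then obtain v where "v \<in> V" "y x = \<rho> v" by (rule imageE)
      then show ?thesis by (intro bexI[of _ v]) simp_all
    qed
    then obtain v where v: "\<And>x. x < q \<Longrightarrow> v x \<in> V" "\<And>x. x < q \<Longrightarrow> \<rho> (v x) = y x" by metis
    define u where "u = (\<lambda>(x, b). if x < q then v x b else \<zero>)"
    have r: "(\<lambda>b. u (x, b)) = v x" if "x < q" for x using that unfolding u_def by simp
    have vF: "v x \<in> Fr {..<c}" if "x < q" for x using v(1)[OF that] V(2) by blast
    have "u \<in> Fr ({..<q} \<times> {..<c})"
      unfolding free_module_carrier_finite[OF finite_cartesian_product[OF finite_lessThan finite_lessThan]] u_def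
      using free_module_closed[OF vF] free_module_eq_zero[OF vF] by auto
    then have "u \<in> row_power V q" unfolding row_power_iff[OF V(2)] using r v(1) by simp
    then show ?thesis using r v(2) by (intro bexI[of _ u]) simp_all
  qed
  show ?thesis
  proof
    assume ex: "mat_exact R Q A p q B r"
    show "\<forall>u\<in>row_power V q. (\<forall>a<p. \<rho> (\<lambda>b. mat_op2 A p q c u (a, b)) = \<zero>\<^bsub>Q\<^esub>) \<longrightarrow>
      (\<exists>s\<in>row_power V r. \<forall>x<q. \<rho> (\<lambda>b. u (x, b)) = \<rho> (\<lambda>b. mat_op2 B q r c s (x, b)))"
    proof (intro ballI impI)
      fix u assume u: "u \<in> row_power V q" and Au: "\<forall>a<p. \<rho> (\<lambda>b. mat_op2 A p q c u (a, b)) = \<zero>\<^bsub>Q\<^esub>"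
      have y: "(\<lambda>x. \<rho> (\<lambda>b. u (x, b))) \<in> {..<q} \<rightarrow> carrier Q" using \<rho>c row[OF u] by simp
      have "\<forall>a<p. (\<Oplus>\<^bsub>Q\<^esub>x\<in>{..<q}. A a x \<odot>\<^bsub>Q\<^esub> \<rho> (\<lambda>b. u (x, b))) = \<zero>\<^bsub>Q\<^esub>"
        using Au ev[of A, OF A u] by simp
      then obtain z where z: "z \<in> {..<r} \<rightarrow> carrier Q"
        "\<forall>x<q. \<rho> (\<lambda>b. u (x, b)) = (\<Oplus>\<^bsub>Q\<^esub>w\<in>{..<r}. B x w \<odot>\<^bsub>Q\<^esub> z w)"
        using ex[unfolded mat_exact_def, THEN bspec, OF y] by auto
      obtain s where s: "s \<in> row_power V r" "\<forall>x<r. \<rho> (\<lambda>b. s (x, b)) = z x" using lift[OF z(1)] by blast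
      have "\<rho> (\<lambda>b. u (x, b)) = \<rho> (\<lambda>b. mat_op2 B q r c s (x, b))" if x: "x < q" for x
      proof -
        have "(\<Oplus>\<^bsub>Q\<^esub>w\<in>{..<r}. B x w \<odot>\<^bsub>Q\<^esub> \<rho> (\<lambda>b. s (w, b))) = (\<Oplus>\<^bsub>Q\<^esub>w\<in>{..<r}. B x w \<odot>\<^bsub>Q\<^esub> z w)"
          using s(2) z(1) B by (intro Q.finsum_cong') auto
        then show ?thesis using z(2) x ev[of B, OF B s(1) x] by simp
      qed
      then show "\<exists>s\<in>row_power V r. \<forall>x<q. \<rho> (\<lambda>b. u (x, b)) = \<rho> (\<lambda>b. mat_op2 B q r c s (x, b))"
        using s(1) by blast
    qed
  next
    assume ex: "\<forall>u\<in>row_power V q. (\<forall>a<p. \<rho> (\<lambda>b. mat_op2 A p q c u (a, b)) = \<zero>\<^bsub>Q\<^esub>) \<longrightarrow>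
      (\<exists>s\<in>row_power V r. \<forall>x<q. \<rho> (\<lambda>b. u (x, b)) = \<rho> (\<lambda>b. mat_op2 B q r c s (x, b)))"
    show "mat_exact R Q A p q B r"
      unfolding mat_exact_def
    proof (intro ballI impI)
      fix y assume y: "y \<in> {..<q} \<rightarrow> carrier Q"
        and Ay: "\<forall>a<p. (\<Oplus>\<^bsub>Q\<^esub>x\<in>{..<q}. A a x \<odot>\<^bsub>Q\<^esub> y x) = \<zero>\<^bsub>Q\<^esub>"
      obtain u where u: "u \<in> row_power V q" "\<forall>x<q. \<rho> (\<lambda>b. u (x, b)) = y x" using lift[OF y] by blast
      have "\<rho> (\<lambda>b. mat_op2 A p q c u (a, b)) = \<zero>\<^bsub>Q\<^esub>" if a: "a < p" for a
      proof -
        have "(\<Oplus>\<^bsub>Q\<^esub>x\<in>{..<q}. A a x \<odot>\<^bsub>Q\<^esub> \<rho> (\<lambda>b. u (x, b))) = (\<Oplus>\<^bsub>Q\<^esub>x\<in>{..<q}. A a x \<odot>\<^bsub>Q\<^esub> y x)"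
          using u(2) y A by (intro Q.finsum_cong') auto
        then show ?thesis using Ay a ev[of A, OF A u(1) a] by simp
      qed
      then obtain s where s: "s \<in> row_power V r"
        "\<forall>x<q. \<rho> (\<lambda>b. u (x, b)) = \<rho> (\<lambda>b. mat_op2 B q r c s (x, b))"
        using ex[THEN bspec, OF u(1)] by auto
      have "y x = (\<Oplus>\<^bsub>Q\<^esub>w\<in>{..<r}. B x w \<odot>\<^bsub>Q\<^esub> \<rho> (\<lambda>b. s (w, b)))" if "x < q" for x
        using u(2) s(2) that ev[of B, OF B s(1) that] by simp
      then show "\<exists>z\<in>{..<r} \<rightarrow> carrier Q. \<forall>x<q. y x = (\<Oplus>\<^bsub>Q\<^esub>w\<in>{..<r}. B x w \<odot>\<^bsub>Q\<^esub> z w)"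
        using \<rho>c row[OF s(1)] by (intro bexI[of _ "\<lambda>w. \<rho> (\<lambda>b. s (w, b))"]) simp_all
    qed
  qed
qed

text \<open>If \<open>N = R\<^bsup>c\<^esup>/K\<close> via \<open>\<epsilon>\<close>, then \<open>N\<^sup>*\<close> is isomorphic to the set of vectors orthogonal to \<open>K\<close>.\<close>

lemma dual_presentation:
  fixes c :: nat
  defines "V \<equiv> \<lambda>\<epsilon> z. {t \<in> Fr {..<c}. \<forall>b\<in>{u \<in> Fr {..<c}. \<epsilon> u = z}.
    pairing {..<c} t b = \<zero>}"
  assumes N: "module R N" and \<epsilon>: "\<epsilon> \<in> module_hom R E N"
    "\<epsilon> ` Fr {..<c} = carrier N"
  obtains \<rho> where "\<rho> \<in> module_hom R (E\<lparr>carrier := V \<epsilon> \<zero>\<^bsub>N\<^esub>\<rparr>) (dual_module R N)"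
    "\<rho> ` V \<epsilon> \<zero>\<^bsub>N\<^esub> = carrier (dual_module R N)" "inj_on \<rho> (V \<epsilon> \<zero>\<^bsub>N\<^esub>)"
proof -
  let ?Fr = "Fr {..<c}" and ?V = "V \<epsilon> \<zero>\<^bsub>N\<^esub>"
  interpret N: module R N by fact
  interpret E: module R "free_module R (UNIV :: nat set)" by (rule free_module_is_module)
  interpret Rm: module R "ring_module R" by (rule ring_module_is_module)
  interpret F: module R "free_module R {..<c}" by (rule free_module_is_module)
  have FE: "u \<in> carrier E" if "u \<in> ?Fr" for u by (rule free_module_UNIV[OF that])
  have sF: "submodule ?Fr R (free_module R (UNIV :: nat set))" by (rule submod_free) simp
  have VF: "t \<in> ?Fr" if "t \<in> ?V" for t using that unfolding V_def by blast
  define lift where "lift v = (SOME u. u \<in> ?Fr \<and> \<epsilon> u = v)" for v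
  have lift: "lift v \<in> ?Fr \<and> \<epsilon> (lift v) = v" if v: "v \<in> carrier N" for v
  proof -
    have "v \<in> \<epsilon> ` ?Fr" unfolding \<epsilon>(2) by (rule v)
    then obtain u where "u \<in> ?Fr" "v = \<epsilon> u" by (rule imageE)
    then have "\<exists>u. u \<in> ?Fr \<and> \<epsilon> u = v" by (intro exI[of _ u]) simp
    then show ?thesis unfolding lift_def by (rule someI_ex)
  qed
  have \<epsilon>c: "\<epsilon> u \<in> carrier N" if "u \<in> ?Fr" for u by (rule module_hom_closed[OF \<epsilon>(1) FE[OF that]])
  have ph: "pairing {..<c} t \<in> module_hom R (free_module R (UNIV :: nat set)) (ring_module R)" if "t \<in> ?Fr" for t
    by (rule pairing_hom[OF free_module_closed[OF that]])
  have pc: "pairing {..<c} t u \<in> carrier R" if "t \<in> ?Fr" "u \<in> ?Fr" for t u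
    by (rule pairing_closed) (simp_all add: free_module_closed[OF that(1)] free_module_closed[OF that(2)])
  have pcomm: "pairing {..<c} t u = pairing {..<c} u t" if "t \<in> ?Fr" "u \<in> ?Fr" for t u
    by (rule pairing_comm) (simp_all add: free_module_closed[OF that(1)] free_module_closed[OF that(2)])
  \<comment> \<open>A vector orthogonal to the kernel of \<open>\<epsilon>\<close> does not see
    which preimage is chosen.\<close>
  have pwd: "pairing {..<c} t u = pairing {..<c} t u'"
    if t: "t \<in> ?V" and u: "u \<in> ?Fr" "u' \<in> ?Fr" "\<epsilon> u = \<epsilon> u'" for t u u'
  proof -
    have d: "u \<ominus>\<^bsub>E\<^esub> u' \<in> ?Fr" by (rule E.submodD(4)[OF sF u(1,2)])
    have "\<epsilon> (u \<ominus>\<^bsub>E\<^esub> u') = \<zero>\<^bsub>N\<^esub>"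
      using module_hom_diff[OF E.module_axioms N \<epsilon>(1) FE[OF u(1)] FE[OF u(2)]] u(3) \<epsilon>c[OF u(2)]
      by (simp add: N.M.diff_self del: free_module_simps)
    then have "pairing {..<c} t (u \<ominus>\<^bsub>E\<^esub> u') = \<zero>" using t d unfolding V_def by blast
    then have "pairing {..<c} t u \<ominus> pairing {..<c} t u' = \<zero>"
      using module_hom_diff[OF E.module_axioms Rm.module_axioms ph[OF VF[OF t]] FE[OF u(1)] FE[OF u(2)]]
      by (simp add: ring_module_diff pc[OF VF[OF t]] u del: free_module_simps)
    then show ?thesis using diff_eq_zero_iff pc[OF VF[OF t]] u by simp
  qed
  define \<rho> where "\<rho> t = (\<lambda>v\<in>carrier N. pairing {..<c} t (lift v))" for t
  have \<rho>\<epsilon>: "\<rho> t (\<epsilon> u) = pairing {..<c} t u" if t: "t \<in> ?V" and u: "u \<in> ?Fr" for t u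
    unfolding \<rho>_def using pwd[OF t _ u] lift[OF \<epsilon>c[OF u]] \<epsilon>c[OF u] by simp
  have dual: "dual_module R N = hom_module R N (ring_module R)" by (rule dual_module_def)
  have eqI: "f = g" if "f \<in> carrier (dual_module R N)" "g \<in> carrier (dual_module R N)"
    "\<And>u. u \<in> ?Fr \<Longrightarrow> f (\<epsilon> u) = g (\<epsilon> u)" for f g
  proof (rule hom_module_eqI[OF that(1,2)[unfolded dual]])
    fix x assume "x \<in> carrier N"
    then have "x \<in> \<epsilon> ` ?Fr" using \<epsilon>(2) by simp
    then show "f x = g x" using that(3) by blast
  qed
  have dm: "module R (dual_module R N)" unfolding dual by (rule Rm.hom_module_is_module[OF N])
  interpret D: module R "dual_module R N" by (rule dm)
  have \<rho>c: "\<rho> t \<in> carrier (dual_module R N)" if t: "t \<in> ?V" for t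
    unfolding dual \<rho>_def
  proof (rule hom_module_restrict[OF N module_homI])
    note lc = lift[THEN conjunct1] and le = lift[THEN conjunct2]
    fix v assume v: "v \<in> carrier N"
    show "pairing {..<c} t (lift v) \<in> carrier (ring_module R)" using pc[OF VF[OF t] lc[OF v]] by simp
    show "pairing {..<c} t (lift (v \<oplus>\<^bsub>N\<^esub> w)) =
        pairing {..<c} t (lift v) \<oplus>\<^bsub>ring_module R\<^esub> pairing {..<c} t (lift w)" if w: "w \<in> carrier N" for w
    proof -
      have s: "lift v \<oplus>\<^bsub>E\<^esub> lift w \<in> ?Fr" by (rule E.submodD(3)[OF sF lc[OF v] lc[OF w]])
      have "\<epsilon> (lift v \<oplus>\<^bsub>E\<^esub> lift w) = v \<oplus>\<^bsub>N\<^esub> w"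
        unfolding module_hom_add[OF \<epsilon>(1) FE[OF lc[OF v]] FE[OF lc[OF w]]] le[OF v] le[OF w] ..
      then have "pairing {..<c} t (lift (v \<oplus>\<^bsub>N\<^esub> w)) = pairing {..<c} t (lift v \<oplus>\<^bsub>E\<^esub> lift w)"
        using v w by (intro pwd[OF t lc s]) (simp_all only: le N.a_closed)
      then show ?thesis unfolding module_hom_add[OF ph[OF VF[OF t]] FE[OF lc[OF v]] FE[OF lc[OF w]]] .
    qed
    show "pairing {..<c} t (lift (r \<odot>\<^bsub>N\<^esub> v)) = r \<odot>\<^bsub>ring_module R\<^esub> pairing {..<c} t (lift v)" if r: "r \<in> carrier R" for r
    proof -
      have s: "r \<odot>\<^bsub>E\<^esub> lift v \<in> ?Fr" by (rule E.submodD(5)[OF sF r lc[OF v]])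
      have "\<epsilon> (r \<odot>\<^bsub>E\<^esub> lift v) = r \<odot>\<^bsub>N\<^esub> v"
        unfolding module_hom_smult[OF \<epsilon>(1) r FE[OF lc[OF v]]] le[OF v] ..
      then have "pairing {..<c} t (lift (r \<odot>\<^bsub>N\<^esub> v)) = pairing {..<c} t (r \<odot>\<^bsub>E\<^esub> lift v)"
        using v r by (intro pwd[OF t lc s]) (simp_all only: le N.smult_closed)
      then show ?thesis unfolding module_hom_smult[OF ph[OF VF[OF t]] r FE[OF lc[OF v]]] .
    qed
  qed
  have Vsub: "submodule ?V R E"
  proof (rule E.submodI)
    show "?V \<subseteq> carrier E" using VF FE by blast
    show "\<zero>\<^bsub>E\<^esub> \<in> ?V"
      unfolding V_def using E.submodD(2)[OF sF] by (auto simp: pairing_zero free_module_closed)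
    fix s assume s: "s \<in> ?V"
    have sb: "pairing {..<c} b s = \<zero>" if "b \<in> ?Fr" "\<epsilon> b = \<zero>\<^bsub>N\<^esub>" for b
      using s that pcomm[OF that(1) VF[OF s]] unfolding V_def by simp
    show "s \<oplus>\<^bsub>E\<^esub> t \<in> ?V" if t: "t \<in> ?V" for t
    proof -
      have m: "s \<oplus>\<^bsub>E\<^esub> t \<in> ?Fr" by (rule E.submodD(3)[OF sF VF[OF s] VF[OF t]])
      have "pairing {..<c} (s \<oplus>\<^bsub>E\<^esub> t) b = \<zero>" if b: "b \<in> ?Fr" "\<epsilon> b = \<zero>\<^bsub>N\<^esub>" for b
      proof -
        have "pairing {..<c} b t = \<zero>" using t b pcomm[OF b(1) VF[OF t]] unfolding V_def by simp
        then show ?thesis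
          using pcomm[OF m b(1)] module_hom_add[OF ph[OF b(1)] FE[OF VF[OF s]] FE[OF VF[OF t]]] sb[OF b] by simp
      qed
      then show ?thesis unfolding V_def using m by blast
    qed
    show "r \<odot>\<^bsub>E\<^esub> s \<in> ?V" if r: "r \<in> carrier R" for r
    proof -
      have m: "r \<odot>\<^bsub>E\<^esub> s \<in> ?Fr" by (rule E.submodD(5)[OF sF r VF[OF s]])
      have "pairing {..<c} (r \<odot>\<^bsub>E\<^esub> s) b = \<zero>" if b: "b \<in> ?Fr" "\<epsilon> b = \<zero>\<^bsub>N\<^esub>" for b
        using pcomm[OF m b(1)] module_hom_smult[OF ph[OF b(1)] r FE[OF VF[OF s]]] sb[OF b] r by simp
      then show ?thesis unfolding V_def using m by blast
    qed
  qed
  have hom: "\<rho> \<in> module_hom R (E\<lparr>carrier := ?V\<rparr>) (dual_module R N)"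
  proof (rule module_homI)
    fix s assume "s \<in> carrier (E\<lparr>carrier := ?V\<rparr>)"
    then have s: "s \<in> ?V" by simp
    show "\<rho> s \<in> carrier (dual_module R N)" by (rule \<rho>c[OF s])
    show "\<rho> (s \<oplus>\<^bsub>E\<lparr>carrier := ?V\<rparr>\<^esub> t) = \<rho> s \<oplus>\<^bsub>dual_module R N\<^esub> \<rho> t"
      if "t \<in> carrier (E\<lparr>carrier := ?V\<rparr>)" for t
    proof -
      have t: "t \<in> ?V" using that by simp
      have m: "s \<oplus>\<^bsub>E\<^esub> t \<in> ?V" by (rule E.submodD(3)[OF Vsub s t])
      have "\<rho> (s \<oplus>\<^bsub>E\<^esub> t) = \<rho> s \<oplus>\<^bsub>dual_module R N\<^esub> \<rho> t"
      proof (rule eqI[OF \<rho>c[OF m] D.a_closed[OF \<rho>c[OF s] \<rho>c[OF t]]])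
        fix u assume u: "u \<in> ?Fr"
        show "\<rho> (s \<oplus>\<^bsub>E\<^esub> t) (\<epsilon> u) = (\<rho> s \<oplus>\<^bsub>dual_module R N\<^esub> \<rho> t) (\<epsilon> u)"
          using \<rho>\<epsilon>[OF m u] \<rho>\<epsilon>[OF s u] \<rho>\<epsilon>[OF t u] pcomm[OF VF[OF m] u] pcomm[OF VF[OF s] u] pcomm[OF VF[OF t] u]
            module_hom_add[OF ph[OF u] FE[OF VF[OF s]] FE[OF VF[OF t]]] \<epsilon>c[OF u]
          unfolding dual hom_module_simps by (simp del: free_module_simps)
      qed
      then show ?thesis by simp
    qed
    show "\<rho> (r \<odot>\<^bsub>E\<lparr>carrier := ?V\<rparr>\<^esub> s) = r \<odot>\<^bsub>dual_module R N\<^esub> \<rho> s" if r: "r \<in> carrier R" for r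
    proof -
      have m: "r \<odot>\<^bsub>E\<^esub> s \<in> ?V" by (rule E.submodD(5)[OF Vsub r s])
      have "\<rho> (r \<odot>\<^bsub>E\<^esub> s) = r \<odot>\<^bsub>dual_module R N\<^esub> \<rho> s"
      proof (rule eqI[OF \<rho>c[OF m] D.smult_closed[OF r \<rho>c[OF s]]])
        fix u assume u: "u \<in> ?Fr"
        show "\<rho> (r \<odot>\<^bsub>E\<^esub> s) (\<epsilon> u) = (r \<odot>\<^bsub>dual_module R N\<^esub> \<rho> s) (\<epsilon> u)"
          using \<rho>\<epsilon>[OF m u] \<rho>\<epsilon>[OF s u] pcomm[OF VF[OF m] u] pcomm[OF VF[OF s] u]
            module_hom_smult[OF ph[OF u] r FE[OF VF[OF s]]] \<epsilon>c[OF u]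
          unfolding dual hom_module_simps by (simp del: free_module_simps)
      qed
      then show ?thesis by simp
    qed
  qed
  have "\<rho> ` ?V = carrier (dual_module R N)"
  proof
    show "\<rho> ` ?V \<subseteq> carrier (dual_module R N)" using \<rho>c by blast
    show "carrier (dual_module R N) \<subseteq> \<rho> ` ?V"
    proof
      fix f assume f: "f \<in> carrier (dual_module R N)"
      then have fh: "f \<in> module_hom R N (ring_module R)" unfolding dual hom_module_simps by blast
      note f\<epsilon> = module_hom_comp[OF \<epsilon>(1) fh]
      \<comment> \<open>The coordinates of the functional on \<open>R^c\<close> that is obtained
        from \<open>f\<close> by composition with \<open>\<epsilon>\<close>.\<close>
      define t where "t b = (if b < c then f (\<epsilon> (basis_vec R b)) else \<zero>)" for b
      have be: "basis_vec R b \<in> Fr (UNIV :: nat set)" for b by (rule basis_vec_carrier) simp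
      have tc: "t b \<in> carrier R" for b using module_hom_closed[OF f\<epsilon> be[of b]] unfolding t_def by simp
      have tF: "t \<in> ?Fr" unfolding free_module_carrier_finite[OF finite_lessThan] using tc by (simp add: t_def)
      have tp: "pairing {..<c} t u = f (\<epsilon> u)" if u: "u \<in> ?Fr" for u
      proof (rule module_hom_eqI[OF Rm.module_axioms ph[OF tF] f\<epsilon> _ _ u])
        fix j assume j: "j \<in> {..<c}"
        show "pairing {..<c} t (basis_vec R j) = f (\<epsilon> (basis_vec R j))"
          using pairing_basis[of "{..<c}" t j, OF tc _ j] j by (simp add: t_def)
      qed simp_all
      have tV: "t \<in> ?V" unfolding V_def using tF tp module_hom_zero[OF N Rm.module_axioms fh] by simp
      have "\<rho> t = f" by (rule eqI[OF \<rho>c[OF tV] f]) (simp add: \<rho>\<epsilon>[OF tV] tp)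
      then show "f \<in> \<rho> ` ?V" using tV by blast
    qed
  qed
  moreover have "inj_on \<rho> ?V"
  proof (rule inj_onI)
    fix s t assume st: "s \<in> ?V" "t \<in> ?V" "\<rho> s = \<rho> t"
    show "s = t"
      by (rule pairing_eqI[OF finite_lessThan VF[OF st(1)] VF[OF st(2)]])
        (use \<rho>\<epsilon>[OF st(1)] \<rho>\<epsilon>[OF st(2)] st(3) in simp)
  qed
  ultimately show thesis using that hom by blast
qed

end

section \<open>Free resolutions\<close>

lemma (in cring) module_hom_free_restrict:
  assumes f: "f \<in> module_hom R (free_module R B) (free_module R C)"
    and sub: "B' \<subseteq> B" "f ` Fr B' \<subseteq> Fr C'"
  shows "f \<in> module_hom R (free_module R B') (free_module R C')"
proof (rule module_homI)
  have m: "u \<in> Fr B" if "u \<in> Fr B'" for u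
    using free_module_mono[OF sub(1)] that by blast
  fix u assume u: "u \<in> Fr B'"
  show "f u \<in> Fr C'" using sub(2) u by blast
  show "f (u \<oplus>\<^bsub>free_module R B'\<^esub> v) = f u \<oplus>\<^bsub>free_module R C'\<^esub> f v" if "v \<in> Fr B'" for v
    using module_hom_add[OF f m[OF u] m[OF that]] by simp
  show "f (r \<odot>\<^bsub>free_module R B'\<^esub> u) = r \<odot>\<^bsub>free_module R C'\<^esub> f u" if "r \<in> carrier R" for r
    using module_hom_smult[OF f that m[OF u]] by simp
qed

context noetherian_cring
begin

text \<open>The kernel of each map is finitely generated, so it is the image of the next one;
  dependent choice produces the sequence.\<close>

lemma free_resolution_exists:
  assumes M: "fin_gen_module R M"
  shows "\<exists>n d \<epsilon>. free_resolution R M n d \<epsilon>"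
proof -
  let ?E = "free_module R (UNIV :: nat set)" and ?Fr = "\<lambda>n :: nat. Fr {..<n}"
  interpret E: module R ?E by (rule free_module_is_module)
  have Mm: "module R M" using M unfolding fin_gen_module_def by blast
  interpret M: module R M by (rule Mm)
  obtain S where S: "finite S" "S \<subseteq> carrier M" "span_module R M S = carrier M"
    using M unfolding fin_gen_module_def by blast
  obtain n0 :: nat and \<epsilon> where \<epsilon>: "\<epsilon> \<in> module_hom R ?E M" "\<epsilon> ` ?Fr n0 = span_module R M S"
    by (rule fin_gen_presentation[OF Mm S(1,2)])
  have ker: "\<exists>n' \<phi>. \<phi> \<in> module_hom R ?E ?E \<and> \<phi> ` ?Fr n' = {u \<in> ?Fr n. f u \<in> {\<zero>\<^bsub>P\<^esub>}}"
    if "module R P" "f \<in> module_hom R ?E P" for n f and P :: "('a, 'z, 'w) module_scheme"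
  proof -
    interpret P: module R P by fact
    have sub: "submodule {u \<in> ?Fr n. f u \<in> {\<zero>\<^bsub>P\<^esub>}} R ?E"
      by (rule submod_preimage[OF free_module_is_module that(1,2) submod_free P.submod_zero]) simp
    show ?thesis by (rule submodule_presentation[OF sub, of n]) blast+
  qed
  \<comment> \<open>The state of the recursion is a triple: the rank of the target, the rank of the
    source, and the differential between them.\<close>
  define good where "good x \<longleftrightarrow> snd (snd x) \<in> module_hom R ?E ?E \<and> snd (snd x) ` ?Fr (fst (snd x)) \<subseteq> ?Fr (fst x)"
    for x :: "nat \<times> nat \<times> ((nat \<Rightarrow> 'a) \<Rightarrow> nat \<Rightarrow> 'a)"
  define ini where "ini i x \<longleftrightarrow> good x \<and> (i = 0 \<longrightarrow> fst x = n0 \<and> snd (snd x) ` ?Fr (fst (snd x)) = {u \<in> ?Fr n0. \<epsilon> u = \<zero>\<^bsub>M\<^esub>})"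
    for i :: nat and x
  define nxt where "nxt x y \<longleftrightarrow> fst y = fst (snd x) \<and>
      snd (snd y) ` ?Fr (fst (snd y)) = {u \<in> ?Fr (fst (snd x)). snd (snd x) u = \<zero>\<^bsub>?E\<^esub>}"
    for x y :: "nat \<times> nat \<times> ((nat \<Rightarrow> 'a) \<Rightarrow> nat \<Rightarrow> 'a)"
  have "\<exists>f. \<forall>i. ini i (f i) \<and> nxt (f i) (f (Suc i))"
  proof (rule dependent_nat_choice)
    obtain n1 \<phi> where "\<phi> \<in> module_hom R ?E ?E" "\<phi> ` ?Fr n1 = {u \<in> ?Fr n0. \<epsilon> u \<in> {\<zero>\<^bsub>M\<^esub>}}"
      using ker[OF Mm \<epsilon>(1)] by blast
    then show "\<exists>x. ini 0 x"
      by (intro exI[of _ "(n0, n1, \<phi>)"]) (auto simp: ini_def good_def)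
  next
    fix x i assume "ini i x"
    then have x: "snd (snd x) \<in> module_hom R ?E ?E" unfolding ini_def good_def by simp
    obtain n' \<phi> where "\<phi> \<in> module_hom R ?E ?E"
      "\<phi> ` ?Fr n' = {u \<in> ?Fr (fst (snd x)). snd (snd x) u \<in> {\<zero>\<^bsub>?E\<^esub>}}"
      using ker[OF free_module_is_module x] by blast
    then show "\<exists>y. ini (Suc i) y \<and> nxt x y"
      by (intro exI[of _ "(fst (snd x), n', \<phi>)"]) (auto simp: ini_def good_def nxt_def simp del: free_module_simps)
  qed
  then obtain f where f: "\<And>i. ini i (f i)" "\<And>i. nxt (f i) (f (Suc i))" by blast
  define n where "n i = (case i of 0 \<Rightarrow> n0 | Suc j \<Rightarrow> fst (snd (f j)))" for i
  define d where "d i = snd (snd (f i))" for i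
  have n: "fst (f i) = n i" "fst (snd (f i)) = n (Suc i)" for i
    using f(1)[of 0] f(2)[of "i - 1"] by (cases i; simp add: n_def ini_def nxt_def)+
  have dE: "d i \<in> module_hom R ?E ?E" and dF: "d i ` ?Fr (n (Suc i)) \<subseteq> ?Fr (n i)" for i
    using f(1)[of i] unfolding ini_def good_def n d_def by blast+
  have d0: "d 0 ` ?Fr (n (Suc 0)) = {u \<in> ?Fr (n 0). \<epsilon> u = \<zero>\<^bsub>M\<^esub>}"
    using f(1)[of 0] n(1)[of 0] unfolding ini_def n d_def by simp
  have dS: "d (Suc i) ` ?Fr (n (Suc (Suc i))) = {u \<in> ?Fr (n (Suc i)). d i u = \<zero>\<^bsub>?E\<^esub>}" for i
    using f(2)[of i] unfolding nxt_def n d_def by blast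
  have "free_resolution R M n d \<epsilon>"
    unfolding free_resolution_def
  proof (intro conjI allI)
    show "\<epsilon> \<in> module_hom R (fin_free R (n 0)) M"
    proof (rule module_homI)
      have m: "u \<in> carrier ?E" if "u \<in> ?Fr (n 0)" for u by (rule free_module_UNIV[OF that])
      fix u assume u: "u \<in> ?Fr (n 0)"
      show "\<epsilon> u \<in> carrier M" by (rule module_hom_closed[OF \<epsilon>(1) m[OF u]])
      show "\<epsilon> (u \<oplus>\<^bsub>fin_free R (n 0)\<^esub> v) = \<epsilon> u \<oplus>\<^bsub>M\<^esub> \<epsilon> v" if "v \<in> ?Fr (n 0)" for v
        using module_hom_add[OF \<epsilon>(1) m[OF u] m[OF that]] by simp
      show "\<epsilon> (r \<odot>\<^bsub>fin_free R (n 0)\<^esub> u) = r \<odot>\<^bsub>M\<^esub> \<epsilon> u" if "r \<in> carrier R" for r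
        using module_hom_smult[OF \<epsilon>(1) that m[OF u]] by simp
    qed
    show "d i \<in> module_hom R (fin_free R (n (Suc i))) (fin_free R (n i))" for i
      by (rule module_hom_free_restrict[OF dE _ dF]) simp
    show "\<epsilon> ` ?Fr (n 0) = carrier M" using \<epsilon>(2) S(3) n_def by simp
    show "d 0 ` ?Fr (n 1) = a_kernel (fin_free R (n 0)) M \<epsilon>"
      using d0 by (auto simp: a_kernel_iff)
    show "d (Suc i) ` ?Fr (n (Suc (Suc i))) = a_kernel (fin_free R (n (Suc i))) (fin_free R (n i)) (d i)" for i
      unfolding dS by (auto simp: a_kernel_iff)
  qed
  then show ?thesis by blast
qed

lemma some_resolution:
  assumes M: "fin_gen_module R M"
  obtains n d \<epsilon> where "some_resolution R M = (n, d)" "free_resolution R M n d \<epsilon>"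
proof -
  obtain n d where nd: "some_resolution R M = (n, d)" by (cases "some_resolution R M")
  have "\<exists>x. case x of (n, d) \<Rightarrow> \<exists>\<epsilon>. free_resolution R M n d \<epsilon>"
    using free_resolution_exists[OF M] by auto
  from someI_ex[OF this] have "\<exists>\<epsilon>. free_resolution R M n d \<epsilon>"
    using nd unfolding some_resolution_def by simp
  then show thesis using nd that by blast
qed

end

section \<open>Resolutions of maximal Cohen--Macaulay modules\<close>

text \<open>The resolution is the one singled out by \<open>some_resolution\<close>, since
  \<open>Tor_module\<close> and \<open>Ext_module\<close> are computed from it.\<close>

locale resolved_mcm = local_gorenstein R I \<delta> \<eta> k m
  for R :: "('a, 'r) ring_scheme" (structure) and I :: "nat \<Rightarrow> ('a, 'i) module" and \<delta> \<eta> k m +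
  fixes M :: "('a, 'm, 'x) module_scheme" and n d \<epsilon>
  assumes mcm: "maximal_cohen_macaulay R M"
    and some_res: "some_resolution R M = (n, d)" and res: "free_resolution R M n d \<epsilon>"
begin

lemma M_module: "module R M"
  using mcm unfolding maximal_cohen_macaulay_def fin_gen_module_def by blast

sublocale M: module R M by (rule M_module)

lemma \<epsilon>_hom: "\<epsilon> \<in> module_hom R (fin_free R (n 0)) M" and \<epsilon>_surj: "\<epsilon> ` Fr {..<n 0} = carrier M"
  and d_hom: "d j \<in> module_hom R (fin_free R (n (Suc j))) (fin_free R (n j))"
  and d_0: "d 0 ` Fr {..<n (Suc 0)} = {u \<in> Fr {..<n 0}. \<epsilon> u = \<zero>\<^bsub>M\<^esub>}"
  and d_Suc: "d (Suc j) ` Fr {..<n (Suc (Suc j))} = {u \<in> Fr {..<n (Suc j)}. d j u = \<zero>\<^bsub>E\<^esub>}"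
  using res unfolding free_resolution_def a_kernel_def' by simp_all

text \<open>The columns are the images of the basis vectors. Columns out of range are zero, because
  \<open>d j\<close> is known to have values in \<open>R\<close> on its own source only and the
  entries have to lie in \<open>R\<close> for all indices.\<close>

definition A :: "nat \<Rightarrow> nat \<Rightarrow> nat \<Rightarrow> 'a" where
  "A j a b = (if b < n (Suc j) then d j (basis_vec R b) a else \<zero>)"

lemma A_mem: "A j a b \<in> carrier R"
  using free_module_closed[OF module_hom_closed[OF d_hom basis_vec_carrier[of b "{..<n (Suc j)}"]]]
  by (simp add: A_def)

lemma mat_op_A:
  assumes u: "u \<in> Fr {..<n (Suc j)}"
  shows "mat_op (A j) (n j) (n (Suc j)) u = d j u"
proof
  fix a
  interpret Rm: module R "ring_module R" by (rule ring_module_is_module)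
  have du: "d j u \<in> Fr {..<n j}" by (rule module_hom_closed[OF d_hom u])
  show "mat_op (A j) (n j) (n (Suc j)) u a = d j u a"
  proof (cases "a < n j")
    case True
    have "d j u a = (\<Oplus>\<^bsub>ring_module R\<^esub>b\<in>{..<n (Suc j)}. u b \<odot>\<^bsub>ring_module R\<^esub> d j (basis_vec R b) a)"
      by (rule module_hom_expand[OF ring_module_is_module module_hom_comp[OF d_hom coord_hom] _ _ u]) simp_all
    also have "\<dots> = (\<Oplus>\<^bsub>ring_module R\<^esub>b\<in>{..<n (Suc j)}. A j a b \<otimes> u b)"
    proof (rule Rm.finsum_cong'[OF refl])
      show "(\<lambda>b. A j a b \<otimes> u b) \<in> {..<n (Suc j)} \<rightarrow> carrier (ring_module R)"
        using A_mem free_module_closed[OF u] by simp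
      fix b assume "b \<in> {..<n (Suc j)}"
      then show "u b \<odot>\<^bsub>ring_module R\<^esub> d j (basis_vec R b) a = A j a b \<otimes> u b"
        using A_mem[of j a b] free_module_closed[OF u] m_comm by (simp add: A_def)
    qed
    also have "\<dots> = (\<Oplus>b\<in>{..<n (Suc j)}. A j a b \<otimes> u b)"
      by (rule ring_module_finsum) (use A_mem free_module_closed[OF u] in auto)
    finally show ?thesis using True by (simp add: mat_op_def pairing_def)
  next
    case False
    then show ?thesis using free_module_eq_zero[OF du, of a] by (simp add: mat_op_def)
  qed
qed

lemma image_mat_op_A: "mat_op (A j) (n j) (n (Suc j)) ` Fr {..<n (Suc j)} = d j ` Fr {..<n (Suc j)}"
  by (rule image_cong[OF refl mat_op_A])

sublocale free_complex R I \<delta> \<eta> k A n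
proof (intro free_complex.intro finite_inj_res_axioms free_complex_axioms.intro A_mem)
  fix j u assume u: "u \<in> Fr {..<n (Suc (Suc j))}"
  have "d (Suc j) u \<in> {u \<in> Fr {..<n (Suc j)}. d j u = \<zero>\<^bsub>E\<^esub>}" unfolding d_Suc[symmetric] using u by blast
  then show "mat_op (A j) (n j) (n (Suc j)) (mat_op (A (Suc j)) (n (Suc j)) (n (Suc (Suc j))) u) = (\<lambda>_. \<zero>)"
    unfolding mat_op_A[OF u] using mat_op_A[of "d (Suc j) u" j] by simp
qed

lemma D_exact: "u \<in> Fr {..<n (Suc j)} \<Longrightarrow> D j u = \<zero>\<^bsub>E\<^esub> \<Longrightarrow> u \<in> D (Suc j) ` Fr {..<n (Suc (Suc j))}"
  unfolding image_mat_op_A d_Suc using mat_op_A by simp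

lemma D_0: "D 0 ` Fr {..<n (Suc 0)} = {u \<in> Fr {..<n 0}. \<epsilon> u = \<zero>\<^bsub>M\<^esub>}"
  unfolding image_mat_op_A d_0 ..

lemma D_ext: "ext_zero (Fr {..<n 0}) (D 0 ` Fr {..<n (Suc 0)}) l"
  unfolding D_0 by (rule ext_zero_mcm[OF mcm \<epsilon>_hom \<epsilon>_surj])

lemma Tor_zero_iff:
  assumes N: "module R N"
  shows "zero_module (Tor_module R (Suc j) M N) \<longleftrightarrow>
    mat_exact R N (A j) (n j) (n (Suc j)) (A (Suc j)) (n (Suc (Suc j)))"
  unfolding Tor_module_def some_res Let_def prod.case nat.case
  by (rule module.tensor_homology_zero_iff[OF N d_hom d_hom]) (simp_all add: A_def)

lemma Ext_zero_iff:
  assumes P: "module R P"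
  shows "zero_module (Ext_module R (Suc j) M P) \<longleftrightarrow>
    mat_exact R P (\<lambda>a b. A (Suc j) b a) (n (Suc (Suc j))) (n (Suc j)) (\<lambda>a b. A j b a) (n j)"
  unfolding Ext_module_def some_res Let_def prod.case nat.case
  by (rule module.hom_cohomology_zero_iff[OF P d_hom d_hom]) (simp_all add: A_def)

end

context free_complex
begin

text \<open>Applying \<open>\<epsilon>\<close> to rows identifies the terms of the complex with
  powers of \<open>N\<close>; two arrays have the same image exactly if their difference has rows in
  \<open>K\<close>.\<close>

lemma exact_iff_mat_exact:
  fixes c :: nat and N :: "('a, 'n, 'y) module_scheme" and \<epsilon> :: "(nat \<Rightarrow> 'a) \<Rightarrow> 'n"
  defines "K \<equiv> {u \<in> Fr {..<c}. \<epsilon> u = \<zero>\<^bsub>N\<^esub>}"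
  assumes N: "module R N" and \<epsilon>: "\<epsilon> \<in> module_hom R E N" "\<epsilon> ` Fr {..<c} = carrier N"
  shows "dual_complex.exact R (\<lambda>j. {..<n j} \<times> {..<c}) (D2 c) (\<lambda>j. row_power K (n j)) j \<longleftrightarrow>
    mat_exact R N (A j) (n j) (n (Suc j)) (A (Suc j)) (n (Suc (Suc j)))"
proof -
  interpret N: module R N by fact
  interpret E: module R "E :: ('a, nat \<Rightarrow> 'a) module" by (rule E_module)
  interpret E2: module R "E :: ('a, nat \<times> nat \<Rightarrow> 'a) module" by (rule E_module)
  have K: "submodule K R E" "K \<subseteq> Fr {..<c}"
    using submod_preimage[OF E_module N \<epsilon>(1) Fr_submodule N.submod_zero, of "{..<c}"] unfolding K_def by auto
  interpret W: dual_complex R I \<delta> \<eta> k "\<lambda>j. {..<n j} \<times> {..<c}" "D2 c" "Dt2 c" "\<lambda>j. row_power K (n j)"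
    by (rule coeff_complex[OF K])
  have \<epsilon>F: "\<epsilon> \<in> module_hom R (E\<lparr>carrier := Fr {..<c}\<rparr>) N"
    by (rule module_homI)
      (simp_all add: module_hom_closed[OF \<epsilon>(1)] module_hom_add[OF \<epsilon>(1)] module_hom_smult[OF \<epsilon>(1)] free_module_UNIV
        del: free_module_simps)
  have rF: "(\<lambda>b. u (a, b)) \<in> Fr {..<c}" if "u \<in> W.T j" for u a j by (rule row_mem[OF that])
  have rE: "(\<lambda>b. u (a, b)) \<in> carrier E" if "u \<in> W.T j" for u a j by (rule free_module_UNIV[OF rF[OF that]])
  have inK: "u \<in> row_power K (n j) \<longleftrightarrow> (\<forall>a<n j. \<epsilon> (\<lambda>b. u (a, b)) = \<zero>\<^bsub>N\<^esub>)" if u: "u \<in> W.T j" for u j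
    unfolding row_power_iff[OF K(2)] using u rF[OF u] by (simp add: K_def)
  have bound: "u \<in> W.bound (Suc j) \<longleftrightarrow>
      (\<exists>s\<in>W.T (Suc (Suc j)). \<forall>x<n (Suc j). \<epsilon> (\<lambda>b. u (x, b)) = \<epsilon> (\<lambda>b. D2 c (Suc j) s (x, b)))"
    if u: "u \<in> W.T (Suc j)" for u
  proof -
    have uE: "u \<in> carrier E" by (rule free_module_UNIV[OF u])
    have key: "u \<ominus>\<^bsub>E\<^esub> v \<in> row_power K (n (Suc j)) \<longleftrightarrow> (\<forall>x<n (Suc j). \<epsilon> (\<lambda>b. u (x, b)) = \<epsilon> (\<lambda>b. v (x, b)))"
      if v: "v \<in> W.T (Suc j)" for v
    proof -
      have vE: "v \<in> carrier E" by (rule free_module_UNIV[OF v])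
      have dT: "u \<ominus>\<^bsub>E\<^esub> v \<in> W.T (Suc j)" by (rule E2.submodD(4)[OF Fr_submodule u v])
      have "\<epsilon> (\<lambda>b. (u \<ominus>\<^bsub>E\<^esub> v) (x, b)) = \<epsilon> (\<lambda>b. u (x, b)) \<ominus>\<^bsub>N\<^esub> \<epsilon> (\<lambda>b. v (x, b))" for x
        by (rule module_hom_diff[OF E_module N module_hom_comp[OF row_hom \<epsilon>(1)] uE vE])
      then show ?thesis
        unfolding inK[OF dT]
        using N.M.diff_eq_zero_iff module_hom_closed[OF \<epsilon>(1) rE[OF u]] module_hom_closed[OF \<epsilon>(1) rE[OF v]]
        by simp
    qed
    show ?thesis
    proof
      assume "u \<in> W.bound (Suc j)"
      then obtain s w where s: "s \<in> W.T (Suc (Suc j))" and w: "w \<in> row_power K (n (Suc j))"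
        and e: "u = D2 c (Suc j) s \<oplus>\<^bsub>E\<^esub> w"
        unfolding W.bound_def by blast
      have wE: "w \<in> carrier E" using w E2.submodD(1)[OF W.K_sub] by blast
      have "u \<ominus>\<^bsub>E\<^esub> D2 c (Suc j) s = w"
        by (rule E2.M.diff_eqI[OF e free_module_UNIV[OF W.\<phi>_mem[OF s]] wE])
      then show "\<exists>s\<in>W.T (Suc (Suc j)). \<forall>x<n (Suc j). \<epsilon> (\<lambda>b. u (x, b)) = \<epsilon> (\<lambda>b. D2 c (Suc j) s (x, b))"
        using key[OF W.\<phi>_mem[OF s]] w s by auto
    next
      assume "\<exists>s\<in>W.T (Suc (Suc j)). \<forall>x<n (Suc j). \<epsilon> (\<lambda>b. u (x, b)) = \<epsilon> (\<lambda>b. D2 c (Suc j) s (x, b))"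
      then obtain s where s: "s \<in> W.T (Suc (Suc j))"
        "\<forall>x<n (Suc j). \<epsilon> (\<lambda>b. u (x, b)) = \<epsilon> (\<lambda>b. D2 c (Suc j) s (x, b))" by blast
      note sE = free_module_UNIV[OF W.\<phi>_mem[OF s(1)]]
      have "u \<ominus>\<^bsub>E\<^esub> D2 c (Suc j) s \<in> row_power K (n (Suc j))" using key[OF W.\<phi>_mem[OF s(1)]] s(2) by blast
      moreover have "u = D2 c (Suc j) s \<oplus>\<^bsub>E\<^esub> (u \<ominus>\<^bsub>E\<^esub> D2 c (Suc j) s)"
        by (rule E2.M.add_diff_cancel[OF uE sE, symmetric])
      ultimately show "u \<in> W.bound (Suc j)" unfolding W.bound_def using s(1) by blast
    qed
  qed
  have T: "row_power (Fr {..<c}) (n j) = W.T j" for j by (rule row_power_Fr)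
  have "W.exact j \<longleftrightarrow> (\<forall>u\<in>row_power (Fr {..<c}) (n (Suc j)). (\<forall>a<n j. \<epsilon> (\<lambda>b. D2 c j u (a, b)) = \<zero>\<^bsub>N\<^esub>) \<longrightarrow>
      (\<exists>s\<in>row_power (Fr {..<c}) (n (Suc (Suc j))). \<forall>x<n (Suc j). \<epsilon> (\<lambda>b. u (x, b)) = \<epsilon> (\<lambda>b. D2 c (Suc j) s (x, b))))"
    unfolding W.exact_def T
  proof (rule ball_cong[OF refl])
    fix u assume u: "u \<in> W.T (Suc j)"
    show "(D2 c j u \<in> row_power K (n j) \<longrightarrow> u \<in> W.bound (Suc j)) \<longleftrightarrow>
      ((\<forall>a<n j. \<epsilon> (\<lambda>b. D2 c j u (a, b)) = \<zero>\<^bsub>N\<^esub>) \<longrightarrow>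
        (\<exists>s\<in>W.T (Suc (Suc j)). \<forall>x<n (Suc j). \<epsilon> (\<lambda>b. u (x, b)) = \<epsilon> (\<lambda>b. D2 c (Suc j) s (x, b))))"
      unfolding inK[OF W.\<phi>_mem[OF u]] bound[OF u] ..
  qed
  also have "\<dots> \<longleftrightarrow> mat_exact R N (A j) (n j) (n (Suc j)) (A (Suc j)) (n (Suc (Suc j)))"
    by (rule mat_exact_iff[OF N Fr_submodule _ \<epsilon>F \<epsilon>(2), symmetric]) (simp_all add: A_closed)
  finally show ?thesis .
qed

text \<open>Rows orthogonal to \<open>K\<close> correspond bijectively to functionals on
  \<open>N\<close>. Injectivity of \<open>\<rho>\<close> makes equality of arrays the same as
  equality of tuples of functionals.\<close>

lemma coexact_iff_mat_exact:
  fixes c :: nat and N :: "('a, 'n, 'y) module_scheme" and \<epsilon> :: "(nat \<Rightarrow> 'a) \<Rightarrow> 'n"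
  defines "K \<equiv> {u \<in> Fr {..<c}. \<epsilon> u = \<zero>\<^bsub>N\<^esub>}"
  assumes N: "module R N" and \<epsilon>: "\<epsilon> \<in> module_hom R E N" "\<epsilon> ` Fr {..<c} = carrier N"
    and Kp: "submodule (perp_of c K) R E"
  shows "dual_complex.coexact R (\<lambda>j. {..<n j} \<times> {..<c}) (Dt2 c) (\<lambda>j. row_power K (n j)) j \<longleftrightarrow>
    mat_exact R (dual_module R N) (\<lambda>a b. A (Suc j) b a) (n (Suc (Suc j))) (n (Suc j)) (\<lambda>a b. A j b a) (n j)"
proof -
  interpret N: module R N by fact
  interpret E: module R "E :: ('a, nat \<Rightarrow> 'a) module" by (rule E_module)
  interpret E2: module R "E :: ('a, nat \<times> nat \<Rightarrow> 'a) module" by (rule E_module)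
  have K: "submodule K R E" "K \<subseteq> Fr {..<c}"
    using submod_preimage[OF E_module N \<epsilon>(1) Fr_submodule N.submod_zero, of "{..<c}"] unfolding K_def by auto
  interpret W: dual_complex R I \<delta> \<eta> k "\<lambda>j. {..<n j} \<times> {..<c}" "D2 c" "Dt2 c" "\<lambda>j. row_power K (n j)"
    by (rule coeff_complex[OF K])
  have dm: "module R (dual_module R N)"
    unfolding dual_module_def by (rule module.hom_module_is_module[OF ring_module_is_module N])
  interpret P: module R "dual_module R N" by (rule dm)
  let ?V = "perp_of c K"
  have VF: "?V \<subseteq> Fr {..<c}" unfolding perp_of_def by blast
  obtain \<rho> where \<rho>: "\<rho> \<in> module_hom R (E\<lparr>carrier := ?V\<rparr>) (dual_module R N)"
    "\<rho> ` ?V = carrier (dual_module R N)" "inj_on \<rho> ?V"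
    unfolding perp_of_def K_def by (rule dual_presentation[OF N \<epsilon>])
  have zV: "\<zero>\<^bsub>E\<^esub> \<in> ?V" by (rule E.submodD(2)[OF Kp])
  have \<rho>0: "\<rho> \<zero>\<^bsub>E\<^esub> = \<zero>\<^bsub>dual_module R N\<^esub>"
    using module_hom_zero[OF E.submod_module[OF Kp] dm \<rho>(1)] by simp
  have perp: "W.perp j = row_power ?V (n j)" for j by (rule coeff_perp[OF K])
  have eq: "u = v \<longleftrightarrow> (\<forall>x<q. \<rho> (\<lambda>b. u (x, b)) = \<rho> (\<lambda>b. v (x, b)))"
    if u: "u \<in> row_power ?V q" and v: "v \<in> row_power ?V q" for u v q
  proof
    assume e: "\<forall>x<q. \<rho> (\<lambda>b. u (x, b)) = \<rho> (\<lambda>b. v (x, b))"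
    have "u (x, b) = v (x, b)" for x b
    proof (cases "x < q")
      case True
      then have "(\<lambda>b. u (x, b)) = (\<lambda>b. v (x, b))"
        using e u v inj_onD[OF \<rho>(3)] unfolding row_power_def by blast
      then show ?thesis by (rule fun_cong)
    qed (use u v in \<open>simp add: row_power_def\<close>)
    then show "u = v" by auto
  qed simp
  have z2: "\<zero>\<^bsub>E\<^esub> \<in> row_power ?V q" for q
    by (rule E2.submodD(2)[OF row_power_sub[OF Kp]])
  have "W.coexact j \<longleftrightarrow> (\<forall>u\<in>row_power ?V (n (Suc j)).
      (\<forall>a<n (Suc (Suc j)). \<rho> (\<lambda>b. Dt2 c (Suc j) u (a, b)) = \<zero>\<^bsub>dual_module R N\<^esub>) \<longrightarrow>
      (\<exists>s\<in>row_power ?V (n j). \<forall>x<n (Suc j). \<rho> (\<lambda>b. u (x, b)) = \<rho> (\<lambda>b. Dt2 c j s (x, b))))"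
    unfolding W.coexact_def perp
  proof (rule ball_cong[OF refl])
    fix u assume u: "u \<in> row_power ?V (n (Suc j))"
    have "Dt2 c (Suc j) u \<in> row_power ?V (n (Suc (Suc j)))" using W.\<psi>_perp u unfolding perp .
    from eq[OF this z2] have 1: "Dt2 c (Suc j) u = \<zero>\<^bsub>E\<^esub> \<longleftrightarrow>
        (\<forall>a<n (Suc (Suc j)). \<rho> (\<lambda>b. Dt2 c (Suc j) u (a, b)) = \<zero>\<^bsub>dual_module R N\<^esub>)"
      using \<rho>0 by simp
    have 2: "u = Dt2 c j s \<longleftrightarrow> (\<forall>x<n (Suc j). \<rho> (\<lambda>b. u (x, b)) = \<rho> (\<lambda>b. Dt2 c j s (x, b)))"
      if "s \<in> row_power ?V (n j)" for s
    proof (rule eq[OF u])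
      show "Dt2 c j s \<in> row_power ?V (n (Suc j))" using W.\<psi>_perp that unfolding perp .
    qed
    show "(Dt2 c (Suc j) u = \<zero>\<^bsub>E\<^esub> \<longrightarrow> (\<exists>s\<in>row_power ?V (n j). u = Dt2 c j s)) \<longleftrightarrow>
      ((\<forall>a<n (Suc (Suc j)). \<rho> (\<lambda>b. Dt2 c (Suc j) u (a, b)) = \<zero>\<^bsub>dual_module R N\<^esub>) \<longrightarrow>
        (\<exists>s\<in>row_power ?V (n j). \<forall>x<n (Suc j). \<rho> (\<lambda>b. u (x, b)) = \<rho> (\<lambda>b. Dt2 c j s (x, b))))"
      unfolding 1 using 2 by blast
  qed
  also have "\<dots> \<longleftrightarrow> mat_exact R (dual_module R N) (\<lambda>a b. A (Suc j) b a) (n (Suc (Suc j))) (n (Suc j)) (\<lambda>a b. A j b a) (n j)"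
    by (rule mat_exact_iff[OF dm Kp VF \<rho>(1,2), symmetric]) (simp_all add: A_closed)
  finally show ?thesis .
qed

end

context resolved_mcm
begin

lemma Zp_perp: "Zp = perp_of (n 0) {u \<in> Fr {..<n 0}. \<epsilon> u = \<zero>\<^bsub>M\<^esub>}"
  unfolding D_0 ..

end

text \<open>The translation into matrices covers positive degrees only, which is enough for eventual
  vanishing.\<close>

lemma eventually_Suc_iff: "(\<exists>k. \<forall>i\<ge>k. P (i :: nat)) \<longleftrightarrow> (\<exists>k. \<forall>i\<ge>k. P (Suc i))"
proof
  assume "\<exists>k. \<forall>i\<ge>k. P (Suc i)"
  then obtain k where k: "P (Suc i)" if "i \<ge> k" for i by blast
  have "P i" if "i \<ge> Suc k" for i using k[of "i - 1"] that by (cases i) auto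
  then show "\<exists>k. \<forall>i\<ge>k. P i" by blast
qed (use le_SucI in blast)

locale two_resolved = F: resolved_mcm R I \<delta> \<eta> k m M n d \<epsilon> + G: resolved_mcm R I \<delta> \<eta> k m N n' d' \<epsilon>'
  for R :: "('a, 'r) ring_scheme" (structure) and I :: "nat \<Rightarrow> ('a, 'i) module" and \<delta> \<eta> k m
    and M :: "('a, 'm, 'x) module_scheme" and n d \<epsilon> and N :: "('a, 'n, 'y) module_scheme" and n' d' \<epsilon>'
begin

abbreviation K :: "(nat \<Rightarrow> 'a) set" where "K \<equiv> {u \<in> F.Fr {..<n' 0}. \<epsilon>' u = \<zero>\<^bsub>N\<^esub>}"

lemma K_sub: "submodule K R F.E" "K \<subseteq> F.Fr {..<n' 0}"
proof -
  show "submodule K R F.E"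
    using submod_image[OF F.E_module F.E_module G.D_hom F.Fr_submodule] unfolding G.D_0[symmetric] .
qed blast

lemma perp_K: "F.perp_of (n' 0) K = {t \<in> F.Fr {..<n' 0}. G.Dt 0 t = \<zero>\<^bsub>F.E\<^esub>}"
  using G.Zp_ker[OF G.D_exact G.D_ext] unfolding G.Zp_perp .

lemma perp_K_sub: "submodule (F.perp_of (n' 0) K) R F.E"
  unfolding G.Zp_perp[symmetric] by (rule G.Zp_sub[OF G.D_exact G.D_ext])

text \<open>The augmentation is a homomorphism on a free module of finite rank, whereas coefficients
  are presented by maps on the ambient module.\<close>

lemma \<epsilon>'_extension:
  obtains \<pi> where "\<pi> \<in> module_hom R F.E N" "\<pi> ` F.Fr {..<n' 0} = carrier N"
    "{u \<in> F.Fr {..<n' 0}. \<pi> u = \<zero>\<^bsub>N\<^esub>} = K"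
proof -
  obtain \<pi> where \<pi>: "\<pi> \<in> module_hom R F.E N" "\<And>u. u \<in> F.Fr {..<n' 0} \<Longrightarrow> \<pi> u = \<epsilon>' u"
    by (rule F.module_hom_extend[OF G.\<epsilon>_hom]) blast
  have "\<pi> ` F.Fr {..<n' 0} = carrier N"
    unfolding G.\<epsilon>_surj[symmetric] by (rule image_cong[OF refl \<pi>(2)])
  then show thesis using \<pi> by (intro that[of \<pi>]) auto
qed

lemma Tor_zero_iff_exact:
  "zero_module (Tor_module R (Suc j) M N) \<longleftrightarrow>
    dual_complex.exact R (\<lambda>j. {..<n j} \<times> {..<n' 0}) (F.D2 (n' 0)) (\<lambda>j. F.row_power K (n j)) j"
proof (rule \<epsilon>'_extension)
  fix \<pi> assume \<pi>: "\<pi> \<in> module_hom R F.E N" "\<pi> ` F.Fr {..<n' 0} = carrier N"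
    and K: "{u \<in> F.Fr {..<n' 0}. \<pi> u = \<zero>\<^bsub>N\<^esub>} = K"
  show ?thesis
    using F.exact_iff_mat_exact[OF G.M_module \<pi>, of j] unfolding K F.Tor_zero_iff[OF G.M_module] by (rule sym)
qed

lemma Ext_zero_iff_coexact:
  "zero_module (Ext_module R (Suc j) M (dual_module R N)) \<longleftrightarrow>
    dual_complex.coexact R (\<lambda>j. {..<n j} \<times> {..<n' 0}) (F.Dt2 (n' 0)) (\<lambda>j. F.row_power K (n j)) j"
proof (rule \<epsilon>'_extension)
  fix \<pi> assume \<pi>: "\<pi> \<in> module_hom R F.E N" "\<pi> ` F.Fr {..<n' 0} = carrier N"
    and K: "{u \<in> F.Fr {..<n' 0}. \<pi> u = \<zero>\<^bsub>N\<^esub>} = K"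
  have dm: "module R (dual_module R N)"
    unfolding dual_module_def by (rule module.hom_module_is_module[OF F.ring_module_is_module G.M_module])
  show ?thesis
    using F.coexact_iff_mat_exact[OF G.M_module \<pi>, unfolded K, OF perp_K_sub, of j]
    unfolding F.Ext_zero_iff[OF dm] by (rule sym)
qed

text \<open>The coefficients are \<open>N = R^(n' 0)/K\<close>. Acyclicity of \<open>N\<close> and
  of its dual and the embedding of \<open>N\<close> in its bidual all come from the resolution of
  the maximal Cohen--Macaulay module \<open>N\<close>.\<close>

lemma eventually_Tor_iff_Ext:
  "(\<exists>k. \<forall>i\<ge>k. zero_module (Tor_module R i M N)) \<longleftrightarrow>
    (\<exists>k. \<forall>i\<ge>k. zero_module (Ext_module R i M (dual_module R N)))"
proof -
  have "(\<exists>k0. \<forall>j\<ge>k0. zero_module (Tor_module R (Suc j) M N)) \<longleftrightarrow>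
    (\<exists>k0. \<forall>j\<ge>k0. zero_module (Ext_module R (Suc j) M (dual_module R N)))"
    unfolding Tor_zero_iff_exact Ext_zero_iff_coexact
  proof (rule F.eventually_exact_iff_coexact[OF K_sub perp_K_sub])
    show "F.ext_zero (F.Fr {..<n' 0}) K l" for l
      using G.D_ext unfolding G.D_0 .
    show "F.ext_zero (F.perp_of (n' 0) K) {\<zero>\<^bsub>F.E\<^esub>} l" for l
      unfolding G.Zp_perp[symmetric] by (rule G.ext_zero_dual[OF G.D_exact G.D_ext])
    show "F.ext_zero (F.Fr {..<n' 0}) (F.perp_of (n' 0) K) l" for l
      unfolding G.Zp_perp[symmetric] by (rule G.ext_zero_Zp[OF G.D_exact G.D_ext])
    fix u assume u: "u \<in> F.Fr {..<n' 0}" and kill: "\<And>t. t \<in> F.perp_of (n' 0) K \<Longrightarrow> F.pairing {..<n' 0} u t = \<zero>"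
    show "u \<in> K"
      unfolding G.D_0[symmetric] by (rule G.Zp_reflexive[OF _ G.D_ext u]) (rule G.D_exact kill[folded G.Zp_perp]; assumption)+
  qed
  then show ?thesis
    unfolding eventually_Suc_iff[of "\<lambda>i. zero_module (Tor_module R i M N)"]
      eventually_Suc_iff[of "\<lambda>i. zero_module (Ext_module R i M (dual_module R N))"] .
qed

lemma Ext_zero_iff_bicomplex:
  "zero_module (Ext_module R (Suc j) M (dual_module R N)) \<longleftrightarrow>
   (\<forall>t\<in>F.row_power {t \<in> F.Fr {..<n' 0}. G.Dt 0 t = \<zero>\<^bsub>F.E\<^esub>} (n (Suc j)). F.Dt2 (n' 0) (Suc j) t = \<zero>\<^bsub>F.E\<^esub> \<longrightarrow>
      (\<exists>s\<in>F.row_power {t \<in> F.Fr {..<n' 0}. G.Dt 0 t = \<zero>\<^bsub>F.E\<^esub>} (n j). t = F.Dt2 (n' 0) j s))"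
proof -
  interpret W: dual_complex R I \<delta> \<eta> k "\<lambda>j. {..<n j} \<times> {..<n' 0}" "F.D2 (n' 0)" "F.Dt2 (n' 0)" "\<lambda>j. F.row_power K (n j)"
    by (rule F.coeff_complex[OF K_sub])
  show ?thesis
    unfolding Ext_zero_iff_coexact W.coexact_def F.coeff_perp[OF K_sub] perp_K ..
qed

end

lemma two_resolved_swap:
  "two_resolved R I \<delta> \<eta> k m M n d \<epsilon> N n' d' \<epsilon>' \<Longrightarrow> two_resolved R I \<delta> \<eta> k m N n' d' \<epsilon>' M n d \<epsilon>"
  unfolding two_resolved_def by blast

context two_resolved
begin

text \<open>Both modules have no higher \<open>Ext\<close> into \<open>R\<close>, so both dual
  resolutions are exact and the double complex is balanced. The equivalence therefore holds in each
  positive degree separately, not just eventually.\<close>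

lemma Ext_zero_iff_Ext_zero:
  "zero_module (Ext_module R (Suc j) M (dual_module R N)) \<longleftrightarrow>
    zero_module (Ext_module R (Suc j) N (dual_module R M))"
proof -
  interpret C: two_complexes R I \<delta> \<eta> k F.A n G.A n'
    by (intro two_complexes.intro two_complexes_axioms.intro F.finite_inj_res_axioms F.free_complex_axioms
        G.free_complex_axioms F.Dt_exact[OF F.D_exact F.D_ext] G.Dt_exact[OF G.D_exact G.D_ext])
  show ?thesis
    unfolding Ext_zero_iff_bicomplex two_resolved.Ext_zero_iff_bicomplex[OF two_resolved_swap[OF two_resolved_axioms]]
    by (rule C.coexact_balance)
qed

lemma eventually_Ext_iff_Ext:
  "(\<exists>k. \<forall>i\<ge>k. zero_module (Ext_module R i M (dual_module R N))) \<longleftrightarrow>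
    (\<exists>k. \<forall>i\<ge>k. zero_module (Ext_module R i N (dual_module R M)))"
  unfolding eventually_Suc_iff[of "\<lambda>i. zero_module (Ext_module R i M (dual_module R N))"]
    eventually_Suc_iff[of "\<lambda>i. zero_module (Ext_module R i N (dual_module R M))"] Ext_zero_iff_Ext_zero ..

end

theorem theorem2p1:
  fixes R :: "('a, 'r) ring_scheme"
    and M :: "('a, 'm, 'x) module_scheme"
    and N :: "('a, 'n, 'y) module_scheme"
  assumes "gorenstein_ring TYPE('i) R"
    and "maximal_cohen_macaulay R M"
    and "maximal_cohen_macaulay R N"
  shows "((\<exists>k. \<forall>i\<ge>k. zero_module (Tor_module R i M N)) \<longleftrightarrow>
          (\<exists>k. \<forall>i\<ge>k. zero_module (Ext_module R i M (dual_module R N)))) \<and>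
         ((\<exists>k. \<forall>i\<ge>k. zero_module (Ext_module R i M (dual_module R N))) \<longleftrightarrow>
          (\<exists>k. \<forall>i\<ge>k. zero_module (Ext_module R i N (dual_module R M))))"
proof -
  obtain I :: "nat \<Rightarrow> ('a, 'i) module" and \<delta> \<eta> k where
    inj: "injective_resolution R (ring_module R) I \<delta> \<eta>" "\<forall>i>k. zero_module (I i)"
    using assms(1) unfolding gorenstein_ring_def finite_injective_dimension_def by blast
  have local: "cring R" "noetherian_ring R" "\<exists>!m. maximalideal m R"
    using assms(1) unfolding gorenstein_ring_def local_ring_def by blast+
  obtain m where m: "maximalideal m R" "\<And>m'. maximalideal m' R \<Longrightarrow> m' = m"
    using local(3) by blast
  interpret nc: noetherian_cring R
    by (intro noetherian_cring.intro local)
  have loc: "local_gorenstein R I \<delta> \<eta> k m"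
    by (intro local_gorenstein.intro finite_inj_res.intro finite_inj_res_axioms.intro
        local_noetherian.intro local_noetherian_axioms.intro local nc.noetherian_cring_axioms m inj(1))
      (use inj(2) in blast)
  have fg: "fin_gen_module R M" "fin_gen_module R N"
    using assms(2,3) unfolding maximal_cohen_macaulay_def by blast+
  obtain n d \<epsilon> where M: "some_resolution R M = (n, d)" "free_resolution R M n d \<epsilon>"
    by (rule nc.some_resolution[OF fg(1)])
  obtain n' d' \<epsilon>' where N: "some_resolution R N = (n', d')" "free_resolution R N n' d' \<epsilon>'"
    by (rule nc.some_resolution[OF fg(2)])
  interpret two_resolved R I \<delta> \<eta> k m M n d \<epsilon> N n' d' \<epsilon>'
    by (intro two_resolved.intro resolved_mcm.intro resolved_mcm_axioms.intro loc assms(2,3) M N)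
  show ?thesis
    using eventually_Tor_iff_Ext eventually_Ext_iff_Ext by blast
qed

end
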